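(* Let $\mathcal{B}$ be an additive category, let $N\ge 3$ and $1\le r\le N-2$ be integers, and let $s$ be an integer. Then there is a recollement of $\mathsf{K}_N(\mathcal{B})$ $$\mathsf{K}_{N-r}(\mathcal{B})\ \xrightarrow{\ i_{s*}\ }\ \mathsf{K}_N(\mathcal{B})\ \xrightarrow{\ j_s^*\ }\ \mathsf{K}_{r+1}(\mathcal{B})$$ with further functors $i_s^*,i_s^!:\mathsf{K}_N(\mathcal{B})\to\mathsf{K}_{N-r}(\mathcal{B})$ and $j_{s!},j_{s*}:\mathsf{K}_{r+1}(\mathcal{B})\to\mathsf{K}_N(\mathcal{B})$, where $$i_s^*=\underline{J}_{s-1}^{\Downarrow_{N-r}^{N}},\quad i_{s*}=\underline{I}_s^{\Uparrow_{N-r}^{N}},\quad i_s^!=\underline{J}_s^{\Downarrow_{N-r}^{N}},\quad j_{s!}=\underline{I}_{r+s}^{\Uparrow_{r+1}^{N}},\quad j_s^*=\underline{J}_{r+s}^{\Downarrow_{r+1}^{N}},\quad j_{s*}=\underline{I}_{r+s+1}^{\Uparrow_{r+1}^{N}}.$$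
   Context: Recollement: a diagram of triangulated categories and triangle functors $i_*:\mathcal{D}'\to\mathcal{D}$, $i^*,i^!:\mathcal{D}\to\mathcal{D}'$, $j^*:\mathcal{D}\to\mathcal{D}''$, $j_!,j_*:\mathcal{D}''\to\mathcal{D}$ such that (1) $i_*,j_!,j_*$ are fully faithful; (2) $(i^*,i_* )$, $(i_*,i^!)$, $(j_!,j^* )$, $(j^*,j_* )$ are adjoint pairs (left adjoint first); (3) the canonical embeddings $\operatorname{Im}j_!\hookrightarrow\operatorname{Ker}i^*$, $\operatorname{Im}i_*\hookrightarrow\operatorname{Ker}j^*$, $\operatorname{Im}j_*\hookrightarrow\operatorname{Ker}i^!$ are equivalences. $N$-complexes ($N\ge2$): an $N$-complex over $\mathcal{B}$ is a family of objects $X^i$ and morphisms $d_X^i:X^i\to X^{i+1}$ ($i\in\mathbb{Z}$) with $d_X^{i+N-1}\cdots d_X^{i+1}d_X^i=0$ for all $i$; morphisms are families commuting with $d$; the category is $\mathsf{C}_N(\mathcal{B})$. With conflations the sequences that are split short exact in each degree, $\mathsf{C}_N(\mathcal{B})$ is a Frobenius category. A morphism $f:X\to Y$ is null-homotopic if there are $s^i:X^i\to Y^{i-N+1}$ with $f^i=\sum_{j=1}^{N}d_Y^{i-1}\cdots d_Y^{i-N+j}\,s^{i+j-1}\,d_X^{i+j-2}\cdots d_X^i$ for all $i$. $\mathsf{K}_N(\mathcal{B})$ is the homotopy category of $N$-complexes; it is the stable category of $\mathsf{C}_N(\mathcal{B})$ and is triangulated as such. Functors: for $N\ge3$ and an integer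 $s$ define $\iota_s^{(N-1)},\rho_s^{(N)}:\mathbb{Z}\to\mathbb{Z}$ (for $k\in\mathbb{Z}$) by $\iota_s^{(N-1)}(s+kN)=s+k(N-1)$, $\iota_s^{(N-1)}(s+i+kN)=s+i-1+k(N-1)$ for $0<i<N$; $\rho_s^{(N)}(s+k(N-1))=s+kN$, $\rho_s^{(N)}(s+i+k(N-1))=s+i+1+kN$ for $0<i<N-1$. For an $(N-1)$-complex $X$, $I_s^{(N-1)}(X)$ is the $N$-complex with $I_s^{(N-1)}(X)^i=X^{\iota(i)}$ and differential $d^{\iota(i)}$ if $\iota(i)<\iota(i+1)$ and $1$ if $\iota(i)=\iota(i+1)$, where $\iota=\iota_s^{(N-1)}$. For an $N$-complex $Y$, $J_s^{(N)}(Y)$ is the $(N-1)$-complex with $J_s^{(N)}(Y)^i=Y^{\rho(i)}$ and differential $d^{\rho(i+1)-1}\cdots d^{\rho(i)}$, where $\rho=\rho_s^{(N)}$. These induce triangle functors $\underline{I}_s^{(N-1)}:\mathsf{K}_{N-1}(\mathcal{B})\to\mathsf{K}_N(\mathcal{B})$ and $\underline{J}_s^{(N)}:\mathsf{K}_N(\mathcal{B})\to\mathsf{K}_{N-1}(\mathcal{B})$. For $2\le M<N$ put $\underline{I}_s^{\Uparrow_M^N}=\underline{I}_s^{(N-1)}\cdots\underline{I}_s^{(M)}:\mathsf{K}_M(\mathcal{B})\to\mathsf{K}_N(\mathcal{B})$ and $\underline{J}_s^{\Downarrow_M^N}=\underline{J}_s^{(M+1)}\cdots\underline{J}_s^{(N)}:\mathsf{K}_N(\mathcal{B})\to\mathsf{K}_M(\mathcal{B})$.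 *)

theory Defs
  imports "HOL-Algebra.Coset" "HOL-Algebra.FiniteProduct"
begin

section \<open>Additive categories\<close>

text \<open>
  A category enriched in abelian groups. Hom-sets come as abelian groups in the sense of
  HOL-Algebra and are therefore written multiplicatively: the group operation is the addition of
  morphisms, \<open>\<one>\<close> is the zero morphism and \<open>inv\<close> is the negative. Hom-sets of different pairs
  of objects need not be disjoint, so composition carries the three objects involved:
  \<open>Cmp C X Y Z g f\<close> is \<open>g\<close> after \<open>f\<close> for \<open>f : X \<rightarrow> Y\<close> and \<open>g : Y \<rightarrow> Z\<close>.
\<close>

record ('o, 'm) cat =
  Obj :: "'o set"
  HomG :: "'o \<Rightarrow> 'o \<Rightarrow> 'm monoid"
  Cmp :: "'o \<Rightarrow> 'o \<Rightarrow> 'o \<Rightarrow> 'm \<Rightarrow> 'm \<Rightarrow> 'm"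
  Idm :: "'o \<Rightarrow> 'm"

abbreviation Hom :: "('o, 'm, 'z) cat_scheme \<Rightarrow> 'o \<Rightarrow> 'o \<Rightarrow> 'm set" where
  "Hom C X Y \<equiv> carrier (HomG C X Y)"

abbreviation Zero :: "('o, 'm, 'z) cat_scheme \<Rightarrow> 'o \<Rightarrow> 'o \<Rightarrow> 'm" where
  "Zero C X Y \<equiv> \<one>\<^bsub>HomG C X Y\<^esub>"

abbreviation Add :: "('o, 'm, 'z) cat_scheme \<Rightarrow> 'o \<Rightarrow> 'o \<Rightarrow> 'm \<Rightarrow> 'm \<Rightarrow> 'm" where
  "Add C X Y f g \<equiv> f \<otimes>\<^bsub>HomG C X Y\<^esub> g"

abbreviation Neg :: "('o, 'm, 'z) cat_scheme \<Rightarrow> 'o \<Rightarrow> 'o \<Rightarrow> 'm \<Rightarrow> 'm" where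
  "Neg C X Y f \<equiv> inv\<^bsub>HomG C X Y\<^esub> f"

locale preadditive_category =
  fixes C :: "('o, 'm, 'z) cat_scheme"
  assumes hom_group:
      "\<lbrakk>X \<in> Obj C; Y \<in> Obj C\<rbrakk> \<Longrightarrow> comm_group (HomG C X Y)"
    and cmp_hom_left:
      "\<lbrakk>X \<in> Obj C; Y \<in> Obj C; Z \<in> Obj C; f \<in> Hom C X Y\<rbrakk>
        \<Longrightarrow> (\<lambda>g. Cmp C X Y Z g f) \<in> hom (HomG C Y Z) (HomG C X Z)"
    and cmp_hom_right:
      "\<lbrakk>X \<in> Obj C; Y \<in> Obj C; Z \<in> Obj C; g \<in> Hom C Y Z\<rbrakk>
        \<Longrightarrow> (\<lambda>f. Cmp C X Y Z g f) \<in> hom (HomG C X Y) (HomG C X Z)"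
    and cmp_assoc:
      "\<lbrakk>W \<in> Obj C; X \<in> Obj C; Y \<in> Obj C; Z \<in> Obj C;
        f \<in> Hom C W X; g \<in> Hom C X Y; h \<in> Hom C Y Z\<rbrakk>
        \<Longrightarrow> Cmp C W X Z (Cmp C X Y Z h g) f = Cmp C W Y Z h (Cmp C W X Y g f)"
    and id_in: "X \<in> Obj C \<Longrightarrow> Idm C X \<in> Hom C X X"
    and id_left: "\<lbrakk>X \<in> Obj C; Y \<in> Obj C; f \<in> Hom C X Y\<rbrakk> \<Longrightarrow> Cmp C X Y Y (Idm C Y) f = f"
    and id_right: "\<lbrakk>X \<in> Obj C; Y \<in> Obj C; f \<in> Hom C X Y\<rbrakk> \<Longrightarrow> Cmp C X X Y f (Idm C X) = f"

definition zero_object :: "('o, 'm, 'z) cat_scheme \<Rightarrow> 'o \<Rightarrow> bool" where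
  "zero_object C Z \<longleftrightarrow> Z \<in> Obj C \<and>
     (\<forall>X\<in>Obj C. (\<exists>!f. f \<in> Hom C X Z) \<and> (\<exists>!f. f \<in> Hom C Z X))"

definition biproduct ::
  "('o, 'm, 'z) cat_scheme \<Rightarrow> 'o \<Rightarrow> 'o \<Rightarrow> 'o \<Rightarrow> 'm \<Rightarrow> 'm \<Rightarrow> 'm \<Rightarrow> 'm \<Rightarrow> bool" where
  "biproduct C X Y P i1 i2 p1 p2 \<longleftrightarrow> P \<in> Obj C \<and>
     i1 \<in> Hom C X P \<and> i2 \<in> Hom C Y P \<and> p1 \<in> Hom C P X \<and> p2 \<in> Hom C P Y \<and>
     Cmp C X P X p1 i1 = Idm C X \<and> Cmp C Y P Y p2 i2 = Idm C Y \<and>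
     Cmp C Y P X p1 i2 = Zero C Y X \<and> Cmp C X P Y p2 i1 = Zero C X Y \<and>
     Add C P P (Cmp C P X P i1 p1) (Cmp C P Y P i2 p2) = Idm C P"

locale additive_category = preadditive_category C
  for C :: "('o, 'm, 'z) cat_scheme" +
  assumes ex_zero_object: "\<exists>Z. zero_object C Z"
    and ex_biproduct:
      "\<lbrakk>X \<in> Obj C; Y \<in> Obj C\<rbrakk> \<Longrightarrow> \<exists>P i1 i2 p1 p2. biproduct C X Y P i1 i2 p1 p2"

definition is_iso :: "('o, 'm, 'z) cat_scheme \<Rightarrow> 'o \<Rightarrow> 'o \<Rightarrow> 'm \<Rightarrow> bool" where
  "is_iso C X Y f \<longleftrightarrow> f \<in> Hom C X Y \<and>
     (\<exists>g\<in>Hom C Y X. Cmp C X Y X g f = Idm C X \<and> Cmp C Y X Y f g = Idm C Y)"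

definition full_subcat :: "('o, 'm, 'z) cat_scheme \<Rightarrow> 'o set \<Rightarrow> ('o, 'm, 'z) cat_scheme" where
  "full_subcat C S = C\<lparr>Obj := S\<rparr>"


section \<open>Functors\<close>

record ('o1, 'm1, 'o2, 'm2) fctr =
  FOb :: "'o1 \<Rightarrow> 'o2"
  FAr :: "'o1 \<Rightarrow> 'o1 \<Rightarrow> 'm1 \<Rightarrow> 'm2"

definition id_fctr :: "('o, 'm, 'o, 'm) fctr" where
  "id_fctr = \<lparr>FOb = (\<lambda>X. X), FAr = (\<lambda>X Y f. f)\<rparr>"

definition comp_fctr ::
  "('o2, 'm2, 'o3, 'm3) fctr \<Rightarrow> ('o1, 'm1, 'o2, 'm2) fctr \<Rightarrow> ('o1, 'm1, 'o3, 'm3) fctr" where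
  "comp_fctr G F = \<lparr>FOb = (\<lambda>X. FOb G (FOb F X)),
                    FAr = (\<lambda>X Y f. FAr G (FOb F X) (FOb F Y) (FAr F X Y f))\<rparr>"

definition is_functor ::
  "('o1, 'm1, 'z1) cat_scheme \<Rightarrow> ('o2, 'm2, 'z2) cat_scheme \<Rightarrow> ('o1, 'm1, 'o2, 'm2) fctr \<Rightarrow> bool"
where
  "is_functor C D F \<longleftrightarrow>
     (\<forall>X\<in>Obj C. FOb F X \<in> Obj D) \<and>
     (\<forall>X\<in>Obj C. \<forall>Y\<in>Obj C. \<forall>f\<in>Hom C X Y. FAr F X Y f \<in> Hom D (FOb F X) (FOb F Y)) \<and>
     (\<forall>X\<in>Obj C. FAr F X X (Idm C X) = Idm D (FOb F X)) \<and>
     (\<forall>X\<in>Obj C. \<forall>Y\<in>Obj C. \<forall>Z\<in>Obj C. \<forall>f\<in>Hom C X Y. \<forall>g\<in>Hom C Y Z.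
        FAr F X Z (Cmp C X Y Z g f)
          = Cmp D (FOb F X) (FOb F Y) (FOb F Z) (FAr F Y Z g) (FAr F X Y f))"

definition additive_functor ::
  "('o1, 'm1, 'z1) cat_scheme \<Rightarrow> ('o2, 'm2, 'z2) cat_scheme \<Rightarrow> ('o1, 'm1, 'o2, 'm2) fctr \<Rightarrow> bool"
where
  "additive_functor C D F \<longleftrightarrow> is_functor C D F \<and>
     (\<forall>X\<in>Obj C. \<forall>Y\<in>Obj C. FAr F X Y \<in> hom (HomG C X Y) (HomG D (FOb F X) (FOb F Y)))"

definition fully_faithful ::
  "('o1, 'm1, 'z1) cat_scheme \<Rightarrow> ('o2, 'm2, 'z2) cat_scheme \<Rightarrow> ('o1, 'm1, 'o2, 'm2) fctr \<Rightarrow> bool"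
where
  "fully_faithful C D F \<longleftrightarrow>
     (\<forall>X\<in>Obj C. \<forall>Y\<in>Obj C. bij_betw (FAr F X Y) (Hom C X Y) (Hom D (FOb F X) (FOb F Y)))"

definition natural_iso ::
  "('o1, 'm1, 'z1) cat_scheme \<Rightarrow> ('o2, 'm2, 'z2) cat_scheme \<Rightarrow>
   ('o1, 'm1, 'o2, 'm2) fctr \<Rightarrow> ('o1, 'm1, 'o2, 'm2) fctr \<Rightarrow> ('o1 \<Rightarrow> 'm2) \<Rightarrow> bool" where
  "natural_iso C D F G \<alpha> \<longleftrightarrow>
     (\<forall>X\<in>Obj C. is_iso D (FOb F X) (FOb G X) (\<alpha> X)) \<and>
     (\<forall>X\<in>Obj C. \<forall>Y\<in>Obj C. \<forall>f\<in>Hom C X Y.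
        Cmp D (FOb F X) (FOb F Y) (FOb G Y) (\<alpha> Y) (FAr F X Y f)
          = Cmp D (FOb F X) (FOb G X) (FOb G Y) (FAr G X Y f) (\<alpha> X))"

definition equivalence ::
  "('o1, 'm1, 'z1) cat_scheme \<Rightarrow> ('o2, 'm2, 'z2) cat_scheme \<Rightarrow> ('o1, 'm1, 'o2, 'm2) fctr \<Rightarrow> bool"
where
  "equivalence C D F \<longleftrightarrow> is_functor C D F \<and>
     (\<exists>G \<eta> \<epsilon>. is_functor D C G \<and>
        natural_iso C C id_fctr (comp_fctr G F) \<eta> \<and>
        natural_iso D D (comp_fctr F G) id_fctr \<epsilon>)"

text \<open>\<open>F : C \<rightarrow> D\<close> is left adjoint to \<open>G : D \<rightarrow> C\<close>.\<close>

definition adjoint_pair ::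
  "('o1, 'm1, 'z1) cat_scheme \<Rightarrow> ('o2, 'm2, 'z2) cat_scheme \<Rightarrow>
   ('o1, 'm1, 'o2, 'm2) fctr \<Rightarrow> ('o2, 'm2, 'o1, 'm1) fctr \<Rightarrow> bool" where
  "adjoint_pair C D F G \<longleftrightarrow> is_functor C D F \<and> is_functor D C G \<and>
     (\<exists>\<phi> :: 'o1 \<Rightarrow> 'o2 \<Rightarrow> 'm2 \<Rightarrow> 'm1.
        (\<forall>X\<in>Obj C. \<forall>Y\<in>Obj D. bij_betw (\<phi> X Y) (Hom D (FOb F X) Y) (Hom C X (FOb G Y))) \<and>
        (\<forall>X\<in>Obj C. \<forall>X'\<in>Obj C. \<forall>Y\<in>Obj D. \<forall>f\<in>Hom C X' X. \<forall>h\<in>Hom D (FOb F X) Y.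
           \<phi> X' Y (Cmp D (FOb F X') (FOb F X) Y h (FAr F X' X f))
             = Cmp C X' X (FOb G Y) (\<phi> X Y h) f) \<and>
        (\<forall>X\<in>Obj C. \<forall>Y\<in>Obj D. \<forall>Y'\<in>Obj D. \<forall>g\<in>Hom D Y Y'. \<forall>h\<in>Hom D (FOb F X) Y.
           \<phi> X Y' (Cmp D (FOb F X) Y Y' g h)
             = Cmp C X (FOb G Y) (FOb G Y') (FAr G Y Y' g) (\<phi> X Y h)))"


section \<open>Triangulated categories and recollements\<close>

text \<open>\<open>(X, Y, Z, u, v, w)\<close> stands for \<open>X \<rightarrow>\<^sup>u Y \<rightarrow>\<^sup>v Z \<rightarrow>\<^sup>w \<Sigma>X\<close>.\<close>

type_synonym ('o, 'm) tri = "'o \<times> 'o \<times> 'o \<times> 'm \<times> 'm \<times> 'm"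

definition triangles ::
  "('o, 'm, 'z) cat_scheme \<Rightarrow> ('o, 'm, 'o, 'm) fctr \<Rightarrow> ('o, 'm) tri set" where
  "triangles C S = {(X, Y, Z, u, v, w). X \<in> Obj C \<and> Y \<in> Obj C \<and> Z \<in> Obj C \<and>
     u \<in> Hom C X Y \<and> v \<in> Hom C Y Z \<and> w \<in> Hom C Z (FOb S X)}"

fun tri_iso ::
  "('o, 'm, 'z) cat_scheme \<Rightarrow> ('o, 'm, 'o, 'm) fctr \<Rightarrow> ('o, 'm) tri \<Rightarrow> ('o, 'm) tri \<Rightarrow> bool"
where
  "tri_iso C S (X, Y, Z, u, v, w) (X', Y', Z', u', v', w') \<longleftrightarrow>
     (\<exists>a b c. is_iso C X X' a \<and> is_iso C Y Y' b \<and> is_iso C Z Z' c \<and>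
        Cmp C X Y Y' b u = Cmp C X X' Y' u' a \<and>
        Cmp C Y Z Z' c v = Cmp C Y Y' Z' v' b \<and>
        Cmp C Z (FOb S X) (FOb S X') (FAr S X X' a) w = Cmp C Z Z' (FOb S X') w' c)"

record ('o, 'm) tcat = "('o, 'm) cat" +
  Susp :: "('o, 'm, 'o, 'm) fctr"
  Dist :: "('o, 'm) tri set"

locale triangulated_category = additive_category T
  for T :: "('o, 'm, 'z) tcat_scheme" +
  assumes susp_additive: "additive_functor T T (Susp T)"
    and susp_equivalence: "equivalence T T (Susp T)"
    and dist_triangles: "Dist T \<subseteq> triangles T (Susp T)"
    and TR1_iso:
      "\<lbrakk>t \<in> Dist T; t' \<in> triangles T (Susp T); tri_iso T (Susp T) t t'\<rbrakk> \<Longrightarrow> t' \<in> Dist T"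
    and TR1_id:
      "\<lbrakk>X \<in> Obj T; zero_object T Z\<rbrakk>
        \<Longrightarrow> (X, X, Z, Idm T X, Zero T X Z, Zero T Z (FOb (Susp T) X)) \<in> Dist T"
    and TR1_cone:
      "\<lbrakk>X \<in> Obj T; Y \<in> Obj T; u \<in> Hom T X Y\<rbrakk> \<Longrightarrow> \<exists>Z v w. (X, Y, Z, u, v, w) \<in> Dist T"
    and TR2:
      "(X, Y, Z, u, v, w) \<in> triangles T (Susp T) \<Longrightarrow>
        (X, Y, Z, u, v, w) \<in> Dist T \<longleftrightarrow>
        (Y, Z, FOb (Susp T) X, v, w,
           Neg T (FOb (Susp T) X) (FOb (Susp T) Y) (FAr (Susp T) X Y u)) \<in> Dist T"
    and TR3:
      "\<lbrakk>(X, Y, Z, u, v, w) \<in> Dist T; (X', Y', Z', u', v', w') \<in> Dist T;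
        a \<in> Hom T X X'; b \<in> Hom T Y Y'; Cmp T X Y Y' b u = Cmp T X X' Y' u' a\<rbrakk>
        \<Longrightarrow> \<exists>c\<in>Hom T Z Z'.
              Cmp T Y Z Z' c v = Cmp T Y Y' Z' v' b \<and>
              Cmp T Z (FOb (Susp T) X) (FOb (Susp T) X') (FAr (Susp T) X X' a) w
                = Cmp T Z Z' (FOb (Susp T) X') w' c"
    and TR4:
      "\<lbrakk>(X, Y, Z', u, i, i') \<in> Dist T; (Y, Z, X', v, j, j') \<in> Dist T;
        (X, Z, Y', Cmp T X Y Z v u, k, k') \<in> Dist T\<rbrakk>
        \<Longrightarrow> \<exists>f\<in>Hom T Z' Y'. \<exists>g\<in>Hom T Y' X'.
              (Z', Y', X', f, g,
                 Cmp T X' (FOb (Susp T) Y) (FOb (Susp T) Z') (FAr (Susp T) Y Z' i) j') \<in> Dist T \<and>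
              Cmp T Y Z' Y' f i = Cmp T Y Z Y' k v \<and>
              Cmp T Z Y' X' g k = j \<and>
              Cmp T Z' Y' (FOb (Susp T) X) k' f = i' \<and>
              Cmp T Y' X' (FOb (Susp T) Y) j' g
                = Cmp T Y' (FOb (Susp T) X) (FOb (Susp T) Y) (FAr (Susp T) X Y u) k'"

definition triangle_functor ::
  "('o1, 'm1, 'z1) tcat_scheme \<Rightarrow> ('o2, 'm2, 'z2) tcat_scheme \<Rightarrow> ('o1, 'm1, 'o2, 'm2) fctr \<Rightarrow> bool"
where
  "triangle_functor T T' F \<longleftrightarrow> additive_functor T T' F \<and>
     (\<exists>\<theta>. natural_iso T T' (comp_fctr F (Susp T)) (comp_fctr (Susp T') F) \<theta> \<and>
        (\<forall>X Y Z u v w. (X, Y, Z, u, v, w) \<in> Dist T \<longrightarrow>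
           (FOb F X, FOb F Y, FOb F Z, FAr F X Y u, FAr F Y Z v,
              Cmp T' (FOb F Z) (FOb F (FOb (Susp T) X)) (FOb (Susp T') (FOb F X))
                (\<theta> X) (FAr F Z (FOb (Susp T) X) w)) \<in> Dist T'))"

definition Im_fctr ::
  "('o1, 'm1, 'z1) cat_scheme \<Rightarrow> ('o2, 'm2, 'z2) cat_scheme \<Rightarrow> ('o1, 'm1, 'o2, 'm2) fctr \<Rightarrow>
   ('o2, 'm2, 'z2) cat_scheme" where
  "Im_fctr C D F = full_subcat D (FOb F ` Obj C)"

definition Ker_fctr ::
  "('o1, 'm1, 'z1) cat_scheme \<Rightarrow> ('o2, 'm2, 'z2) cat_scheme \<Rightarrow> ('o1, 'm1, 'o2, 'm2) fctr \<Rightarrow>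
   ('o1, 'm1, 'z1) cat_scheme" where
  "Ker_fctr C D F = full_subcat C {X \<in> Obj C. zero_object D (FOb F X)}"

text \<open>
  The arguments are \<open>D'\<close>, \<open>D\<close>, \<open>D''\<close> followed by
  \<open>i\<^sup>*\<close>, \<open>i\<^sub>*\<close>, \<open>i\<^sup>!\<close>, \<open>j\<^sub>!\<close>, \<open>j\<^sup>*\<close>, \<open>j\<^sub>*\<close>. The embeddings of the image into the kernel are the
  identity on objects and morphisms.
\<close>

definition recollement ::
  "('o1, 'm1, 'z1) tcat_scheme \<Rightarrow> ('o, 'm, 'z) tcat_scheme \<Rightarrow> ('o2, 'm2, 'z2) tcat_scheme \<Rightarrow>
   ('o, 'm, 'o1, 'm1) fctr \<Rightarrow> ('o1, 'm1, 'o, 'm) fctr \<Rightarrow> ('o, 'm, 'o1, 'm1) fctr \<Rightarrow>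
   ('o2, 'm2, 'o, 'm) fctr \<Rightarrow> ('o, 'm, 'o2, 'm2) fctr \<Rightarrow> ('o2, 'm2, 'o, 'm) fctr \<Rightarrow> bool"
where
  "recollement D' D D'' i_ustar i_lstar i_ushriek j_lshriek j_ustar j_lstar \<longleftrightarrow>
     triangulated_category D' \<and> triangulated_category D \<and> triangulated_category D'' \<and>
     triangle_functor D D' i_ustar \<and> triangle_functor D' D i_lstar \<and>
     triangle_functor D D' i_ushriek \<and> triangle_functor D'' D j_lshriek \<and>
     triangle_functor D D'' j_ustar \<and> triangle_functor D'' D j_lstar \<and>
     fully_faithful D' D i_lstar \<and> fully_faithful D'' D j_lshriek \<and>
     fully_faithful D'' D j_lstar \<and>
     adjoint_pair D D' i_ustar i_lstar \<and> adjoint_pair D' D i_lstar i_ushriek \<and>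
     adjoint_pair D'' D j_lshriek j_ustar \<and> adjoint_pair D D'' j_ustar j_lstar \<and>
     equivalence (Im_fctr D'' D j_lshriek) (Ker_fctr D D' i_ustar) id_fctr \<and>
     equivalence (Im_fctr D' D i_lstar) (Ker_fctr D D'' j_ustar) id_fctr \<and>
     equivalence (Im_fctr D'' D j_lstar) (Ker_fctr D D' i_ushriek) id_fctr"


section \<open>The triangulated stable category of a Frobenius category\<close>

definition mor_class ::
  "('o, 'm, 'z) cat_scheme \<Rightarrow> ('o \<Rightarrow> 'o \<Rightarrow> 'm set) \<Rightarrow> 'o \<Rightarrow> 'o \<Rightarrow> 'm \<Rightarrow> 'm set" where
  "mor_class C I X Y f = I X Y #>\<^bsub>HomG C X Y\<^esub> f"

text \<open>
  Quotient by a two-sided ideal \<open>I\<close> of morphisms. Operations on classes are unions over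
  representatives; for an ideal all the members of such a union are the same class.
\<close>

definition quot_cat ::
  "('o, 'm, 'z) cat_scheme \<Rightarrow> ('o \<Rightarrow> 'o \<Rightarrow> 'm set) \<Rightarrow> ('o, 'm set) cat" where
  "quot_cat C I =
     \<lparr>Obj = Obj C,
      HomG = (\<lambda>X Y. HomG C X Y Mod I X Y),
      Cmp = (\<lambda>X Y Z G F. \<Union>g\<in>G. \<Union>f\<in>F. mor_class C I X Z (Cmp C X Y Z g f)),
      Idm = (\<lambda>X. mor_class C I X X (Idm C X))\<rparr>"

text \<open>The functor induced by \<open>F\<close> on quotients, \<open>I'\<close> being the ideal in the target \<open>D\<close>.\<close>

definition quot_fctr ::
  "('o2, 'm2, 'z2) cat_scheme \<Rightarrow> ('o2 \<Rightarrow> 'o2 \<Rightarrow> 'm2 set) \<Rightarrow> ('o1, 'm1, 'o2, 'm2) fctr \<Rightarrow>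
   ('o1, 'm1 set, 'o2, 'm2 set) fctr" where
  "quot_fctr D I' F =
     \<lparr>FOb = FOb F,
      FAr = (\<lambda>X Y G. \<Union>g\<in>G. mor_class D I' (FOb F X) (FOb F Y) (FAr F X Y g))\<rparr>"

text \<open>\<open>(X, Y, Z, u, v)\<close> stands for a conflation \<open>X \<rightarrow>\<^sup>u Y \<rightarrow>\<^sup>v Z\<close>.\<close>

type_synonym ('o, 'm) ses = "'o \<times> 'o \<times> 'o \<times> 'm \<times> 'm"

definition injective_object ::
  "('o, 'm, 'z) cat_scheme \<Rightarrow> ('o, 'm) ses set \<Rightarrow> 'o \<Rightarrow> bool" where
  "injective_object C E J \<longleftrightarrow> J \<in> Obj C \<and>
     (\<forall>X Y Z u v. (X, Y, Z, u, v) \<in> E \<longrightarrow>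
        (\<forall>f\<in>Hom C X J. \<exists>g\<in>Hom C Y J. Cmp C X Y J g u = f))"

text \<open>
  For every object \<open>X\<close> a conflation \<open>X \<rightarrow>\<^sup>u J \<rightarrow>\<^sup>p \<Sigma>X\<close> with \<open>J\<close> injective is chosen; different
  choices lead to equivalent triangulated categories.
\<close>

definition susp_choice ::
  "('o, 'm, 'z) cat_scheme \<Rightarrow> ('o, 'm) ses set \<Rightarrow> 'o \<Rightarrow> 'o \<times> 'o \<times> 'm \<times> 'm" where
  "susp_choice C E X = (SOME (J, S, u, p). (X, J, S, u, p) \<in> E \<and> injective_object C E J)"

definition inj_hull :: "('o, 'm, 'z) cat_scheme \<Rightarrow> ('o, 'm) ses set \<Rightarrow> 'o \<Rightarrow> 'o" where
  "inj_hull C E X = fst (susp_choice C E X)"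

definition susp_ob :: "('o, 'm, 'z) cat_scheme \<Rightarrow> ('o, 'm) ses set \<Rightarrow> 'o \<Rightarrow> 'o" where
  "susp_ob C E X = fst (snd (susp_choice C E X))"

definition susp_in :: "('o, 'm, 'z) cat_scheme \<Rightarrow> ('o, 'm) ses set \<Rightarrow> 'o \<Rightarrow> 'm" where
  "susp_in C E X = fst (snd (snd (susp_choice C E X)))"

definition susp_pr :: "('o, 'm, 'z) cat_scheme \<Rightarrow> ('o, 'm) ses set \<Rightarrow> 'o \<Rightarrow> 'm" where
  "susp_pr C E X = snd (snd (snd (susp_choice C E X)))"

text \<open>\<open>h : \<Sigma>X \<rightarrow> \<Sigma>Y\<close> represents \<open>\<Sigma>f\<close> if it comes from a map of the chosen conflations
  extending \<open>f\<close>.\<close>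

definition susp_lift ::
  "('o, 'm, 'z) cat_scheme \<Rightarrow> ('o, 'm) ses set \<Rightarrow> 'o \<Rightarrow> 'o \<Rightarrow> 'm \<Rightarrow> 'm \<Rightarrow> bool" where
  "susp_lift C E X Y f h \<longleftrightarrow> h \<in> Hom C (susp_ob C E X) (susp_ob C E Y) \<and>
     (\<exists>g\<in>Hom C (inj_hull C E X) (inj_hull C E Y).
        Cmp C X (inj_hull C E X) (inj_hull C E Y) g (susp_in C E X)
          = Cmp C X Y (inj_hull C E Y) (susp_in C E Y) f \<and>
        Cmp C (inj_hull C E X) (susp_ob C E X) (susp_ob C E Y) h (susp_pr C E X)
          = Cmp C (inj_hull C E X) (inj_hull C E Y) (susp_ob C E Y) (susp_pr C E Y) g)"

definition susp_fctr ::
  "('o, 'm, 'z) cat_scheme \<Rightarrow> ('o, 'm) ses set \<Rightarrow> ('o \<Rightarrow> 'o \<Rightarrow> 'm set) \<Rightarrow>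
   ('o, 'm set, 'o, 'm set) fctr" where
  "susp_fctr C E I =
     \<lparr>FOb = susp_ob C E,
      FAr = (\<lambda>X Y F. \<Union>f\<in>F. \<Union>h\<in>{h. susp_lift C E X Y f h}.
               mor_class C I (susp_ob C E X) (susp_ob C E Y) h)\<rparr>"

definition is_pushout ::
  "('o, 'm, 'z) cat_scheme \<Rightarrow> 'o \<Rightarrow> 'o \<Rightarrow> 'o \<Rightarrow> 'o \<Rightarrow> 'm \<Rightarrow> 'm \<Rightarrow> 'm \<Rightarrow> 'm \<Rightarrow> bool" where
  "is_pushout C X J Y P u f t g \<longleftrightarrow>
     X \<in> Obj C \<and> J \<in> Obj C \<and> Y \<in> Obj C \<and> P \<in> Obj C \<and>
     u \<in> Hom C X J \<and> f \<in> Hom C X Y \<and> t \<in> Hom C J P \<and> g \<in> Hom C Y P \<and>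
     Cmp C X J P t u = Cmp C X Y P g f \<and>
     (\<forall>W\<in>Obj C. \<forall>a\<in>Hom C J W. \<forall>b\<in>Hom C Y W. Cmp C X J W a u = Cmp C X Y W b f \<longrightarrow>
        (\<exists>!c. c \<in> Hom C P W \<and> Cmp C J P W c t = a \<and> Cmp C Y P W c g = b))"

text \<open>
  The standard triangle \<open>X \<rightarrow>\<^sup>f Y \<rightarrow>\<^sup>g P \<rightarrow>\<^sup>h \<Sigma>X\<close> of \<open>f\<close>: \<open>P\<close> is the pushout of \<open>f\<close> and of the
  chosen inflation \<open>X \<rightarrow> J\<close>, and \<open>h\<close> is induced by \<open>J \<rightarrow> \<Sigma>X\<close> and \<open>0 : Y \<rightarrow> \<Sigma>X\<close>.
\<close>

definition standard_triangles ::
  "('o, 'm, 'z) cat_scheme \<Rightarrow> ('o, 'm) ses set \<Rightarrow> ('o \<Rightarrow> 'o \<Rightarrow> 'm set) \<Rightarrow> ('o, 'm set) tri set"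
where
  "standard_triangles C E I =
     {(X, Y, P, mor_class C I X Y f, mor_class C I Y P g, mor_class C I P (susp_ob C E X) h)
       | X Y P f g h.
         \<exists>t. is_pushout C X (inj_hull C E X) Y P (susp_in C E X) f t g \<and>
             h \<in> Hom C P (susp_ob C E X) \<and>
             Cmp C (inj_hull C E X) P (susp_ob C E X) h t = susp_pr C E X \<and>
             Cmp C Y P (susp_ob C E X) h g = Zero C Y (susp_ob C E X)}"

text \<open>
  \<open>C\<close> with conflations \<open>E\<close> is meant to be a Frobenius category and \<open>I\<close> its ideal of morphisms
  factoring through an injective object.
\<close>

definition stable_tcat ::
  "('o, 'm, 'z) cat_scheme \<Rightarrow> ('o, 'm) ses set \<Rightarrow> ('o \<Rightarrow> 'o \<Rightarrow> 'm set) \<Rightarrow> ('o, 'm set) tcat"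
where
  "stable_tcat C E I = cat.extend (quot_cat C I)
     \<lparr>Susp = susp_fctr C E I,
      Dist = {t \<in> triangles (quot_cat C I) (susp_fctr C E I).
                \<exists>t0\<in>standard_triangles C E I. tri_iso (quot_cat C I) (susp_fctr C E I) t0 t}\<rparr>"


section \<open>\<open>N\<close>-complexes and their homotopy category\<close>

record ('o, 'm) cpx =
  Ob :: "int \<Rightarrow> 'o"
  Df :: "int \<Rightarrow> 'm"

text \<open>\<open>dpath B X i n\<close> is the composite \<open>d\<^sup>i\<^sup>+\<^sup>n\<^sup>-\<^sup>1 \<dots> d\<^sup>i\<close> of \<open>n\<close> differentials starting in degree \<open>i\<close>.\<close>

primrec dpath :: "('o, 'm, 'z) cat_scheme \<Rightarrow> ('o, 'm) cpx \<Rightarrow> int \<Rightarrow> nat \<Rightarrow> 'm" where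
  "dpath B X i 0 = Idm B (Ob X i)"
| "dpath B X i (Suc n) =
     Cmp B (Ob X i) (Ob X (i + int n)) (Ob X (i + int n + 1)) (Df X (i + int n)) (dpath B X i n)"

definition is_cpx :: "('o, 'm, 'z) cat_scheme \<Rightarrow> nat \<Rightarrow> ('o, 'm) cpx \<Rightarrow> bool" where
  "is_cpx B N X \<longleftrightarrow>
     (\<forall>i. Ob X i \<in> Obj B \<and> Df X i \<in> Hom B (Ob X i) (Ob X (i + 1)) \<and>
          dpath B X i N = Zero B (Ob X i) (Ob X (i + int N)))"

definition cpx_maps ::
  "('o, 'm, 'z) cat_scheme \<Rightarrow> ('o, 'm) cpx \<Rightarrow> ('o, 'm) cpx \<Rightarrow> (int \<Rightarrow> 'm) set" where
  "cpx_maps B X Y = {f. \<forall>i. f i \<in> Hom B (Ob X i) (Ob Y i) \<and>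
     Cmp B (Ob X i) (Ob X (i + 1)) (Ob Y (i + 1)) (f (i + 1)) (Df X i)
       = Cmp B (Ob X i) (Ob Y i) (Ob Y (i + 1)) (Df Y i) (f i)}"

definition CN :: "('o, 'm, 'z) cat_scheme \<Rightarrow> nat \<Rightarrow> (('o, 'm) cpx, int \<Rightarrow> 'm) cat" where
  "CN B N =
     \<lparr>Obj = {X. is_cpx B N X},
      HomG = (\<lambda>X Y. \<lparr>carrier = cpx_maps B X Y,
                     mult = (\<lambda>f g i. Add B (Ob X i) (Ob Y i) (f i) (g i)),
                     one = (\<lambda>i. Zero B (Ob X i) (Ob Y i))\<rparr>),
      Cmp = (\<lambda>X Y Z g f i. Cmp B (Ob X i) (Ob Y i) (Ob Z i) (g i) (f i)),
      Idm = (\<lambda>X i. Idm B (Ob X i))\<rparr>"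

text \<open>\<open>t\<close> and \<open>q\<close> are a section of \<open>v\<close> and a retraction of \<open>u\<close>.\<close>

definition split_exact ::
  "('o, 'm, 'z) cat_scheme \<Rightarrow> 'o \<Rightarrow> 'o \<Rightarrow> 'o \<Rightarrow> 'm \<Rightarrow> 'm \<Rightarrow> bool" where
  "split_exact B X Y Z u v \<longleftrightarrow> (\<exists>q t. biproduct B X Z Y u t q v)"

definition conflations ::
  "('o, 'm, 'z) cat_scheme \<Rightarrow> nat \<Rightarrow> (('o, 'm) cpx, int \<Rightarrow> 'm) ses set" where
  "conflations B N = {(X, Y, Z, u, v). X \<in> Obj (CN B N) \<and> Y \<in> Obj (CN B N) \<and> Z \<in> Obj (CN B N) \<and>
     u \<in> Hom (CN B N) X Y \<and> v \<in> Hom (CN B N) Y Z \<and>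
     (\<forall>i. split_exact B (Ob X i) (Ob Y i) (Ob Z i) (u i) (v i))}"

definition null_homotopic ::
  "('o, 'm, 'z) cat_scheme \<Rightarrow> nat \<Rightarrow> ('o, 'm) cpx \<Rightarrow> ('o, 'm) cpx \<Rightarrow> (int \<Rightarrow> 'm) set" where
  "null_homotopic B N X Y = {f \<in> cpx_maps B X Y.
     \<exists>s. (\<forall>i. s i \<in> Hom B (Ob X i) (Ob Y (i - int N + 1))) \<and>
       (\<forall>i. f i = finprod (HomG B (Ob X i) (Ob Y i))
          (\<lambda>j. Cmp B (Ob X i) (Ob Y (i - int N + int j)) (Ob Y i)
                 (dpath B Y (i - int N + int j) (N - j))
                 (Cmp B (Ob X i) (Ob X (i + int j - 1)) (Ob Y (i - int N + int j))
                   (s (i + int j - 1))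
                   (dpath B X i (j - 1))))
          {1..N})}"

text \<open>
  The null-homotopic morphisms are precisely those factoring through an injective object of
  \<^term>\<open>CN B N\<close>, so this is the stable category with its triangulated structure.
\<close>

definition KN :: "('o, 'm, 'z) cat_scheme \<Rightarrow> nat \<Rightarrow> (('o, 'm) cpx, (int \<Rightarrow> 'm) set) tcat" where
  "KN B N = stable_tcat (CN B N) (conflations B N) (null_homotopic B N)"


section \<open>The functors \<open>I\<close> and \<open>J\<close>\<close>

text \<open>\<open>iota M s\<close> is \<open>\<iota>\<^sub>s\<close> with upper index \<open>M = N - 1\<close>, and \<open>rho N s\<close> is \<open>\<rho>\<^sub>s\<close> with upper index \<open>N\<close>;
  quotient and remainder are the \<open>k\<close> and \<open>i\<close> of \<open>n = s + i + k (M + 1)\<close>,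
  respectively of \<open>n = s + i + k (N - 1)\<close>.\<close>

definition iota :: "nat \<Rightarrow> int \<Rightarrow> int \<Rightarrow> int" where
  "iota M s n = (let k = (n - s) div (int M + 1); i = (n - s) mod (int M + 1)
                 in if i = 0 then s + k * int M else s + i - 1 + k * int M)"

definition rho :: "nat \<Rightarrow> int \<Rightarrow> int \<Rightarrow> int" where
  "rho N s n = (let k = (n - s) div (int N - 1); i = (n - s) mod (int N - 1)
                in if i = 0 then s + k * int N else s + i + 1 + k * int N)"

text \<open>From \<open>M\<close>-complexes to \<open>(M + 1)\<close>-complexes.\<close>

definition I_fctr ::
  "('o, 'm, 'z) cat_scheme \<Rightarrow> nat \<Rightarrow> int \<Rightarrow>
   (('o, 'm) cpx, int \<Rightarrow> 'm, ('o, 'm) cpx, int \<Rightarrow> 'm) fctr" where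
  "I_fctr B M s =
     \<lparr>FOb = (\<lambda>X. \<lparr>Ob = (\<lambda>i. Ob X (iota M s i)),
                  Df = (\<lambda>i. if iota M s i < iota M s (i + 1) then Df X (iota M s i)
                            else Idm B (Ob X (iota M s i)))\<rparr>),
      FAr = (\<lambda>X Y f i. f (iota M s i))\<rparr>"

text \<open>From \<open>N\<close>-complexes to \<open>(N - 1)\<close>-complexes.\<close>

definition J_fctr ::
  "('o, 'm, 'z) cat_scheme \<Rightarrow> nat \<Rightarrow> int \<Rightarrow>
   (('o, 'm) cpx, int \<Rightarrow> 'm, ('o, 'm) cpx, int \<Rightarrow> 'm) fctr" where
  "J_fctr B N s =
     \<lparr>FOb = (\<lambda>Y. \<lparr>Ob = (\<lambda>i. Ob Y (rho N s i)),
                  Df = (\<lambda>i. dpath B Y (rho N s i) (nat (rho N s (i + 1) - rho N s i)))\<rparr>),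
      FAr = (\<lambda>X Y f i. f (rho N s i))\<rparr>"

definition I_K ::
  "('o, 'm, 'z) cat_scheme \<Rightarrow> nat \<Rightarrow> int \<Rightarrow>
   (('o, 'm) cpx, (int \<Rightarrow> 'm) set, ('o, 'm) cpx, (int \<Rightarrow> 'm) set) fctr" where
  "I_K B M s = quot_fctr (CN B (M + 1)) (null_homotopic B (M + 1)) (I_fctr B M s)"

definition J_K ::
  "('o, 'm, 'z) cat_scheme \<Rightarrow> nat \<Rightarrow> int \<Rightarrow>
   (('o, 'm) cpx, (int \<Rightarrow> 'm) set, ('o, 'm) cpx, (int \<Rightarrow> 'm) set) fctr" where
  "J_K B N s = quot_fctr (CN B (N - 1)) (null_homotopic B (N - 1)) (J_fctr B N s)"

text \<open>\<open>k\<close>-fold composites starting, respectively ending, at \<open>M\<close>-complexes.\<close>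

primrec I_iter ::
  "('o, 'm, 'z) cat_scheme \<Rightarrow> int \<Rightarrow> nat \<Rightarrow> nat \<Rightarrow>
   (('o, 'm) cpx, (int \<Rightarrow> 'm) set, ('o, 'm) cpx, (int \<Rightarrow> 'm) set) fctr" where
  "I_iter B s M 0 = id_fctr"
| "I_iter B s M (Suc k) = comp_fctr (I_K B (M + k) s) (I_iter B s M k)"

primrec J_iter ::
  "('o, 'm, 'z) cat_scheme \<Rightarrow> int \<Rightarrow> nat \<Rightarrow> nat \<Rightarrow>
   (('o, 'm) cpx, (int \<Rightarrow> 'm) set, ('o, 'm) cpx, (int \<Rightarrow> 'm) set) fctr" where
  "J_iter B s M 0 = id_fctr"
| "J_iter B s M (Suc k) = comp_fctr (J_iter B s M k) (J_K B (M + k + 1) s)"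

text \<open>For \<open>2 \<le> M < N\<close>.\<close>

definition I_up ::
  "('o, 'm, 'z) cat_scheme \<Rightarrow> int \<Rightarrow> nat \<Rightarrow> nat \<Rightarrow>
   (('o, 'm) cpx, (int \<Rightarrow> 'm) set, ('o, 'm) cpx, (int \<Rightarrow> 'm) set) fctr" where
  "I_up B s M N = I_iter B s M (N - M)"

definition J_down ::
  "('o, 'm, 'z) cat_scheme \<Rightarrow> int \<Rightarrow> nat \<Rightarrow> nat \<Rightarrow>
   (('o, 'm) cpx, (int \<Rightarrow> 'm) set, ('o, 'm) cpx, (int \<Rightarrow> 'm) set) fctr" where
  "J_down B s M N = J_iter B s M (N - M)"

end

theory Submission
  imports Defs
begin

text \<open>
  An \<open>N\<close>-complex is a functor on the ordered set \<open>\<int>\<close> all of whose steps of length \<open>N\<close> vanish, and the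
  functors of the theorem are restrictions along monotone maps \<open>\<phi> : \<int> \<rightarrow> \<int>\<close> with
  \<open>\<phi> (i + N) = \<phi> i + M\<close>. These preserve conflations and contractible complexes, hence induce triangle
  functors; a Galois connection between two such maps induces an adjunction, and a Galois insertion
  a fully faithful adjoint. A restriction along a map that factors through a map of period \<open>1\<close> is
  contractible, as \<open>1\<close>-complexes are; this gives the inclusions of images in kernels. Conversely, let
  \<open>\<lambda> \<le> id \<le> \<mu>\<close> be the composites of adjacent adjoints on the two sides. In each degree they form
  with a map \<open>\<pi>\<close> of the previous kind a square with two opposite sides the identity, so there is a
  degreewise split sequence \<open>\<lambda>X \<rightarrow> X \<oplus> \<pi>X \<rightarrow> \<mu>X\<close>, and \<open>X\<close> is isomorphic in the homotopy category to
  one of \<open>\<lambda>X\<close>, \<open>\<mu>X\<close> as soon as the other is contractible.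

  That the stable category is triangulated is proved with the triangles of conflations: those are
  up to isomorphism the standard triangles, and the octahedral axiom holds strictly for them.
\<close>


section \<open>Preadditive categories\<close>

text \<open>The suspension rests on an arbitrary choice of conflations, and maps of the quotient are
  cosets. Nothing can be computed from the chosen data: comparisons come from extending maps into
  injective objects, and most identities between the results hold only modulo null maps. Hence the
  index functors are treated as exact functors, without a formula for their compatibility with
  suspension.

  On the combinatorial side restriction reverses the order: the lower Galois adjoint of an index map
  gives the right adjoint functor. The map that repeats s has two extreme sections, through the
  first and through the last copy of s. They are its lower and upper adjoints, which is why the
  right and left adjoints of I at s are J at s and at s - 1. The base points r + s and r + s + 1
  arise by matching: the indices that survive one J must form exactly the run that the other I
  collapses to a point.\<close>

context preadditive_category
begin

lemma cmp_in [simp, intro]: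
  assumes "X \<in> Obj C" "Y \<in> Obj C" "Z \<in> Obj C" "f \<in> Hom C X Y" "g \<in> Hom C Y Z"
  shows "Cmp C X Y Z g f \<in> Hom C X Z"
  using cmp_hom_left[OF assms(1-4)] assms(5) by (auto simp: hom_def)

lemma zero_in [simp, intro]: "\<lbrakk>X \<in> Obj C; Y \<in> Obj C\<rbrakk> \<Longrightarrow> Zero C X Y \<in> Hom C X Y"
  using hom_group[of X Y] by (simp add: comm_group_def group.is_monoid monoid.one_closed)

lemma add_in [simp, intro]:
  "\<lbrakk>X \<in> Obj C; Y \<in> Obj C; f \<in> Hom C X Y; f' \<in> Hom C X Y\<rbrakk> \<Longrightarrow> Add C X Y f f' \<in> Hom C X Y"
  using hom_group[of X Y] by (simp add: comm_group_def group.is_monoid monoid.m_closed)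

lemma neg_in [simp, intro]:
  "\<lbrakk>X \<in> Obj C; Y \<in> Obj C; f \<in> Hom C X Y\<rbrakk> \<Longrightarrow> Neg C X Y f \<in> Hom C X Y"
  using hom_group[of X Y] by (simp add: comm_group_def group.inv_closed)

declare id_in [simp, intro] id_left [simp] id_right [simp]

lemma add_assoc:
  "\<lbrakk>X \<in> Obj C; Y \<in> Obj C; f \<in> Hom C X Y; f' \<in> Hom C X Y; f'' \<in> Hom C X Y\<rbrakk>
    \<Longrightarrow> Add C X Y (Add C X Y f f') f'' = Add C X Y f (Add C X Y f' f'')"
  using hom_group[of X Y] by (simp add: comm_group_def group.is_monoid monoid.m_assoc)

lemma add_commute:
  "\<lbrakk>X \<in> Obj C; Y \<in> Obj C; f \<in> Hom C X Y; f' \<in> Hom C X Y\<rbrakk> \<Longrightarrow> Add C X Y f f' = Add C X Y f' f"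
  using hom_group[of X Y] by (simp add: comm_group_def comm_monoid.m_comm)

lemma add_left_commute:
  "\<lbrakk>X \<in> Obj C; Y \<in> Obj C; f \<in> Hom C X Y; f' \<in> Hom C X Y; f'' \<in> Hom C X Y\<rbrakk>
    \<Longrightarrow> Add C X Y f (Add C X Y f' f'') = Add C X Y f' (Add C X Y f f'')"
  using hom_group[of X Y] by (simp add: comm_group_def comm_monoid.m_lcomm)

lemmas add_ac = add_assoc add_commute add_left_commute

lemma add_zero [simp]:
  "\<lbrakk>X \<in> Obj C; Y \<in> Obj C; f \<in> Hom C X Y\<rbrakk> \<Longrightarrow> Add C X Y f (Zero C X Y) = f"
  "\<lbrakk>X \<in> Obj C; Y \<in> Obj C; f \<in> Hom C X Y\<rbrakk> \<Longrightarrow> Add C X Y (Zero C X Y) f = f"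
  using hom_group[of X Y] by (simp_all add: comm_group_def group.is_monoid)

lemma add_neg [simp]:
  "\<lbrakk>X \<in> Obj C; Y \<in> Obj C; f \<in> Hom C X Y\<rbrakk> \<Longrightarrow> Add C X Y f (Neg C X Y f) = Zero C X Y"
  "\<lbrakk>X \<in> Obj C; Y \<in> Obj C; f \<in> Hom C X Y\<rbrakk> \<Longrightarrow> Add C X Y (Neg C X Y f) f = Zero C X Y"
  using hom_group[of X Y] by (simp_all add: comm_group_def group.l_inv group.r_inv)

lemma add_neg_cancel [simp]:
  "\<lbrakk>X \<in> Obj C; Y \<in> Obj C; f \<in> Hom C X Y; g \<in> Hom C X Y\<rbrakk>
    \<Longrightarrow> Add C X Y f (Add C X Y (Neg C X Y f) g) = g"
  "\<lbrakk>X \<in> Obj C; Y \<in> Obj C; f \<in> Hom C X Y; g \<in> Hom C X Y\<rbrakk>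
    \<Longrightarrow> Add C X Y (Neg C X Y f) (Add C X Y f g) = g"
  by (simp_all add: add_assoc[symmetric])

lemma neg_neg [simp]: "\<lbrakk>X \<in> Obj C; Y \<in> Obj C; f \<in> Hom C X Y\<rbrakk> \<Longrightarrow> Neg C X Y (Neg C X Y f) = f"
  using hom_group[of X Y] by (simp add: comm_group_def group.inv_inv)

lemma neg_zero [simp]: "\<lbrakk>X \<in> Obj C; Y \<in> Obj C\<rbrakk> \<Longrightarrow> Neg C X Y (Zero C X Y) = Zero C X Y"
  using hom_group[of X Y] by (simp add: comm_group_def group.is_monoid monoid.inv_one)

lemma neg_add [simp]:
  "\<lbrakk>X \<in> Obj C; Y \<in> Obj C; f \<in> Hom C X Y; f' \<in> Hom C X Y\<rbrakk>
      \<Longrightarrow> Neg C X Y (Add C X Y f f') = Add C X Y (Neg C X Y f) (Neg C X Y f')"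
  using hom_group[of X Y] by (simp add: comm_group.inv_mult)

lemma add_left_cancel:
  "\<lbrakk>X \<in> Obj C; Y \<in> Obj C; f \<in> Hom C X Y; f1 \<in> Hom C X Y; f2 \<in> Hom C X Y\<rbrakk>
    \<Longrightarrow> Add C X Y f f1 = Add C X Y f f2 \<longleftrightarrow> f1 = f2"
  by (metis add_neg_cancel(2))

lemma neg_unique:
  "\<lbrakk>X \<in> Obj C; Y \<in> Obj C; f \<in> Hom C X Y; f' \<in> Hom C X Y; Add C X Y f f' = Zero C X Y\<rbrakk>
    \<Longrightarrow> f' = Neg C X Y f"
  by (metis add_left_cancel add_neg(1) neg_in)

lemma eq_iff_diff:
  "\<lbrakk>X \<in> Obj C; Y \<in> Obj C; f \<in> Hom C X Y; f' \<in> Hom C X Y\<rbrakk>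
    \<Longrightarrow> f = f' \<longleftrightarrow> Add C X Y f (Neg C X Y f') = Zero C X Y"
  by (metis add_neg(1) neg_in neg_neg neg_unique add_commute)

lemma cmp_zero [simp]:
  "\<lbrakk>X \<in> Obj C; Y \<in> Obj C; Z \<in> Obj C; f \<in> Hom C X Y\<rbrakk> \<Longrightarrow> Cmp C X Y Z (Zero C Y Z) f = Zero C X Z"
  "\<lbrakk>X \<in> Obj C; Y \<in> Obj C; Z \<in> Obj C; g \<in> Hom C Y Z\<rbrakk> \<Longrightarrow> Cmp C X Y Z g (Zero C X Y) = Zero C X Z"
proof -
  show "Cmp C X Y Z (Zero C Y Z) f = Zero C X Z" if "X \<in> Obj C" "Y \<in> Obj C" "Z \<in> Obj C"
      "f \<in> Hom C X Y"
    using hom_one[OF cmp_hom_left[OF that]] hom_group that by (simp add: comm_group_def)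
  show "Cmp C X Y Z g (Zero C X Y) = Zero C X Z" if "X \<in> Obj C" "Y \<in> Obj C" "Z \<in> Obj C"
      "g \<in> Hom C Y Z"
    using hom_one[OF cmp_hom_right[OF that]] hom_group that by (simp add: comm_group_def)
qed

lemma cmp_add [simp]:
  "\<lbrakk>X \<in> Obj C; Y \<in> Obj C; Z \<in> Obj C; f \<in> Hom C X Y; g \<in> Hom C Y Z; g' \<in> Hom C Y Z\<rbrakk>
    \<Longrightarrow> Cmp C X Y Z (Add C Y Z g g') f = Add C X Z (Cmp C X Y Z g f) (Cmp C X Y Z g' f)"
  "\<lbrakk>X \<in> Obj C; Y \<in> Obj C; Z \<in> Obj C; f \<in> Hom C X Y; f' \<in> Hom C X Y; g \<in> Hom C Y Z\<rbrakk>
    \<Longrightarrow> Cmp C X Y Z g (Add C X Y f f') = Add C X Z (Cmp C X Y Z g f) (Cmp C X Y Z g f')"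
  using hom_mult[OF cmp_hom_left] hom_mult[OF cmp_hom_right] by simp_all

lemma cmp_neg [simp]:
  "\<lbrakk>X \<in> Obj C; Y \<in> Obj C; Z \<in> Obj C; f \<in> Hom C X Y; g \<in> Hom C Y Z\<rbrakk>
    \<Longrightarrow> Cmp C X Y Z (Neg C Y Z g) f = Neg C X Z (Cmp C X Y Z g f)"
  "\<lbrakk>X \<in> Obj C; Y \<in> Obj C; Z \<in> Obj C; f \<in> Hom C X Y; g \<in> Hom C Y Z\<rbrakk>
    \<Longrightarrow> Cmp C X Y Z g (Neg C X Y f) = Neg C X Z (Cmp C X Y Z g f)"
proof -
  assume a: "X \<in> Obj C" "Y \<in> Obj C" "Z \<in> Obj C" "f \<in> Hom C X Y" "g \<in> Hom C Y Z"
  have "Add C X Z (Cmp C X Y Z g f) (Cmp C X Y Z (Neg C Y Z g) f) = Zero C X Z"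
    using a by (simp flip: cmp_add)
  then show "Cmp C X Y Z (Neg C Y Z g) f = Neg C X Z (Cmp C X Y Z g f)" using a
      by (intro neg_unique) auto
  have "Add C X Z (Cmp C X Y Z g f) (Cmp C X Y Z g (Neg C X Y f)) = Zero C X Z"
    using a by (simp flip: cmp_add)
  then show "Cmp C X Y Z g (Neg C X Y f) = Neg C X Z (Cmp C X Y Z g f)" using a
      by (intro neg_unique) auto
qed

declare cmp_assoc [simp]

text \<open>Composites are kept associated to the right, so a pair \<open>h\<close>,
  \<open>f\<close> with a known composite usually occurs as h (f w). This carries an identity h f =
  k to that position.\<close>

lemma cmp_eq_assoc:
  "\<lbrakk>Cmp C X Y Z h f = k; W \<in> Obj C; X \<in> Obj C; Y \<in> Obj C; Z \<in> Obj C;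
    w \<in> Hom C W X; f \<in> Hom C X Y; h \<in> Hom C Y Z\<rbrakk> \<Longrightarrow> Cmp C W Y Z h (Cmp C W X Y f w) = Cmp C W X Z k
        w"
  using cmp_assoc by metis

lemma cmp_finprod_right:
  assumes "X \<in> Obj C" "Y \<in> Obj C" "Z \<in> Obj C" "g \<in> Hom C Y Z" "F \<in> A \<rightarrow> Hom C X Y"
  shows "Cmp C X Y Z g (finprod (HomG C X Y) F A)
      = finprod (HomG C X Z) (\<lambda>a. Cmp C X Y Z g (F a)) A"
proof -
  interpret G: comm_group "HomG C X Y" using assms hom_group by blast
  interpret H: comm_group "HomG C X Z" using assms hom_group by blast
  show ?thesis using assms(5)
  proof (induction A rule: infinite_finite_induct)
    case (insert x A)
    then have "F \<in> A \<rightarrow> Hom C X Y" "F x \<in> Hom C X Y" by auto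
    then show ?case using insert assms(1-4) by (simp add: Pi_def)
  qed (use assms in auto)
qed

lemma cmp_finprod_left:
  assumes "X \<in> Obj C" "Y \<in> Obj C" "Z \<in> Obj C" "g \<in> Hom C X Y" "F \<in> A \<rightarrow> Hom C Y Z"
  shows "Cmp C X Y Z (finprod (HomG C Y Z) F A) g
      = finprod (HomG C X Z) (\<lambda>a. Cmp C X Y Z (F a) g) A"
proof -
  interpret G: comm_group "HomG C Y Z" using assms hom_group by blast
  interpret H: comm_group "HomG C X Z" using assms hom_group by blast
  show ?thesis using assms(5)
  proof (induction A rule: infinite_finite_induct)
    case (insert x A)
    then have "F \<in> A \<rightarrow> Hom C Y Z" "F x \<in> Hom C Y Z" by auto
    then show ?case using insert assms(1-4) by (simp add: Pi_def)
  qed (use assms in auto)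
qed

lemma is_isoI:
  "\<lbrakk>f \<in> Hom C X Y; g \<in> Hom C Y X; Cmp C X Y X g f = Idm C X; Cmp C Y X Y f g = Idm C Y\<rbrakk>
    \<Longrightarrow> is_iso C X Y f"
  by (auto simp: is_iso_def)

lemma is_isoE:
  assumes "is_iso C X Y f"
  obtains g where "f \<in> Hom C X Y" "g \<in> Hom C Y X" "Cmp C X Y X g f = Idm C X"
    "Cmp C Y X Y f g = Idm C Y"
  using assms by (auto simp: is_iso_def)

lemma is_iso_id: "X \<in> Obj C \<Longrightarrow> is_iso C X X (Idm C X)"
  by (rule is_isoI) auto

lemma is_iso_cmp:
  assumes [simp]: "X \<in> Obj C" "Y \<in> Obj C" "Z \<in> Obj C"
    and f: "is_iso C X Y f" and g: "is_iso C Y Z g"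
  shows "is_iso C X Z (Cmp C X Y Z g f)"
proof -
  obtain f' where f': "f \<in> Hom C X Y" "f' \<in> Hom C Y X" "Cmp C X Y X f' f = Idm C X"
      "Cmp C Y X Y f f' = Idm C Y"
    using f by (rule is_isoE)
  obtain g' where g': "g \<in> Hom C Y Z" "g' \<in> Hom C Z Y" "Cmp C Y Z Y g' g = Idm C Y"
      "Cmp C Z Y Z g g' = Idm C Z"
    using g by (rule is_isoE)
  note [simp] = f'(1,2) g'(1,2)
  have "Cmp C X Z Y g' (Cmp C X Y Z g f) = f" "Cmp C Z X Y f (Cmp C Z Y X f' g') = g'"
    using f' g' cmp_eq_assoc by auto
  then show ?thesis
    using f' g' by (intro is_isoI[where g = "Cmp C Z Y X f' g'"]) auto
qed

lemma biproductD:
  assumes "biproduct C X Y P i1 i2 p1 p2"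
  shows "P \<in> Obj C" "i1 \<in> Hom C X P" "i2 \<in> Hom C Y P" "p1 \<in> Hom C P X" "p2 \<in> Hom C P Y"
    "Cmp C X P X p1 i1 = Idm C X" "Cmp C Y P Y p2 i2 = Idm C Y"
    "Cmp C Y P X p1 i2 = Zero C Y X" "Cmp C X P Y p2 i1 = Zero C X Y"
    "Add C P P (Cmp C P X P i1 p1) (Cmp C P Y P i2 p2) = Idm C P"
  using assms by (simp_all add: biproduct_def)

lemma zero_object_iff:
  assumes "Z \<in> Obj C"
  shows "zero_object C Z \<longleftrightarrow> Idm C Z = Zero C Z Z"
proof
  assume "zero_object C Z"
  then show "Idm C Z = Zero C Z Z"
    using assms unfolding zero_object_def by (metis id_in zero_in)
next
  assume z: "Idm C Z = Zero C Z Z"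
  show "zero_object C Z"
    unfolding zero_object_def
  proof (intro conjI ballI assms ex1I)
    fix X assume X: "X \<in> Obj C"
    show "Zero C X Z \<in> Hom C X Z" "Zero C Z X \<in> Hom C Z X" using X assms by auto
    show "f = Zero C X Z" if "f \<in> Hom C X Z" for f
      using id_left[OF X assms that] z cmp_zero(1)[OF X assms assms that] by simp
    show "f = Zero C Z X" if "f \<in> Hom C Z X" for f
      using id_right[OF assms X that] z cmp_zero(2)[OF assms assms X that] by simp
  qed
qed

end


section \<open>Quotients by ideals\<close>

locale ideal_quotient = additive_category C
  for C :: "('o, 'm, 'z) cat_scheme" and I :: "'o \<Rightarrow> 'o \<Rightarrow> 'm set" +
  assumes ideal_subgroup: "\<lbrakk>X \<in> Obj C; Y \<in> Obj C\<rbrakk> \<Longrightarrow> subgroup (I X Y) (HomG C X Y)"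
    and ideal_left: "\<lbrakk>X \<in> Obj C; Y \<in> Obj C; Z \<in> Obj C; f \<in> I X Y; g \<in> Hom C Y Z\<rbrakk>
      \<Longrightarrow> Cmp C X Y Z g f \<in> I X Z"
    and ideal_right: "\<lbrakk>X \<in> Obj C; Y \<in> Obj C; Z \<in> Obj C; f \<in> Hom C X Y; g \<in> I Y Z\<rbrakk>
      \<Longrightarrow> Cmp C X Y Z g f \<in> I X Z"
begin

abbreviation cls :: "'o \<Rightarrow> 'o \<Rightarrow> 'm \<Rightarrow> 'm set" where
  "cls \<equiv> mor_class C I"

abbreviation Q :: "('o, 'm set) cat" where
  "Q \<equiv> quot_cat C I"

lemma ideal_in: "\<lbrakk>f \<in> I X Y; X \<in> Obj C; Y \<in> Obj C\<rbrakk> \<Longrightarrow> f \<in> Hom C X Y"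
  by (rule subgroup.mem_carrier[OF ideal_subgroup])

lemma ideal_add: "\<lbrakk>X \<in> Obj C; Y \<in> Obj C; f \<in> I X Y; f' \<in> I X Y\<rbrakk> \<Longrightarrow> Add C X Y f f' \<in> I X Y"
  by (rule subgroup.m_closed[OF ideal_subgroup])

lemma ideal_neg: "\<lbrakk>X \<in> Obj C; Y \<in> Obj C; f \<in> I X Y\<rbrakk> \<Longrightarrow> Neg C X Y f \<in> I X Y"
  by (rule subgroup.m_inv_closed[OF ideal_subgroup])

lemma ideal_zero [simp]: "\<lbrakk>X \<in> Obj C; Y \<in> Obj C\<rbrakk> \<Longrightarrow> Zero C X Y \<in> I X Y"
  by (rule subgroup.one_closed[OF ideal_subgroup])

lemma quot_sel [simp]: "Obj Q = Obj C" "Idm Q X = cls X X (Idm C X)"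
  by (simp_all add: quot_cat_def)

lemma HomG_quot: "HomG Q X Y = HomG C X Y Mod I X Y"
  by (simp add: quot_cat_def)

lemma ideal_normal: "\<lbrakk>X \<in> Obj C; Y \<in> Obj C\<rbrakk> \<Longrightarrow> I X Y \<lhd> HomG C X Y"
  using hom_group ideal_subgroup by (simp add: comm_group.subgroup_imp_normal)

lemma cls_in [simp]:
  "\<lbrakk>X \<in> Obj C; Y \<in> Obj C; f \<in> Hom C X Y\<rbrakk> \<Longrightarrow> cls X Y f \<in> Hom Q X Y"
  by (auto simp: mor_class_def RCOSETS_def HomG_quot FactGroup_def)

lemma cls_cases:
  assumes "F \<in> Hom Q X Y"
  obtains f where "f \<in> Hom C X Y" "F = cls X Y f"
  using assms by (auto simp: mor_class_def RCOSETS_def HomG_quot FactGroup_def)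

lemma in_cls_iff:
  assumes "X \<in> Obj C" "Y \<in> Obj C" "f \<in> Hom C X Y"
  shows "f' \<in> cls X Y f \<longleftrightarrow> (\<exists>h\<in>I X Y. f' = Add C X Y h f)"
  by (auto simp: mor_class_def r_coset_def)

lemma in_cls_iff_diff:
  assumes "X \<in> Obj C" "Y \<in> Obj C" "f \<in> Hom C X Y" "f' \<in> Hom C X Y"
  shows "f' \<in> cls X Y f \<longleftrightarrow> Add C X Y f' (Neg C X Y f) \<in> I X Y"
proof
  assume "f' \<in> cls X Y f"
  then obtain h where h: "h \<in> I X Y" "f' = Add C X Y h f" using assms in_cls_iff by auto
  moreover have "h \<in> Hom C X Y" using h ideal_in assms by auto
  ultimately show "Add C X Y f' (Neg C X Y f) \<in> I X Y" using assms by (simp add: add_assoc)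
next
  assume "Add C X Y f' (Neg C X Y f) \<in> I X Y"
  moreover have "f' = Add C X Y (Add C X Y f' (Neg C X Y f)) f" using assms by (simp add: add_assoc)
  ultimately show "f' \<in> cls X Y f" using assms in_cls_iff by blast
qed

lemma cls_eq_iff:
  assumes "X \<in> Obj C" "Y \<in> Obj C" "f \<in> Hom C X Y" "f' \<in> Hom C X Y"
  shows "cls X Y f' = cls X Y f \<longleftrightarrow> Add C X Y f' (Neg C X Y f) \<in> I X Y"
proof -
  interpret G: comm_group "HomG C X Y" using assms hom_group by blast
  have "cls X Y f' = cls X Y f \<longleftrightarrow> f' \<in> cls X Y f"
    unfolding mor_class_def
    using assms ideal_subgroup G.repr_independence G.rcos_self by metis
  then show ?thesis using in_cls_iff_diff assms by simp
qed

lemma cls_eqI: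
  assumes h: "h \<in> I X Y" and f: "f = Add C X Y h f'"
    and [simp]: "X \<in> Obj C" "Y \<in> Obj C" "f' \<in> Hom C X Y"
  shows "cls X Y f = cls X Y f'"
proof -
  have [simp]: "h \<in> Hom C X Y" using ideal_in[OF h] by simp
  have "Add C X Y (Add C X Y h f') (Neg C X Y f') = h" by (simp add: add_assoc)
  then show ?thesis unfolding f using cls_eq_iff[of X Y f' "Add C X Y h f'"] h by simp
qed

lemma cls_eqE:
  assumes "cls X Y f = cls X Y f'" and [simp]: "X \<in> Obj C" "Y \<in> Obj C" "f \<in> Hom C X Y"
      "f' \<in> Hom C X Y"
  obtains h where "h \<in> I X Y" "f = Add C X Y h f'" "h \<in> Hom C X Y"
proof -
  have 1: "Add C X Y f (Neg C X Y f') \<in> I X Y" using cls_eq_iff[THEN iffD1, OF assms(2,3,5,4,1)] .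
  have 2: "Add C X Y (Add C X Y f (Neg C X Y f')) f' = f" by (simp add: add_assoc)
  have 3: "Add C X Y f (Neg C X Y f') \<in> Hom C X Y" by simp
  show thesis by (rule that[OF 1 2[symmetric] 3])
qed

lemma cls_zero_iff:
  assumes "X \<in> Obj C" "Y \<in> Obj C" "f \<in> Hom C X Y"
  shows "cls X Y f = cls X Y (Zero C X Y) \<longleftrightarrow> f \<in> I X Y"
  using cls_eq_iff[of X Y "Zero C X Y" f] assms by simp

lemma zero_Q_eq [simp]:
  assumes "X \<in> Obj C" "Y \<in> Obj C"
  shows "Zero Q X Y = cls X Y (Zero C X Y)"
proof -
  interpret G: comm_group "HomG C X Y" using assms by (rule hom_group)
  show ?thesis
    unfolding HomG_quot one_FactGroup mor_class_def
    by (rule G.coset_mult_one[symmetric]) (rule subgroup.subset[OF ideal_subgroup[OF assms]])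
qed

text \<open>Changing the representatives to h + g and k + f changes the composite by h k + h f + g
  k, a member of the ideal. All members of the union that defines composition thus coincide, and the
  union is nonempty.\<close>

lemma cls_cmp [simp]:
  assumes [simp]: "X \<in> Obj C" "Y \<in> Obj C" "Z \<in> Obj C" "f \<in> Hom C X Y" "g \<in> Hom C Y Z"
  shows "Cmp Q X Y Z (cls Y Z g) (cls X Y f) = cls X Z (Cmp C X Y Z g f)"
proof -
  have eq: "cls X Z (Cmp C X Y Z g' f') = cls X Z (Cmp C X Y Z g f)"
    if g': "g' \<in> cls Y Z g" and f': "f' \<in> cls X Y f" for g' f'
  proof -
    obtain k where k: "k \<in> I X Y" "f' = Add C X Y k f" using f' in_cls_iff by auto
    obtain h where h: "h \<in> I Y Z" "g' = Add C Y Z h g" using g' in_cls_iff by auto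
    have [simp]: "k \<in> Hom C X Y" "h \<in> Hom C Y Z" using h k ideal_in by auto
    have 1: "Cmp C X Y Z (Add C Y Z h g) (Add C X Y k f)
        = Add C X Z (Add C X Z (Add C X Z (Cmp C X Y Z h k) (Cmp C X Y Z h f)) (Cmp C X Y Z g k))
        (Cmp C X Y Z g f)"
      by (simp add: add_ac)
    have 2: "Add C X Z (Add C X Z (Cmp C X Y Z h k) (Cmp C X Y Z h f)) (Cmp C X Y Z g k) \<in> I X Z"
      by (intro ideal_add) (auto intro: ideal_left ideal_right h k)
    show ?thesis unfolding h(2) k(2) by (rule cls_eqI[OF 2 1]) simp_all
  qed
  have ne: "g \<in> cls Y Z g" "f \<in> cls X Y f" by (simp_all add: in_cls_iff_diff)
  have "Cmp Q X Y Z (cls Y Z g) (cls X Y f)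
      = (\<Union>g'\<in>cls Y Z g. \<Union>f'\<in>cls X Y f. cls X Z (Cmp C X Y Z g' f'))"
    by (simp add: quot_cat_def)
  also have "\<dots> = (\<Union>g'\<in>cls Y Z g. \<Union>f'\<in>cls X Y f. cls X Z (Cmp C X Y Z g f))"
    by (intro SUP_cong refl eq)
  also have "\<dots> = cls X Z (Cmp C X Y Z g f)" using ne by blast
  finally show ?thesis .
qed

lemma cls_add [simp]:
  assumes "X \<in> Obj C" "Y \<in> Obj C" "f \<in> Hom C X Y" "f' \<in> Hom C X Y"
  shows "Add Q X Y (cls X Y f) (cls X Y f') = cls X Y (Add C X Y f f')"
  unfolding mor_class_def HomG_quot mult_FactGroup
  by (rule normal.rcos_sum[OF ideal_normal]) (use assms in auto)

lemma hom_group_Q: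
  assumes "X \<in> Obj C" "Y \<in> Obj C"
  shows "comm_group (HomG Q X Y)"
proof (rule group.group_comm_groupI)
  show "group (HomG Q X Y)"
    using assms by (simp add: HomG_quot normal.factorgroup_is_group ideal_normal)
  show "Add Q X Y F G = Add Q X Y G F" if "F \<in> Hom Q X Y" "G \<in> Hom Q X Y" for F G
    using that assms by (auto simp: add_commute elim!: cls_cases)
qed

lemma cls_neg [simp]:
  assumes "X \<in> Obj C" "Y \<in> Obj C" "f \<in> Hom C X Y"
  shows "Neg Q X Y (cls X Y f) = cls X Y (Neg C X Y f)"
proof -
  interpret G: comm_group "HomG Q X Y" using assms hom_group_Q by blast
  have "cls X Y (Neg C X Y f) \<otimes>\<^bsub>HomG Q X Y\<^esub> cls X Y f = \<one>\<^bsub>HomG Q X Y\<^esub>"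
    using assms by simp
  from G.inv_equality[OF this] show ?thesis using assms by simp
qed

lemma zero_object_Q:
  assumes "zero_object C Z"
  shows "zero_object Q Z"
proof -
  have Z: "Z \<in> Obj C" using assms by (simp add: zero_object_def)
  have u: "f = Zero C X Z" if "f \<in> Hom C X Z" "X \<in> Obj C" for f X
    using assms that Z unfolding zero_object_def by (metis zero_in)
  have u': "f = Zero C Z X" if "f \<in> Hom C Z X" "X \<in> Obj C" for f X
    using assms that Z unfolding zero_object_def by (metis zero_in)
  show ?thesis
    unfolding zero_object_def
  proof (intro conjI ballI)
    fix X assume X: "X \<in> Obj Q"
    show "\<exists>!F. F \<in> Hom Q X Z"
      by (rule ex1I[of _ "cls X Z (Zero C X Z)"]) (use X Z in \<open>auto elim!: cls_cases dest: u\<close>)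
    show "\<exists>!F. F \<in> Hom Q Z X"
      by (rule ex1I[of _ "cls Z X (Zero C Z X)"]) (use X Z in \<open>auto elim!: cls_cases dest: u'\<close>)
  qed (use Z in simp)
qed

lemma biproduct_Q:
  assumes "biproduct C X Y P i1 i2 p1 p2" "X \<in> Obj C" "Y \<in> Obj C"
  shows "biproduct Q X Y P (cls X P i1) (cls Y P i2) (cls P X p1) (cls P Y p2)"
proof -
  note [simp] = assms(2,3) biproductD[OF assms(1)]
  show ?thesis unfolding biproduct_def by simp
qed

lemma additive_Q: "additive_category Q"
proof (intro additive_category.intro preadditive_category.intro additive_category_axioms.intro)
  show "comm_group (HomG Q X Y)" if "X \<in> Obj Q" "Y \<in> Obj Q" for X Y
    using hom_group_Q that by simp
  show "(\<lambda>g. Cmp Q X Y Z g f) \<in> hom (HomG Q Y Z) (HomG Q X Z)"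
    if "X \<in> Obj Q" "Y \<in> Obj Q" "Z \<in> Obj Q" "f \<in> Hom Q X Y" for X Y Z f
    using that by (auto simp: hom_def elim!: cls_cases)
  show "(\<lambda>f. Cmp Q X Y Z g f) \<in> hom (HomG Q X Y) (HomG Q X Z)"
    if "X \<in> Obj Q" "Y \<in> Obj Q" "Z \<in> Obj Q" "g \<in> Hom Q Y Z" for X Y Z g
    using that by (auto simp: hom_def elim!: cls_cases)
  show "Cmp Q W X Z (Cmp Q X Y Z h g) f = Cmp Q W Y Z h (Cmp Q W X Y g f)"
    if "W \<in> Obj Q" "X \<in> Obj Q" "Y \<in> Obj Q" "Z \<in> Obj Q"
       "f \<in> Hom Q W X" "g \<in> Hom Q X Y" "h \<in> Hom Q Y Z" for W X Y Z f g h
    using that by (auto elim!: cls_cases)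
  show "Idm Q X \<in> Hom Q X X" if "X \<in> Obj Q" for X
    using that by simp
  show "Cmp Q X Y Y (Idm Q Y) f = f" if "X \<in> Obj Q" "Y \<in> Obj Q" "f \<in> Hom Q X Y" for X Y f
    using that by (auto elim!: cls_cases)
  show "Cmp Q X X Y f (Idm Q X) = f" if "X \<in> Obj Q" "Y \<in> Obj Q" "f \<in> Hom Q X Y" for X Y f
    using that by (auto elim!: cls_cases)
  show "\<exists>Z. zero_object Q Z" using ex_zero_object zero_object_Q by blast
  show "\<exists>P i1 i2 p1 p2. biproduct Q X Y P i1 i2 p1 p2" if "X \<in> Obj Q" "Y \<in> Obj Q" for X Y
    using ex_biproduct biproduct_Q that quot_sel(1) by metis
qed

end


section \<open>Functors, equivalences and adjunctions\<close>

lemma is_functorI: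
  assumes "\<And>X. X \<in> Obj C \<Longrightarrow> FOb F X \<in> Obj D"
    and "\<And>X Y f. \<lbrakk>X \<in> Obj C; Y \<in> Obj C; f \<in> Hom C X Y\<rbrakk> \<Longrightarrow> FAr F X Y f \<in> Hom D (FOb F X) (FOb F Y)"
    and "\<And>X. X \<in> Obj C \<Longrightarrow> FAr F X X (Idm C X) = Idm D (FOb F X)"
    and "\<And>X Y Z f g. \<lbrakk>X \<in> Obj C; Y \<in> Obj C; Z \<in> Obj C; f \<in> Hom C X Y; g \<in> Hom C Y Z\<rbrakk> \<Longrightarrow>
        FAr F X Z (Cmp C X Y Z g f)
          = Cmp D (FOb F X) (FOb F Y) (FOb F Z) (FAr F Y Z g) (FAr F X Y f)"
  shows "is_functor C D F"
  using assms unfolding is_functor_def by blast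

lemma is_functorD:
  assumes "is_functor C D F"
  shows "X \<in> Obj C \<Longrightarrow> FOb F X \<in> Obj D"
    and "\<lbrakk>X \<in> Obj C; Y \<in> Obj C; f \<in> Hom C X Y\<rbrakk> \<Longrightarrow> FAr F X Y f \<in> Hom D (FOb F X) (FOb F Y)"
    and "X \<in> Obj C \<Longrightarrow> FAr F X X (Idm C X) = Idm D (FOb F X)"
    and "\<lbrakk>X \<in> Obj C; Y \<in> Obj C; Z \<in> Obj C; f \<in> Hom C X Y; g \<in> Hom C Y Z\<rbrakk> \<Longrightarrow>
        FAr F X Z (Cmp C X Y Z g f)
          = Cmp D (FOb F X) (FOb F Y) (FOb F Z) (FAr F Y Z g) (FAr F X Y f)"
  using assms unfolding is_functor_def by blast+

lemma functor_iso:
  assumes F: "is_functor C D F" and f: "is_iso C X Y f" and XY: "X \<in> Obj C" "Y \<in> Obj C"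
  shows "is_iso D (FOb F X) (FOb F Y) (FAr F X Y f)"
proof -
  obtain g where "f \<in> Hom C X Y" "g \<in> Hom C Y X"
    "Cmp C X Y X g f = Idm C X" "Cmp C Y X Y f g = Idm C Y"
    using f by (auto simp: is_iso_def)
  then show ?thesis
    using is_functorD[OF F] XY unfolding is_iso_def by metis
qed

text \<open>A quasi-inverse is obtained by choosing preimages of objects, conjugating with the
  chosen isomorphisms and pulling back along the bijections on Hom-sets. Identities for it are
  checked after applying \<open>F\<close>, which is injective on morphisms.\<close>

lemma equivalence_if_ff_ess_surj:
  assumes C: "preadditive_category C" and D: "preadditive_category D"
    and F: "is_functor C D F" and ff: "fully_faithful C D F"
    and es: "\<And>Y. Y \<in> Obj D \<Longrightarrow> \<exists>X\<in>Obj C. \<exists>e. is_iso D (FOb F X) Y e"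
  shows "equivalence C D F"
proof -
  interpret C: preadditive_category C by fact
  interpret D: preadditive_category D by fact
  note Fs [simp] = is_functorD[OF F]
  define F' where "F' X Y h = inv_into (Hom C X Y) (FAr F X Y) h" for X Y h
  have bij: "bij_betw (FAr F X Y) (Hom C X Y) (Hom D (FOb F X) (FOb F Y))"
    if "X \<in> Obj C" "Y \<in> Obj C" for X Y
    using ff that by (auto simp: fully_faithful_def)
  have FF' [simp]: "FAr F X Y (F' X Y h) = h" and F'_in [simp]: "F' X Y h \<in> Hom C X Y"
    if "X \<in> Obj C" "Y \<in> Obj C" "h \<in> Hom D (FOb F X) (FOb F Y)" for X Y h
    using bij[OF that(1,2)] that(3) inv_into_into f_inv_into_f unfolding F'_def bij_betw_def
        by metis+
  have inj: "f = f'" if "FAr F X Y f = FAr F X Y f'" "f \<in> Hom C X Y" "f' \<in> Hom C X Y"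
    "X \<in> Obj C" "Y \<in> Obj C" for X Y f f'
    using bij[OF that(4,5)] that(1-3) by (meson bij_betw_imp_inj_on inj_onD)
  have "\<forall>Y\<in>Obj D. \<exists>X e e'. X \<in> Obj C \<and> e \<in> Hom D (FOb F X) Y \<and> e' \<in> Hom D Y (FOb F X) \<and>
      Cmp D (FOb F X) Y (FOb F X) e' e = Idm D (FOb F X) \<and> Cmp D Y (FOb F X) Y e e' = Idm D Y"
    using es unfolding is_iso_def by meson
  then obtain G e e' where G [simp]: "\<And>Y. Y \<in> Obj D \<Longrightarrow> G Y \<in> Obj C"
    and e [simp]: "\<And>Y. Y \<in> Obj D \<Longrightarrow> e Y \<in> Hom D (FOb F (G Y)) Y"
      "\<And>Y. Y \<in> Obj D \<Longrightarrow> e' Y \<in> Hom D Y (FOb F (G Y))"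
      "\<And>Y. Y \<in> Obj D \<Longrightarrow> Cmp D (FOb F (G Y)) Y (FOb F (G Y)) (e' Y) (e Y) = Idm D (FOb F (G Y))"
      "\<And>Y. Y \<in> Obj D \<Longrightarrow> Cmp D Y (FOb F (G Y)) Y (e Y) (e' Y) = Idm D Y"
    by metis
  have ea [simp]: "Cmp D W (FOb F (G Y)) Y (e Y) (Cmp D W Y (FOb F (G Y)) (e' Y) h) = h"
    if "Y \<in> Obj D" "W \<in> Obj D" "h \<in> Hom D W Y" for Y W h
    using that D.cmp_eq_assoc[OF e(4)] by simp
  have ea' [simp]: "Cmp D W Y (FOb F (G Y)) (e' Y) (Cmp D W (FOb F (G Y)) Y (e Y) h) = h"
    if "Y \<in> Obj D" "W \<in> Obj D" "h \<in> Hom D W (FOb F (G Y))" for Y W h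
    using that D.cmp_eq_assoc[OF e(3)] by simp
  define GG
      where "GG = \<lparr>FOb = G, FAr
      = (\<lambda>Y Z f. F' (G Y) (G Z) (Cmp D (FOb F (G Y)) Z (FOb F (G Z)) (e' Z)
      (Cmp D (FOb F (G Y)) Y Z f (e Y))))\<rparr>"
  have GGs [simp]: "FOb GG = G"
      "FAr GG Y Z f
      = F' (G Y) (G Z)
      (Cmp D (FOb F (G Y)) Z (FOb F (G Z)) (e' Z) (Cmp D (FOb F (G Y)) Y Z f (e Y)))" for Y
      Z f
    by (simp_all add: GG_def)
  have Gf: "is_functor D C GG"
    by (rule is_functorI) (auto intro!: inj)
  have "natural_iso D D (comp_fctr F GG) id_fctr e"
    unfolding natural_iso_def comp_fctr_def id_fctr_def
    using D.is_isoI[OF e] by auto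
  moreover have "is_iso C X (G (FOb F X)) (F' X (G (FOb F X)) (e' (FOb F X)))" if "X \<in> Obj C" for X
    by (rule C.is_isoI[where g = "F' (G (FOb F X)) X (e (FOb F X))"])
        (use that in \<open>auto intro!: inj\<close>)
  then have "natural_iso C C id_fctr (comp_fctr GG F) (\<lambda>X. F' X (G (FOb F X)) (e' (FOb F X)))"
    unfolding natural_iso_def comp_fctr_def id_fctr_def
    by (auto intro!: inj)
  ultimately show ?thesis using F Gf unfolding equivalence_def by blast
qed

lemma preadditive_full_subcat:
  assumes "preadditive_category D" "S \<subseteq> Obj D"
  shows "preadditive_category (full_subcat D S)"
proof -
  interpret preadditive_category D by fact
  show ?thesis using assms(2)
    by (intro preadditive_category.intro)
        (auto simp: full_subcat_def subset_iff hom_group cmp_hom_left cmp_hom_right)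
qed

text \<open>An inclusion of full subcategories is fully faithful, so only essential surjectivity is
  left. It is applied to the image of one functor inside the kernel of another.\<close>

lemma equivalence_subcat_inclusion:
  assumes D: "preadditive_category D" and S: "S \<subseteq> S'" "S' \<subseteq> Obj D"
    and es: "\<And>Y. Y \<in> S' \<Longrightarrow> \<exists>X\<in>S. \<exists>e. is_iso D X Y e"
  shows "equivalence (full_subcat D S) (full_subcat D S') id_fctr"
proof (rule equivalence_if_ff_ess_surj)
  show "preadditive_category (full_subcat D S)" "preadditive_category (full_subcat D S')"
    using preadditive_full_subcat D S by (metis order_trans)+
  show "is_functor (full_subcat D S) (full_subcat D S') id_fctr"
    using S by (auto simp: is_functor_def id_fctr_def full_subcat_def)
  show "fully_faithful (full_subcat D S) (full_subcat D S') id_fctr"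
    by (auto simp: fully_faithful_def id_fctr_def full_subcat_def bij_betw_def)
  show "\<exists>X\<in>Obj (full_subcat D S). \<exists>e. is_iso (full_subcat D S') (FOb id_fctr X) Y e"
    if "Y \<in> Obj (full_subcat D S')" for Y
    using es that by (auto simp: is_iso_def id_fctr_def full_subcat_def)
qed

lemma adjoint_pairI:
  assumes C: "preadditive_category C" and D: "preadditive_category D"
    and F: "is_functor C D F" and G: "is_functor D C G"
    and u_in: "\<And>X. X \<in> Obj C \<Longrightarrow> u X \<in> Hom C X (FOb G (FOb F X))"
    and e_in: "\<And>Y. Y \<in> Obj D \<Longrightarrow> e Y \<in> Hom D (FOb F (FOb G Y)) Y"
    and u_nat: "\<And>X X' f. \<lbrakk>X \<in> Obj C; X' \<in> Obj C; f \<in> Hom C X X'\<rbrakk> \<Longrightarrow>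
      Cmp C X X' (FOb G (FOb F X')) (u X') f
        = Cmp C X (FOb G (FOb F X)) (FOb G (FOb F X')) (FAr G (FOb F X) (FOb F X') (FAr F X X' f))
            (u X)"
    and e_nat: "\<And>Y Y' g. \<lbrakk>Y \<in> Obj D; Y' \<in> Obj D; g \<in> Hom D Y Y'\<rbrakk> \<Longrightarrow>
      Cmp D (FOb F (FOb G Y)) (FOb F (FOb G Y')) Y' (e Y')
          (FAr F (FOb G Y) (FOb G Y') (FAr G Y Y' g))
        = Cmp D (FOb F (FOb G Y)) Y Y' g (e Y)"
    and t1: "\<And>X. X \<in> Obj C \<Longrightarrow>
      Cmp D (FOb F X) (FOb F (FOb G (FOb F X))) (FOb F X) (e (FOb F X))
          (FAr F X (FOb G (FOb F X)) (u X))
        = Idm D (FOb F X)"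
    and t2: "\<And>Y. Y \<in> Obj D \<Longrightarrow>
      Cmp C (FOb G Y) (FOb G (FOb F (FOb G Y))) (FOb G Y) (FAr G (FOb F (FOb G Y)) Y (e Y))
          (u (FOb G Y))
        = Idm C (FOb G Y)"
  shows "adjoint_pair C D F G"
proof -
  interpret C: preadditive_category C by fact
  interpret D: preadditive_category D by fact
  note [simp] = is_functorD[OF F] is_functorD[OF G] u_in e_in
  define \<phi>
      where "\<phi> X Y h = Cmp C X (FOb G (FOb F X)) (FOb G Y) (FAr G (FOb F X) Y h) (u X)" for X Y h
  have "bij_betw (\<phi> X Y) (Hom D (FOb F X) Y) (Hom C X (FOb G Y))" if [simp]: "X \<in> Obj C"
      "Y \<in> Obj D" for X Y
  proof (rule bij_betwI[where g = "\<lambda>k. Cmp D (FOb F X) (FOb F (FOb G Y)) Y (e Y)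
      (FAr F X (FOb G Y) k)"])
    show "\<phi> X Y \<in> Hom D (FOb F X) Y \<rightarrow> Hom C X (FOb G Y)" by (auto simp: \<phi>_def)
    show "(\<lambda>k. (Cmp D (FOb F X) (FOb F (FOb G Y)) Y (e Y) (FAr F X (FOb G Y) k))) \<in> Hom C X
        (FOb G Y) \<rightarrow> Hom D (FOb F X) Y" by auto
    show "Cmp D (FOb F X) (FOb F (FOb G Y)) Y (e Y) (FAr F X (FOb G Y) (\<phi> X Y h)) = h"
      if [simp]: "h \<in> Hom D (FOb F X) Y" for h
      using D.cmp_assoc[of "FOb F X" "FOb F (FOb G (FOb F X))" "FOb F (FOb G Y)" Y
          "FAr F X (FOb G (FOb F X)) (u X)"
              "FAr F (FOb G (FOb F X)) (FOb G Y) (FAr G (FOb F X) Y h)" "e Y"]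
      by (simp add: \<phi>_def e_nat t1)
    show "\<phi> X Y (Cmp D (FOb F X) (FOb F (FOb G Y)) Y (e Y) (FAr F X (FOb G Y) k)) = k"
        if [simp]: "k \<in> Hom C X (FOb G Y)" for k
      using C.cmp_assoc[of X "FOb G (FOb F X)" "FOb G (FOb F (FOb G Y))" "FOb G Y" "u X"
          "FAr G (FOb F X) (FOb F (FOb G Y)) (FAr F X (FOb G Y) k)"
              "FAr G (FOb F (FOb G Y)) Y (e Y)"]
        C.cmp_assoc[of X "FOb G Y" "FOb G (FOb F (FOb G Y))" "FOb G Y" k "u (FOb G Y)" "FAr G
            (FOb F (FOb G Y)) Y (e Y)"]
      by (simp add: \<phi>_def t2 u_nat[symmetric] del: C.cmp_assoc)
  qed
  moreover have
      "\<phi> X' Y (Cmp D (FOb F X') (FOb F X) Y h (FAr F X' X f)) = Cmp C X' X (FOb G Y) (\<phi> X Y h) f"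
    if "X \<in> Obj C" "X' \<in> Obj C" "Y \<in> Obj D" "f \<in> Hom C X' X" "h \<in> Hom D (FOb F X) Y" for X X' Y f h
    using that by (simp add: \<phi>_def u_nat)
  moreover have
      "\<phi> X Y' (Cmp D (FOb F X) Y Y' g h) = Cmp C X (FOb G Y) (FOb G Y') (FAr G Y Y' g) (\<phi> X Y h)"
    if "X \<in> Obj C" "Y \<in> Obj D" "Y' \<in> Obj D" "g \<in> Hom D Y Y'" "h \<in> Hom D (FOb F X) Y" for X Y Y' g h
    using that by (simp add: \<phi>_def)
  ultimately show ?thesis
    unfolding adjoint_pair_def using F G by blast
qed


section \<open>Triangles\<close>

text \<open>Isomorphism of triangles, and what is invariant under it, depends only on an additive
  endofunctor. It is settled here before anything is known to be triangulated.\<close>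

locale suspended_category = additive_category C
  for C :: "('o, 'm, 'z) cat_scheme" +
  fixes S :: "('o, 'm, 'o, 'm) fctr"
  assumes S_additive: "additive_functor C C S"
begin

lemma S_functor: "is_functor C C S"
  using S_additive by (simp add: additive_functor_def)

lemmas S_simps [simp] = is_functorD[OF S_functor]

lemma triangles_iff:
  "(X, Y, Z, u, v, w) \<in> triangles C S \<longleftrightarrow> X \<in> Obj C \<and> Y \<in> Obj C \<and> Z \<in> Obj C \<and>
     u \<in> Hom C X Y \<and> v \<in> Hom C Y Z \<and> w \<in> Hom C Z (FOb S X)"
  by (simp add: triangles_def)

text \<open>Turning a square around along its vertical arrows takes a right inverse of
  \<open>a\<close> and a left inverse of \<open>b\<close>.\<close>

lemma square_inv:
  assumes [simp]: "X \<in> Obj C" "Y \<in> Obj C" "X' \<in> Obj C" "Y' \<in> Obj C"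
    "u \<in> Hom C X Y" "u' \<in> Hom C X' Y'" "a \<in> Hom C X X'" "a' \<in> Hom C X' X" "b \<in> Hom C Y Y'"
        "b' \<in> Hom C Y' Y"
    and eq: "Cmp C X Y Y' b u = Cmp C X X' Y' u' a" and a: "Cmp C X' X X' a a' = Idm C X'"
        and b: "Cmp C Y Y' Y b' b = Idm C Y"
  shows "Cmp C X' Y' Y b' u' = Cmp C X' X Y u a'"
proof -
  have "Cmp C X' Y' Y b' u' = Cmp C X' Y' Y b' (Cmp C X' X Y' (Cmp C X X' Y' u' a) a')"
      by (simp add: a)
  also have "\<dots> = Cmp C X' X Y u a'" unfolding eq[symmetric] by (simp add: cmp_eq_assoc[OF b])
  finally show ?thesis .
qed

lemma tri_isoI:
  assumes "is_iso C X X' a" "is_iso C Y Y' b" "is_iso C Z Z' c"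
    and "Cmp C X Y Y' b u = Cmp C X X' Y' u' a" "Cmp C Y Z Z' c v = Cmp C Y Y' Z' v' b"
    and "Cmp C Z (FOb S X) (FOb S X') (FAr S X X' a) w = Cmp C Z Z' (FOb S X') w' c"
  shows "tri_iso C S (X, Y, Z, u, v, w) (X', Y', Z', u', v', w')"
  using assms by auto

lemma tri_iso_refl:
  assumes "t \<in> triangles C S" shows "tri_iso C S t t"
proof -
  obtain X Y Z u v w where t: "t = (X, Y, Z, u, v, w)" by (cases t) auto
  show ?thesis using assms unfolding t triangles_iff
    by (auto intro!: exI[of _ "Idm C _"] is_iso_id)
qed

lemma tri_iso_sym:
  assumes t: "t \<in> triangles C S" and t': "t' \<in> triangles C S" and iso: "tri_iso C S t t'"
  shows "tri_iso C S t' t"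
proof -
  obtain X Y Z u v w where t_eq: "t = (X, Y, Z, u, v, w)" by (cases t) auto
  obtain X' Y' Z' u' v' w' where t'_eq: "t' = (X', Y', Z', u', v', w')" by (cases t') auto
  note [simp] = t[unfolded t_eq triangles_iff] t'[unfolded t'_eq triangles_iff]
  from iso obtain a b c where abc: "is_iso C X X' a" "is_iso C Y Y' b" "is_iso C Z Z' c"
    and sq: "Cmp C X Y Y' b u = Cmp C X X' Y' u' a" "Cmp C Y Z Z' c v = Cmp C Y Y' Z' v' b"
        "Cmp C Z (FOb S X) (FOb S X') (FAr S X X' a) w = Cmp C Z Z' (FOb S X') w' c"
    unfolding t_eq t'_eq by auto
  obtain a' where a [simp]: "a \<in> Hom C X X'" "a' \<in> Hom C X' X" and
    a': "Cmp C X X' X a' a = Idm C X" "Cmp C X' X X' a a' = Idm C X'" by (rule is_isoE[OF abc(1)])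
  obtain b' where b [simp]: "b \<in> Hom C Y Y'" "b' \<in> Hom C Y' Y" and
    b': "Cmp C Y Y' Y b' b = Idm C Y" "Cmp C Y' Y Y' b b' = Idm C Y'" by (rule is_isoE[OF abc(2)])
  obtain c' where c [simp]: "c \<in> Hom C Z Z'" "c' \<in> Hom C Z' Z" and
    c': "Cmp C Z Z' Z c' c = Idm C Z" "Cmp C Z' Z Z' c c' = Idm C Z'" by (rule is_isoE[OF abc(3)])
  have Sa: "Cmp C (FOb S X) (FOb S X') (FOb S X) (FAr S X' X a') (FAr S X X' a) = Idm C (FOb S X)"
    using a' by (simp flip: S_simps(3,4))
  show ?thesis unfolding t_eq t'_eq
  proof (rule tri_isoI)
    show "is_iso C X' X a'" "is_iso C Y' Y b'" "is_iso C Z' Z c'"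
      using a b c a' b' c' is_isoI by metis+
    show "Cmp C X' Y' Y b' u' = Cmp C X' X Y u a'"
      by (rule square_inv[OF _ _ _ _ _ _ _ _ _ _ sq(1) a'(2) b'(1)]) simp_all
    show "Cmp C Y' Z' Z c' v' = Cmp C Y' Y Z v b'"
      by (rule square_inv[OF _ _ _ _ _ _ _ _ _ _ sq(2) b'(2) c'(1)]) simp_all
    show "Cmp C Z' (FOb S X') (FOb S X) (FAr S X' X a') w' = Cmp C Z' Z (FOb S X) w c'"
      by (rule square_inv[OF _ _ _ _ _ _ _ _ _ _ sq(3) c'(2) Sa]) simp_all
  qed
qed

lemma tri_iso_trans:
  assumes t: "t \<in> triangles C S" and t': "t' \<in> triangles C S" and t2: "t2 \<in> triangles C S"
    and iso: "tri_iso C S t t'" "tri_iso C S t' t2"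
  shows "tri_iso C S t t2"
proof -
  obtain X Y Z u v w where t_eq: "t = (X, Y, Z, u, v, w)" by (cases t) auto
  obtain X' Y' Z' u' v' w' where t'_eq: "t' = (X', Y', Z', u', v', w')" by (cases t') auto
  obtain X2 Y2 Z2 u2 v2 w2 where t2_eq: "t2 = (X2, Y2, Z2, u2, v2, w2)" by (cases t2) auto
  note [simp] = t[unfolded t_eq triangles_iff] t'[unfolded t'_eq triangles_iff]
    t2[unfolded t2_eq triangles_iff]
  from iso(1) obtain a b c where abc: "is_iso C X X' a" "is_iso C Y Y' b" "is_iso C Z Z' c"
    and sq: "Cmp C X Y Y' b u = Cmp C X X' Y' u' a" "Cmp C Y Z Z' c v = Cmp C Y Y' Z' v' b"
        "Cmp C Z (FOb S X) (FOb S X') (FAr S X X' a) w = Cmp C Z Z' (FOb S X') w' c"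
    unfolding t_eq t'_eq by auto
  from iso(2) obtain a2 b2 c2 where abc2: "is_iso C X' X2 a2" "is_iso C Y' Y2 b2"
      "is_iso C Z' Z2 c2"
    and sq2: "Cmp C X' Y' Y2 b2 u' = Cmp C X' X2 Y2 u2 a2"
        "Cmp C Y' Z' Z2 c2 v' = Cmp C Y' Y2 Z2 v2 b2"
        "Cmp C Z' (FOb S X') (FOb S X2) (FAr S X' X2 a2) w' = Cmp C Z' Z2 (FOb S X2) w2 c2"
    unfolding t2_eq t'_eq by auto
  have [simp]: "a \<in> Hom C X X'" "b \<in> Hom C Y Y'" "c \<in> Hom C Z Z'"
    "a2 \<in> Hom C X' X2" "b2 \<in> Hom C Y' Y2" "c2 \<in> Hom C Z' Z2"
    using abc abc2 by (auto simp: is_iso_def)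
  have "is_iso C X X2 (Cmp C X X' X2 a2 a)" "is_iso C Y Y2 (Cmp C Y Y' Y2 b2 b)"
      "is_iso C Z Z2 (Cmp C Z Z' Z2 c2 c)"
    using is_iso_cmp abc abc2 by auto
  moreover have "Cmp C X Y Y2 (Cmp C Y Y' Y2 b2 b) u = Cmp C X X2 Y2 u2 (Cmp C X X' X2 a2 a)"
      "Cmp C Y Z Z2 (Cmp C Z Z' Z2 c2 c) v = Cmp C Y Y2 Z2 v2 (Cmp C Y Y' Y2 b2 b)"
    "Cmp C Z (FOb S X) (FOb S X2) (FAr S X X2 (Cmp C X X' X2 a2 a)) w
        = Cmp C Z Z2 (FOb S X2) w2 (Cmp C Z Z' Z2 c2 c)"
    using sq sq2
        by (simp_all add: cmp_eq_assoc[OF sq2(1)] cmp_eq_assoc[OF sq2(2)] cmp_eq_assoc[OF sq2(3)])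
  ultimately show ?thesis unfolding t_eq t2_eq by (rule tri_isoI)
qed

text \<open>\<open>TR3\<close> for one pair of triangles, isolated as a predicate so that it can be
  moved along isomorphisms in each argument separately.\<close>

fun fills :: "('o, 'm) tri \<Rightarrow> ('o, 'm) tri \<Rightarrow> bool" where
  "fills (X, Y, Z, u, v, w) (X', Y', Z', u', v', w') \<longleftrightarrow>
    (\<forall>a\<in>Hom C X X'. \<forall>b\<in>Hom C Y Y'. Cmp C X Y Y' b u = Cmp C X X' Y' u' a \<longrightarrow>
      (\<exists>c\<in>Hom C Z Z'. Cmp C Y Z Z' c v = Cmp C Y Y' Z' v' b \<and> Cmp C Z (FOb S X) (FOb S X')
          (FAr S X X' a) w = (Cmp C Z Z' (FOb S X') w' c)))"

text \<open>Exactness of Hom(-, W) at the third vertex. This piece of the long exact sequence is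
  what makes cones unique up to isomorphism.\<close>

fun coexact :: "('o, 'm) tri \<Rightarrow> bool" where
  "coexact (X, Y, Z, u, v, w) \<longleftrightarrow>
    (\<forall>W\<in>Obj C. \<forall>k\<in>Hom C Z W. Cmp C Y Z W k v = Zero C Y W \<longrightarrow>
        (\<exists>m\<in>Hom C (FOb S X) W. k = (Cmp C Z (FOb S X) W m w)))"

text \<open>The square into the new triangle is pulled back by inverses of the first two
  isomorphisms and filled there; the filler is then composed with the third isomorphism.\<close>

lemma fills_iso_right:
  assumes t: "t \<in> triangles C S" and t': "t' \<in> triangles C S" and t2: "t2 \<in> triangles C S"
    and iso: "tri_iso C S t' t2" and fl: "fills t t'"
  shows "fills t t2"
proof -
  obtain X Y Z u v w where t_eq: "t = (X, Y, Z, u, v, w)" by (cases t) auto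
  obtain X' Y' Z' u' v' w' where t'_eq: "t' = (X', Y', Z', u', v', w')" by (cases t') auto
  obtain X2 Y2 Z2 u2 v2 w2 where t2_eq: "t2 = (X2, Y2, Z2, u2, v2, w2)" by (cases t2) auto
  note [simp] = t[unfolded t_eq triangles_iff] t'[unfolded t'_eq triangles_iff]
    t2[unfolded t2_eq triangles_iff]
  from iso obtain a2 b2 c2 where abc2: "is_iso C X' X2 a2" "is_iso C Y' Y2 b2" "is_iso C Z' Z2 c2"
    and sq2: "Cmp C X' Y' Y2 b2 u' = Cmp C X' X2 Y2 u2 a2"
        "Cmp C Y' Z' Z2 c2 v' = Cmp C Y' Y2 Z2 v2 b2"
        "Cmp C Z' (FOb S X') (FOb S X2) (FAr S X' X2 a2) w' = Cmp C Z' Z2 (FOb S X2) w2 c2"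
    unfolding t2_eq t'_eq by auto
  obtain a' where a [simp]: "a2 \<in> Hom C X' X2" "a' \<in> Hom C X2 X'" and
    a': "Cmp C X' X2 X' a' a2 = Idm C X'" "Cmp C X2 X' X2 a2 a' = Idm C X2"
        by (rule is_isoE[OF abc2(1)])
  obtain b' where b [simp]: "b2 \<in> Hom C Y' Y2" "b' \<in> Hom C Y2 Y'" and
    b': "Cmp C Y' Y2 Y' b' b2 = Idm C Y'" "Cmp C Y2 Y' Y2 b2 b' = Idm C Y2"
        by (rule is_isoE[OF abc2(2)])
  have c [simp]: "c2 \<in> Hom C Z' Z2" using abc2(3) by (auto simp: is_iso_def)
  have sq': "Cmp C X2 Y2 Y' b' u2 = Cmp C X2 X' Y' u' a'"
    by (rule square_inv[OF _ _ _ _ _ _ _ _ _ _ sq2(1) a'(2) b'(1)]) simp_all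
  have "\<exists>c\<in>Hom C Z Z2. Cmp C Y Z Z2 c v = Cmp C Y Y2 Z2 v2 b3
      \<and> Cmp C Z (FOb S X) (FOb S X2) (FAr S X X2 a3) w = Cmp C Z Z2 (FOb S X2) w2 c"
    if [simp]: "a3 \<in> Hom C X X2" "b3 \<in> Hom C Y Y2"
        and e: "Cmp C X Y Y2 b3 u = Cmp C X X2 Y2 u2 a3" for a3 b3
  proof -
    have "Cmp C X Y Y' (Cmp C Y Y2 Y' b' b3) u = Cmp C X X' Y' u' (Cmp C X X2 X' a' a3)"
      using cmp_eq_assoc[OF sq'] by (simp add: e)
    then obtain c3 where c3 [simp]: "c3 \<in> Hom C Z Z'" and
      c3': "Cmp C Y Z Z' c3 v = Cmp C Y Y' Z' v' (Cmp C Y Y2 Y' b' b3)"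
          "Cmp C Z (FOb S X) (FOb S X') (FAr S X X' (Cmp C X X2 X' a' a3)) w
          = Cmp C Z Z' (FOb S X') w' c3"
      using fl[unfolded t_eq t'_eq fills.simps, rule_format, of "Cmp C X X2 X' a' a3"
          "Cmp C Y Y2 Y' b' b3"] by auto
    have 1: "Cmp C Y Z Z2 (Cmp C Z Z' Z2 c2 c3) v = Cmp C Y Y2 Z2 v2 b3"
      using cmp_eq_assoc[OF sq2(2)] cmp_eq_assoc[OF b'(2)] by (simp add: c3')
    \<comment> \<open>The identity \<open>a2\<close> after \<open>a'\<close> is inserted under
      \<open>S\<close>, so that the third square of the filler and that of the isomorphism can be
      pasted.\<close>
    have "Cmp C Z (FOb S X) (FOb S X2) (FAr S X X2 a3) w
        = Cmp C Z (FOb S X) (FOb S X2)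
        (Cmp C (FOb S X) (FOb S X') (FOb S X2) (FAr S X' X2 a2)
        (Cmp C (FOb S X) (FOb S X2) (FOb S X') (FAr S X2 X' a') (FAr S X X2 a3))) w"
      using cmp_eq_assoc[OF a'(2)] by (simp flip: S_simps(4))
    also have "\<dots> = Cmp C Z Z2 (FOb S X2) w2 (Cmp C Z Z' Z2 c2 c3)"
      using c3'(2) cmp_eq_assoc[OF sq2(3)] by simp
    finally show ?thesis using 1 by (intro bexI[of _ "Cmp C Z Z' Z2 c2 c3"]) auto
  qed
  then show ?thesis unfolding t_eq t2_eq fills.simps by blast
qed

lemma fills_iso_left:
  assumes t: "t \<in> triangles C S" and t': "t' \<in> triangles C S" and t2: "t2 \<in> triangles C S"
    and iso: "tri_iso C S t' t" and fl: "fills t t2"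
  shows "fills t' t2"
proof -
  obtain X Y Z u v w where t_eq: "t = (X, Y, Z, u, v, w)" by (cases t) auto
  obtain X' Y' Z' u' v' w' where t'_eq: "t' = (X', Y', Z', u', v', w')" by (cases t') auto
  obtain X2 Y2 Z2 u2 v2 w2 where t2_eq: "t2 = (X2, Y2, Z2, u2, v2, w2)" by (cases t2) auto
  note [simp] = t[unfolded t_eq triangles_iff] t'[unfolded t'_eq triangles_iff]
    t2[unfolded t2_eq triangles_iff]
  from iso obtain a b c where abc: "is_iso C X' X a" "is_iso C Y' Y b" "is_iso C Z' Z c"
    and sq: "Cmp C X' Y' Y b u' = Cmp C X' X Y u a" "Cmp C Y' Z' Z c v' = Cmp C Y' Y Z v b"
        "Cmp C Z' (FOb S X') (FOb S X) (FAr S X' X a) w' = Cmp C Z' Z (FOb S X) w c"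
    unfolding t_eq t'_eq by auto
  obtain a' where a [simp]: "a \<in> Hom C X' X" "a' \<in> Hom C X X'" and
    a': "Cmp C X' X X' a' a = Idm C X'" "Cmp C X X' X a a' = Idm C X" by (rule is_isoE[OF abc(1)])
  obtain b' where b [simp]: "b \<in> Hom C Y' Y" "b' \<in> Hom C Y Y'" and
    b': "Cmp C Y' Y Y' b' b = Idm C Y'" "Cmp C Y Y' Y b b' = Idm C Y" by (rule is_isoE[OF abc(2)])
  have c [simp]: "c \<in> Hom C Z' Z" using abc(3) by (auto simp: is_iso_def)
  have sq': "Cmp C X Y Y' b' u = Cmp C X X' Y' u' a'"
    by (rule square_inv[OF _ _ _ _ _ _ _ _ _ _ sq(1) a'(2) b'(1)]) simp_all
  have "\<exists>c\<in>Hom C Z' Z2. Cmp C Y' Z' Z2 c v' = Cmp C Y' Y2 Z2 v2 b3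
      \<and> Cmp C Z' (FOb S X') (FOb S X2) (FAr S X' X2 a3) w' = Cmp C Z' Z2 (FOb S X2) w2 c"
    if [simp]: "a3 \<in> Hom C X' X2" "b3 \<in> Hom C Y' Y2"
        and e: "Cmp C X' Y' Y2 b3 u' = Cmp C X' X2 Y2 u2 a3" for a3 b3
  proof -
    have "Cmp C X Y Y2 (Cmp C Y Y' Y2 b3 b') u = Cmp C X X2 Y2 u2 (Cmp C X X' X2 a3 a')"
      using cmp_eq_assoc[OF e] by (simp add: sq')
    then obtain c3 where c3 [simp]: "c3 \<in> Hom C Z Z2" and
      c3': "Cmp C Y Z Z2 c3 v = Cmp C Y Y2 Z2 v2 (Cmp C Y Y' Y2 b3 b')"
          "Cmp C Z (FOb S X) (FOb S X2) (FAr S X X2 (Cmp C X X' X2 a3 a')) w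
          = Cmp C Z Z2 (FOb S X2) w2 c3"
      using fl[unfolded t_eq t2_eq fills.simps, rule_format, of "Cmp C X X' X2 a3 a'"
          "Cmp C Y Y' Y2 b3 b'"] by auto
    have 1: "Cmp C Y' Z' Z2 (Cmp C Z' Z Z2 c3 c) v' = Cmp C Y' Y2 Z2 v2 b3"
      using cmp_eq_assoc[OF c3'(1)] b'(1) by (simp add: sq(2))
    have Sa: "Cmp C (FOb S X') (FOb S X) (FOb S X') (FAr S X X' a') (FAr S X' X a)
        = Idm C (FOb S X')"
      using a'(1) by (simp flip: S_simps(3,4))
    then have
        "Cmp C Z' (FOb S X') (FOb S X2) (FAr S X' X2 a3) w'
        = Cmp C Z' (FOb S X') (FOb S X2) (FAr S X' X2 a3)
        (Cmp C Z' (FOb S X') (FOb S X')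
        (Cmp C (FOb S X') (FOb S X) (FOb S X') (FAr S X X' a') (FAr S X' X a)) w')"
      by simp
    also have
        "\<dots> = Cmp C Z' (FOb S X) (FOb S X2) (FAr S X X2 (Cmp C X X' X2 a3 a'))
        (Cmp C Z' Z (FOb S X) w c)"
      by (simp add: sq(3))
    also have "\<dots> = Cmp C Z' Z2 (FOb S X2) w2 (Cmp C Z' Z Z2 c3 c)"
      using cmp_eq_assoc[OF c3'(2)] by simp
    finally show ?thesis using 1 by (intro bexI[of _ "Cmp C Z' Z Z2 c3 c"]) auto
  qed
  then show ?thesis unfolding t'_eq t2_eq fills.simps by blast
qed

lemma coexact_iso:
  assumes t: "t \<in> triangles C S" and t': "t' \<in> triangles C S"
    and iso: "tri_iso C S t t'" and ex: "coexact t"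
  shows "coexact t'"
proof -
  obtain X Y Z u v w where t_eq: "t = (X, Y, Z, u, v, w)" by (cases t) auto
  obtain X' Y' Z' u' v' w' where t'_eq: "t' = (X', Y', Z', u', v', w')" by (cases t') auto
  note [simp] = t[unfolded t_eq triangles_iff] t'[unfolded t'_eq triangles_iff]
  from iso obtain a b c where abc: "is_iso C X X' a" "is_iso C Y Y' b" "is_iso C Z Z' c"
    and sq: "Cmp C X Y Y' b u = Cmp C X X' Y' u' a" "Cmp C Y Z Z' c v = Cmp C Y Y' Z' v' b"
        "Cmp C Z (FOb S X) (FOb S X') (FAr S X X' a) w = Cmp C Z Z' (FOb S X') w' c"
    unfolding t_eq t'_eq by auto
  obtain a' where a [simp]: "a \<in> Hom C X X'" "a' \<in> Hom C X' X" and
    a': "Cmp C X X' X a' a = Idm C X" "Cmp C X' X X' a a' = Idm C X'" by (rule is_isoE[OF abc(1)])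
  have b [simp]: "b \<in> Hom C Y Y'" using abc(2) by (auto simp: is_iso_def)
  obtain c' where c [simp]: "c \<in> Hom C Z Z'" "c' \<in> Hom C Z' Z" and
    c': "Cmp C Z Z' Z c' c = Idm C Z" "Cmp C Z' Z Z' c c' = Idm C Z'" by (rule is_isoE[OF abc(3)])
  have "\<exists>m\<in>Hom C (FOb S X') W. k = Cmp C Z' (FOb S X') W m w'"
    if [simp]: "W \<in> Obj C" "k \<in> Hom C Z' W" and k: "Cmp C Y' Z' W k v' = Zero C Y' W" for W k
  proof -
    have "Cmp C Y Z W (Cmp C Z Z' W k c) v = Zero C Y W" using cmp_eq_assoc[OF k] by (simp add: sq)
    then obtain m where m [simp]: "m \<in> Hom C (FOb S X) W"
        and mk: "Cmp C Z Z' W k c = Cmp C Z (FOb S X) W m w"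
      using ex[unfolded t_eq coexact.simps, rule_format, of W "Cmp C Z Z' W k c"] by auto
    have Sa: "Cmp C (FOb S X) (FOb S X') (FOb S X) (FAr S X' X a') (FAr S X X' a) = Idm C (FOb S X)"
      using a' by (simp flip: S_simps(3,4))
    have "k = Cmp C Z' Z W (Cmp C Z Z' W k c) c'" by (simp add: c'(2))
    also have "\<dots> = Cmp C Z' (FOb S X) W m (Cmp C Z' Z (FOb S X) w c')" unfolding mk by simp
    also have "Cmp C Z' Z (FOb S X) w c' = Cmp C Z' (FOb S X') (FOb S X) (FAr S X' X a') w'"
      by (rule square_inv[OF _ _ _ _ _ _ _ _ _ _ sq(3) c'(2) Sa, symmetric]) simp_all
    finally show ?thesis by (intro bexI[of _ "Cmp C (FOb S X') (FOb S X) W m (FAr S X' X a')"]) auto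
  qed
  then show ?thesis unfolding t'_eq by auto
qed

end

text \<open>Rotation is assumed in one direction; full faithfulness of \<open>S\<close> will give
  the other. The octahedron is left out because it is proved for special triangles and then only
  transported.\<close>

locale pretriangulated_category = suspended_category C S
  for C :: "('o, 'm, 'z) cat_scheme" and S :: "('o, 'm, 'o, 'm) fctr" +
  fixes \<Delta> :: "('o, 'm) tri set"
  assumes tri_sub: "\<Delta> \<subseteq> triangles C S"
    and tri_iso_closed: "\<lbrakk>t \<in> \<Delta>; t' \<in> triangles C S; tri_iso C S t t'\<rbrakk> \<Longrightarrow> t' \<in> \<Delta>"
    and tri_cone: "\<lbrakk>X \<in> Obj C; Y \<in> Obj C; u \<in> Hom C X Y\<rbrakk> \<Longrightarrow> \<exists>Z v w. (X, Y, Z, u, v, w) \<in> \<Delta>"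
    and tri_fills: "\<lbrakk>t \<in> \<Delta>; t' \<in> \<Delta>\<rbrakk> \<Longrightarrow> fills t t'"
    and tri_coexact: "t \<in> \<Delta> \<Longrightarrow> coexact t"
    and tri_rotate: "(X, Y, Z, u, v, w) \<in> \<Delta> \<Longrightarrow>
      (Y, Z, FOb S X, v, w, Neg C (FOb S X) (FOb S Y) (FAr S X Y u)) \<in> \<Delta>"
    and S_ff: "fully_faithful C C S"
begin

lemma triD:
  assumes "(X, Y, Z, u, v, w) \<in> \<Delta>"
  shows "X \<in> Obj C" "Y \<in> Obj C" "Z \<in> Obj C" "u \<in> Hom C X Y" "v \<in> Hom C Y Z" "w \<in> Hom C Z (FOb S X)"
  using assms tri_sub triangles_iff by blast+

text \<open>Since \<open>c - 1\<close> kills \<open>v\<close>, it factors through \<open>w\<close> and hence has square zero.\<close>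

lemma filler_endo_iso:
  assumes t: "(X, Y, Z, u, v, w) \<in> \<Delta>" and c [simp]: "c \<in> Hom C Z Z"
    and cv: "Cmp C Y Z Z c v = v" and wc: "Cmp C Z Z (FOb S X) w c = w"
  shows "is_iso C Z Z c"
proof -
  note [simp] = triD[OF t]
  define n where "n = Add C Z Z c (Neg C Z Z (Idm C Z))"
  have n [simp]: "n \<in> Hom C Z Z" by (simp add: n_def)
  have c_n: "c = Add C Z Z n (Idm C Z)" by (simp add: n_def add_assoc)
  have "Cmp C Y Z Z n v = Zero C Y Z" by (simp add: n_def cv)
  then obtain k where k [simp]: "k \<in> Hom C (FOb S X) Z" and nk: "n = Cmp C Z (FOb S X) Z k w"
    using tri_coexact[OF t, unfolded coexact.simps, rule_format, of Z n] by auto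
  have "Cmp C Z Z (FOb S X) w n = Zero C Z (FOb S X)" by (simp add: n_def wc)
  moreover have "Cmp C Z Z Z n n = Cmp C Z (FOb S X) Z k (Cmp C Z Z (FOb S X) w n)"
      using arg_cong[OF nk, of "\<lambda>x. Cmp C Z (FOb S X) Z k (Cmp C Z Z (FOb S X) w n)"]
      by (subst nk) simp
  ultimately have nn: "Cmp C Z Z Z n n = Zero C Z Z" by simp
  show ?thesis
    by (rule is_isoI[where g = "Add C Z Z (Neg C Z Z n) (Idm C Z)"])
        (simp_all add: c_n nn add_assoc)
qed

text \<open>The fillers \<open>c\<close> and \<open>d\<close>, obtained from the isomorphisms and
  from their inverses, are not mutually inverse in general. But d c and c d fix the arrows around
  the third vertex, hence are isomorphisms, so \<open>c\<close> is invertible from both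
  sides.\<close>

lemma filler_iso:
  assumes t: "(X, Y, Z, u, v, w) \<in> \<Delta>" and t': "(X', Y', Z', u', v', w') \<in> \<Delta>"
    and a: "is_iso C X X' a" and b: "is_iso C Y Y' b"
        and sq: "Cmp C X Y Y' b u = Cmp C X X' Y' u' a"
  obtains c where "is_iso C Z Z' c" "Cmp C Y Z Z' c v = Cmp C Y Y' Z' v' b"
      "Cmp C Z (FOb S X) (FOb S X') (FAr S X X' a) w = Cmp C Z Z' (FOb S X') w' c"
proof -
  note [simp] = triD[OF t] triD[OF t']
  obtain a' where a [simp]: "a \<in> Hom C X X'" "a' \<in> Hom C X' X" and
    a': "Cmp C X X' X a' a = Idm C X" "Cmp C X' X X' a a' = Idm C X'" by (rule is_isoE[OF a])
  obtain b' where b [simp]: "b \<in> Hom C Y Y'" "b' \<in> Hom C Y' Y" and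
    b': "Cmp C Y Y' Y b' b = Idm C Y" "Cmp C Y' Y Y' b b' = Idm C Y'" by (rule is_isoE[OF b])
  have Sa: "Cmp C (FOb S X) (FOb S X') (FOb S X) (FAr S X' X a') (FAr S X X' a) = Idm C (FOb S X)"
      "Cmp C (FOb S X') (FOb S X) (FOb S X') (FAr S X X' a) (FAr S X' X a') = Idm C (FOb S X')"
    using a' by (simp_all flip: S_simps(3,4))
  obtain c where c [simp]: "c \<in> Hom C Z Z'" and c1: "Cmp C Y Z Z' c v = Cmp C Y Y' Z' v' b"
      "Cmp C Z (FOb S X) (FOb S X') (FAr S X X' a) w = Cmp C Z Z' (FOb S X') w' c"
    using tri_fills[OF t t', unfolded fills.simps, rule_format, of a b] sq by auto
  have "Cmp C X' Y' Y b' u' = Cmp C X' X Y u a'"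
    by (rule square_inv[OF _ _ _ _ _ _ _ _ _ _ sq(1) a'(2) b'(1)]) simp_all
  then obtain d where d [simp]: "d \<in> Hom C Z' Z" and d1: "Cmp C Y' Z' Z d v' = Cmp C Y' Y Z v b'"
      "Cmp C Z' (FOb S X') (FOb S X) (FAr S X' X a') w' = Cmp C Z' Z (FOb S X) w d"
    using tri_fills[OF t' t, unfolded fills.simps, rule_format, of a' b'] by auto
  have 1: "is_iso C Z Z (Cmp C Z Z' Z d c)"
  proof (rule filler_endo_iso[OF t])
    show "Cmp C Y Z Z (Cmp C Z Z' Z d c) v = v" using cmp_eq_assoc[OF d1(1)] by (simp add: c1 b')
    have "Cmp C Z Z (FOb S X) w (Cmp C Z Z' Z d c)
        = Cmp C Z (FOb S X') (FOb S X) (FAr S X' X a')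
        (Cmp C Z (FOb S X) (FOb S X') (FAr S X X' a) w)"
      using cmp_eq_assoc[OF d1(2)[symmetric]] by (simp add: c1)
    then show "Cmp C Z Z (FOb S X) w (Cmp C Z Z' Z d c) = w" using cmp_eq_assoc[OF Sa(1)] by simp
  qed simp
  have 2: "is_iso C Z' Z' (Cmp C Z' Z Z' c d)"
  proof (rule filler_endo_iso[OF t'])
    show "Cmp C Y' Z' Z' (Cmp C Z' Z Z' c d) v' = v'" using cmp_eq_assoc[OF c1(1)]
        by (simp add: d1 b')
    have "Cmp C Z' Z' (FOb S X') w' (Cmp C Z' Z Z' c d)
        = Cmp C Z' (FOb S X) (FOb S X') (FAr S X X' a)
        (Cmp C Z' (FOb S X') (FOb S X) (FAr S X' X a') w')"
      using cmp_eq_assoc[OF c1(2)[symmetric]] by (simp add: d1)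
    then show "Cmp C Z' Z' (FOb S X') w' (Cmp C Z' Z Z' c d) = w'" using cmp_eq_assoc[OF Sa(2)]
        by simp
  qed simp
  obtain e where e: "e \<in> Hom C Z Z" "Cmp C Z Z Z e (Cmp C Z Z' Z d c) = Idm C Z" using 1
      by (auto simp: is_iso_def)
  obtain f where f: "f \<in> Hom C Z' Z'" "Cmp C Z' Z' Z' (Cmp C Z' Z Z' c d) f = Idm C Z'" using 2
      by (auto simp: is_iso_def)
  \<comment> \<open>A left inverse e d and a right inverse d f of \<open>c\<close> must
    agree.\<close>
  have "Cmp C Z' Z Z e d = Cmp C Z' Z' Z (Cmp C Z' Z Z e d) (Cmp C Z' Z' Z' (Cmp C Z' Z Z' c d) f)"
      using f e by simp
  also have "\<dots> = Cmp C Z' Z Z (Cmp C Z Z Z e (Cmp C Z Z' Z d c)) (Cmp C Z' Z' Z d f)"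
      using f(1) e(1) by simp
  also have "\<dots> = Cmp C Z' Z' Z d f" unfolding e(2) using f(1) by simp
  finally have "Cmp C Z' Z Z e d = Cmp C Z' Z' Z d f" .
  moreover have "Cmp C Z Z' Z (Cmp C Z' Z Z e d) c = Idm C Z"
      "Cmp C Z' Z Z' c (Cmp C Z' Z' Z d f) = Idm C Z'" using e f by simp_all
  ultimately have "Cmp C Z Z' Z (Cmp C Z' Z Z e d) c = Idm C Z"
      "Cmp C Z' Z Z' c (Cmp C Z' Z Z e d) = Idm C Z'" by simp_all
  then have "is_iso C Z Z' c" using e by (intro is_isoI[where g = "Cmp C Z' Z Z e d"]) simp_all
  then show thesis using that c1 by blast
qed

text \<open>A triangle on \<open>u\<close> with some third object Z' is compared with the given data
  after enough rotations that both start with minus the suspension of \<open>u\<close>. The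
  isomorphism found between the suspensions of Z' and \<open>Z\<close> comes from an isomorphism Z'
  -> \<open>Z\<close>, since \<open>S\<close> is fully faithful.\<close>

lemma tri_rotate_back:
  assumes T: "(X, Y, Z, u, v, w) \<in> triangles C S"
    and t: "(Y, Z, FOb S X, v, w, (Neg C (FOb S X) (FOb S Y) (FAr S X Y u))) \<in> \<Delta>"
  shows "(X, Y, Z, u, v, w) \<in> \<Delta>"
proof -
  note [simp] = T[unfolded triangles_iff]
  obtain Z' v' w' where t': "(X, Y, Z', u, v', w') \<in> \<Delta>" using tri_cone[of X Y u] by auto
  note [simp] = triD[OF t']
  have r: "(FOb S X, FOb S Y, FOb S Z, Neg C (FOb S X) (FOb S Y) (FAr S X Y u),
      Neg C (FOb S Y) (FOb S Z) (FAr S Y Z v),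
      (Neg C (FOb S Z) (FOb S (FOb S X)) (FAr S Z (FOb S X) w))) \<in> \<Delta>"
    using tri_rotate[OF tri_rotate[OF t]] .
  have r': "(FOb S X, FOb S Y, FOb S Z', Neg C (FOb S X) (FOb S Y) (FAr S X Y u),
      Neg C (FOb S Y) (FOb S Z') (FAr S Y Z' v'),
      (Neg C (FOb S Z') (FOb S (FOb S X)) (FAr S Z' (FOb S X) w'))) \<in> \<Delta>"
    using tri_rotate[OF tri_rotate[OF tri_rotate[OF t']]] .
  obtain h where h: "is_iso C (FOb S Z') (FOb S Z) h" and
    h1: "Cmp C (FOb S Y) (FOb S Z') (FOb S Z) h (Neg C (FOb S Y) (FOb S Z') (FAr S Y Z' v'))
        = Cmp C (FOb S Y) (FOb S Y) (FOb S Z) (Neg C (FOb S Y) (FOb S Z) (FAr S Y Z v))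
        (Idm C (FOb S Y))"
     and h2: "Cmp C (FOb S Z') (FOb S (FOb S X)) (FOb S (FOb S X)) (FAr S (FOb S X) (FOb S X)
         (Idm C (FOb S X))) (Neg C (FOb S Z') (FOb S (FOb S X)) (FAr S Z' (FOb S X) w'))
       = Cmp C (FOb S Z') (FOb S Z) (FOb S (FOb S X))
           (Neg C (FOb S Z) (FOb S (FOb S X)) (FAr S Z (FOb S X) w)) h"
    using filler_iso[OF r' r is_iso_id is_iso_id] by auto
  obtain h' where h_in [simp]: "h \<in> Hom C (FOb S Z') (FOb S Z)" "h' \<in> Hom C (FOb S Z) (FOb S Z')"
    and h': "Cmp C (FOb S Z') (FOb S Z) (FOb S Z') h' h = Idm C (FOb S Z')"
      "Cmp C (FOb S Z) (FOb S Z') (FOb S Z) h h' = Idm C (FOb S Z)"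
    by (rule is_isoE[OF h])
  have bij: "bij_betw (FAr S A B) (Hom C A B) (Hom C (FOb S A) (FOb S B))"
      if "A \<in> Obj C" "B \<in> Obj C" for A B
    using S_ff that by (auto simp: fully_faithful_def)
  have inj: "f = g" if "FAr S A B f = FAr S A B g" "A \<in> Obj C" "B \<in> Obj C" "f \<in> Hom C A B"
      "g \<in> Hom C A B" for A B f g
    using bij[OF that(2,3)] that(1,4,5) by (meson bij_betw_imp_inj_on inj_onD)
  have surj: "\<exists>f\<in>Hom C A B. FAr S A B f = g" if "A \<in> Obj C" "B \<in> Obj C"
      "g \<in> Hom C (FOb S A) (FOb S B)" for A B g
    using bij[OF that(1,2)] that(3) by (metis bij_betw_imp_surj_on imageE)
  obtain c where c [simp]: "c \<in> Hom C Z' Z" and ch: "h = (FAr S Z' Z c)" using surj[of Z' Z h]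
      by auto
  obtain c' where c' [simp]: "c' \<in> Hom C Z Z'" and ch': "h' = (FAr S Z Z' c')"
      using surj[of Z Z' h'] by auto
  have "is_iso C Z' Z c"

  proof (rule is_isoI[where g = c'])
    show "Cmp C Z' Z Z' c' c = Idm C Z'" using h'(1)
        by - (rule inj[where A = Z' and B = Z'], simp_all add: ch ch')
    show "Cmp C Z Z' Z c c' = Idm C Z" using h'(2)
        by - (rule inj[where A = Z and B = Z], simp_all add: ch ch')
  qed simp_all
  moreover have "Cmp C Y Z' Z c v' = v"
  proof (rule inj)
    have "Neg C (FOb S Y) (FOb S Z) (Cmp C (FOb S Y) (FOb S Z') (FOb S Z) (FAr S Z' Z c)
        (FAr S Y Z' v')) = Neg C (FOb S Y) (FOb S Z) (FAr S Y Z v)" using h1 ch by simp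
    then have
        "Neg C (FOb S Y) (FOb S Z) (Neg C (FOb S Y) (FOb S Z) (Cmp C (FOb S Y) (FOb S Z') (FOb S Z)
        (FAr S Z' Z c) (FAr S Y Z' v'))) = Neg C (FOb S Y) (FOb S Z)
        (Neg C (FOb S Y) (FOb S Z) (FAr S Y Z v))" by simp
    then show "FAr S Y Z (Cmp C Y Z' Z c v') = (FAr S Y Z v)" by simp
  qed simp_all
  moreover have "w' = Cmp C Z' Z (FOb S X) w c"
  proof (rule inj)
    have "Neg C (FOb S Z') (FOb S (FOb S X)) (FAr S Z' (FOb S X) w')
        = Neg C (FOb S Z') (FOb S (FOb S X))
        (Cmp C (FOb S Z') (FOb S Z) (FOb S (FOb S X)) (FAr S Z (FOb S X) w)
        (FAr S Z' Z c))" using h2 ch by simp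
    then have
        "Neg C (FOb S Z') (FOb S (FOb S X)) (Neg C (FOb S Z') (FOb S (FOb S X))
        (FAr S Z' (FOb S X) w')) = Neg C (FOb S Z') (FOb S (FOb S X)) (Neg C (FOb S Z')
        (FOb S (FOb S X))
        (Cmp C (FOb S Z') (FOb S Z) (FOb S (FOb S X)) (FAr S Z (FOb S X) w)
        (FAr S Z' Z c)))" by simp
    then show "FAr S Z' (FOb S X) w' = FAr S Z' (FOb S X) (Cmp C Z' Z (FOb S X) w c)" by simp
  qed simp_all
  ultimately have "tri_iso C S (X, Y, Z', u, v', w') (X, Y, Z, u, v, w)"
    by (intro tri_isoI[of X X "Idm C X" Y Y "Idm C Y" _ _ c] is_iso_id) simp_all
  then show ?thesis using tri_iso_closed[OF t' T] by simp
qed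

text \<open>An octahedron on morphisms isomorphic to \<open>u\<close> and \<open>v\<close> is transported along the isomorphisms
  between the given triangles and its faces.\<close>

lemma octahedron_transport:
  assumes T1: "(X, Y, Z', u, i, i') \<in> \<Delta>" and T2: "(Y, Z, X', v, j, j') \<in> \<Delta>"
    and T3: "(X, Z, Y', Cmp C X Y Z v u, k, k') \<in> \<Delta>"
    and p: "is_iso C Y0 Y p" and q: "is_iso C Z0 Z q"
    and pu: "Cmp C X Y0 Y p u0 = u" and qv: "Cmp C Y0 Z0 Z q v0 = Cmp C Y0 Y Z v p"
    and S1: "(X, Y0, A, u0, i0, i0') \<in> \<Delta>" and S2: "(Y0, Z0, B, v0, j0, j0') \<in> \<Delta>"
    and S3: "(X, Z0, D, Cmp C X Y0 Z0 v0 u0, k0, k0') \<in> \<Delta>"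
    and S4: "(A, D, B, f0, g0, (Cmp C B (FOb S Y0) (FOb S A) (FAr S Y0 A i0) j0')) \<in> \<Delta>"
    and fi: "Cmp C Y0 A D f0 i0 = Cmp C Y0 Z0 D k0 v0" and gk: "Cmp C Z0 D B g0 k0 = j0"
        and kf: "Cmp C A D (FOb S X) k0' f0 = i0'"
    and jg: "Cmp C D B (FOb S Y0) j0' g0 = Cmp C D (FOb S X) (FOb S Y0) (FAr S X Y0 u0) k0'"
  shows "\<exists>f\<in>Hom C Z' Y'. \<exists>g\<in>Hom C Y' X'. (Z', Y', X', f, g,
      (Cmp C X' (FOb S Y) (FOb S Z') (FAr S Y Z' i) j')) \<in> \<Delta> \<and>
      Cmp C Y Z' Y' f i = Cmp C Y Z Y' k v \<and> Cmp C Z Y' X' g k = j \<and>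
      Cmp C Z' Y' (FOb S X) k' f = i' \<and> Cmp C Y' X' (FOb S Y) j' g = Cmp C Y' (FOb S X) (FOb S Y)
          (FAr S X Y u) k'"
proof -
  note [simp] = triD[OF T1] triD[OF T2] triD[OF T3] triD[OF S1] triD[OF S2] triD[OF S3] triD[OF S4]
  obtain p' where p_in [simp]: "p \<in> Hom C Y0 Y" "p' \<in> Hom C Y Y0" and
    p': "Cmp C Y0 Y Y0 p' p = Idm C Y0" "Cmp C Y Y0 Y p p' = Idm C Y" by (rule is_isoE[OF p])
  obtain q' where q_in [simp]: "q \<in> Hom C Z0 Z" "q' \<in> Hom C Z Z0" and
    q': "Cmp C Z0 Z Z0 q' q = Idm C Z0" "Cmp C Z Z0 Z q q' = Idm C Z" by (rule is_isoE[OF q])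
  \<comment> \<open>The first and third faces are compared over the identity of \<open>X\<close>, so
    the connecting maps \<open>i0'\<close> and \<open>k0'\<close> are those of the given triangles
    precomposed with \<open>a\<close> and \<open>d\<close>.\<close>
  have sq1: "Cmp C X Y0 Y p u0 = Cmp C X X Y u (Idm C X)" using pu by simp
  have sq3: "Cmp C X Z0 Z q (Cmp C X Y0 Z0 v0 u0) = Cmp C X X Z (Cmp C X Y Z v u) (Idm C X)"
    using cmp_eq_assoc[OF qv] by (simp add: pu)
  obtain a where a: "is_iso C A Z' a" and a1: "Cmp C Y0 A Z' a i0 = Cmp C Y0 Y Z' i p"
      "Cmp C A (FOb S X) (FOb S X) (FAr S X X (Idm C X)) i0' = Cmp C A Z' (FOb S X) i' a"
    by (rule filler_iso[OF S1 T1 is_iso_id p sq1]) simp_all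
  obtain b where b: "is_iso C B X' b" and b1: "Cmp C Z0 B X' b j0 = Cmp C Z0 Z X' j q"
      "Cmp C B (FOb S Y0) (FOb S Y) (FAr S Y0 Y p) j0' = Cmp C B X' (FOb S Y) j' b"
    by (rule filler_iso[OF S2 T2 p q qv])
  obtain d where d: "is_iso C D Y' d" and d1: "Cmp C Z0 D Y' d k0 = Cmp C Z0 Z Y' k q"
      "Cmp C D (FOb S X) (FOb S X) (FAr S X X (Idm C X)) k0' = Cmp C D Y' (FOb S X) k' d"
    by (rule filler_iso[OF S3 T3 is_iso_id q sq3]) simp_all
  obtain a' where a_in [simp]: "a \<in> Hom C A Z'" "a' \<in> Hom C Z' A" and
    a': "Cmp C A Z' A a' a = Idm C A" "Cmp C Z' A Z' a a' = Idm C Z'" by (rule is_isoE[OF a])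
  obtain d' where d_in [simp]: "d \<in> Hom C D Y'" "d' \<in> Hom C Y' D" and
    d': "Cmp C D Y' D d' d = Idm C D" "Cmp C Y' D Y' d d' = Idm C Y'" by (rule is_isoE[OF d])
  have b_in [simp]: "b \<in> Hom C B X'" using b by (simp add: is_iso_def)
  have a2: "i0' = Cmp C A Z' (FOb S X) i' a" and d2: "k0' = Cmp C D Y' (FOb S X) k' d" using a1 d1
      by simp_all
  have ai: "Cmp C Y Z' A a' i = Cmp C Y Y0 A i0 p'"
      by (rule square_inv[OF _ _ _ _ _ _ _ _ _ _ a1(1) p'(2) a'(1)]) simp_all
  have dk: "Cmp C Z Y' D d' k = Cmp C Z Z0 D k0 q'"
      by (rule square_inv[OF _ _ _ _ _ _ _ _ _ _ d1(1) q'(2) d'(1)]) simp_all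
  define f where "f = Cmp C Z' D Y' d (Cmp C Z' A D f0 a')"
  define g where "g = Cmp C Y' B X' b (Cmp C Y' D B g0 d')"
  have fg [simp]: "f \<in> Hom C Z' Y'" "g \<in> Hom C Y' X'" by (simp_all add: f_def g_def)
  have fa: "Cmp C A D Y' d f0 = Cmp C A Z' Y' f a" by (simp add: f_def a')
  have gd: "Cmp C D B X' b g0 = Cmp C D Y' X' g d" by (simp add: g_def d')
  have Sai: "Cmp C (FOb S Y0) (FOb S A) (FOb S Z') (FAr S A Z' a) (FAr S Y0 A i0)
      = Cmp C (FOb S Y0) (FOb S Y) (FOb S Z') (FAr S Y Z' i) (FAr S Y0 Y p)"
    using a1(1) by (simp flip: S_simps(4))
  have Spu: "Cmp C (FOb S X) (FOb S Y0) (FOb S Y) (FAr S Y0 Y p) (FAr S X Y0 u0) = (FAr S X Y u)"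
      using pu by (simp flip: S_simps(4))
  have "tri_iso C S (A, D, B, f0, g0, (Cmp C B (FOb S Y0) (FOb S A) (FAr S Y0 A i0) j0')) (Z', Y',
      X', f, g, (Cmp C X' (FOb S Y) (FOb S Z') (FAr S Y Z' i) j'))"
    by (rule tri_isoI[OF a d b fa gd])
      (use cmp_eq_assoc[OF Sai] b1(2) in simp)
  then have "(Z', Y', X', f, g, (Cmp C X' (FOb S Y) (FOb S Z') (FAr S Y Z' i) j')) \<in> \<Delta>"
    by (rule tri_iso_closed[OF S4, rotated]) (simp add: triangles_iff)
  moreover have "Cmp C Y Z' Y' f i = Cmp C Y Z Y' k v"
  proof -
    have "Cmp C Y Z' Y' f i = Cmp C Y D Y' d (Cmp C Y Y0 D (Cmp C Y0 A D f0 i0) p')"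
        by (simp add: f_def ai)
    also have "\<dots> = Cmp C Y Z0 Y' (Cmp C Z0 D Y' d k0) (Cmp C Y Y0 Z0 v0 p')" by (simp add: fi)
    also have "\<dots> = Cmp C Y Z Y' k (Cmp C Y Y0 Z (Cmp C Y0 Z0 Z q v0) p')" unfolding d1(1) by simp
    also have "\<dots> = Cmp C Y Z Y' k v" unfolding qv by (simp add: p')
    finally show ?thesis .
  qed
  moreover have "Cmp C Z Y' X' g k = j"
  proof -
    have "Cmp C Z Y' X' g k = Cmp C Z B X' b (Cmp C Z Z0 B (Cmp C Z0 D B g0 k0) q')"
        by (simp add: g_def dk)
    also have "\<dots> = Cmp C Z Z0 X' (Cmp C Z0 B X' b j0) q'" by (simp add: gk)
    also have "\<dots> = j" unfolding b1(1) by (simp add: q')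
    finally show ?thesis .
  qed
  moreover have "Cmp C Z' Y' (FOb S X) k' f = i'"
  proof -
    have "Cmp C Z' Y' (FOb S X) k' f
        = Cmp C Z' D (FOb S X) (Cmp C D Y' (FOb S X) k' d)
        (Cmp C Z' A D f0 a')" by (simp add: f_def)
    also have "\<dots> = Cmp C Z' A (FOb S X) (Cmp C A D (FOb S X) k0' f0) a'" by (simp flip: d2)
    also have "\<dots> = i'" unfolding kf by (simp add: a2 a')
    finally show ?thesis .
  qed
  moreover have "Cmp C Y' X' (FOb S Y) j' g = Cmp C Y' (FOb S X) (FOb S Y) (FAr S X Y u) k'"
  proof -
    have "Cmp C Y' X' (FOb S Y) j' g
        = Cmp C Y' B (FOb S Y) (Cmp C B X' (FOb S Y) j' b)
        (Cmp C Y' D B g0 d')" by (simp add: g_def)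
    also have
        "\<dots> = Cmp C Y' (FOb S Y0) (FOb S Y) (FAr S Y0 Y p) (Cmp C Y' D (FOb S Y0)
        (Cmp C D B (FOb S Y0) j0' g0) d')" by (simp flip: b1(2))
    also have
        "\<dots> = Cmp C Y' (FOb S X) (FOb S Y) (Cmp C (FOb S X) (FOb S Y0) (FOb S Y) (FAr S Y0 Y p)
        (FAr S X Y0 u0)) (Cmp C Y' D (FOb S X) k0' d')" unfolding jg by simp
    also have "\<dots> = Cmp C Y' (FOb S X) (FOb S Y) (FAr S X Y u) k'" unfolding Spu by (simp add: d2 d')
    finally show ?thesis .
  qed
  ultimately show ?thesis using fg by blast
qed

end


section \<open>Stable categories of Frobenius categories\<close>

text \<open>The axioms record what the proof that the stable category is triangulated uses of a
  Frobenius category; \<open>I\<close> is the ideal of morphisms factoring through an injective object.\<close>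

locale frobenius_category = additive_category C
  for C :: "('o, 'm, 'z) cat_scheme" +
  fixes E :: "('o, 'm) ses set" and I :: "'o \<Rightarrow> 'o \<Rightarrow> 'm set"
  assumes conf_obj: "(X, Y, Z, a, b) \<in> E \<Longrightarrow> X \<in> Obj C \<and> Y \<in> Obj C \<and> Z \<in> Obj C"
    and conf_hom: "(X, Y, Z, a, b) \<in> E \<Longrightarrow> a \<in> Hom C X Y \<and> b \<in> Hom C Y Z"
    and conf_zero: "(X, Y, Z, a, b) \<in> E \<Longrightarrow> Cmp C X Y Z b a = Zero C X Z"
    and conf_mono: "\<lbrakk>(X, Y, Z, a, b) \<in> E; W \<in> Obj C; f \<in> Hom C W X; Cmp C W X Y a f = Zero C W Y\<rbrakk>
      \<Longrightarrow> f = Zero C W X"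
    and conf_epi: "\<lbrakk>(X, Y, Z, a, b) \<in> E; W \<in> Obj C; g \<in> Hom C Z W; Cmp C Y Z W g b = Zero C Y W\<rbrakk>
      \<Longrightarrow> g = Zero C Z W"
    and conf_ker: "\<lbrakk>(X, Y, Z, a, b) \<in> E; W \<in> Obj C; g \<in> Hom C W Y; Cmp C W Y Z b g = Zero C W Z\<rbrakk>
      \<Longrightarrow> \<exists>f\<in>Hom C W X. Cmp C W X Y a f = g"
    and conf_coker: "\<lbrakk>(X, Y, Z, a, b) \<in> E; W \<in> Obj C; f \<in> Hom C Y W; Cmp C X Y W f a = Zero C X W\<rbrakk>
      \<Longrightarrow> \<exists>g\<in>Hom C Z W. Cmp C Y Z W g b = f"
    and conf_id: "\<lbrakk>X \<in> Obj C; zero_object C Z\<rbrakk> \<Longrightarrow> (X, X, Z, Idm C X, (Zero C X Z)) \<in> E"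
    and conf_pushout:
        "\<lbrakk>(X, J, S, u, p) \<in> E; Y \<in> Obj C; f1 \<in> Hom C X Y; biproduct C J Y B i1 i2 p1 p2\<rbrakk>
      \<Longrightarrow> \<exists>P v h. (X, B, P, Add C X B (Cmp C X J B i1 u) (Cmp C X Y B i2 f1), v) \<in> E \<and>
          (Y, P, S, Cmp C Y B P v i2, h) \<in> E \<and> Cmp C B P S h v = Neg C B S (Cmp C B J S p p1)"
    and conf_cmp: "\<lbrakk>(X, Y, Z', a, q) \<in> E; (Y, Z, X', c, d) \<in> E\<rbrakk>
      \<Longrightarrow> \<exists>Y' k m n. (X, Z, Y', Cmp C X Y Z c a, k) \<in> E \<and> (Z', Y', X', m, n) \<in> E \<and>
            (Cmp C Y Z' Y' m q) = Cmp C Y Z Y' k c \<and> Cmp C Z Y' X' n k = d"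
    and inj_proj: "\<lbrakk>injective_object C E K; (X, Y, Z, a, b) \<in> E; f \<in> Hom C K Z\<rbrakk>
      \<Longrightarrow> \<exists>g\<in>Hom C K Y. Cmp C K Y Z b g = f"
    and enough_inj: "X \<in> Obj C \<Longrightarrow> \<exists>J S u p. (X, J, S, u, p) \<in> E \<and> injective_object C E J"
    and enough_proj: "Z \<in> Obj C \<Longrightarrow> \<exists>K P u p. (K, P, Z, u, p) \<in> E \<and> injective_object C E P"
    and null_iff: "\<lbrakk>X \<in> Obj C; Y \<in> Obj C\<rbrakk> \<Longrightarrow>
      f \<in> I X Y \<longleftrightarrow> (\<exists>K. injective_object C E K \<and> (\<exists>a\<in>Hom C X K. \<exists>b\<in>Hom C K Y. f = Cmp C X K Y b a))"
begin

abbreviation JJ where "JJ \<equiv> inj_hull C E"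
abbreviation SS where "SS \<equiv> susp_ob C E"
abbreviation uu where "uu \<equiv> susp_in C E"
abbreviation pp where "pp \<equiv> susp_pr C E"

lemma inj_obj [simp]: "injective_object C E K \<Longrightarrow> K \<in> Obj C"
  by (simp add: injective_object_def)

lemma inj_ext:
  "\<lbrakk>injective_object C E K; (X, Y, Z, a, b) \<in> E; f \<in> Hom C X K\<rbrakk> \<Longrightarrow> \<exists>g\<in>Hom C Y K. Cmp C X Y K g a = f"
  unfolding injective_object_def by blast

lemma hull:
  assumes "X \<in> Obj C"
  shows "(X, JJ X, SS X, uu X, pp X) \<in> E \<and> injective_object C E (JJ X)"
proof -
  obtain J S u p where eq: "susp_choice C E X = (J, S, u, p)" by (cases "susp_choice C E X") auto
  have "case susp_choice C E X of (J, S, u, p) \<Rightarrow> (X, J, S, u, p) \<in> E \<and> injective_object C E J"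
    unfolding susp_choice_def by (rule someI_ex) (use enough_inj[OF assms] in auto)
  then show ?thesis by (simp add: inj_hull_def susp_ob_def susp_in_def susp_pr_def eq)
qed

lemma hull_conf: "X \<in> Obj C \<Longrightarrow> (X, JJ X, SS X, uu X, pp X) \<in> E"
  and hull_inj [simp]: "X \<in> Obj C \<Longrightarrow> injective_object C E (JJ X)"
  using hull by auto

lemma hull_simps [simp]:
  assumes "X \<in> Obj C"
  shows "JJ X \<in> Obj C" "SS X \<in> Obj C" "uu X \<in> Hom C X (JJ X)" "pp X \<in> Hom C (JJ X) (SS X)"
    "Cmp C X (JJ X) (SS X) (pp X) (uu X) = Zero C X (SS X)"
  using conf_obj[OF hull_conf[OF assms]] conf_hom[OF hull_conf[OF assms]]
      conf_zero[OF hull_conf[OF assms]]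
  by auto

lemma pp_uu_assoc [simp]:
  "\<lbrakk>X \<in> Obj C; W \<in> Obj C; w \<in> Hom C W X\<rbrakk>
    \<Longrightarrow> Cmp C W (JJ X) (SS X) (pp X) (Cmp C W X (JJ X) (uu X) w) = Zero C W (SS X)"
  using cmp_eq_assoc[OF hull_simps(5)] by simp

lemma null_through:
  "\<lbrakk>injective_object C E K; X \<in> Obj C; Y \<in> Obj C; a \<in> Hom C X K; b \<in> Hom C K Y\<rbrakk>
      \<Longrightarrow> Cmp C X K Y b a \<in> I X Y"
  using null_iff by blast

text \<open>Every map from \<open>X\<close> to an injective object extends over the chosen hull, so
  this one object detects null maps. Two null maps out of \<open>X\<close> then factor through the
  same object, which makes their sum null.\<close>

lemma null_iff_hull:
  assumes [simp]: "X \<in> Obj C" "Y \<in> Obj C"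
  shows "f \<in> I X Y \<longleftrightarrow> (\<exists>g\<in>Hom C (JJ X) Y. f = (Cmp C X (JJ X) Y g (uu X)))"
proof
  assume "f \<in> I X Y"
  then obtain K a b where K: "injective_object C E K" and a [simp]: "a \<in> Hom C X K" "b \<in> Hom C K Y"
      and f: "f = Cmp C X K Y b a"
    using null_iff by auto
  note [simp] = inj_obj[OF K]
  obtain a' where a': "a' \<in> Hom C (JJ X) K" "Cmp C X (JJ X) K a' (uu X) = a"
    using inj_ext[OF K hull_conf[of X], of a] by auto
  then have "f = Cmp C X (JJ X) Y (Cmp C (JJ X) K Y b a') (uu X)" using f by simp
  then show "\<exists>g\<in>Hom C (JJ X) Y. f = Cmp C X (JJ X) Y g (uu X)" using a'(1)
      by (intro bexI[of _ "Cmp C (JJ X) K Y b a'"]) simp_all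
next
  assume "\<exists>g\<in>Hom C (JJ X) Y. f = Cmp C X (JJ X) Y g (uu X)"
  then show "f \<in> I X Y" using null_through by auto
qed

lemma null_hullE:
  assumes "f \<in> I X Y" "X \<in> Obj C" "Y \<in> Obj C"
  obtains k where "k \<in> Hom C (JJ X) Y" "f = Cmp C X (JJ X) Y k (uu X)"
  using assms null_iff_hull by blast

lemma null_hullI:
  "\<lbrakk>X \<in> Obj C; Y \<in> Obj C; k \<in> Hom C (JJ X) Y; f = Cmp C X (JJ X) Y k (uu X)\<rbrakk> \<Longrightarrow> f \<in> I X Y"
  using null_iff_hull by blast

lemma null_ideal: "ideal_quotient C I"
proof (intro ideal_quotient.intro ideal_quotient_axioms.intro)
  fix X Y assume [simp]: "X \<in> Obj C" "Y \<in> Obj C"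
  interpret G: comm_group "HomG C X Y" by (rule hom_group) simp_all
  show "subgroup (I X Y) (HomG C X Y)"
  proof (rule G.subgroupI)
    show "I X Y \<subseteq> Hom C X Y" by (auto elim!: null_hullE)
    show "I X Y \<noteq> {}" using null_hullI[of X Y "Zero C (JJ X) Y"] by auto
    show "Neg C X Y f \<in> I X Y" if f: "f \<in> I X Y" for f
    proof -
      obtain k where "k \<in> Hom C (JJ X) Y" "f = Cmp C X (JJ X) Y k (uu X)"
          by (rule null_hullE[OF f]) simp_all
      then show ?thesis by (intro null_hullI[of X Y "Neg C (JJ X) Y k"]) simp_all
    qed
    show "Add C X Y f f' \<in> I X Y" if f: "f \<in> I X Y" "f' \<in> I X Y" for f f'
    proof -
      obtain k where "k \<in> Hom C (JJ X) Y" "f = Cmp C X (JJ X) Y k (uu X)"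
          by (rule null_hullE[OF f(1)]) simp_all
      moreover obtain k' where "k' \<in> Hom C (JJ X) Y" "f' = Cmp C X (JJ X) Y k' (uu X)"
          by (rule null_hullE[OF f(2)]) simp_all
      ultimately show ?thesis by (intro null_hullI[of X Y "Add C (JJ X) Y k k'"]) simp_all
    qed
  qed
next
  fix X Y Z f g
  assume [simp]: "X \<in> Obj C" "Y \<in> Obj C" "Z \<in> Obj C" and f: "f \<in> I X Y"
      and g [simp]: "g \<in> Hom C Y Z"
  obtain k where "k \<in> Hom C (JJ X) Y" "f = Cmp C X (JJ X) Y k (uu X)"
      by (rule null_hullE[OF f]) simp_all
  then show "Cmp C X Y Z g f \<in> I X Z" by (intro null_hullI[of X Z "Cmp C (JJ X) Y Z g k"]) simp_all
next
  fix X Y Z f g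
  assume [simp]: "X \<in> Obj C" "Y \<in> Obj C" "Z \<in> Obj C" and f [simp]: "f \<in> Hom C X Y"
      and g: "g \<in> I Y Z"
  obtain m where m: "m \<in> Hom C (JJ Y) Z" "g = Cmp C Y (JJ Y) Z m (uu Y)"
      by (rule null_hullE[OF g]) simp_all
  have "Cmp C X (JJ Y) Z m (Cmp C X Y (JJ Y) (uu Y) f) \<in> I X Z"
      by (rule null_through) (use m in simp_all)
  then show "Cmp C X Y Z g f \<in> I X Z" using m by simp
qed (rule additive_category_axioms)

sublocale ideal_quotient C I by (rule null_ideal)

text \<open>The half of the factorization that lands in the injective object is extended. With this
  a square commuting modulo null maps becomes strictly commutative after one arrow is changed by a
  null map.\<close>

lemma null_ext:
  assumes conf: "(X, Y, Z, a, b) \<in> E" and W [simp]: "W \<in> Obj C" and f: "f \<in> I X W"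
  obtains g where "g \<in> I Y W" "g \<in> Hom C Y W" "Cmp C X Y W g a = f"
proof -
  note [simp] = conf_obj[OF conf] conf_hom[OF conf]
  obtain K k c where K: "injective_object C E K" and [simp]: "k \<in> Hom C X K" "c \<in> Hom C K W"
      and f: "f = Cmp C X K W c k"
    using f null_iff by auto
  note [simp] = inj_obj[OF K]
  obtain k' where k' [simp]: "k' \<in> Hom C Y K" "Cmp C X Y K k' a = k" using inj_ext[OF K conf, of k]
      by auto
  show thesis by (rule that[of "Cmp C Y K W c k'"]) (auto simp: f intro: null_through[OF K])
qed

text \<open>The dual of \<open>null_ext\<close>; it rests on injective objects being
  projective.\<close>

lemma null_lift:
  assumes conf: "(X, Y, Z, a, b) \<in> E" and W [simp]: "W \<in> Obj C" and f: "f \<in> I W Z"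
  obtains g where "g \<in> I W Y" "g \<in> Hom C W Y" "Cmp C W Y Z b g = f"
proof -
  note [simp] = conf_obj[OF conf] conf_hom[OF conf]
  obtain K k c where K: "injective_object C E K" and [simp]: "k \<in> Hom C W K" "c \<in> Hom C K Z"
      and f: "f = Cmp C W K Z c k"
    using f null_iff by auto
  note [simp] = inj_obj[OF K]
  obtain c' where c' [simp]: "c' \<in> Hom C K Y" "Cmp C K Y Z b c' = c" using inj_proj[OF K conf, of c]
      by auto
  have "Cmp C W Y Z b (Cmp C W K Y c' k) = f" using cmp_eq_assoc[OF c'(2)] by (simp add: f)
  then show thesis by (intro that[of "Cmp C W K Y c' k"]) (auto intro: null_through[OF K])
qed

text \<open>Injectivity of the middle term extends \<open>f\<close>, and the cokernels receive an
  induced map. This takes the place of a formula for the suspension of \<open>f\<close>.\<close>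

lemma conf_map_exists:
  assumes e: "(X, Y, Z, a, b) \<in> E" and e': "(X', Y', Z', a', b') \<in> E"
    and inj: "injective_object C E Y'" and f [simp]: "f \<in> Hom C X X'"
  obtains g h where "g \<in> Hom C Y Y'" "h \<in> Hom C Z Z'" "Cmp C X Y Y' g a = Cmp C X X' Y' a' f"
      "Cmp C Y Z Z' h b = Cmp C Y Y' Z' b' g"
proof -
  note [simp] = conf_obj[OF e] conf_hom[OF e] conf_obj[OF e'] conf_hom[OF e'] conf_zero[OF e]
      conf_zero[OF e']
  obtain g where g [simp]: "g \<in> Hom C Y Y'" and ga: "Cmp C X Y Y' g a = Cmp C X X' Y' a' f"
    using inj_ext[OF inj e, of "Cmp C X X' Y' a' f"] by auto
  have "Cmp C X Y Z' (Cmp C Y Y' Z' b' g) a = Zero C X Z'"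
      by (simp add: ga cmp_eq_assoc[OF conf_zero[OF e']])
  then obtain h where "h \<in> Hom C Z Z'" "Cmp C Y Z Z' h b = Cmp C Y Y' Z' b' g"
    using conf_coker[OF e, of Z' "Cmp C Y Y' Z' b' g"] by auto
  then show thesis by (rule that[OF g _ ga])
qed

text \<open>If \<open>n\<close> extends \<open>f\<close> along \<open>a\<close>, then g - a' n kills
  \<open>a\<close> and hence equals k b. Cancelling \<open>b\<close> gives h = b' k, which factors
  through the injective middle term.\<close>

lemma conf_map_null:
  assumes e: "(X, Y, Z, a, b) \<in> E" and e': "(X', Y', Z', a', b') \<in> E"
    and inj: "injective_object C E Y'" and f: "f \<in> I X X'"
    and gh [simp]: "g \<in> Hom C Y Y'" "h \<in> Hom C Z Z'" and ga: "Cmp C X Y Y' g a = Cmp C X X' Y' a' f"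
        and hb: "Cmp C Y Z Z' h b = Cmp C Y Y' Z' b' g"
  shows "h \<in> I Z Z'"
proof -
  note [simp] = conf_obj[OF e] conf_hom[OF e] conf_obj[OF e'] conf_hom[OF e']
  have [simp]: "f \<in> Hom C X X'" using f ideal_in by auto
  obtain n where n [simp]: "n \<in> Hom C Y X'" and na: "Cmp C X Y X' n a = f" using null_ext[OF e _ f]
      by auto
  have "Cmp C X Y Y' (Add C Y Y' g (Neg C Y Y' (Cmp C Y X' Y' a' n))) a = Zero C X Y'"
      by (simp add: ga na)
  then obtain k where k [simp]: "k \<in> Hom C Z Y'"
      and kb: "Cmp C Y Z Y' k b = Add C Y Y' g (Neg C Y Y' (Cmp C Y X' Y' a' n))"
    using conf_coker[OF e, of Y' "Add C Y Y' g (Neg C Y Y' (Cmp C Y X' Y' a' n))"] by auto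
  have "Cmp C Y Z Z' (Add C Z Z' h (Neg C Z Z' (Cmp C Z Y' Z' b' k))) b = Zero C Y Z'"
    by (simp add: hb kb cmp_eq_assoc[OF conf_zero[OF e']])
  then have "Add C Z Z' h (Neg C Z Z' (Cmp C Z Y' Z' b' k)) = Zero C Z Z'"
      by (intro conf_epi[OF e]) auto
  then have "h = Cmp C Z Y' Z' b' k" using eq_iff_diff[of Z Z' h "Cmp C Z Y' Z' b' k"] by simp
  then show ?thesis using null_through[OF inj] by simp
qed

text \<open>The dual argument, with \<open>h\<close> lifted to \<open>k\<close> and the injective
  object now in the source. It yields faithfulness of the suspension.\<close>

lemma conf_map_null':
  assumes e: "(X, Y, Z, a, b) \<in> E" and e': "(X', Y', Z', a', b') \<in> E"
    and inj: "injective_object C E Y" and h: "h \<in> I Z Z'"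
    and fg [simp]: "f \<in> Hom C X X'" "g \<in> Hom C Y Y'" and ga: "Cmp C X Y Y' g a = Cmp C X X' Y' a' f"
        and hb: "Cmp C Y Z Z' h b = Cmp C Y Y' Z' b' g"
  shows "f \<in> I X X'"
proof -
  note [simp] = conf_obj[OF e] conf_hom[OF e] conf_obj[OF e'] conf_hom[OF e']
  have [simp]: "h \<in> Hom C Z Z'" using h ideal_in by auto
  obtain k where k [simp]: "k \<in> Hom C Z Y'" and kb: "Cmp C Z Y' Z' b' k = h"
      using null_lift[OF e' _ h] by auto
  have "Cmp C Y Y' Z' b' (Add C Y Y' g (Neg C Y Y' (Cmp C Y Z Y' k b))) = Zero C Y Z'"
      using cmp_eq_assoc[OF kb] by (simp add: hb)
  then obtain n where n [simp]: "n \<in> Hom C Y X'"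
      and an: "Cmp C Y X' Y' a' n = Add C Y Y' g (Neg C Y Y' (Cmp C Y Z Y' k b))"
    using conf_ker[OF e', of Y "Add C Y Y' g (Neg C Y Y' (Cmp C Y Z Y' k b))"] by auto
  have "Cmp C X X' Y' a' (Add C X X' f (Neg C X X' (Cmp C X Y X' n a))) = Zero C X Y'"
    using cmp_eq_assoc[OF an] by (simp add: ga conf_zero[OF e])
  then have "Add C X X' f (Neg C X X' (Cmp C X Y X' n a)) = Zero C X X'"
      by (intro conf_mono[OF e']) auto
  then have "f = Cmp C X Y X' n a" using eq_iff_diff[of X X' f "Cmp C X Y X' n a"] by simp
  then show ?thesis using null_through[OF inj] by simp
qed

text \<open>An inflation out of an injective object splits, and the idempotent a g complementary to
  t b factors through that object.\<close>

lemma conf_stable_iso_right: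
  assumes e: "(X, Y, Z, a, b) \<in> E" and inj: "injective_object C E X"
  shows "is_iso Q Y Z (cls Y Z b)"
proof -
  interpret Q: additive_category Q by (rule additive_Q)
  note [simp] = conf_obj[OF e] conf_hom[OF e] conf_zero[OF e]
  obtain g where g [simp]: "g \<in> Hom C Y X" and ga: "Cmp C X Y X g a = Idm C X"
      using inj_ext[OF inj e, of "Idm C X"] by auto
  have "Cmp C X Y Y (Add C Y Y (Idm C Y) (Neg C Y Y (Cmp C Y X Y a g))) a = Zero C X Y"
      by (simp add: ga)
  then obtain t where t [simp]: "t \<in> Hom C Z Y"
      and tb: "Cmp C Y Z Y t b = Add C Y Y (Idm C Y) (Neg C Y Y (Cmp C Y X Y a g))"
    using conf_coker[OF e, of Y "Add C Y Y (Idm C Y) (Neg C Y Y (Cmp C Y X Y a g))"] by auto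
  have "Cmp C Y Z Z (Add C Z Z (Cmp C Z Y Z b t) (Neg C Z Z (Idm C Z))) b = Zero C Y Z"
      by (simp add: tb cmp_eq_assoc[OF conf_zero[OF e]])
  then have "Add C Z Z (Cmp C Z Y Z b t) (Neg C Z Z (Idm C Z)) = Zero C Z Z"
      by (intro conf_epi[OF e]) auto
  then have bt: "Cmp C Z Y Z b t = Idm C Z" using eq_iff_diff[of Z Z "Cmp C Z Y Z b t" "Idm C Z"]
      by simp
  have "Add C Y Y (Cmp C Y Z Y t b) (Neg C Y Y (Idm C Y)) = Neg C Y Y (Cmp C Y X Y a g)"
      by (simp add: tb add_ac)
  then have "Add C Y Y (Cmp C Y Z Y t b) (Neg C Y Y (Idm C Y)) \<in> I Y Y"
      using null_through[OF inj] ideal_neg by simp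
  then have "cls Y Y (Cmp C Y Z Y t b) = cls Y Y (Idm C Y)" by (subst cls_eq_iff) auto
  then show ?thesis by (intro Q.is_isoI[where g = "cls Z Y t"]) (simp_all add: bt)
qed

text \<open>Dually, a deflation onto an injective, hence projective, object splits.\<close>

lemma conf_stable_iso_left:
  assumes e: "(X, Y, Z, a, b) \<in> E" and inj: "injective_object C E Z"
  shows "is_iso Q X Y (cls X Y a)"
proof -
  interpret Q: additive_category Q by (rule additive_Q)
  note [simp] = conf_obj[OF e] conf_hom[OF e] conf_zero[OF e]
  obtain t where t [simp]: "t \<in> Hom C Z Y" and bt: "Cmp C Z Y Z b t = Idm C Z"
      using inj_proj[OF inj e, of "Idm C Z"] by auto
  have "Cmp C Y Y Z b (Add C Y Y (Idm C Y) (Neg C Y Y (Cmp C Y Z Y t b))) = Zero C Y Z"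
      using cmp_eq_assoc[OF bt] by simp
  then obtain m where m [simp]: "m \<in> Hom C Y X"
      and am: "Cmp C Y X Y a m = Add C Y Y (Idm C Y) (Neg C Y Y (Cmp C Y Z Y t b))"
    using conf_ker[OF e, of Y "Add C Y Y (Idm C Y) (Neg C Y Y (Cmp C Y Z Y t b))"] by auto
  have "Cmp C X X Y a (Add C X X (Cmp C X Y X m a) (Neg C X X (Idm C X))) = Zero C X Y"
      by (simp add: cmp_eq_assoc[OF am] conf_zero[OF e])
  then have "Add C X X (Cmp C X Y X m a) (Neg C X X (Idm C X)) = Zero C X X"
      by (intro conf_mono[OF e]) auto
  then have ma: "Cmp C X Y X m a = Idm C X" using eq_iff_diff[of X X "Cmp C X Y X m a" "Idm C X"]
      by simp
  have "Add C Y Y (Cmp C Y X Y a m) (Neg C Y Y (Idm C Y)) = Neg C Y Y (Cmp C Y Z Y t b)"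
      by (simp add: am add_ac)
  then have "Add C Y Y (Cmp C Y X Y a m) (Neg C Y Y (Idm C Y)) \<in> I Y Y"
      using null_through[OF inj] ideal_neg by simp
  then have "cls Y Y (Cmp C Y X Y a m) = cls Y Y (Idm C Y)" by (subst cls_eq_iff) auto
  then show ?thesis by (intro Q.is_isoI[where g = "cls Y X m"]) (simp_all add: ma)
qed

lemma biproduct_stable_iso:
  assumes bp: "biproduct C X K P i1 i2 p1 p2" and inj: "injective_object C E K"
      and X [simp]: "X \<in> Obj C"
  shows "is_iso Q X P (cls X P i1)" "is_iso Q P X (cls P X p1)"
proof -
  interpret Q: additive_category Q by (rule additive_Q)
  note [simp] = biproductD[OF bp] inj_obj[OF inj]
  have "Neg C P P (Add C P P (Cmp C P X P i1 p1) (Neg C P P (Idm C P)))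
      = Add C P P (Add C P P (Cmp C P X P i1 p1) (Cmp C P K P i2 p2))
      (Neg C P P (Cmp C P X P i1 p1))" by (simp add: add_ac)
  also have "\<dots> = Cmp C P K P i2 p2" by (simp add: add_ac del: biproductD(10)[OF bp])
  finally have "Neg C P P (Neg C P P (Add C P P (Cmp C P X P i1 p1) (Neg C P P (Idm C P))))
      = Neg C P P (Cmp C P K P i2 p2)" by simp
  then have "Add C P P (Cmp C P X P i1 p1) (Neg C P P (Idm C P)) \<in> I P P"
      using null_through[OF inj] ideal_neg by simp
  then have "cls P P (Cmp C P X P i1 p1) = cls P P (Idm C P)" by (subst cls_eq_iff) auto
  then show "is_iso Q X P (cls X P i1)" "is_iso Q P X (cls P X p1)"
    by (auto intro: Q.is_isoI[where g = "cls P X p1"] Q.is_isoI[where g = "cls X P i1"])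
qed

text \<open>Vanishing in the quotient means that the identity of \<open>Z\<close> is null. Then
  every map into \<open>Z\<close> is null, and null maps extend along inflations.\<close>

lemma zero_object_Q_iff:
  "Z \<in> Obj C \<Longrightarrow> zero_object Q Z \<longleftrightarrow> injective_object C E Z"
proof -
  assume [simp]: "Z \<in> Obj C"
  interpret Q: additive_category Q by (rule additive_Q)
  have "zero_object Q Z \<longleftrightarrow> Idm C Z \<in> I Z Z"
    using Q.zero_object_iff[of Z] cls_zero_iff[of Z Z "Idm C Z"] by simp
  also have "\<dots> \<longleftrightarrow> injective_object C E Z"
  proof
    assume "injective_object C E Z"
    then show "Idm C Z \<in> I Z Z" using null_through[of Z Z Z "Idm C Z" "Idm C Z"] by simp
  next
    assume n: "Idm C Z \<in> I Z Z"
    show "injective_object C E Z"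
      unfolding injective_object_def
    proof (intro conjI allI impI ballI)
      fix X Y Z' a b f assume e: "(X, Y, Z', a, b) \<in> E" and f: "f \<in> Hom C X Z"
      note [simp] = conf_obj[OF e] conf_hom[OF e]
      have "f \<in> I X Z" using ideal_right[of X Z Z f "Idm C Z"] f n by simp
      then show "\<exists>g\<in>Hom C Y Z. Cmp C X Y Z g a = f" using null_ext[OF e _ \<open>f \<in> I X Z\<close>] by auto
    qed simp
  qed
  finally show ?thesis .
qed

end

section \<open>The suspension functor\<close>

context frobenius_category
begin

abbreviation Sig where "Sig \<equiv> susp_fctr C E I"

lemma FOb_Sig: "FOb Sig X = SS X"
  by (simp add: susp_fctr_def)

text \<open>A map back over the identity exists; the composites minus the identities lie over zero
  and are null by \<open>conf_map_null\<close>. This serves both the essential surjectivity of the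
  suspension and the isomorphism by which an exact functor commutes with suspension.\<close>

lemma conf_over_id_iso:
  assumes e: "(X, Y, Z, a, b) \<in> E" and e': "(X, Y', Z', a', b') \<in> E"
    and inj: "injective_object C E Y" "injective_object C E Y'"
    and gh [simp]: "g \<in> Hom C Y Y'" "h \<in> Hom C Z Z'" and ga: "Cmp C X Y Y' g a = a'"
        and hb: "Cmp C Y Z Z' h b = Cmp C Y Y' Z' b' g"
  shows "is_iso Q Z Z' (cls Z Z' h)"
proof -
  interpret Q: additive_category Q by (rule additive_Q)
  note [simp] = conf_obj[OF e] conf_hom[OF e] conf_obj[OF e'] conf_hom[OF e']
  obtain g' h' where gh' [simp]: "g' \<in> Hom C Y' Y" "h' \<in> Hom C Z' Z"
    and ga': "Cmp C X Y' Y g' a' = Cmp C X X Y a (Idm C X)"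
        and hb': "Cmp C Y' Z' Z h' b' = Cmp C Y' Y Z b g'"
    by (rule conf_map_exists[OF e' e inj(1), of "Idm C X"]) simp_all
  have "Add C Z Z (Cmp C Z Z' Z h' h) (Neg C Z Z (Idm C Z)) \<in> I Z Z"
  proof (rule conf_map_null[OF e e inj(1)])
    show "Cmp C X Y Y (Add C Y Y (Cmp C Y Y' Y g' g) (Neg C Y Y (Idm C Y))) a
        = Cmp C X X Y a (Zero C X X)" using ga ga' by simp
    show "Cmp C Y Z Z (Add C Z Z (Cmp C Z Z' Z h' h) (Neg C Z Z (Idm C Z))) b
        = Cmp C Y Y Z b (Add C Y Y (Cmp C Y Y' Y g' g) (Neg C Y Y (Idm C Y)))" by
        (simp add: hb cmp_eq_assoc[OF hb'])
  qed simp_all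
  moreover have "Add C Z' Z' (Cmp C Z' Z Z' h h') (Neg C Z' Z' (Idm C Z')) \<in> I Z' Z'"
  proof (rule conf_map_null[OF e' e' inj(2)])
    show "Cmp C X Y' Y' (Add C Y' Y' (Cmp C Y' Y Y' g g') (Neg C Y' Y' (Idm C Y'))) a'
        = Cmp C X X Y' a' (Zero C X X)" using ga ga' by simp
    show "Cmp C Y' Z' Z' (Add C Z' Z' (Cmp C Z' Z Z' h h') (Neg C Z' Z' (Idm C Z'))) b'
        = Cmp C Y' Y' Z' b' (Add C Y' Y' (Cmp C Y' Y Y' g g') (Neg C Y' Y' (Idm C Y')))" by
        (simp add: hb' cmp_eq_assoc[OF hb])
  qed simp_all
  ultimately show ?thesis
    by (intro Q.is_isoI[where g = "cls Z' Z h'"]) (simp_all add: cls_eq_iff)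
qed

lemma susp_lift_iff:
  "susp_lift C E X Y f h \<longleftrightarrow> h \<in> Hom C (SS X) (SS Y) \<and>
    (\<exists>g\<in>Hom C (JJ X) (JJ Y). Cmp C X (JJ X) (JJ Y) g (uu X) = Cmp C X Y (JJ Y) (uu Y) f \<and> Cmp C
        (JJ X) (SS X) (SS Y) h (pp X) = (Cmp C (JJ X) (JJ Y) (SS Y) (pp Y) g))"
  by (auto simp: susp_lift_def)

lemma susp_lift_exists:
  assumes "X \<in> Obj C" "Y \<in> Obj C" "f \<in> Hom C X Y"
  shows "\<exists>h. susp_lift C E X Y f h"
  by (rule conf_map_exists[OF hull_conf hull_conf hull_inj, of X Y f])
      (use assms susp_lift_iff in auto)

text \<open>The implication from left to right makes the suspension well defined on classes, the
  other one makes it faithful.\<close>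

lemma susp_lift_null:
  assumes XY [simp]: "X \<in> Obj C" "Y \<in> Obj C" "f \<in> Hom C X Y" "f' \<in> Hom C X Y"
    and h: "susp_lift C E X Y f h" and h': "susp_lift C E X Y f' h'"
  shows "cls X Y f = cls X Y f' \<longleftrightarrow> cls (SS X) (SS Y) h = cls (SS X) (SS Y) h'"
proof -
  obtain g where g [simp]: "h \<in> Hom C (SS X) (SS Y)" "g \<in> Hom C (JJ X) (JJ Y)"
    and ge: "Cmp C X (JJ X) (JJ Y) g (uu X) = Cmp C X Y (JJ Y) (uu Y) f"
        "Cmp C (JJ X) (SS X) (SS Y) h (pp X) = Cmp C (JJ X) (JJ Y) (SS Y) (pp Y) g"
        using h susp_lift_iff by auto
  obtain g' where g' [simp]: "h' \<in> Hom C (SS X) (SS Y)" "g' \<in> Hom C (JJ X) (JJ Y)"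
    and ge': "Cmp C X (JJ X) (JJ Y) g' (uu X) = Cmp C X Y (JJ Y) (uu Y) f'"
        "Cmp C (JJ X) (SS X) (SS Y) h' (pp X) = Cmp C (JJ X) (JJ Y) (SS Y) (pp Y) g'"
        using h' susp_lift_iff by auto
  have 1: "Cmp C X (JJ X) (JJ Y) (Add C (JJ X) (JJ Y) g (Neg C (JJ X) (JJ Y) g')) (uu X)
      = Cmp C X Y (JJ Y) (uu Y) (Add C X Y f (Neg C X Y f'))" "Cmp C (JJ X) (SS X) (SS Y)
      (Add C (SS X) (SS Y) h (Neg C (SS X) (SS Y) h')) (pp X) = Cmp C (JJ X) (JJ Y) (SS Y)
      (pp Y) (Add C (JJ X) (JJ Y) g (Neg C (JJ X) (JJ Y) g'))"
    by (simp_all add: ge ge')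
  have "Add C X Y f (Neg C X Y f') \<in> I X Y
      \<longleftrightarrow> Add C (SS X) (SS Y) h (Neg C (SS X) (SS Y) h') \<in> I (SS X) (SS Y)"
    using conf_map_null[OF hull_conf[of X] hull_conf[of Y] hull_inj _ _ _ 1]
      conf_map_null'[OF hull_conf[of X] hull_conf[of Y] hull_inj _ _ _ 1] by auto
  then show ?thesis by (simp add: cls_eq_iff)
qed

text \<open>The definition is a union over all representatives and all their lifts. By
  \<open>susp_lift_null\<close> its members agree, and no inner union is empty since lifts
  exist.\<close>

lemma FAr_Sig:
  assumes XY [simp]: "X \<in> Obj C" "Y \<in> Obj C" "f \<in> Hom C X Y" and h: "susp_lift C E X Y f h"
  shows "FAr Sig X Y (cls X Y f) = cls (SS X) (SS Y) h"
proof -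
  have f: "f \<in> cls X Y f" by (simp add: in_cls_iff_diff)
  have eq: "cls (SS X) (SS Y) h' = cls (SS X) (SS Y) h"
    if f': "f' \<in> cls X Y f" and h': "susp_lift C E X Y f' h'" for f' h'
  proof -
    obtain k where "k \<in> I X Y" "f' = Add C X Y k f" using in_cls_iff[OF XY, THEN iffD1, OF f']
        by blast
    then have "f' \<in> Hom C X Y" "cls X Y f' = cls X Y f" using ideal_in cls_eqI by auto
    then show ?thesis using susp_lift_null[OF XY(1,2) _ XY(3) h' h] by simp
  qed
  have "FAr Sig X Y (cls X Y f)
      = (\<Union>f'\<in>cls X Y f. \<Union>h'\<in>{h'. susp_lift C E X Y f' h'}. cls (SS X) (SS Y) h')"
    by (simp add: susp_fctr_def)
  also have "\<dots> = (\<Union>f'\<in>cls X Y f. \<Union>h'\<in>{h'. susp_lift C E X Y f' h'}. cls (SS X) (SS Y) h)"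
    using eq by (intro SUP_cong refl) auto
  also have "\<dots> = cls (SS X) (SS Y) h"
  proof -
    have "{h'. susp_lift C E X Y f' h'} \<noteq> {}" if H: "f' \<in> cls X Y f" for f'
    proof -
      obtain k where "k \<in> I X Y" "f' = Add C X Y k f" using in_cls_iff[OF XY, THEN iffD1, OF H]
          by blast
      then have "f' \<in> Hom C X Y" using ideal_in by auto
      then show ?thesis using susp_lift_exists[OF XY(1,2)] by auto
    qed
    then have "(\<Union>f'\<in>cls X Y f. \<Union>h'\<in>{h'. susp_lift C E X Y f' h'}. cls (SS X) (SS Y) h)
      = (\<Union>f'\<in>cls X Y f. cls (SS X) (SS Y) h)" by (intro SUP_cong refl) auto
    then show ?thesis using f by auto
  qed
  finally show ?thesis .
qed

lemma susp_lift_cmp: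
  assumes [simp]: "X \<in> Obj C" "Y \<in> Obj C" "Z \<in> Obj C" "f \<in> Hom C X Y" "f' \<in> Hom C Y Z"
    and h: "susp_lift C E X Y f h" and h': "susp_lift C E Y Z f' h'"
  shows "susp_lift C E X Z (Cmp C X Y Z f' f) (Cmp C (SS X) (SS Y) (SS Z) h' h)"
proof -
  obtain g where g [simp]: "h \<in> Hom C (SS X) (SS Y)" "g \<in> Hom C (JJ X) (JJ Y)"
    and ge: "Cmp C X (JJ X) (JJ Y) g (uu X) = Cmp C X Y (JJ Y) (uu Y) f"
        "Cmp C (JJ X) (SS X) (SS Y) h (pp X) = Cmp C (JJ X) (JJ Y) (SS Y) (pp Y) g"
        using h susp_lift_iff by auto
  obtain g' where g' [simp]: "h' \<in> Hom C (SS Y) (SS Z)" "g' \<in> Hom C (JJ Y) (JJ Z)"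
    and ge': "Cmp C Y (JJ Y) (JJ Z) g' (uu Y) = Cmp C Y Z (JJ Z) (uu Z) f'"
        "Cmp C (JJ Y) (SS Y) (SS Z) h' (pp Y) = Cmp C (JJ Y) (JJ Z) (SS Z) (pp Z) g'"
        using h' susp_lift_iff by auto
  show ?thesis unfolding susp_lift_iff
    by (intro conjI bexI[of _ "Cmp C (JJ X) (JJ Y) (JJ Z) g' g"])
        (simp_all add: ge cmp_eq_assoc[OF ge'(1)] cmp_eq_assoc[OF ge'(2)])
qed

lemma susp_lift_add:
  assumes [simp]: "X \<in> Obj C" "Y \<in> Obj C" "f \<in> Hom C X Y" "f' \<in> Hom C X Y"
    and h: "susp_lift C E X Y f h" and h': "susp_lift C E X Y f' h'"
  shows "susp_lift C E X Y (Add C X Y f f') (Add C (SS X) (SS Y) h h')"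
proof -
  obtain g where g [simp]: "h \<in> Hom C (SS X) (SS Y)" "g \<in> Hom C (JJ X) (JJ Y)"
    and ge: "Cmp C X (JJ X) (JJ Y) g (uu X) = Cmp C X Y (JJ Y) (uu Y) f"
        "Cmp C (JJ X) (SS X) (SS Y) h (pp X) = Cmp C (JJ X) (JJ Y) (SS Y) (pp Y) g"
        using h susp_lift_iff by auto
  obtain g' where g' [simp]: "h' \<in> Hom C (SS X) (SS Y)" "g' \<in> Hom C (JJ X) (JJ Y)"
    and ge': "Cmp C X (JJ X) (JJ Y) g' (uu X) = Cmp C X Y (JJ Y) (uu Y) f'"
        "Cmp C (JJ X) (SS X) (SS Y) h' (pp X) = Cmp C (JJ X) (JJ Y) (SS Y) (pp Y) g'"
        using h' susp_lift_iff by auto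
  show ?thesis unfolding susp_lift_iff
    by (intro conjI bexI[of _ "Add C (JJ X) (JJ Y) g g'"]) (simp_all add: ge ge')
qed

lemma susp_lift_id: "X \<in> Obj C \<Longrightarrow> susp_lift C E X X (Idm C X) (Idm C (SS X))"
  unfolding susp_lift_iff by (intro conjI bexI[of _ "Idm C (JJ X)"]) simp_all

lemma susp_lift_in: "susp_lift C E X Y f h \<Longrightarrow> h \<in> Hom C (SS X) (SS Y)"
  by (simp add: susp_lift_iff)

lemma Sig_functor: "is_functor Q Q Sig"
proof (rule is_functorI)
  show "FOb Sig X \<in> Obj Q" if "X \<in> Obj Q" for X using that by (simp add: FOb_Sig)
  show "FAr Sig X Y F \<in> Hom Q (FOb Sig X) (FOb Sig Y)" if H: "X \<in> Obj Q" "Y \<in> Obj Q"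
      "F \<in> Hom Q X Y" for X Y F
  proof -
    obtain f where f: "f \<in> Hom C X Y" "F = cls X Y f" using H by (auto elim: cls_cases)
    obtain h where "susp_lift C E X Y f h" using susp_lift_exists[OF _ _ f(1)] H by auto
    then show ?thesis using H f by (simp add: FAr_Sig FOb_Sig susp_lift_in)
  qed
  show "FAr Sig X X (Idm Q X) = Idm Q (FOb Sig X)" if "X \<in> Obj Q" for X
    using that by (simp add: FAr_Sig[OF _ _ _ susp_lift_id] FOb_Sig)
  show "FAr Sig X Z (Cmp Q X Y Z G F)
      = Cmp Q (FOb Sig X) (FOb Sig Y) (FOb Sig Z) (FAr Sig Y Z G) (FAr Sig X Y F)"
    if H: "X \<in> Obj Q" "Y \<in> Obj Q" "Z \<in> Obj Q" "F \<in> Hom Q X Y" "G \<in> Hom Q Y Z" for X Y Z F G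
  proof -
    obtain f where f: "f \<in> Hom C X Y" "F = cls X Y f" using H by (auto elim: cls_cases)
    obtain g where g: "g \<in> Hom C Y Z" "G = cls Y Z g" using H by (auto elim: cls_cases)
    obtain h where h: "susp_lift C E X Y f h" using susp_lift_exists[OF _ _ f(1)] H by auto
    obtain k where k: "susp_lift C E Y Z g k" using susp_lift_exists[OF _ _ g(1)] H by auto
    show ?thesis using H f g h k
      by (simp add: FAr_Sig[OF _ _ _ h] FAr_Sig[OF _ _ _ k]
          FAr_Sig[OF _ _ _ susp_lift_cmp[OF _ _ _ _ _ h k]]
          FOb_Sig susp_lift_in)
  qed
qed

lemma Sig_additive: "additive_functor Q Q Sig"
  unfolding additive_functor_def
proof (intro conjI ballI Sig_functor)
  fix X Y assume [simp]: "X \<in> Obj Q" "Y \<in> Obj Q"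
  have "FAr Sig X Y (Add Q X Y F G) = Add Q (FOb Sig X) (FOb Sig Y) (FAr Sig X Y F) (FAr Sig X Y G)"
    if H: "F \<in> Hom Q X Y" "G \<in> Hom Q X Y" for F G
  proof -
    obtain f where f: "f \<in> Hom C X Y" "F = cls X Y f" using H by (auto elim: cls_cases)
    obtain g where g: "g \<in> Hom C X Y" "G = cls X Y g" using H by (auto elim: cls_cases)
    have XY: "X \<in> Obj C" "Y \<in> Obj C" by (simp_all flip: quot_sel)
    obtain h where h: "susp_lift C E X Y f h" using susp_lift_exists[OF XY f(1)] by auto
    obtain k where k: "susp_lift C E X Y g k" using susp_lift_exists[OF XY g(1)] by auto
    show ?thesis using f g h k XY
      by (simp add: FAr_Sig[OF _ _ _ h] FAr_Sig[OF _ _ _ k]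
          FAr_Sig[OF _ _ _ susp_lift_add[OF _ _ _ _ h k]]
          FOb_Sig susp_lift_in)
  qed
  then show "FAr Sig X Y \<in> hom (HomG Q X Y) (HomG Q (FOb Sig X) (FOb Sig Y))"
    using is_functorD(2)[OF Sig_functor \<open>X \<in> Obj Q\<close> \<open>Y \<in> Obj Q\<close>] by (auto simp: hom_def)
qed

lemma Sig_ff: "fully_faithful Q Q Sig"
  unfolding fully_faithful_def
proof (intro ballI bij_betw_imageI)
  fix X Y assume "X \<in> Obj Q" "Y \<in> Obj Q"
  then have [simp]: "X \<in> Obj C" "Y \<in> Obj C" by simp_all
  show "inj_on (FAr Sig X Y) (Hom Q X Y)"
  proof (rule inj_onI)
    fix F G assume FG: "F \<in> Hom Q X Y" "G \<in> Hom Q X Y" "FAr Sig X Y F = FAr Sig X Y G"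
    obtain f where f: "f \<in> Hom C X Y" "F = cls X Y f" using FG by (auto elim: cls_cases)
    obtain g where g: "g \<in> Hom C X Y" "G = cls X Y g" using FG by (auto elim: cls_cases)
    obtain h where h: "susp_lift C E X Y f h" using susp_lift_exists[OF _ _ f(1)] by auto
    obtain k where k: "susp_lift C E X Y g k" using susp_lift_exists[OF _ _ g(1)] by auto
    show "F = G" using FG(3) susp_lift_null[OF _ _ _ _ h k] f g
        by (simp add: FAr_Sig[OF _ _ _ h] FAr_Sig[OF _ _ _ k])
  qed
  show "FAr Sig X Y ` Hom Q X Y = Hom Q (FOb Sig X) (FOb Sig Y)"
  proof
    show "FAr Sig X Y ` Hom Q X Y \<subseteq> Hom Q (FOb Sig X) (FOb Sig Y)"
      using is_functorD(2)[OF Sig_functor, of X Y] by auto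
    show "Hom Q (FOb Sig X) (FOb Sig Y) \<subseteq> FAr Sig X Y ` Hom Q X Y"
    proof
      fix H assume "H \<in> Hom Q (FOb Sig X) (FOb Sig Y)"
      then have "H \<in> Hom Q (SS X) (SS Y)" by (simp add: FOb_Sig)
      then obtain h where h [simp]: "h \<in> Hom C (SS X) (SS Y)" and H: "H = cls (SS X) (SS Y) h"
          by (rule cls_cases)
      \<comment> \<open>The hull of \<open>X\<close> is also projective, so h after
        \<open>pp X\<close> lifts to the hull of \<open>Y\<close>. Restricting the lift to kernels
        gives a preimage of \<open>h\<close>.\<close>
      obtain g where g [simp]: "g \<in> Hom C (JJ X) (JJ Y)"
          and gh: "Cmp C (JJ X) (JJ Y) (SS Y) (pp Y) g = Cmp C (JJ X) (SS X) (SS Y) h (pp X)"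
        using inj_proj[OF hull_inj[of X] hull_conf[of Y], of "Cmp C (JJ X) (SS X) (SS Y) h (pp X)"]
            by auto
      have "Cmp C X (JJ Y) (SS Y) (pp Y) (Cmp C X (JJ X) (JJ Y) g (uu X)) = Zero C X (SS Y)"
          using cmp_eq_assoc[OF gh] by simp
      then obtain f where f: "f \<in> Hom C X Y"
          "Cmp C X Y (JJ Y) (uu Y) f = Cmp C X (JJ X) (JJ Y) g (uu X)"
        using conf_ker[OF hull_conf[of Y], of X "Cmp C X (JJ X) (JJ Y) g (uu X)"] by auto
      have "susp_lift C E X Y f h" unfolding susp_lift_iff using f gh by (auto intro!: bexI[of _ g])
      then have "H = FAr Sig X Y (cls X Y f)" using f H by (simp add: FAr_Sig)
      then show "H \<in> FAr Sig X Y ` Hom Q X Y" using f by auto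
    qed
  qed
qed

lemma Sig_equivalence: "equivalence Q Q Sig"
proof (rule equivalence_if_ff_ess_surj[OF _ _ Sig_functor Sig_ff])
  interpret Q: additive_category Q by (rule additive_Q)
  show "preadditive_category Q" "preadditive_category Q" by unfold_locales
  show "\<exists>K\<in>Obj Q. \<exists>e. is_iso Q (FOb Sig K) Z e" if "Z \<in> Obj Q" for Z
  proof -
    have [simp]: "Z \<in> Obj C" using that by simp
    \<comment> \<open>\<open>Z\<close> is a suspension up to isomorphism because it is the cokernel
      term of a conflation with injective middle; the kernel \<open>K\<close> desuspends it.\<close>
    obtain K P u p where e: "(K, P, Z, u, p) \<in> E" and P: "injective_object C E P"
        using enough_proj[of Z] by auto
    note [simp] = conf_obj[OF e] conf_hom[OF e]
    obtain g h where gh [simp]: "g \<in> Hom C (JJ K) P" "h \<in> Hom C (SS K) Z"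
      and eq: "Cmp C K (JJ K) P g (uu K) = Cmp C K K P u (Idm C K)"
          "Cmp C (JJ K) (SS K) Z h (pp K) = Cmp C (JJ K) P Z p g"
      by (rule conf_map_exists[OF hull_conf[of K] e P, of "Idm C K"]) simp_all
    have "is_iso Q (SS K) Z (cls (SS K) Z h)"
      by (rule conf_over_id_iso[OF hull_conf[of K] e hull_inj P gh]) (use eq in simp_all)
    then show ?thesis unfolding FOb_Sig by (intro bexI[of _ K]) auto
  qed
qed

sublocale Q: suspended_category Q Sig
  by (intro suspended_category.intro suspended_category_axioms.intro additive_Q Sig_additive)

subsection \<open>Conflation triangles\<close>

text \<open>The comparison \<open>g\<close> of the conflation with the hull of \<open>X\<close>
  induces minus \<open>w\<close>. With this sign the conflation X -> J + Y -> P that produces the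
  pushout of a map has as its \<open>w\<close> the connecting map of the standard triangle,
  \<open>g\<close> being the projection to J.\<close>

definition conf_tri :: "'o \<Rightarrow> 'o \<Rightarrow> 'o \<Rightarrow> 'm \<Rightarrow> 'm \<Rightarrow> 'm \<Rightarrow> bool" where
  "conf_tri X Y Z a b w \<longleftrightarrow> (X, Y, Z, a, b) \<in> E \<and> w \<in> Hom C Z (SS X) \<and>
    (\<exists>g\<in>Hom C Y (JJ X). Cmp C X Y (JJ X) g a = uu X \<and> Cmp C Y Z (SS X) w b =
        (Neg C Y (SS X) (Cmp C Y (JJ X) (SS X) (pp X) g)))"

definition conf_tris :: "('o, 'm set) tri set" where
  "conf_tris
      = {(X, Y, Z, cls X Y a, cls Y Z b, cls Z (SS X) w) | X Y Z a b w. conf_tri X Y Z a b w}"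

lemma conf_triE:
  assumes "conf_tri X Y Z a b w"
  obtains g where "(X, Y, Z, a, b) \<in> E" "X \<in> Obj C" "Y \<in> Obj C" "Z \<in> Obj C"
    "a \<in> Hom C X Y" "b \<in> Hom C Y Z" "w \<in> Hom C Z (SS X)" "g \<in> Hom C Y (JJ X)"
    "Cmp C X Y (JJ X) g a = uu X"
        "Cmp C Y Z (SS X) w b = Neg C Y (SS X) (Cmp C Y (JJ X) (SS X) (pp X) g)"
  using assms conf_obj conf_hom unfolding conf_tri_def by metis

lemma conf_tri_exists:
  assumes e: "(X, Y, Z, a, b) \<in> E"
  obtains w where "conf_tri X Y Z a b w"
proof -
  note [simp] = conf_obj[OF e] conf_hom[OF e]
  obtain g h where gh: "g \<in> Hom C Y (JJ X)" "h \<in> Hom C Z (SS X)"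
      "Cmp C X Y (JJ X) g a = Cmp C X X (JJ X) (uu X) (Idm C X)"
      "Cmp C Y Z (SS X) h b = Cmp C Y (JJ X) (SS X) (pp X) g"
    by (rule conf_map_exists[OF e hull_conf[of X] hull_inj, of "Idm C X"]) simp_all
  then have "conf_tri X Y Z a b (Neg C Z (SS X) h)" unfolding conf_tri_def using e
      by (auto intro!: bexI[of _ g])
  then show thesis by (rule that)
qed

lemma conf_tris_triangles: "conf_tris \<subseteq> triangles Q Sig"
  by (auto simp: conf_tris_def Q.triangles_iff FOb_Sig elim!: conf_triE)

text \<open>The pushout P of the inflation \<open>a\<close> and the hull of \<open>X\<close> is
  isomorphic to \<open>Z\<close> in the quotient, and it is also the middle term of a conflation Y
  -> P -> \<open>SS X\<close>. Replacing \<open>Z\<close> by P serves both the comparison with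
  standard triangles and the rotation.\<close>

lemma conf_tri_pushout:
  assumes t: "conf_tri X Y Z a b w"
  obtains B i1 i2 p1 p2 P v h phi where
    "biproduct C (JJ X) Y B i1 i2 p1 p2"
    "(X, B, P, Add C X B (Cmp C X (JJ X) B i1 (uu X)) (Cmp C X Y B i2 a), v) \<in> E"
        "(Y, P, SS X, Cmp C Y B P v i2, h) \<in> E"
        "Cmp C B P (SS X) h v = Neg C B (SS X) (Cmp C B (JJ X) (SS X) (pp X) p1)"
    "phi \<in> Hom C P Z" "Cmp C Y P Z phi (Cmp C Y B P v i2) = b" "is_iso Q P Z (cls P Z phi)"
    "cls P (SS X) (Cmp C P Z (SS X) w phi) = cls P (SS X) h"
proof -
  from t obtain g where e: "(X, Y, Z, a, b) \<in> E" and [simp]: "X \<in> Obj C" "Y \<in> Obj C" "Z \<in> Obj C"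
    "a \<in> Hom C X Y" "b \<in> Hom C Y Z" "w \<in> Hom C Z (SS X)" "g \<in> Hom C Y (JJ X)"
    and ga: "Cmp C X Y (JJ X) g a = uu X"
        and wb: "Cmp C Y Z (SS X) w b = Neg C Y (SS X) (Cmp C Y (JJ X) (SS X) (pp X) g)"
        by (rule conf_triE)
  obtain B i1 i2 p1 p2 where bp: "biproduct C (JJ X) Y B i1 i2 p1 p2"
      using ex_biproduct[of "JJ X" Y] by auto
  note [simp] = biproductD[OF bp]
  obtain P v h
      where P: "(X, B, P, Add C X B (Cmp C X (JJ X) B i1 (uu X)) (Cmp C X Y B i2 a), v) \<in> E"
      "(Y, P, SS X, Cmp C Y B P v i2, h) \<in> E"
    and hv: "Cmp C B P (SS X) h v = Neg C B (SS X) (Cmp C B (JJ X) (SS X) (pp X) p1)"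
    using conf_pushout[OF hull_conf[of X], of Y a B i1 i2 p1 p2] bp by auto
  note [simp] = conf_obj[OF P(1)] conf_hom[OF P(1)] conf_obj[OF P(2)] conf_hom[OF P(2)]
      conf_zero[OF e]
  have ve: "Add C X P (Cmp C X B P v (Cmp C X (JJ X) B i1 (uu X)))
      (Cmp C X B P v (Cmp C X Y B i2 a)) = Zero C X P" using conf_zero[OF P(1)] by simp
  have bpz:
      "Cmp C X Y Z b (Cmp C X B Y p2 (Add C X B (Cmp C X (JJ X) B i1 (uu X)) (Cmp C X Y B i2 a)))
      = Zero C X Z"
    by (simp add: cmp_eq_assoc[OF biproductD(9)[OF bp]] cmp_eq_assoc[OF biproductD(7)[OF bp]]
        conf_zero[OF e])
  then obtain phi where phi [simp]: "phi \<in> Hom C P Z"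
      and phiv: "Cmp C B P Z phi v = Cmp C B Y Z b p2"
    using conf_coker[OF P(1), of Z "Cmp C B Y Z b p2"] by auto
  \<comment> \<open>The map i2 + i1 g from \<open>Y\<close> to the biproduct carries
    \<open>a\<close> to the inflation whose cokernel is \<open>v\<close>, so it induces
    \<open>psi\<close> on cokernels.\<close>
  have "Cmp C X Y P (Add C Y P (Cmp C Y B P v i2) (Cmp C Y B P v (Cmp C Y (JJ X) B i1 g))) a
      = Zero C X P"
    using ve by (simp add: ga add_commute)
  then obtain psi where psi [simp]: "psi \<in> Hom C Z P"
      and psib:
      "Cmp C Y Z P psi b = Add C Y P (Cmp C Y B P v i2) (Cmp C Y B P v (Cmp C Y (JJ X) B i1 g))"
    using conf_coker[OF e, of P "Add C Y P (Cmp C Y B P v i2)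
        (Cmp C Y B P v (Cmp C Y (JJ X) B i1 g))"] by auto
  have "Add C Z Z (Cmp C Z P Z phi psi) (Neg C Z Z (Idm C Z)) = Zero C Z Z"
  proof (rule conf_epi[OF e])
    show "Cmp C Y Z Z (Add C Z Z (Cmp C Z P Z phi psi) (Neg C Z Z (Idm C Z))) b = Zero C Y Z"
      by (simp add: psib cmp_eq_assoc[OF phiv] cmp_eq_assoc[OF biproductD(9)[OF bp]])
  qed simp_all
  then have 1: "Cmp C Z P Z phi psi = Idm C Z"
      using eq_iff_diff[of Z Z "Cmp C Z P Z phi psi" "Idm C Z"] by simp
  \<comment> \<open>The map p1 - g p2 vanishes on \<open>X\<close> and descends to \<open>k\<close>,
    through which the difference between the identity and psi phi factors.\<close>
  have "Cmp C X B (JJ X) (Add C B (JJ X) p1 (Neg C B (JJ X) (Cmp C B Y (JJ X) g p2)))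
      (Add C X B (Cmp C X (JJ X) B i1 (uu X)) (Cmp C X Y B i2 a)) = Zero C X (JJ X)"
    by (simp add: ga cmp_eq_assoc[OF biproductD(6)[OF bp]] cmp_eq_assoc[OF biproductD(7)[OF bp]]
        cmp_eq_assoc[OF biproductD(8)[OF bp]] cmp_eq_assoc[OF biproductD(9)[OF bp]])
  then obtain k where k [simp]: "k \<in> Hom C P (JJ X)"
      and kv: "Cmp C B P (JJ X) k v = Add C B (JJ X) p1 (Neg C B (JJ X) (Cmp C B Y (JJ X) g p2))"
    using conf_coker[OF P(1), of "JJ X" "Add C B (JJ X) p1
        (Neg C B (JJ X) (Cmp C B Y (JJ X) g p2))"] by auto
  have "Add C P P (Add C P P (Cmp C P Z P psi phi) (Cmp C P B P v (Cmp C P (JJ X) B i1 k)))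
      (Neg C P P (Idm C P)) = Zero C P P"
  proof (rule conf_epi[OF P(1)])
    have "Cmp C B P P (Add C P P (Add C P P (Cmp C P Z P psi phi)
        (Cmp C P B P v (Cmp C P (JJ X) B i1 k))) (Neg C P P (Idm C P))) v = Add C B P
        (Cmp C B B P v (Add C B B (Cmp C B (JJ X) B i1 p1) (Cmp C B Y B i2 p2))) (Neg C B P v)"
      by (simp add: phiv kv cmp_eq_assoc[OF psib] add_ac del: biproductD(10)[OF bp])
    then show
        "Cmp C B P P (Add C P P (Add C P P (Cmp C P Z P psi phi)
        (Cmp C P B P v (Cmp C P (JJ X) B i1 k))) (Neg C P P (Idm C P))) v = Zero C B P" by simp
  qed simp_all
  then have "Add C P P (Cmp C P Z P psi phi) (Cmp C P B P v (Cmp C P (JJ X) B i1 k)) = Idm C P"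
      using eq_iff_diff[of P P "Add C P P (Cmp C P Z P psi phi)
      (Cmp C P B P v (Cmp C P (JJ X) B i1 k))" "Idm C P"] by simp
  then have
      "Cmp C P Z P psi phi
      = Add C P P (Neg C P P (Cmp C P B P v (Cmp C P (JJ X) B i1 k))) (Idm C P)"
    by (metis (no_types, lifting) add_commute add_neg_cancel(2) biproductD(1,2) bp cmp_in
        hull_simps(1) k phi psi neg_in
        \<open>X \<in> Obj C\<close> \<open>Z \<in> Obj C\<close> conf_obj[OF P(1)] conf_hom[OF P(1)])
  moreover have "Cmp C P (JJ X) P (Cmp C (JJ X) B P v i1) k \<in> I P P"
      by (rule null_through[OF hull_inj[of X]]) simp_all
  ultimately have 2: "cls P P (Cmp C P Z P psi phi) = cls P P (Idm C P)"
      by (intro cls_eqI[OF ideal_neg]) simp_all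
  have iso: "is_iso Q P Z (cls P Z phi)"
    by (rule Q.is_isoI[where g = "cls Z P psi"]) (simp_all add: 1 2)
  have "Add C Z (SS X) (Cmp C Z P (SS X) h psi) (Neg C Z (SS X) w) = Zero C Z (SS X)"
  proof (rule conf_epi[OF e])
    show "Cmp C Y Z (SS X) (Add C Z (SS X) (Cmp C Z P (SS X) h psi) (Neg C Z (SS X) w)) b
        = Zero C Y (SS X)"
      by (simp add: psib cmp_eq_assoc[OF hv] wb cmp_eq_assoc[OF biproductD(6)[OF bp]]
        cmp_eq_assoc[OF biproductD(8)[OF bp]])
  qed simp_all
  then have "Cmp C Z P (SS X) h psi = w" using eq_iff_diff[of Z "SS X" "Cmp C Z P (SS X) h psi" w]
      by simp
  then have "Cmp C P Z (SS X) w phi = Cmp C P P (SS X) h (Cmp C P Z P psi phi)"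
      by (auto simp: cmp_assoc[symmetric] simp del: cmp_assoc)
  then have
      "cls P (SS X) (Cmp C P Z (SS X) w phi)
      = Cmp Q P P (SS X) (cls P (SS X) h) (cls P P (Cmp C P Z P psi phi))" by simp
  also have "\<dots> = cls P (SS X) h" unfolding 2 by simp
  finally have 3: "cls P (SS X) (Cmp C P Z (SS X) w phi) = cls P (SS X) h" .
  have 4: "Cmp C Y P Z phi (Cmp C Y B P v i2) = b" using cmp_eq_assoc[OF phiv] by simp
  show thesis by (rule that[OF bp P hv phi 4 iso 3])
qed

text \<open>A cocone (al, be) corresponds to the map - al p1 + be p2 on the biproduct, which
  vanishes on \<open>X\<close>. The signs arise because \<open>v\<close> kills the sum i1 u + i2 a
  rather than a difference.\<close>

lemma pushout_of_conf:
  assumes bp: "biproduct C (JJ X) Y B i1 i2 p1 p2" and X [simp]: "X \<in> Obj C"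
      and Y [simp]: "Y \<in> Obj C"
    and a [simp]: "a \<in> Hom C X Y"
        and P: "(X, B, P, Add C X B (Cmp C X (JJ X) B i1 (uu X)) (Cmp C X Y B i2 a), v) \<in> E"
  shows "is_pushout C X (JJ X) Y P (uu X) a (Neg C (JJ X) P (Cmp C (JJ X) B P v i1))
      (Cmp C Y B P v i2)"
proof -
  note [simp] = biproductD[OF bp] conf_obj[OF P] conf_hom[OF P]
  have ve: "Add C X P (Cmp C X B P v (Cmp C X (JJ X) B i1 (uu X)))
      (Cmp C X B P v (Cmp C X Y B i2 a)) = Zero C X P" using conf_zero[OF P] by simp
  have 1: "Cmp C X B P v (Cmp C X Y B i2 a)
      = Neg C X P (Cmp C X B P v (Cmp C X (JJ X) B i1 (uu X)))" by (rule neg_unique)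
      (use ve in simp_all)
  note bps = cmp_eq_assoc[OF biproductD(6)[OF bp]] cmp_eq_assoc[OF biproductD(7)[OF bp]]
        cmp_eq_assoc[OF biproductD(8)[OF bp]] cmp_eq_assoc[OF biproductD(9)[OF bp]]
  have "\<exists>!c. c \<in> Hom C P W \<and> Cmp C (JJ X) P W c (Neg C (JJ X) P (Cmp C (JJ X) B P v i1)) = al
      \<and> Cmp C Y P W c (Cmp C Y B P v i2) = be"
    if [simp]: "W \<in> Obj C" "al \<in> Hom C (JJ X) W" "be \<in> Hom C Y W"
        and eq: "Cmp C X (JJ X) W al (uu X) = Cmp C X Y W be a" for W al be
  proof -
    have "Cmp C X B W (Add C B W (Neg C B W (Cmp C B (JJ X) W al p1)) (Cmp C B Y W be p2))
        (Add C X B (Cmp C X (JJ X) B i1 (uu X)) (Cmp C X Y B i2 a)) = Zero C X W"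
      by (simp add: bps eq)
    then obtain c where c [simp]: "c \<in> Hom C P W"
        and cv: "Cmp C B P W c v
        = Add C B W (Neg C B W (Cmp C B (JJ X) W al p1)) (Cmp C B Y W be p2)"
      using conf_coker[OF P, of W "Add C B W (Neg C B W (Cmp C B (JJ X) W al p1))
          (Cmp C B Y W be p2)"] by auto
    show ?thesis
    proof (rule ex1I[of _ c])
      show c2: "c \<in> Hom C P W \<and> Cmp C (JJ X) P W c (Neg C (JJ X) P (Cmp C (JJ X) B P v i1)) = al
          \<and> Cmp C Y P W c (Cmp C Y B P v i2) = be"
        by (simp add: cmp_eq_assoc[OF cv] bps)
      fix c' assume c':
          "c' \<in> Hom C P W \<and> Cmp C (JJ X) P W c' (Neg C (JJ X) P (Cmp C (JJ X) B P v i1)) = al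
          \<and> Cmp C Y P W c' (Cmp C Y B P v i2) = be"
      define d where "d = Add C P W c' (Neg C P W c)"
      have [simp]: "c' \<in> Hom C P W" using c' by simp
      then have [simp]: "d \<in> Hom C P W" by (simp add: d_def)
      have "Neg C (JJ X) W (Neg C (JJ X) W (Cmp C (JJ X) P W c' (Cmp C (JJ X) B P v i1)))
          = Neg C (JJ X) W
          (Neg C (JJ X) W (Cmp C (JJ X) P W c (Cmp C (JJ X) B P v i1)))" using c' c2 by simp
      then have e1:
          "Cmp C (JJ X) P W c' (Cmp C (JJ X) B P v i1) = Cmp C (JJ X) P W c (Cmp C (JJ X) B P v i1)"
          by simp
      have d0: "Cmp C (JJ X) P W d (Cmp C (JJ X) B P v i1) = Zero C (JJ X) W"
          by (simp add: d_def e1)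
      have d0': "Cmp C Y P W d (Cmp C Y B P v i2) = Zero C Y W" using c' c2 by (simp add: d_def)
      have "Cmp C B P W d v
          = Cmp C B P W d
          (Cmp C B B P v (Add C B B (Cmp C B (JJ X) B i1 p1) (Cmp C B Y B i2 p2)))" by simp
      also have
          "\<dots> = Add C B W (Cmp C B (JJ X) W (Cmp C (JJ X) P W d (Cmp C (JJ X) B P v i1)) p1)
          (Cmp C B Y W (Cmp C Y P W d (Cmp C Y B P v i2)) p2)" by
          (simp del: biproductD(10)[OF bp])
      also have "\<dots> = Zero C B W" unfolding d0 d0' by simp
      finally have "d = Zero C P W" by (intro conf_epi[OF P]) simp_all
      then show "c' = c" using eq_iff_diff[of P W c' c] by (simp add: d_def)
    qed
  qed
  then show ?thesis unfolding is_pushout_def by (simp add: 1)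
qed

subsection \<open>The triangulated structure\<close>

abbreviation std_tris where "std_tris \<equiv> standard_triangles C E I"

definition distinguished :: "('o, 'm set) tri set" where
  "distinguished = {t \<in> triangles Q Sig. \<exists>t0\<in>conf_tris. tri_iso Q Sig t0 t}"

lemma conf_tri_std:
  assumes t: "t \<in> conf_tris"
  shows "\<exists>t0\<in>std_tris. t0 \<in> triangles Q Sig \<and> tri_iso Q Sig t0 t"
proof -
  obtain X Y Z a b w where t_eq: "t = (X, Y, Z, cls X Y a, cls Y Z b, cls Z (SS X) w)"
      and ct: "conf_tri X Y Z a b w"
    using t by (auto simp: conf_tris_def)
  have [simp]: "X \<in> Obj C" "Y \<in> Obj C" "Z \<in> Obj C" "a \<in> Hom C X Y" "b \<in> Hom C Y Z"
      "w \<in> Hom C Z (SS X)"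
    using ct by (auto elim: conf_triE)
  obtain B i1 i2 p1 p2 P v h phi where bp: "biproduct C (JJ X) Y B i1 i2 p1 p2"
    and P: "(X, B, P, Add C X B (Cmp C X (JJ X) B i1 (uu X)) (Cmp C X Y B i2 a), v) \<in> E"
        "(Y, P, SS X, Cmp C Y B P v i2, h) \<in> E"
        and hv: "Cmp C B P (SS X) h v = Neg C B (SS X) (Cmp C B (JJ X) (SS X) (pp X) p1)"
    and phi [simp]: "phi \<in> Hom C P Z" and phiv: "Cmp C Y P Z phi (Cmp C Y B P v i2) = b"
        and iso: "is_iso Q P Z (cls P Z phi)"
    and w: "cls P (SS X) (Cmp C P Z (SS X) w phi) = cls P (SS X) h"
        by (rule conf_tri_pushout[OF ct])
  note [simp] = biproductD[OF bp] conf_obj[OF P(1)] conf_hom[OF P(1)] conf_obj[OF P(2)]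
      conf_hom[OF P(2)]
  let ?t0 = "(X, Y, P, cls X Y a, cls Y P (Cmp C Y B P v i2), cls P (SS X) h)"
  have "is_pushout C X (JJ X) Y P (uu X) a (Neg C (JJ X) P (Cmp C (JJ X) B P v i1))
      (Cmp C Y B P v i2)"
    by (rule pushout_of_conf[OF bp _ _ _ P(1)]) simp_all
  moreover have "Cmp C (JJ X) P (SS X) h (Neg C (JJ X) P (Cmp C (JJ X) B P v i1)) = pp X"
      "Cmp C Y P (SS X) h (Cmp C Y B P v i2) = Zero C Y (SS X)"
    by (simp_all add: cmp_eq_assoc[OF hv])
  ultimately have "?t0 \<in> std_tris"
    unfolding standard_triangles_def by (auto intro!: exI)
  moreover have "?t0 \<in> triangles Q Sig" by (simp add: Q.triangles_iff FOb_Sig)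
  moreover have "tri_iso Q Sig ?t0 t" unfolding t_eq
    by (rule Q.tri_isoI[OF Q.is_iso_id Q.is_iso_id iso])
      (simp_all add: phiv w FOb_Sig FAr_Sig[OF _ _ _ susp_lift_id])
  ultimately show ?thesis by blast
qed

text \<open>Adding the hull of \<open>X\<close> to \<open>Y\<close> turns \<open>f\<close> into an
  inflation. The projection back to \<open>Y\<close> is an isomorphism in the quotient, and the
  cokernel has the universal property of the pushout, hence is isomorphic to
  \<open>P\<close>.\<close>

lemma std_conf_tri:
  assumes t: "t \<in> std_tris"
  shows "\<exists>t0\<in>conf_tris. t \<in> triangles Q Sig \<and> tri_iso Q Sig t0 t"
proof -
  obtain X Y P f gp h t' where t_eq: "t = (X, Y, P, cls X Y f, cls Y P gp, cls P (SS X) h)"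
    and po: "is_pushout C X (JJ X) Y P (uu X) f t' gp"
    and h [simp]: "h \<in> Hom C P (SS X)" and ht: "Cmp C (JJ X) P (SS X) h t' = pp X"
    and hg: "Cmp C Y P (SS X) h gp = Zero C Y (SS X)"
    using t unfolding standard_triangles_def by auto
  have [simp]: "X \<in> Obj C" "Y \<in> Obj C" "P \<in> Obj C" "f \<in> Hom C X Y" "t' \<in> Hom C (JJ X) P"
      "gp \<in> Hom C Y P"
    and tu: "Cmp C X (JJ X) P t' (uu X) = Cmp C X Y P gp f"
    using po by (auto simp: is_pushout_def)
  have po1: "\<exists>!c. c \<in> Hom C P W \<and> Cmp C (JJ X) P W c t' = al \<and> Cmp C Y P W c gp = be"
    if "W \<in> Obj C" "al \<in> Hom C (JJ X) W" "be \<in> Hom C Y W"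
        "Cmp C X (JJ X) W al (uu X) = Cmp C X Y W be f" for W al be
    using po that unfolding is_pushout_def by blast
  obtain B i1 i2 p1 p2 where bp: "biproduct C (JJ X) Y B i1 i2 p1 p2"
      using ex_biproduct[of "JJ X" Y] by auto
  note [simp] = biproductD[OF bp]
  note bps = cmp_eq_assoc[OF biproductD(6)[OF bp]] cmp_eq_assoc[OF biproductD(7)[OF bp]]
        cmp_eq_assoc[OF biproductD(8)[OF bp]] cmp_eq_assoc[OF biproductD(9)[OF bp]]
  obtain P0 v0
      where e: "(X, B, P0, Add C X B (Cmp C X (JJ X) B i1 (uu X)) (Cmp C X Y B i2 f), v0) \<in> E"
    using conf_pushout[OF hull_conf[of X], of Y f B i1 i2 p1 p2] bp by auto
  note [simp] = conf_obj[OF e] conf_hom[OF e]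
  have "Cmp C X B P (Add C B P (Cmp C B Y P gp p2) (Neg C B P (Cmp C B (JJ X) P t' p1)))
      (Add C X B (Cmp C X (JJ X) B i1 (uu X)) (Cmp C X Y B i2 f)) = Zero C X
      P" by (simp add: bps tu)
  then obtain c' where c' [simp]: "c' \<in> Hom C P0 P"
      and c'v: "Cmp C B P0 P c' v0
      = Add C B P (Cmp C B Y P gp p2) (Neg C B P (Cmp C B (JJ X) P t' p1))"
    using conf_coker[OF e, of P "Add C B P (Cmp C B Y P gp p2)
        (Neg C B P (Cmp C B (JJ X) P t' p1))"] by auto
  have ve: "Add C X P0 (Cmp C X B P0 v0 (Cmp C X (JJ X) B i1 (uu X)))
      (Cmp C X B P0 v0 (Cmp C X Y B i2 f)) = Zero C X P0" using conf_zero[OF e] by simp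
  have vi: "Cmp C X B P0 v0 (Cmp C X Y B i2 f)
      = Neg C X P0 (Cmp C X B P0 v0 (Cmp C X (JJ X) B i1 (uu X)))" by (rule neg_unique)
      (use ve in simp_all)
  obtain c where c [simp]: "c \<in> Hom C P P0"
      and ct: "Cmp C (JJ X) P P0 c t' = Neg C (JJ X) P0 (Cmp C (JJ X) B P0 v0 i1)"
      and cg: "Cmp C Y P P0 c gp = Cmp C Y B P0 v0 i2"
    using po1[of P0 "Neg C (JJ X) P0 (Cmp C (JJ X) B P0 v0 i1)" "Cmp C Y B P0 v0 i2"] vi by auto
  have c'c: "Cmp C P P0 P c' c = Idm C P"
  proof -
    have "Cmp C (JJ X) P P (Cmp C P P0 P c' c) t' = t'" "Cmp C Y P P (Cmp C P P0 P c' c) gp = gp"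
        by (simp_all add: ct cg cmp_eq_assoc[OF c'v] bps)
    moreover have "Cmp C (JJ X) P P (Idm C P) t' = t'" "Cmp C Y P P (Idm C P) gp = gp" by simp_all
    ultimately show ?thesis using po1[of P t' gp] tu
        by (metis c c' cmp_in \<open>P \<in> Obj C\<close> conf_obj[OF e] id_in \<open>t' \<in> Hom C (JJ X) P\<close> \<open>gp \<in> Hom C Y
        P\<close>)
  qed
  have "Add C P0 P0 (Cmp C P0 P P0 c c') (Neg C P0 P0 (Idm C P0)) = Zero C P0 P0"
  proof (rule conf_epi[OF e])
    have "Cmp C B P0 P0 (Cmp C P0 P P0 c c') v0
        = Cmp C B B P0 v0 (Add C B B (Cmp C B (JJ X) B i1 p1) (Cmp C B Y B i2 p2))"
      by (simp add: c'v cmp_eq_assoc[OF ct] cmp_eq_assoc[OF cg] add_commute del: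
          biproductD(10)[OF bp])
    then show "Cmp C B P0 P0 (Add C P0 P0 (Cmp C P0 P P0 c c') (Neg C P0 P0 (Idm C P0))) v0
        = Zero C B P0" by simp
  qed simp_all
  then have cc': "Cmp C P0 P P0 c c' = Idm C P0"
      using eq_iff_diff[of P0 P0 "Cmp C P0 P P0 c c'" "Idm C P0"] by simp
  have ctri:
      "conf_tri X B P0 (Add C X B (Cmp C X (JJ X) B i1 (uu X)) (Cmp C X Y B i2 f)) v0
      (Cmp C P0 P (SS X) h c')"
    unfolding conf_tri_def
    by (intro conjI e bexI[of _ p1])
        (simp_all add: bps c'v cmp_eq_assoc[OF hg] ht cmp_eq_assoc[OF ht])
  let ?t0 =
      "(X, B, P0, cls X B (Add C X B (Cmp C X (JJ X) B i1 (uu X)) (Cmp C X Y B i2 f)), cls B P0 v0,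
      cls P0 (SS X) (Cmp C P0 P (SS X) h c'))"
  have t0: "?t0 \<in> conf_tris" using ctri unfolding conf_tris_def by auto
  have tt: "t \<in> triangles Q Sig" by (simp add: t_eq Q.triangles_iff FOb_Sig)
  have bp': "biproduct C Y (JJ X) B i2 i1 p2 p1"
    using bp add_commute[of B B "Cmp C B (JJ X) B i1 p1" "Cmp C B Y B i2 p2"]
        by (simp add: biproduct_def)
  have "tri_iso Q Sig ?t0 t" unfolding t_eq
  proof (rule Q.tri_isoI)
    show "is_iso Q X X (Idm Q X)" by (rule Q.is_iso_id) simp
    show "is_iso Q B Y (cls B Y p2)" by (rule biproduct_stable_iso[OF bp']) simp_all
    show "is_iso Q P0 P (cls P0 P c')"
      by (rule Q.is_isoI[where g = "cls P P0 c"]) (simp_all add: c'c cc')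
    show "Cmp Q X B Y (cls B Y p2) (cls X B (Add C X B (Cmp C X (JJ X) B i1 (uu X))
        (Cmp C X Y B i2 f))) = Cmp Q X X Y (cls X Y f) (Idm Q X)"
      by (simp add: bps)
    have "Cmp C B (JJ X) P t' p1 \<in> I B P" by (rule null_through[OF hull_inj[of X]]) simp_all
    then have "cls B P (Cmp C B P0 P c' v0) = cls B P (Cmp C B Y P gp p2)"
      by (intro cls_eqI[OF ideal_neg[of B P "Cmp C B (JJ X) P t' p1"]])
          (simp_all add: c'v add_commute)
    then show "Cmp Q B P0 P (cls P0 P c') (cls B P0 v0) = Cmp Q B Y P (cls Y P gp) (cls B Y p2)"
        by simp
  qed (simp add: FOb_Sig FAr_Sig[OF _ _ _ susp_lift_id])
  then show ?thesis using t0 tt by blast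
qed

lemma conf_trisI: "conf_tri X Y Z a b w
    \<Longrightarrow> (X, Y, Z, cls X Y a, cls Y Z b, cls Z (SS X) w) \<in> conf_tris"
  unfolding conf_tris_def by blast

lemma conf_tris_cases:
  assumes "t \<in> conf_tris"
  obtains X Y Z a b w where "t = (X, Y, Z, cls X Y a, cls Y Z b, cls Z (SS X) w)"
      "conf_tri X Y Z a b w"
  using assms unfolding conf_tris_def by blast

lemma distinguished_eq:
  "{t \<in> triangles Q Sig. \<exists>t0\<in>std_tris. tri_iso Q Sig t0 t} = distinguished"
proof -
  have "\<exists>t0\<in>conf_tris. tri_iso Q Sig t0 t" if t: "t \<in> triangles Q Sig" "t0 \<in> std_tris"
      "tri_iso Q Sig t0 t" for t t0
  proof -
    obtain t1 where "t1 \<in> conf_tris" "t0 \<in> triangles Q Sig" "tri_iso Q Sig t1 t0"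
        using std_conf_tri[OF t(2)] by auto
    then show ?thesis using t Q.tri_iso_trans conf_tris_triangles by blast
  qed
  moreover have "\<exists>t0\<in>std_tris. tri_iso Q Sig t0 t" if t: "t \<in> triangles Q Sig" "t0 \<in> conf_tris"
      "tri_iso Q Sig t0 t" for t t0
  proof -
    obtain t1 where "t1 \<in> std_tris" "t1 \<in> triangles Q Sig" "tri_iso Q Sig t1 t0"
        using conf_tri_std[OF t(2)] by auto
    then show ?thesis using t Q.tri_iso_trans conf_tris_triangles by blast
  qed
  ultimately show ?thesis unfolding distinguished_def by blast
qed

lemma conf_tris_distinguished: "conf_tris \<subseteq> distinguished"
  unfolding distinguished_def using conf_tris_triangles Q.tri_iso_refl by blast

text \<open>The given square commutes only modulo null maps, so the representative of the second
  arrow is first corrected; the filler is then the induced map of cokernels.\<close>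

lemma conf_tris_fills:
  assumes t: "t \<in> conf_tris" and t': "t' \<in> conf_tris"
  shows "Q.fills t t'"
proof -
  obtain X Y Z a b w where t_eq: "t = (X, Y, Z, cls X Y a, cls Y Z b, cls Z (SS X) w)"
      and ct: "conf_tri X Y Z a b w"
    using t by (rule conf_tris_cases)
  obtain X' Y' Z' a' b' w'
      where t'_eq: "t' = (X', Y', Z', cls X' Y' a', cls Y' Z' b', cls Z' (SS X') w')"
    and ct': "conf_tri X' Y' Z' a' b' w'"
    using t' by (rule conf_tris_cases)
  obtain g where e: "(X, Y, Z, a, b) \<in> E" and [simp]: "X \<in> Obj C" "Y \<in> Obj C" "Z \<in> Obj C"
    "a \<in> Hom C X Y" "b \<in> Hom C Y Z" "w \<in> Hom C Z (SS X)" "g \<in> Hom C Y (JJ X)"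
    and ga: "Cmp C X Y (JJ X) g a = uu X"
        and wb: "Cmp C Y Z (SS X) w b = Neg C Y (SS X) (Cmp C Y (JJ X) (SS X) (pp X) g)"
        by (rule conf_triE[OF ct])
  obtain g' where e': "(X', Y', Z', a', b') \<in> E" and [simp]: "X' \<in> Obj C" "Y' \<in> Obj C" "Z' \<in> Obj C"
    "a' \<in> Hom C X' Y'" "b' \<in> Hom C Y' Z'" "w' \<in> Hom C Z' (SS X')" "g' \<in> Hom C Y' (JJ X')"
    and ga': "Cmp C X' Y' (JJ X') g' a' = uu X'"
        and wb': "Cmp C Y' Z' (SS X') w' b'
        = Neg C Y' (SS X') (Cmp C Y' (JJ X') (SS X') (pp X') g')" by (rule conf_triE[OF ct'])
  have "\<exists>c\<in>Hom Q Z Z'. Cmp Q Y Z Z' c (cls Y Z b) = Cmp Q Y Y' Z' (cls Y' Z' b') G \<and>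
      Cmp Q Z (FOb Sig X) (FOb Sig X') (FAr Sig X X' F) (cls Z (SS X) w) = Cmp Q Z Z' (FOb Sig X')
          (cls Z' (SS X') w') c"
    if FG: "F \<in> Hom Q X X'" "G \<in> Hom Q Y Y'"
        "Cmp Q X Y Y' G (cls X Y a) = Cmp Q X X' Y' (cls X' Y' a') F" for F G
  proof -
    obtain al where al [simp]: "al \<in> Hom C X X'" and F: "F = cls X X' al" using FG(1)
        by (auto elim: cls_cases)
    obtain be' where be' [simp]: "be' \<in> Hom C Y Y'" and G: "G = cls Y Y' be'" using FG(2)
        by (auto elim: cls_cases)
    have "cls X Y' (Cmp C X Y Y' be' a) = cls X Y' (Cmp C X X' Y' a' al)" using FG(3) F G by simp
    then obtain m where m: "m \<in> I X Y'" "Cmp C X Y Y' be' a = Add C X Y' m (Cmp C X X' Y' a' al)"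
        and [simp]: "m \<in> Hom C X Y'"
      by (rule cls_eqE) simp_all
    obtain n where n: "n \<in> I Y Y'" and [simp]: "n \<in> Hom C Y Y'" and na: "Cmp C X Y Y' n a = m"
      using null_ext[OF e _ m(1)] by auto
    define be where "be = Add C Y Y' (Neg C Y Y' n) be'"
    have be [simp]: "be \<in> Hom C Y Y'" by (simp add: be_def)
    have G': "G = cls Y Y' be" unfolding G be_def
        by (rule cls_eqI[symmetric, OF ideal_neg[OF _ _ n]]) simp_all
    have sq: "Cmp C X Y Y' be a = Cmp C X X' Y' a' al" by (simp add: be_def m(2) na)
    have "Cmp C X Y Z' (Cmp C Y Y' Z' b' be) a = Zero C X Z'"
        by (simp add: sq cmp_eq_assoc[OF conf_zero[OF e']])
    then obtain c where c [simp]: "c \<in> Hom C Z Z'" and cb: "Cmp C Y Z Z' c b = Cmp C Y Y' Z' b' be"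
      using conf_coker[OF e, of Z' "Cmp C Y Y' Z' b' be"] by auto
    obtain h where h: "susp_lift C E X X' al h" using susp_lift_exists[of X X' al] by auto
    then obtain A where [simp]: "h \<in> Hom C (SS X) (SS X')" "A \<in> Hom C (JJ X) (JJ X')"
      and A: "Cmp C X (JJ X) (JJ X') A (uu X) = Cmp C X X' (JJ X') (uu X') al"
          "Cmp C (JJ X) (SS X) (SS X') h (pp X) = Cmp C (JJ X) (JJ X') (SS X') (pp X') A"
          using susp_lift_iff by auto
    \<comment> \<open>A g and g' be restrict along \<open>a\<close> to the same map, so they differ
      by some k b. This \<open>k\<close> is the defect of the third square, and it contributes only
      a map through the hull of X'.\<close>
    have "Cmp C X Y (JJ X') (Add C Y (JJ X') (Cmp C Y (JJ X) (JJ X') A g)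
        (Neg C Y (JJ X') (Cmp C Y Y' (JJ X') g' be))) a = Zero C X (JJ X')"
      by (simp add: ga A(1) sq cmp_eq_assoc[OF ga'])
    then obtain k where k [simp]: "k \<in> Hom C Z (JJ X')"
        and kb: "Cmp C Y Z (JJ X') k b
        = Add C Y (JJ X') (Cmp C Y (JJ X) (JJ X') A g)
        (Neg C Y (JJ X') (Cmp C Y Y' (JJ X') g' be))"
      using conf_coker[OF e, of "JJ X'" "Add C Y (JJ X') (Cmp C Y (JJ X) (JJ X') A g)
          (Neg C Y (JJ X') (Cmp C Y Y' (JJ X') g' be))"] by auto
    have "Add C Z (SS X') (Add C Z (SS X') (Cmp C Z (SS X) (SS X') h w) (Cmp C Z (JJ X') (SS X')
        (pp X') k)) (Neg C Z (SS X') (Cmp C Z Z' (SS X') w' c)) = Zero C Z (SS X')"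
    proof (rule conf_epi[OF e])
      show "Cmp C Y Z (SS X') (Add C Z (SS X') (Add C Z (SS X') (Cmp C Z (SS X) (SS X') h w)
          (Cmp C Z (JJ X') (SS X') (pp X') k)) (Neg C Z (SS X') (Cmp C Z Z' (SS X') w' c))) b = Zero
          C Y (SS X')"
        by (simp add: wb kb cb cmp_eq_assoc[OF A(2)] cmp_eq_assoc[OF wb'] add_assoc)
    qed simp_all
    then have "Add C Z (SS X') (Cmp C Z (SS X) (SS X') h w) (Cmp C Z (JJ X') (SS X') (pp X') k)
        = Cmp C Z Z' (SS X') w' c"
      using eq_iff_diff[of Z "SS X'" "Add C Z (SS X') (Cmp C Z (SS X) (SS X') h w)
          (Cmp C Z (JJ X') (SS X') (pp X') k)" "Cmp C Z Z' (SS X') w' c"] by simp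
    moreover have "Cmp C Z (JJ X') (SS X') (pp X') k \<in> I Z (SS X')"
        by (rule null_through[OF hull_inj[of X']]) simp_all
    ultimately have
        "cls Z (SS X') (Cmp C Z Z' (SS X') w' c) = cls Z (SS X') (Cmp C Z (SS X) (SS X') h w)"
      by (intro cls_eqI[of "Cmp C Z (JJ X') (SS X') (pp X') k"])
          (simp_all add: add_commute[of Z "SS X'" "Cmp C Z (JJ X') (SS X') (pp X') k"])
    then show ?thesis
      by (intro bexI[of _ "cls Z Z' c"]) (simp_all add: F G' cb FAr_Sig[OF _ _ _ h] FOb_Sig)
  qed
  then show ?thesis unfolding t_eq t'_eq Q.fills.simps by blast
qed

text \<open>If k b factors through an injective object as c l, the restriction of \<open>l\<close>
  to \<open>X\<close> extends to the hull of \<open>X\<close> as l'. The rest of \<open>l\<close>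
  descends to \<open>n\<close> on \<open>Z\<close>, and c l' descends to \<open>m\<close> on the
  suspension, whence k = c n - m w.\<close>

lemma conf_tris_coexact:
  assumes t: "t \<in> conf_tris"
  shows "Q.coexact t"
proof -
  obtain X Y Z a b w where t_eq: "t = (X, Y, Z, cls X Y a, cls Y Z b, cls Z (SS X) w)"
      and ct: "conf_tri X Y Z a b w"
    using t by (rule conf_tris_cases)
  obtain g where e: "(X, Y, Z, a, b) \<in> E" and [simp]: "X \<in> Obj C" "Y \<in> Obj C" "Z \<in> Obj C"
    "a \<in> Hom C X Y" "b \<in> Hom C Y Z" "w \<in> Hom C Z (SS X)" "g \<in> Hom C Y (JJ X)"
    and ga: "Cmp C X Y (JJ X) g a = uu X"
        and wb: "Cmp C Y Z (SS X) w b = Neg C Y (SS X) (Cmp C Y (JJ X) (SS X) (pp X) g)"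
        by (rule conf_triE[OF ct])
  have "\<exists>m\<in>Hom Q (SS X) W. F = Cmp Q Z (SS X) W m (cls Z (SS X) w)"
    if [simp]: "W \<in> Obj C" and F: "F \<in> Hom Q Z W"
        and z: "Cmp Q Y Z W F (cls Y Z b) = Zero Q Y W" for W F
  proof -
    obtain k where k [simp]: "k \<in> Hom C Z W" and F: "F = cls Z W k" using F
        by (auto elim: cls_cases)
    have "Cmp C Y Z W k b \<in> I Y W" using z F cls_zero_iff[of Y W "Cmp C Y Z W k b"] by simp
    then obtain K l c where K: "injective_object C E K" and [simp]: "l \<in> Hom C Y K" "c \<in> Hom C K W"
        and kb: "Cmp C Y Z W k b = Cmp C Y K W c l"
      using null_iff[of Y W] by auto
    note [simp] = inj_obj[OF K]
    obtain l' where [simp]: "l' \<in> Hom C (JJ X) K"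
        and l': "Cmp C X (JJ X) K l' (uu X) = Cmp C X Y K l a"
      using inj_ext[OF K hull_conf[of X], of "Cmp C X Y K l a"] by auto
    have "Cmp C X Y K (Add C Y K l (Neg C Y K (Cmp C Y (JJ X) K l' g))) a = Zero C X K"
        by (simp add: ga l')
    then obtain n where [simp]: "n \<in> Hom C Z K"
        and nb: "Cmp C Y Z K n b = Add C Y K l (Neg C Y K (Cmp C Y (JJ X) K l' g))"
      using conf_coker[OF e, of K "Add C Y K l (Neg C Y K (Cmp C Y (JJ X) K l' g))"] by auto
    have "Cmp C X (JJ X) W (Cmp C (JJ X) K W c l') (uu X) = Cmp C X Z W k (Cmp C X Y Z b a)"
        using cmp_eq_assoc[OF kb] by (simp add: l')
    then have "Cmp C X (JJ X) W (Cmp C (JJ X) K W c l') (uu X) = Zero C X W"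
        by (simp add: conf_zero[OF e])
    then obtain m where [simp]: "m \<in> Hom C (SS X) W"
        and mp: "Cmp C (JJ X) (SS X) W m (pp X) = Cmp C (JJ X) K W c l'"
      using conf_coker[OF hull_conf[of X], of W "Cmp C (JJ X) K W c l'"] by auto
    have "Add C Z W k
        (Neg C Z W (Add C Z W (Cmp C Z K W c n) (Cmp C Z (SS X) W (Neg C (SS X) W m) w))) = Zero C Z
        W"
    proof (rule conf_epi[OF e])
      show "Cmp C Y Z W
          (Add C Z W k
          (Neg C Z W (Add C Z W (Cmp C Z K W c n) (Cmp C Z (SS X) W (Neg C (SS X) W m) w)))) b =
          Zero C Y W"
        by (simp add: kb nb wb cmp_eq_assoc[OF mp] add_assoc)
    qed simp_all
    then have "k = Add C Z W (Cmp C Z K W c n) (Cmp C Z (SS X) W (Neg C (SS X) W m) w)"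
        using eq_iff_diff[of Z W k "Add C Z W (Cmp C Z K W c n)
        (Cmp C Z (SS X) W (Neg C (SS X) W m) w)"] by simp
    moreover have "Cmp C Z K W c n \<in> I Z W" by (rule null_through[OF K]) simp_all
    ultimately have "F = cls Z W (Cmp C Z (SS X) W (Neg C (SS X) W m) w)" unfolding F
        by (intro cls_eqI[of "Cmp C Z K W c n"]) simp_all
    then show ?thesis by (intro bexI[of _ "cls (SS X) W (Neg C (SS X) W m)"]) simp_all
  qed
  then show ?thesis unfolding t_eq Q.coexact.simps by (simp add: FOb_Sig)
qed

text \<open>Once \<open>Z\<close> is replaced by the pushout P, the rotated triangle belongs to the
  conflation Y -> P -> \<open>SS X\<close>. It remains to see that minus the suspension of
  \<open>a\<close> is a connecting map for it.\<close>

lemma conf_tris_rotate: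
  assumes t: "conf_tri X Y Z a b w"
  shows "(Y, Z, FOb Sig X, cls Y Z b, cls Z (SS X) w,
      Neg Q (FOb Sig X) (FOb Sig Y) (FAr Sig X Y (cls X Y a)))
    \<in> distinguished"
proof -
  have [simp]: "X \<in> Obj C" "Y \<in> Obj C" "Z \<in> Obj C" "a \<in> Hom C X Y" "b \<in> Hom C Y Z"
      "w \<in> Hom C Z (SS X)"
    using t by (auto elim: conf_triE)
  obtain B i1 i2 p1 p2 P v h phi where bp: "biproduct C (JJ X) Y B i1 i2 p1 p2"
    and P: "(X, B, P, Add C X B (Cmp C X (JJ X) B i1 (uu X)) (Cmp C X Y B i2 a), v) \<in> E"
        "(Y, P, SS X, Cmp C Y B P v i2, h) \<in> E"
        and hv: "Cmp C B P (SS X) h v = Neg C B (SS X) (Cmp C B (JJ X) (SS X) (pp X) p1)"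
    and phi [simp]: "phi \<in> Hom C P Z" and phiv: "Cmp C Y P Z phi (Cmp C Y B P v i2) = b"
        and iso: "is_iso Q P Z (cls P Z phi)"
    and w: "cls P (SS X) (Cmp C P Z (SS X) w phi) = cls P (SS X) h" by (rule conf_tri_pushout[OF t])
  note [simp] = biproductD[OF bp] conf_obj[OF P(1)] conf_hom[OF P(1)] conf_obj[OF P(2)]
      conf_hom[OF P(2)]
  note bps = cmp_eq_assoc[OF biproductD(6)[OF bp]] cmp_eq_assoc[OF biproductD(7)[OF bp]]
        cmp_eq_assoc[OF biproductD(8)[OF bp]] cmp_eq_assoc[OF biproductD(9)[OF bp]]
  obtain hh where hh: "susp_lift C E X Y a hh" using susp_lift_exists[of X Y a] by auto
  then obtain F where [simp]: "hh \<in> Hom C (SS X) (SS Y)" "F \<in> Hom C (JJ X) (JJ Y)"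
      and F: "Cmp C X (JJ X) (JJ Y) F (uu X) = Cmp C X Y (JJ Y) (uu Y) a"
          "Cmp C (JJ X) (SS X) (SS Y) hh (pp X) = Cmp C (JJ X) (JJ Y) (SS Y) (pp Y) F"
          using susp_lift_iff by auto
  \<comment> \<open>With \<open>F\<close> over \<open>a\<close>, the map - F p1 + uu p2 into the
    hull of \<open>Y\<close> vanishes on \<open>X\<close> and descends to \<open>G\<close>. This is
    the comparison with the hull that \<open>conf_tri\<close> asks for: it extends
    \<open>uu Y\<close> along Y -> P.\<close>
  have "Cmp C X B (JJ Y) (Add C B (JJ Y) (Neg C B (JJ Y) (Cmp C B (JJ X) (JJ Y) F p1))
      (Cmp C B Y (JJ Y) (uu Y) p2)) (Add C X B (Cmp C X (JJ X) B i1 (uu X)) (Cmp C X Y B i2 a)) =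
      Zero C X (JJ Y)" by (simp add: bps F)
  then obtain G where [simp]: "G \<in> Hom C P (JJ Y)"
      and Gv: "Cmp C B P (JJ Y) G v
      = Add C B (JJ Y) (Neg C B (JJ Y) (Cmp C B (JJ X) (JJ Y) F p1))
      (Cmp C B Y (JJ Y) (uu Y) p2)"
    using conf_coker[OF P(1), of "JJ Y" "Add C B (JJ Y)
        (Neg C B (JJ Y) (Cmp C B (JJ X) (JJ Y) F p1)) (Cmp C B Y (JJ Y) (uu Y) p2)"] by auto
  have "Add C P (SS Y) (Cmp C P (SS X) (SS Y) (Neg C (SS X) (SS Y) hh) h)
      (Neg C P (SS Y) (Neg C P (SS Y) (Cmp C P (JJ Y) (SS Y) (pp Y) G))) = Zero C P (SS Y)"
  proof (rule conf_epi[OF P(1)])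
    show "Cmp C B P (SS Y) (Add C P (SS Y) (Cmp C P (SS X) (SS Y) (Neg C (SS X) (SS Y) hh) h)
        (Neg C P (SS Y) (Neg C P (SS Y) (Cmp C P (JJ Y) (SS Y) (pp Y) G)))) v = Zero C B (SS
        Y)" by (simp add: hv Gv cmp_eq_assoc[OF F(2)])
  qed simp_all
  then have
      "Cmp C P (SS X) (SS Y) (Neg C (SS X) (SS Y) hh) h
      = Neg C P (SS Y) (Cmp C P (JJ Y) (SS Y) (pp Y) G)"
    using eq_iff_diff[of P "SS Y" "Cmp C P (SS X) (SS Y) (Neg C (SS X) (SS Y) hh) h" "Neg C P (SS Y)
        (Cmp C P (JJ Y) (SS Y) (pp Y) G)"] by simp
  then have "conf_tri Y P (SS X) (Cmp C Y B P v i2) h (Neg C (SS X) (SS Y) hh)"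
    unfolding conf_tri_def by (intro conjI P bexI[of _ G]) (simp_all add: cmp_eq_assoc[OF Gv] bps)
  then have ct:
      "(Y, P, SS X, cls Y P (Cmp C Y B P v i2), cls P (SS X) h,
      cls (SS X) (SS Y) (Neg C (SS X) (SS Y) hh)) \<in> conf_tris"
    by (rule conf_trisI)
  have "tri_iso Q Sig (Y, P, SS X, cls Y P (Cmp C Y B P v i2), cls P (SS X) h,
      cls (SS X) (SS Y) (Neg C (SS X) (SS Y) hh))
    (Y, Z, SS X, cls Y Z b, cls Z (SS X) w, cls (SS X) (SS Y) (Neg C (SS X) (SS Y) hh))"
    by (rule Q.tri_isoI[OF Q.is_iso_id iso Q.is_iso_id])
      (simp_all add: phiv w FOb_Sig FAr_Sig[OF _ _ _ susp_lift_id])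
  then show ?thesis unfolding distinguished_def mem_Collect_eq
    by (intro conjI bexI[OF _ ct])
        (simp_all add: FAr_Sig[OF _ _ _ hh] FOb_Sig Q.triangles_iff del: tri_iso.simps)
qed

end

lemma (in preadditive_category) add_neg_neg_cancel:
  assumes [simp]: "X \<in> Obj C" "Y \<in> Obj C" "f \<in> Hom C X Y" "g \<in> Hom C X Y"
  shows "Add C X Y (Neg C X Y f) (Add C X Y (Neg C X Y g) (Add C X Y f g)) = Zero C X Y"
  by (subst add_commute[of X Y f g]) simp_all

section \<open>Pretriangulated structure and octahedral axiom\<close>

context frobenius_category
begin

lemma FOb_Sig_in [simp]: "X \<in> Obj C \<Longrightarrow> FOb Sig X \<in> Obj C"
  by (simp add: FOb_Sig)

lemma distinguishedI: "\<lbrakk>t \<in> triangles Q Sig; t0 \<in> conf_tris; tri_iso Q Sig t0 t\<rbrakk>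
    \<Longrightarrow> t \<in> distinguished"
  unfolding distinguished_def by blast

lemma distinguishedE:
  assumes "t \<in> distinguished"
  obtains t0 where "t0 \<in> conf_tris" "t0 \<in> triangles Q Sig" "t \<in> triangles Q Sig"
      "tri_iso Q Sig t0 t"
  using assms conf_tris_triangles unfolding distinguished_def by blast

lemma distinguished_iso:
  "\<lbrakk>t \<in> distinguished; t' \<in> triangles Q Sig; tri_iso Q Sig t t'\<rbrakk> \<Longrightarrow> t' \<in> distinguished"
  by (erule distinguishedE) (blast intro: distinguishedI Q.tri_iso_trans)

lemma tri_iso_rotate:
  assumes t: "(X, Y, Z, u, v, w) \<in> triangles Q Sig"
      and t': "(X', Y', Z', u', v', w') \<in> triangles Q Sig"
    and iso: "tri_iso Q Sig (X, Y, Z, u, v, w) (X', Y', Z', u', v', w')"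
  shows "tri_iso Q Sig (Y, Z, FOb Sig X, v, w, (Neg Q (FOb Sig X) (FOb Sig Y) (FAr Sig X Y u))) (Y',
      Z', FOb Sig X', v', w', (Neg Q (FOb Sig X') (FOb Sig Y') (FAr Sig X' Y' u')))"
proof -
  note [simp] = t[unfolded Q.triangles_iff] t'[unfolded Q.triangles_iff]
  from iso obtain a b c where abc: "is_iso Q X X' a" "is_iso Q Y Y' b" "is_iso Q Z Z' c"
    and sq: "Cmp Q X Y Y' b u = Cmp Q X X' Y' u' a" "Cmp Q Y Z Z' c v = Cmp Q Y Y' Z' v' b"
        "Cmp Q Z (FOb Sig X) (FOb Sig X') (FAr Sig X X' a) w = Cmp Q Z Z' (FOb Sig X') w' c" by auto
  have ab: "a \<in> Hom Q X X'" "b \<in> Hom Q Y Y'" using abc by (auto simp: is_iso_def)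
  have Sa: "is_iso Q (FOb Sig X) (FOb Sig X') (FAr Sig X X' a)"
    by (rule functor_iso[OF Q.S_functor abc(1)]) (use t t' in \<open>simp_all add: Q.triangles_iff\<close>)
  have S3: "Cmp Q (FOb Sig X) (FOb Sig Y) (FOb Sig Y') (FAr Sig Y Y' b) (FAr Sig X Y u)
      = Cmp Q (FOb Sig X) (FOb Sig X') (FOb Sig Y') (FAr Sig X' Y' u') (FAr Sig X X' a)"
    using Q.S_simps(4)[of X Y Y' u b] Q.S_simps(4)[of X X' Y' a u'] ab t t' sq(1)
        by (simp add: Q.triangles_iff)
  have "Cmp Q (FOb Sig X) (FOb Sig Y) (FOb Sig Y') (FAr Sig Y Y' b) (Neg Q (FOb Sig X) (FOb Sig Y)
      (FAr Sig X Y u)) = Cmp Q (FOb Sig X) (FOb Sig X') (FOb Sig Y') (Neg Q (FOb Sig X')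
      (FOb Sig Y') (FAr Sig X' Y' u')) (FAr Sig X X' a)"
    using ab t t' S3 by (simp add: Q.triangles_iff)
  then show ?thesis by (rule Q.tri_isoI[OF abc(2,3) Sa sq(2,3)])
qed

text \<open>The mapping cylinder: adding the hull of \<open>X\<close> to \<open>Y\<close> makes any
  map an inflation without changing \<open>Y\<close> in the quotient.\<close>

lemma conf_cylinder:
  assumes [simp]: "X \<in> Obj C" "Y \<in> Obj C" "f \<in> Hom C X Y"
  obtains B p2 e P v where "(X, B, P, e, v) \<in> E" "B \<in> Obj C" "e \<in> Hom C X B" "p2 \<in> Hom C B Y"
    "Cmp C X B Y p2 e = f" "is_iso Q B Y (cls B Y p2)"
proof -
  obtain B i1 i2 p1 p2 where bp: "biproduct C (JJ X) Y B i1 i2 p1 p2"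
      using ex_biproduct[of "JJ X" Y] by auto
  note [simp] = biproductD[OF bp]
  note bps = cmp_eq_assoc[OF biproductD(7)[OF bp]] cmp_eq_assoc[OF biproductD(9)[OF bp]]
  obtain P v where P: "(X, B, P, Add C X B (Cmp C X (JJ X) B i1 (uu X)) (Cmp C X Y B i2 f), v) \<in> E"
    using conf_pushout[OF hull_conf[of X], of Y f B i1 i2 p1 p2] bp by auto
  have bp': "biproduct C Y (JJ X) B i2 i1 p2 p1"
    using bp add_commute[of B B "Cmp C B (JJ X) B i1 p1" "Cmp C B Y B i2 p2"]
        by (simp add: biproduct_def)
  show thesis
    by (rule that[OF P _ _ _ _ biproduct_stable_iso(2)[OF bp']]) (simp_all add: bps)
qed

lemma distinguished_cone:
  assumes [simp]: "X \<in> Obj C" "Y \<in> Obj C" and F: "F \<in> Hom Q X Y"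
  shows "\<exists>Z v w. (X, Y, Z, F, v, w) \<in> distinguished"
proof -
  obtain f where [simp]: "f \<in> Hom C X Y" and F: "F = cls X Y f" using F by (auto elim: cls_cases)
  obtain B p2 e P v where P: "(X, B, P, e, v) \<in> E" and [simp]: "B \<in> Obj C" "e \<in> Hom C X B"
      "p2 \<in> Hom C B Y"
    and p2: "Cmp C X B Y p2 e = f" "is_iso Q B Y (cls B Y p2)"
        by (rule conf_cylinder[of X Y f]) simp_all
  note [simp] = conf_obj[OF P] conf_hom[OF P]
  obtain w where w: "conf_tri X B P e v w" by (rule conf_tri_exists[OF P])
  have [simp]: "w \<in> Hom C P (SS X)" using w by (auto elim: conf_triE)
  obtain q where [simp]: "q \<in> Hom Q Y B" and q: "Cmp Q B Y B q (cls B Y p2) = Idm Q B"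
    using p2(2) by (auto simp: is_iso_def)
  have "tri_iso Q Sig (X, B, P, cls X B e, cls B P v, cls P (SS X) w)
      (X, Y, P, F, Cmp Q Y B P (cls B P v) q, cls P (SS X) w)"
    by (rule Q.tri_isoI[OF Q.is_iso_id p2(2) Q.is_iso_id])
      (simp_all add: F p2(1) q[simplified] FOb_Sig FAr_Sig[OF _ _ _ susp_lift_id])
  then have "(X, Y, P, F, Cmp Q Y B P (cls B P v) q, cls P (SS X) w) \<in> distinguished"
    by (rule distinguishedI[OF _ conf_trisI[OF w], rotated]) (simp add: Q.triangles_iff F FOb_Sig)
  then show ?thesis by blast
qed

sublocale Q: pretriangulated_category Q Sig distinguished
proof (intro pretriangulated_category.intro pretriangulated_category_axioms.intro
    Q.suspended_category_axioms)
  show "distinguished \<subseteq> triangles Q Sig" by (auto simp: distinguished_def)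
  show "t' \<in> distinguished" if "t \<in> distinguished" "t' \<in> triangles Q Sig"
      "tri_iso Q Sig t t'" for t t'
    using that by (rule distinguished_iso)
  show "\<exists>Z v w. (X, Y, Z, u, v, w) \<in> distinguished" if "X \<in> Obj Q" "Y \<in> Obj Q"
      "u \<in> Hom Q X Y" for X Y u
    using that distinguished_cone by simp
  show "Q.fills t t'" if t: "t \<in> distinguished" "t' \<in> distinguished" for t t'
  proof -
    obtain t0 where 0: "t0 \<in> conf_tris" "t0 \<in> triangles Q Sig" "t \<in> triangles Q Sig"
        "tri_iso Q Sig t0 t"
      by (rule distinguishedE[OF t(1)])
    obtain t1 where 1: "t1 \<in> conf_tris" "t1 \<in> triangles Q Sig" "t' \<in> triangles Q Sig"
        "tri_iso Q Sig t1 t'"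
      by (rule distinguishedE[OF t(2)])
    have "Q.fills t0 t'" by (rule Q.fills_iso_right[OF 0(2) 1(2,3,4) conf_tris_fills[OF 0(1) 1(1)]])
    then show ?thesis
      by (rule Q.fills_iso_left[OF 0(2,3) 1(3) Q.tri_iso_sym[OF 0(2,3,4)]])
  qed
  show "Q.coexact t" if t: "t \<in> distinguished" for t
  proof -
    obtain t0 where 0: "t0 \<in> conf_tris" "t0 \<in> triangles Q Sig" "t \<in> triangles Q Sig"
        "tri_iso Q Sig t0 t"
      by (rule distinguishedE[OF t])
    then show ?thesis using Q.coexact_iso conf_tris_coexact by blast
  qed
  show "(Y, Z, FOb Sig X, v, w, Neg Q (FOb Sig X) (FOb Sig Y) (FAr Sig X Y u)) \<in> distinguished"
    if t: "(X, Y, Z, u, v, w) \<in> distinguished" for X Y Z u v w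
  proof -
    obtain t0 where t0: "t0 \<in> conf_tris" "t0 \<in> triangles Q Sig"
        and tt: "(X, Y, Z, u, v, w) \<in> triangles Q Sig"
      and iso: "tri_iso Q Sig t0 (X, Y, Z, u, v, w)"
      by (rule distinguishedE[OF t])
    obtain X' Y' Z' a b w'
        where t0_eq: "t0 = (X', Y', Z', cls X' Y' a, cls Y' Z' b, cls Z' (SS X') w')"
      and ct: "conf_tri X' Y' Z' a b w'" using t0(1) by (rule conf_tris_cases)
    show ?thesis
      by (rule distinguished_iso[OF conf_tris_rotate[OF ct] _
          tri_iso_rotate[OF t0(2)[unfolded t0_eq] tt iso[unfolded t0_eq]]])
        (use tt in \<open>simp add: Q.triangles_iff del: zero_Q_eq\<close>)
  qed
qed (rule Sig_ff)

text \<open>Cylinders replace both maps by composable inflations, for which the cokernels form a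
  conflation. What remains is to match the connecting maps; the identities that contain a suspended
  arrow hold modulo maps through hulls.\<close>

lemma octahedron:
  assumes T1: "(X, Y, Z', u', i, i') \<in> distinguished"
      and T2: "(Y, Z, X', v', j, j') \<in> distinguished"
    and T3: "(X, Z, Y', Cmp Q X Y Z v' u', k, k') \<in> distinguished"
  shows "\<exists>f\<in>Hom Q Z' Y'. \<exists>g\<in>Hom Q Y' X'.
      (Z', Y', X', f, g, Cmp Q X' (FOb Sig Y) (FOb Sig Z') (FAr Sig Y Z' i) j') \<in> distinguished \<and>
      Cmp Q Y Z' Y' f i = Cmp Q Y Z Y' k v' \<and> Cmp Q Z Y' X' g k = j \<and>
      Cmp Q Z' Y' (FOb Sig X) k' f = i' \<and> Cmp Q Y' X' (FOb Sig Y) j' g = Cmp Q Y' (FOb Sig X)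
          (FOb Sig Y) (FAr Sig X Y u') k'"
proof -
  have [simp]: "X \<in> Obj C" "Y \<in> Obj C" "Z \<in> Obj C" using Q.triD[OF T1] Q.triD[OF T2] by simp_all
  obtain u where [simp]: "u \<in> Hom C X Y" and u: "u' = cls X Y u" using Q.triD(4)[OF T1]
      by (auto elim: cls_cases)
  obtain v where [simp]: "v \<in> Hom C Y Z" and v: "v' = cls Y Z v" using Q.triD(4)[OF T2]
      by (auto elim: cls_cases)
  obtain Y0 p u0 A i0 where e1: "(X, Y0, A, u0, i0) \<in> E" and [simp]: "Y0 \<in> Obj C" "u0 \<in> Hom C X Y0"
      "p \<in> Hom C Y0 Y"
    and p: "Cmp C X Y0 Y p u0 = u" "is_iso Q Y0 Y (cls Y0 Y p)"
        by (rule conf_cylinder[of X Y u]) simp_all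
  note [simp] = conf_obj[OF e1] conf_hom[OF e1]
  obtain Z0 q v0 B j0 where e2: "(Y0, Z0, B, v0, j0) \<in> E" and [simp]: "Z0 \<in> Obj C"
      "v0 \<in> Hom C Y0 Z0" "q \<in> Hom C Z0 Z"
    and q: "Cmp C Y0 Z0 Z q v0 = Cmp C Y0 Y Z v p" "is_iso Q Z0 Z (cls Z0 Z q)"
        by (rule conf_cylinder[of Y0 Z "Cmp C Y0 Y Z v p"]) simp_all
  note [simp] = conf_obj[OF e2] conf_hom[OF e2]
  obtain D k0 f0 g0 where e3: "(X, Z0, D, Cmp C X Y0 Z0 v0 u0, k0) \<in> E"
      and e4: "(A, D, B, f0, g0) \<in> E"
    and fi: "Cmp C Y0 A D f0 i0 = Cmp C Y0 Z0 D k0 v0" and gk: "Cmp C Z0 D B g0 k0 = j0"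
    using conf_cmp[OF e1 e2] by auto
  note [simp] = conf_obj[OF e3] conf_hom[OF e3] conf_obj[OF e4] conf_hom[OF e4]
  obtain w3 where c3: "conf_tri X Z0 D (Cmp C X Y0 Z0 v0 u0) k0 w3" by (rule conf_tri_exists[OF e3])
  obtain G3 where [simp]: "w3 \<in> Hom C D (SS X)" "G3 \<in> Hom C Z0 (JJ X)"
    and G3: "Cmp C X Z0 (JJ X) G3 (Cmp C X Y0 Z0 v0 u0) = uu X"
        "Cmp C Z0 D (SS X) w3 k0 = Neg C Z0 (SS X) (Cmp C Z0 (JJ X) (SS X) (pp X) G3)"
        by (rule conf_triE[OF c3])
  \<comment> \<open>The connecting map of the first face is taken to be w3 f0, which makes one of
    the octahedral identities strict.\<close>
  have c1: "conf_tri X Y0 A u0 i0 (Cmp C A D (SS X) w3 f0)"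
    unfolding conf_tri_def
    by (intro conjI e1 bexI[of _ "Cmp C Y0 Z0 (JJ X) G3 v0"])
        (use G3(1) in \<open>simp_all add: fi cmp_eq_assoc[OF G3(2)]\<close>)
  obtain w2 where c2: "conf_tri Y0 Z0 B v0 j0 w2" by (rule conf_tri_exists[OF e2])
  obtain G2 where [simp]: "w2 \<in> Hom C B (SS Y0)" "G2 \<in> Hom C Z0 (JJ Y0)"
    and G2: "Cmp C Y0 Z0 (JJ Y0) G2 v0 = uu Y0"
        "Cmp C Z0 B (SS Y0) w2 j0 = Neg C Z0 (SS Y0) (Cmp C Z0 (JJ Y0) (SS Y0) (pp Y0) G2)"
        by (rule conf_triE[OF c2])
  obtain hu where hu: "susp_lift C E X Y0 u0 hu" using susp_lift_exists[of X Y0 u0] by auto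
  then obtain U where [simp]: "hu \<in> Hom C (SS X) (SS Y0)" "U \<in> Hom C (JJ X) (JJ Y0)"
    and U: "Cmp C X (JJ X) (JJ Y0) U (uu X) = Cmp C X Y0 (JJ Y0) (uu Y0) u0"
        "Cmp C (JJ X) (SS X) (SS Y0) hu (pp X) = Cmp C (JJ X) (JJ Y0) (SS Y0) (pp Y0) U"
        using susp_lift_iff by auto
  \<comment> \<open>U G3 and G2 agree on \<open>X\<close>. Their difference descends to
    \<open>m2\<close> and accounts for the difference between w2 g0 and the suspension of
    \<open>u0\<close> after \<open>w3\<close>.\<close>
  have "Cmp C X Z0 (JJ Y0) (Add C Z0 (JJ Y0) (Cmp C Z0 (JJ X) (JJ Y0) U G3) (Neg C Z0 (JJ Y0) G2))
      (Cmp C X Y0 Z0 v0 u0) = Zero C X (JJ Y0)"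
    using G3(1) by (simp add: U(1) cmp_eq_assoc[OF G2(1)])
  then obtain m2 where [simp]: "m2 \<in> Hom C D (JJ Y0)"
      and m2: "Cmp C Z0 D (JJ Y0) m2 k0
      = Add C Z0 (JJ Y0) (Cmp C Z0 (JJ X) (JJ Y0) U G3) (Neg C Z0 (JJ Y0) G2)"
    using conf_coker[OF e3, of "JJ Y0" "Add C Z0 (JJ Y0) (Cmp C Z0 (JJ X) (JJ Y0) U G3)
        (Neg C Z0 (JJ Y0) G2)"] by auto
  have "Add C D (SS Y0) (Cmp C D B (SS Y0) w2 g0)
      (Neg C D (SS Y0) (Add C D (SS Y0) (Cmp C D (JJ Y0) (SS Y0) (pp Y0) m2)
      (Cmp C D (SS X) (SS Y0) hu w3))) = Zero C D (SS Y0)"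
  proof (rule conf_epi[OF e3])
    show "Cmp C Z0 D (SS Y0) (Add C D (SS Y0) (Cmp C D B (SS Y0) w2 g0)
        (Neg C D (SS Y0) (Add C D (SS Y0) (Cmp C D (JJ Y0) (SS Y0) (pp Y0) m2)
        (Cmp C D (SS X) (SS Y0) hu w3)))) k0 = Zero C Z0 (SS Y0)"
      by (simp add: gk G2 G3 m2 cmp_eq_assoc[OF U(2)] add_assoc add_neg_neg_cancel)
  qed simp_all
  then have
      "Cmp C D B (SS Y0) w2 g0
      = Add C D (SS Y0) (Cmp C D (JJ Y0) (SS Y0) (pp Y0) m2) (Cmp C D (SS X) (SS Y0) hu w3)"
    using eq_iff_diff[of D "SS Y0" "Cmp C D B (SS Y0) w2 g0" "Add C D (SS Y0)
        (Cmp C D (JJ Y0) (SS Y0) (pp Y0) m2) (Cmp C D (SS X) (SS Y0) hu w3)"] by simp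
  moreover have "Cmp C D (JJ Y0) (SS Y0) (pp Y0) m2 \<in> I D (SS Y0)"
      by (rule null_through[OF hull_inj[of Y0]]) simp_all
  ultimately have jg:
      "cls D (SS Y0) (Cmp C D B (SS Y0) w2 g0) = cls D (SS Y0) (Cmp C D (SS X) (SS Y0) hu w3)"
      by (intro cls_eqI[of "Cmp C D (JJ Y0) (SS Y0) (pp Y0) m2"]) simp_all
  obtain w4 where c4: "conf_tri A D B f0 g0 w4" by (rule conf_tri_exists[OF e4])
  obtain G4 where [simp]: "w4 \<in> Hom C B (SS A)" "G4 \<in> Hom C D (JJ A)"
    and G4: "Cmp C A D (JJ A) G4 f0 = uu A"
        "Cmp C D B (SS A) w4 g0 = Neg C D (SS A) (Cmp C D (JJ A) (SS A) (pp A) G4)"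
        by (rule conf_triE[OF c4])
  obtain hi where hi: "susp_lift C E Y0 A i0 hi" using susp_lift_exists[of Y0 A i0] by auto
  then obtain L where [simp]: "hi \<in> Hom C (SS Y0) (SS A)" "L \<in> Hom C (JJ Y0) (JJ A)"
    and L: "Cmp C Y0 (JJ Y0) (JJ A) L (uu Y0) = Cmp C Y0 A (JJ A) (uu A) i0"
        "Cmp C (JJ Y0) (SS Y0) (SS A) hi (pp Y0) = Cmp C (JJ Y0) (JJ A) (SS A) (pp A) L"
        using susp_lift_iff by auto
  \<comment> \<open>In the same way L G2 and G4 k0 agree on \<open>Y0\<close>, which identifies
    \<open>w4\<close> with the suspension of \<open>i0\<close> after \<open>w2\<close>, modulo the
    hull of \<open>A\<close>.\<close>
  have "Cmp C Y0 Z0 (JJ A) (Add C Z0 (JJ A) (Cmp C Z0 (JJ Y0) (JJ A) L G2)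
      (Neg C Z0 (JJ A) (Cmp C Z0 D (JJ A) G4 k0))) v0 = Zero C Y0 (JJ A)"
    by (simp add: G2(1) L(1) fi[symmetric] cmp_eq_assoc[OF G4(1)])
  then obtain m4 where [simp]: "m4 \<in> Hom C B (JJ A)"
      and m4: "Cmp C Z0 B (JJ A) m4 j0
      = Add C Z0 (JJ A) (Cmp C Z0 (JJ Y0) (JJ A) L G2)
      (Neg C Z0 (JJ A) (Cmp C Z0 D (JJ A) G4 k0))"
    using conf_coker[OF e2, of "JJ A" "Add C Z0 (JJ A) (Cmp C Z0 (JJ Y0) (JJ A) L G2)
        (Neg C Z0 (JJ A) (Cmp C Z0 D (JJ A) G4 k0))"] by auto
  have "Add C B (SS A) w4 (Neg C B (SS A) (Add C B (SS A) (Cmp C B (JJ A) (SS A) (pp A) m4)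
      (Cmp C B (SS Y0) (SS A) hi w2))) = Zero C B (SS A)"
  proof (rule conf_epi[OF e2])
    have "Cmp C Z0 B (SS A) w4 j0
        = Neg C Z0 (SS A)
        (Cmp C Z0 (JJ A) (SS A) (pp A) (Cmp C Z0 D (JJ A) G4 k0))" unfolding gk[symmetric] by
        (simp add: cmp_eq_assoc[OF G4(2)])
    then show
        "Cmp C Z0 B (SS A)
        (Add C B (SS A) w4
        (Neg C B (SS A) (Add C B (SS A) (Cmp C B (JJ A) (SS A) (pp A) m4)
        (Cmp C B (SS Y0) (SS A) hi w2)))) j0 = Zero C Z0 (SS A)"
      by (simp add: m4 G2 cmp_eq_assoc[OF L(2)] add_ac)
  qed simp_all
  then have "w4 = Add C B (SS A) (Cmp C B (JJ A) (SS A) (pp A) m4) (Cmp C B (SS Y0) (SS A) hi w2)"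
    using eq_iff_diff[of B "SS A" w4 "Add C B (SS A) (Cmp C B (JJ A) (SS A) (pp A) m4)
        (Cmp C B (SS Y0) (SS A) hi w2)"] by simp
  moreover have "Cmp C B (JJ A) (SS A) (pp A) m4 \<in> I B (SS A)"
      by (rule null_through[OF hull_inj[of A]]) simp_all
  ultimately have w4: "cls B (SS A) w4 = cls B (SS A) (Cmp C B (SS Y0) (SS A) hi w2)"
      by (intro cls_eqI[of "Cmp C B (JJ A) (SS A) (pp A) m4"]) simp_all
  note ct = conf_tris_distinguished[THEN subsetD, OF conf_trisI]
  show ?thesis
  proof (rule Q.octahedron_transport[OF T1 T2 T3 p(2) q(2)])
    show "Cmp Q X Y0 Y (cls Y0 Y p) (cls X Y0 u0) = u'" using p(1) by (simp add: u)
    show "Cmp Q Y0 Z0 Z (cls Z0 Z q) (cls Y0 Z0 v0) = Cmp Q Y0 Y Z v' (cls Y0 Y p)" using q(1)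
        by (simp add: v)
    show "(X, Y0, A, cls X Y0 u0, cls Y0 A i0,
        cls A (SS X) (Cmp C A D (SS X) w3 f0)) \<in> distinguished" by (rule ct[OF c1])
    show "(Y0, Z0, B, cls Y0 Z0 v0, cls Z0 B j0, cls B (SS Y0) w2) \<in> distinguished"
        by (rule ct[OF c2])
    show "(X, Z0, D, Cmp Q X Y0 Z0 (cls Y0 Z0 v0) (cls X Y0 u0), cls Z0 D k0,
        cls D (SS X) w3) \<in> distinguished"
      using ct[OF c3] by simp
    show "(A, D, B, cls A D f0, cls D B g0,
        Cmp Q B (FOb Sig Y0) (FOb Sig A) (FAr Sig Y0 A (cls Y0 A i0)) (cls B (SS Y0) w2)) \<in>
        distinguished"
      using ct[OF c4] by (simp add: w4 FAr_Sig[OF _ _ _ hi] FOb_Sig)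
  qed (simp_all add: fi gk jg FOb_Sig FAr_Sig[OF _ _ _ hu])
qed

section \<open>The axioms of a triangulated category\<close>

abbreviation T :: "('o, 'm set) tcat" where "T \<equiv> stable_tcat C E I"

lemma stable_sel [simp]:
  "Obj T = Obj C" "HomG T = HomG Q" "Cmp T = Cmp Q" "Idm T = Idm Q" "Susp T = Sig"
      "Dist T = distinguished"
  unfolding stable_tcat_def distinguished_eq[symmetric] by (simp_all add: cat.defs)

lemma stable_triangles [simp]: "triangles T = triangles Q"
  by (intro ext) (simp add: triangles_def)

lemma stable_is_iso [simp]: "is_iso T = is_iso Q"
  by (intro ext) (simp add: is_iso_def)

lemma stable_zero_object [simp]: "zero_object T = zero_object Q"
  by (intro ext) (simp add: zero_object_def)

lemma stable_tri_iso [simp]: "tri_iso T S t t' = tri_iso Q S t t'"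
  by (cases t; cases t') simp

lemma stable_additive: "additive_category T"
proof (intro additive_category.intro preadditive_category.intro additive_category_axioms.intro)
  show "\<exists>P i1 i2 p1 p2. biproduct T X Y P i1 i2 p1 p2" if "X \<in> Obj T" "Y \<in> Obj T" for X Y
    using Q.ex_biproduct[of X Y] that by (simp add: biproduct_def)
qed (use Q.hom_group Q.cmp_hom_left Q.cmp_hom_right Q.cmp_assoc Q.ex_zero_object in
      \<open>simp_all del: quot_sel(2) add: quot_sel(1)\<close>)

theorem stable_triangulated: "triangulated_category T"
proof (intro triangulated_category.intro triangulated_category_axioms.intro stable_additive)
  show "additive_functor T T (Susp T)"
    using Q.S_additive by (simp add: additive_functor_def is_functor_def)
  show "equivalence T T (Susp T)"
    using Sig_equivalence by (simp add: equivalence_def is_functor_def natural_iso_def)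
  show "Dist T \<subseteq> triangles T (Susp T)" using Q.tri_sub by simp
  show "t' \<in> Dist T" if "t \<in> Dist T" "t' \<in> triangles T (Susp T)" "tri_iso T (Susp T) t t'" for t t'
    using that distinguished_iso by simp
  show "(X, X, Z, Idm T X, Zero T X Z, Zero T Z (FOb (Susp T) X)) \<in> Dist T"
    if "X \<in> Obj T" "zero_object T Z" for X Z
  proof -
    have [simp]: "X \<in> Obj C" "Z \<in> Obj C" and Z: "zero_object Q Z" using that
        by (simp_all add: zero_object_def)
    \<comment> \<open>A zero object of the quotient is merely an injective object. The triangle is
      built on a genuine zero object and moved along the zero map, which is invertible in the
      quotient.\<close>
    obtain Z0 where Z0: "zero_object C Z0" using ex_zero_object by auto
    then have [simp]: "Z0 \<in> Obj C" by (simp add: zero_object_def)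
    have "conf_tri X X Z0 (Idm C X) (Zero C X Z0) (Zero C Z0 (SS X))"
      unfolding conf_tri_def using conf_id[of X Z0] Z0 by (auto intro!: bexI[of _ "uu X"])
    then have ct:
        "(X, X, Z0, cls X X (Idm C X), cls X Z0 (Zero C X Z0),
        cls Z0 (SS X) (Zero C Z0 (SS X))) \<in> conf_tris"
      by (rule conf_trisI)
    have iso: "is_iso Q Z0 Z (Zero Q Z0 Z)"
      using Q.zero_object_iff[of Z] Q.zero_object_iff[of Z0] Z zero_object_Q[OF Z0]
      by (intro Q.is_isoI[where g = "Zero Q Z Z0"]) simp_all
    have "tri_iso Q Sig (X, X, Z0, cls X X (Idm C X), cls X Z0 (Zero C X Z0),
        cls Z0 (SS X) (Zero C Z0 (SS X)))
      (X, X, Z, cls X X (Idm C X), cls X Z (Zero C X Z), cls Z (SS X) (Zero C Z (SS X)))"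
      by (rule Q.tri_isoI[OF Q.is_iso_id Q.is_iso_id iso])
          (simp_all add: FOb_Sig FAr_Sig[OF _ _ _ susp_lift_id])
    then have
        "(X, X, Z, cls X X (Idm C X), cls X Z (Zero C X Z),
        cls Z (SS X) (Zero C Z (SS X))) \<in> distinguished"
      by (rule distinguishedI[OF _ ct, rotated]) (simp add: Q.triangles_iff FOb_Sig)
    then show ?thesis by (simp add: FOb_Sig)
  qed
  show "\<exists>Z v w. (X, Y, Z, u, v, w) \<in> Dist T" if "X \<in> Obj T" "Y \<in> Obj T" "u \<in> Hom T X Y" for X Y u
    using that distinguished_cone by simp
  show "(X, Y, Z, u, v, w) \<in> Dist T \<longleftrightarrow>
      (Y, Z, FOb (Susp T) X, v, w, Neg T (FOb (Susp T) X) (FOb (Susp T) Y) (FAr (Susp T) X Y u)) \<in>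
          Dist T"
    if "(X, Y, Z, u, v, w) \<in> triangles T (Susp T)" for X Y Z u v w
    using that Q.tri_rotate Q.tri_rotate_back by auto
  show "\<exists>c\<in>Hom T Z Z'. Cmp T Y Z Z' c v = Cmp T Y Y' Z' v' b \<and>
        Cmp T Z (FOb (Susp T) X) (FOb (Susp T) X') (FAr (Susp T) X X' a) w = Cmp T Z Z'
            (FOb (Susp T) X') w' c"
    if "(X, Y, Z, u, v, w) \<in> Dist T" "(X', Y', Z', u', v', w') \<in> Dist T"
      "a \<in> Hom T X X'" "b \<in> Hom T Y Y'" "Cmp T X Y Y' b u = Cmp T X X' Y' u' a"
    for X Y Z u v w X' Y' Z' u' v' w' a b
    using Q.tri_fills[of "(X, Y, Z, u, v, w)" "(X', Y', Z', u', v', w')", unfolded Q.fills.simps]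
        that by simp
qed (use octahedron in simp)

end


section \<open>Exact functors and triangle functors\<close>

locale exact_functor = A: frobenius_category C E I + B: frobenius_category D E' I'
  for C :: "('o1, 'm1, 'z1) cat_scheme" and E and I
    and D :: "('o2, 'm2, 'z2) cat_scheme" and E' and I' +
  fixes F :: "('o1, 'm1, 'o2, 'm2) fctr"
  assumes F_additive: "additive_functor C D F"
    and F_conf: "(X, Y, Z, a, b) \<in> E \<Longrightarrow> (FOb F X, FOb F Y, FOb F Z, FAr F X Y a, FAr F Y Z b) \<in> E'"
    and F_inj: "injective_object C E K \<Longrightarrow> injective_object D E' (FOb F K)"
begin

abbreviation qF where "qF \<equiv> quot_fctr D I' F"

lemma F_functor: "is_functor C D F"
  using F_additive by (simp add: additive_functor_def)

lemmas F_simps [simp] = is_functorD[OF F_functor]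

lemma F_add [simp]:
  "\<lbrakk>X \<in> Obj C; Y \<in> Obj C; f \<in> Hom C X Y; f' \<in> Hom C X Y\<rbrakk>
    \<Longrightarrow> FAr F X Y (Add C X Y f f') = Add D (FOb F X) (FOb F Y) (FAr F X Y f) (FAr F X Y f')"
  using F_additive by (auto simp: additive_functor_def hom_def)

lemma F_zero [simp]: "\<lbrakk>X \<in> Obj C; Y \<in> Obj C\<rbrakk> \<Longrightarrow> FAr F X Y (Zero C X Y) = Zero D (FOb F X) (FOb F Y)"
  using F_add[of X Y "Zero C X Y" "Zero C X Y"]
  by (metis A.add_zero(1) A.zero_in B.add_left_cancel B.add_zero(1) B.zero_in F_simps(1,2))

lemma F_neg [simp]:
  assumes [simp]: "X \<in> Obj C" "Y \<in> Obj C" "f \<in> Hom C X Y"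
  shows "FAr F X Y (Neg C X Y f) = Neg D (FOb F X) (FOb F Y) (FAr F X Y f)"
  by (rule B.neg_unique) (simp_all flip: F_add)

lemma F_null:
  assumes [simp]: "X \<in> Obj C" "Y \<in> Obj C" and f: "f \<in> I X Y"
  shows "FAr F X Y f \<in> I' (FOb F X) (FOb F Y)"
proof -
  obtain K a b where K: "injective_object C E K" and [simp]: "a \<in> Hom C X K" "b \<in> Hom C K Y"
      and f: "f = Cmp C X K Y b a"
    using f A.null_iff by auto
  note [simp] = A.inj_obj[OF K]
  show ?thesis unfolding f by (simp add: B.null_through[OF F_inj[OF K]])
qed

lemma FOb_qF [simp]: "FOb qF = FOb F"
  by (simp add: quot_fctr_def)

lemma FAr_qF [simp]:
  assumes [simp]: "X \<in> Obj C" "Y \<in> Obj C" "f \<in> Hom C X Y"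
  shows "FAr qF X Y (A.cls X Y f) = B.cls (FOb F X) (FOb F Y) (FAr F X Y f)"
proof -
  have eq: "B.cls (FOb F X) (FOb F Y) (FAr F X Y f') = B.cls (FOb F X) (FOb F Y) (FAr F X Y f)"
    if f': "f' \<in> A.cls X Y f" for f'
  proof -
    obtain k where k: "k \<in> I X Y" "f' = Add C X Y k f" using A.in_cls_iff[THEN iffD1, OF _ _ _ f']
        by auto
    then have "k \<in> Hom C X Y" using A.ideal_in by auto
    then show ?thesis unfolding k(2) by (intro B.cls_eqI[OF F_null[OF _ _ k(1)]]) simp_all
  qed
  have "f \<in> A.cls X Y f" by (simp add: A.in_cls_iff_diff)
  moreover have
      "FAr qF X Y (A.cls X Y f) = (\<Union>f'\<in>A.cls X Y f. B.cls (FOb F X) (FOb F Y) (FAr F X Y f'))"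
    by (simp add: quot_fctr_def)
  moreover have "\<dots> = (\<Union>f'\<in>A.cls X Y f. B.cls (FOb F X) (FOb F Y) (FAr F X Y f))"
    by (intro SUP_cong refl eq)
  ultimately show ?thesis by auto
qed

lemma qF_functor: "is_functor A.Q B.Q qF"
  by (rule is_functorI) (auto elim!: A.cls_cases)

lemma qF_additive: "additive_functor A.Q B.Q qF"
  unfolding additive_functor_def by (intro conjI qF_functor) (auto simp: hom_def elim!: A.cls_cases)

lemma F_hull:
  assumes "X \<in> Obj C"
  shows "(FOb F X, FOb F (A.JJ X), FOb F (A.SS X), FAr F X (A.JJ X) (A.uu X),
      FAr F (A.JJ X) (A.SS X) (A.pp X)) \<in> E'"
    "injective_object D E' (FOb F (A.JJ X))"
  using F_conf[OF A.hull_conf[OF assms]] F_inj[OF A.hull_inj[OF assms]] by auto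

text \<open>\<open>F\<close> turns the chosen conflation of \<open>X\<close> into one with injective
  middle term that starts at F X. Its comparison with the chosen conflation of F X gives the
  isomorphism \<theta> between F of the suspension and the suspension of F X, and it also supplies
  the connecting maps of the image triangles.\<close>

lemma qF_triangle: "triangle_functor A.T B.T qF"
proof -
  have "\<exists>k h. k \<in> Hom D (FOb F (A.JJ X)) (B.JJ (FOb F X))
      \<and> h \<in> Hom D (FOb F (A.SS X)) (B.SS (FOb F X)) \<and>
      Cmp D (FOb F X) (FOb F (A.JJ X)) (B.JJ (FOb F X)) k (FAr F X (A.JJ X) (A.uu X)) = B.uu
          (FOb F X) \<and>
      Cmp D (FOb F (A.JJ X)) (FOb F (A.SS X)) (B.SS (FOb F X)) h (FAr F (A.JJ X) (A.SS X) (A.pp X))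
       = Cmp D (FOb F (A.JJ X)) (B.JJ (FOb F X)) (B.SS (FOb F X)) (B.pp (FOb F X)) k" if [simp]: "X
           \<in> Obj C" for X
    by (rule B.conf_map_exists[OF F_hull(1)[of X] B.hull_conf[of "FOb F X"] B.hull_inj, of "Idm D
        (FOb F X)"]) auto
  then obtain kk th where [simp]: "\<And>X. X \<in> Obj C \<Longrightarrow> kk X \<in> Hom D (FOb F (A.JJ X)) (B.JJ (FOb F X))"
    "\<And>X. X \<in> Obj C \<Longrightarrow> th X \<in> Hom D (FOb F (A.SS X)) (B.SS (FOb F X))"
    and kk: "\<And>X. X \<in> Obj C
        \<Longrightarrow> Cmp D (FOb F X) (FOb F (A.JJ X)) (B.JJ (FOb F X)) (kk X) (FAr F X (A.JJ X) (A.uu X)) =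
        B.uu (FOb F X)"
    and th: "\<And>X. X \<in> Obj C
        \<Longrightarrow> Cmp D (FOb F (A.JJ X)) (FOb F (A.SS X)) (B.SS (FOb F X)) (th X)
        (FAr F (A.JJ X) (A.SS X) (A.pp X)) = Cmp D (FOb F (A.JJ X)) (B.JJ (FOb F X))
        (B.SS (FOb F X)) (B.pp (FOb F X)) (kk X)"
    by metis
  define \<theta> where "\<theta> X = B.cls (FOb F (A.SS X)) (B.SS (FOb F X)) (th X)" for X
  have iso: "is_iso B.Q (FOb F (A.SS X)) (B.SS (FOb F X)) (\<theta> X)" if [simp]: "X \<in> Obj C" for X
    unfolding \<theta>_def
    by (rule B.conf_over_id_iso[OF F_hull(1) B.hull_conf F_hull(2) B.hull_inj _ _ kk th]) simp_all
  have nat: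
      "Cmp B.Q (FOb F (A.SS X)) (FOb F (A.SS Y)) (B.SS (FOb F Y)) (\<theta> Y) (FAr qF (A.SS X) (A.SS Y)
      (FAr A.Sig X Y G))
      = Cmp B.Q (FOb F (A.SS X)) (B.SS (FOb F X)) (B.SS (FOb F Y))
          (FAr B.Sig (FOb F X) (FOb F Y) (FAr qF X Y G)) (\<theta> X)"
    if [simp]: "X \<in> Obj C" "Y \<in> Obj C" and G: "G \<in> Hom A.Q X Y" for X Y G
  proof -
    obtain f where [simp]: "f \<in> Hom C X Y" and G: "G = A.cls X Y f" using G
        by (auto elim: A.cls_cases)
    obtain h where h: "susp_lift C E X Y f h" using A.susp_lift_exists[of X Y f] by auto
    then obtain g where [simp]: "h \<in> Hom C (A.SS X) (A.SS Y)" "g \<in> Hom C (A.JJ X) (A.JJ Y)"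
      and gh: "Cmp C X (A.JJ X) (A.JJ Y) g (A.uu X) = Cmp C X Y (A.JJ Y) (A.uu Y) f"
        "Cmp C (A.JJ X) (A.SS X) (A.SS Y) h (A.pp X) = Cmp C (A.JJ X) (A.JJ Y) (A.SS Y) (A.pp Y) g"
      using A.susp_lift_iff by auto
    obtain h' where h': "susp_lift D E' (FOb F X) (FOb F Y) (FAr F X Y f) h'"
      using B.susp_lift_exists[of "FOb F X" "FOb F Y" "FAr F X Y f"] by auto
    then obtain g' where [simp]: "h' \<in> Hom D (B.SS (FOb F X)) (B.SS (FOb F Y))"
        "g' \<in> Hom D (B.JJ (FOb F X)) (B.JJ (FOb F Y))"
      and gh': "Cmp D (FOb F X) (B.JJ (FOb F X)) (B.JJ (FOb F Y)) g' (B.uu (FOb F X))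
          = Cmp D (FOb F X) (FOb F Y) (B.JJ (FOb F Y)) (B.uu (FOb F Y)) (FAr F X Y f)" "Cmp D
          (B.JJ (FOb F X)) (B.SS (FOb F X)) (B.SS (FOb F Y)) h' (B.pp (FOb F X)) = Cmp D
          (B.JJ (FOb F X)) (B.JJ (FOb F Y)) (B.SS (FOb F Y)) (B.pp (FOb F Y)) g'"
      using B.susp_lift_iff by auto
    have Fg: "Cmp D (FOb F X) (FOb F (A.JJ X)) (FOb F (A.JJ Y)) (FAr F (A.JJ X) (A.JJ Y) g)
        (FAr F X (A.JJ X) (A.uu X)) = Cmp D (FOb F X) (FOb F Y) (FOb F (A.JJ Y))
        (FAr F Y (A.JJ Y) (A.uu Y)) (FAr F X Y f)"
      "Cmp D (FOb F (A.JJ X)) (FOb F (A.SS X)) (FOb F (A.SS Y)) (FAr F (A.SS X) (A.SS Y) h)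
          (FAr F (A.JJ X) (A.SS X) (A.pp X)) = Cmp D (FOb F (A.JJ X)) (FOb F (A.JJ Y))
          (FOb F (A.SS Y)) (FAr F (A.JJ Y) (A.SS Y) (A.pp Y)) (FAr F (A.JJ X) (A.JJ Y) g)"
      using gh by (simp_all flip: F_simps(4))
    \<comment> \<open>The two ways around the naturality square are both induced by maps of
      conflations over F f. Their difference lies over zero and is null.\<close>
    have "Add D (FOb F (A.SS X)) (B.SS (FOb F Y)) (Cmp D (FOb F (A.SS X)) (FOb F (A.SS Y))
        (B.SS (FOb F Y)) (th Y) (FAr F (A.SS X) (A.SS Y) h)) (Neg D (FOb F (A.SS X))
        (B.SS (FOb F Y)) (Cmp D (FOb F (A.SS X)) (B.SS (FOb F X)) (B.SS (FOb F Y)) h' (th X))) \<in>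
        I' (FOb F (A.SS X)) (B.SS (FOb F Y))"
    proof (rule B.conf_map_null[OF F_hull(1)[of X] B.hull_conf[of "FOb F Y"] B.hull_inj
        B.ideal_zero])
      show "Cmp D (FOb F X) (FOb F (A.JJ X)) (B.JJ (FOb F Y)) (Add D (FOb F (A.JJ X))
          (B.JJ (FOb F Y))
          (Cmp D (FOb F (A.JJ X)) (FOb F (A.JJ Y)) (B.JJ (FOb F Y)) (kk Y)
          (FAr F (A.JJ X) (A.JJ Y) g)) (Neg D (FOb F (A.JJ X)) (B.JJ (FOb F Y))
          (Cmp D (FOb F (A.JJ X)) (B.JJ (FOb F X)) (B.JJ (FOb F Y)) g' (kk X))))
          (FAr F X (A.JJ X) (A.uu X)) = Cmp D (FOb F X) (FOb F Y) (B.JJ (FOb F Y))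
          (B.uu (FOb F Y)) (Zero D (FOb F X) (FOb F Y))"
        by (simp add: Fg kk gh' B.cmp_eq_assoc[OF kk])
      show "(Cmp D (FOb F (A.JJ X)) (FOb F (A.SS X)) (B.SS (FOb F Y)) (Add D (FOb F (A.SS X))
          (B.SS (FOb F Y))
          (Cmp D (FOb F (A.SS X)) (FOb F (A.SS Y)) (B.SS (FOb F Y)) (th Y)
          (FAr F (A.SS X) (A.SS Y) h)) (Neg D (FOb F (A.SS X)) (B.SS (FOb F Y))
          (Cmp D (FOb F (A.SS X)) (B.SS (FOb F X)) (B.SS (FOb F Y)) h' (th X))))
          (FAr F (A.JJ X) (A.SS X) (A.pp X)))
          = Cmp D (FOb F (A.JJ X)) (B.JJ (FOb F Y)) (B.SS (FOb F Y)) (B.pp (FOb F Y))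
              (Add D (FOb F (A.JJ X)) (B.JJ (FOb F Y)) (Cmp D (FOb F (A.JJ X)) (FOb F (A.JJ Y))
              (B.JJ (FOb F Y)) (kk Y) (FAr F (A.JJ X) (A.JJ Y) g)) (Neg D (FOb F (A.JJ X))
              (B.JJ (FOb F Y))
              (Cmp D (FOb F (A.JJ X)) (B.JJ (FOb F X)) (B.JJ (FOb F Y)) g' (kk X))))"
        by (simp add: Fg th B.cmp_eq_assoc[OF th] B.cmp_eq_assoc[OF gh'(2)])
    qed simp_all
    then show ?thesis
        by (simp add: G A.FAr_Sig[OF _ _ _ h] B.FAr_Sig[OF _ _ _ h'] \<theta>_def B.cls_eq_iff)
  qed
  have dist: "(FOb F X, FOb F Y, FOb F Z, FAr qF X Y u, FAr qF Y Z v,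
      Cmp B.Q (FOb F Z) (FOb F (A.SS X)) (B.SS (FOb F X)) (\<theta> X) (FAr qF Z (A.SS X) w)) \<in>
          B.distinguished"
    if t: "(X, Y, Z, u, v, w) \<in> A.distinguished" for X Y Z u v w
  proof -
    obtain t0 where t0: "t0 \<in> A.conf_tris" and iso': "tri_iso A.Q A.Sig t0 (X, Y, Z, u, v, w)"
      by (rule A.distinguishedE[OF t])
    obtain X0 Y0 Z0 a b w0
        where t0_eq: "t0 = (X0, Y0, Z0, A.cls X0 Y0 a, A.cls Y0 Z0 b, A.cls Z0 (A.SS X0) w0)"
      and ct: "A.conf_tri X0 Y0 Z0 a b w0" using t0 by (rule A.conf_tris_cases)
    obtain g where e: "(X0, Y0, Z0, a, b) \<in> E" and [simp]: "X0 \<in> Obj C" "Y0 \<in> Obj C" "Z0 \<in> Obj C"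
      "a \<in> Hom C X0 Y0" "b \<in> Hom C Y0 Z0" "w0 \<in> Hom C Z0 (A.SS X0)" "g \<in> Hom C Y0 (A.JJ X0)"
      and ga: "Cmp C X0 Y0 (A.JJ X0) g a = A.uu X0"
      and wb: "Cmp C Y0 Z0 (A.SS X0) w0 b
          = Neg C Y0 (A.SS X0) (Cmp C Y0 (A.JJ X0) (A.SS X0) (A.pp X0) g)"
      by (rule A.conf_triE[OF ct])
    have Fga: "Cmp D (FOb F X0) (FOb F Y0) (FOb F (A.JJ X0)) (FAr F Y0 (A.JJ X0) g) (FAr F X0 Y0 a)
        = FAr F X0 (A.JJ X0) (A.uu X0)" using ga by (simp flip: F_simps(4))
    have Fwb: "Cmp D (FOb F Y0) (FOb F Z0) (FOb F (A.SS X0)) (FAr F Z0 (A.SS X0) w0) (FAr F Y0 Z0 b)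
        = Neg D (FOb F Y0) (FOb F (A.SS X0))
        (Cmp D (FOb F Y0) (FOb F (A.JJ X0)) (FOb F (A.SS X0))
        (FAr F (A.JJ X0) (A.SS X0) (A.pp X0)) (FAr F Y0 (A.JJ X0) g))"
      using wb by (simp flip: F_simps(4) F_neg)
    \<comment> \<open>The comparison with the hull of F X0 is \<open>kk\<close> after F g.\<close>
    have "B.conf_tri (FOb F X0) (FOb F Y0) (FOb F Z0) (FAr F X0 Y0 a) (FAr F Y0 Z0 b)
        (Cmp D (FOb F Z0) (FOb F (A.SS X0)) (B.SS (FOb F X0)) (th X0) (FAr F Z0 (A.SS X0) w0))"
      unfolding B.conf_tri_def
      by (intro conjI F_conf[OF e] bexI[of _ "Cmp D (FOb F Y0) (FOb F (A.JJ X0)) (B.JJ (FOb F X0))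
          (kk X0) (FAr F Y0 (A.JJ X0) g)"])
        (simp_all add: Fga Fwb kk B.cmp_eq_assoc[OF th])
    then have ct': "(FOb F X0, FOb F Y0, FOb F Z0, B.cls (FOb F X0) (FOb F Y0) (FAr F X0 Y0 a),
        B.cls (FOb F Y0) (FOb F Z0) (FAr F Y0 Z0 b), B.cls (FOb F Z0) (B.SS (FOb F X0))
            (Cmp D (FOb F Z0) (FOb F (A.SS X0)) (B.SS (FOb F X0)) (th X0) (FAr F Z0 (A.SS X0) w0)))
            \<in> B.conf_tris"
      by (rule B.conf_trisI)
    have tt: "X \<in> Obj C" "Y \<in> Obj C" "Z \<in> Obj C" "u \<in> Hom A.Q X Y" "v \<in> Hom A.Q Y Z"
        "w \<in> Hom A.Q Z (A.SS X)"
      using A.Q.triD[OF t] by (simp_all add: A.FOb_Sig)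
    note [simp] = tt
    note Fq = is_functorD[OF qF_functor, simplified]
    obtain p q r where pqr: "is_iso A.Q X0 X p" "is_iso A.Q Y0 Y q" "is_iso A.Q Z0 Z r"
      and sq: "Cmp A.Q X0 Y0 Y q (A.cls X0 Y0 a) = Cmp A.Q X0 X Y u p"
        "Cmp A.Q Y0 Z0 Z r (A.cls Y0 Z0 b) = Cmp A.Q Y0 Y Z v q"
        "Cmp A.Q Z0 (A.SS X0) (A.SS X) (FAr A.Sig X0 X p) (A.cls Z0 (A.SS X0) w0)
            = Cmp A.Q Z0 Z (A.SS X) w r"
      using iso' unfolding t0_eq by (auto simp: A.FOb_Sig)
    have [simp]: "p \<in> Hom A.Q X0 X" "q \<in> Hom A.Q Y0 Y" "r \<in> Hom A.Q Z0 Z" using pqr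
        by (simp_all add: is_iso_def)
    have Sp [simp]: "FAr A.Sig X0 X p \<in> Hom A.Q (A.SS X0) (A.SS X)"
      using is_functorD(2)[OF A.Sig_functor, of X0 X p] by (simp add: A.FOb_Sig)
    have [simp]: "\<theta> Y \<in> Hom B.Q (FOb F (A.SS Y)) (B.SS (FOb F Y))" if "Y \<in> Obj C" for Y
      using that by (simp add: \<theta>_def)
    have SFp [simp]:
        "FAr B.Sig (FOb F X0) (FOb F X) (FAr qF X0 X p) \<in> Hom B.Q (B.SS (FOb F X0))
        (B.SS (FOb F X))"
      using is_functorD(2)[OF B.Sig_functor, of "FOb F X0" "FOb F X" "FAr qF X0 X p"] Fq
          by (simp add: B.FOb_Sig)
    have 3: "Cmp B.Q (FOb F Z0) (FOb F (A.SS X0)) (FOb F (A.SS X)) (FAr qF (A.SS X0) (A.SS X)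
        (FAr A.Sig X0 X p))
        (FAr qF Z0 (A.SS X0) (A.cls Z0 (A.SS X0) w0))
      = Cmp B.Q (FOb F Z0) (FOb F Z) (FOb F (A.SS X)) (FAr qF Z (A.SS X) w) (FAr qF Z0 Z r)"
      using sq(3) Fq(4)[of Z0 "A.SS X0" "A.SS X" "A.cls Z0 (A.SS X0) w0" "FAr A.Sig X0 X p"]
        Fq(4)[of Z0 Z "A.SS X" r w] by simp
    have "tri_iso B.Q B.Sig (FOb F X0, FOb F Y0, FOb F Z0,
        B.cls (FOb F X0) (FOb F Y0) (FAr F X0 Y0 a),
        B.cls (FOb F Y0) (FOb F Z0) (FAr F Y0 Z0 b), B.cls (FOb F Z0) (B.SS (FOb F X0))
            (Cmp D (FOb F Z0) (FOb F (A.SS X0)) (B.SS (FOb F X0)) (th X0) (FAr F Z0 (A.SS X0) w0)))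
      (FOb F X, FOb F Y, FOb F Z, FAr qF X Y u, FAr qF Y Z v,
      Cmp B.Q (FOb F Z) (FOb F (A.SS X)) (B.SS (FOb F X)) (\<theta> X) (FAr qF Z (A.SS X) w))"
    proof (rule B.Q.tri_isoI)
      show "is_iso B.Q (FOb F X0) (FOb F X) (FAr qF X0 X p)"
          "is_iso B.Q (FOb F Y0) (FOb F Y) (FAr qF Y0 Y q)"
        "is_iso B.Q (FOb F Z0) (FOb F Z) (FAr qF Z0 Z r)"
        using functor_iso[OF qF_functor] pqr by simp_all
      show "Cmp B.Q (FOb F X0) (FOb F Y0) (FOb F Y) (FAr qF Y0 Y q) (B.cls (FOb F X0) (FOb F Y0)
          (FAr F X0 Y0 a))
         = Cmp B.Q (FOb F X0) (FOb F X) (FOb F Y) (FAr qF X Y u) (FAr qF X0 X p)"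
        using sq(1) by (simp flip: FAr_qF Fq(4))
      show "Cmp B.Q (FOb F Y0) (FOb F Z0) (FOb F Z) (FAr qF Z0 Z r) (B.cls (FOb F Y0) (FOb F Z0)
          (FAr F Y0 Z0 b))
         = Cmp B.Q (FOb F Y0) (FOb F Y) (FOb F Z) (FAr qF Y Z v) (FAr qF Y0 Y q)"
        using sq(2) by (simp flip: FAr_qF Fq(4))
      have "Cmp B.Q (FOb F Z0) (B.SS (FOb F X0)) (B.SS (FOb F X)) (FAr B.Sig (FOb F X0) (FOb F X)
          (FAr qF X0 X p))
          (Cmp B.Q (FOb F Z0) (FOb F (A.SS X0)) (B.SS (FOb F X0)) (\<theta> X0)
              (FAr qF Z0 (A.SS X0) (A.cls Z0 (A.SS X0) w0)))
        = Cmp B.Q (FOb F Z0) (FOb F Z) (B.SS (FOb F X))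
            (Cmp B.Q (FOb F Z) (FOb F (A.SS X)) (B.SS (FOb F X)) (\<theta> X) (FAr qF Z (A.SS X) w))
            (FAr qF Z0 Z r)"
        using B.Q.cmp_eq_assoc[OF nat[of X0 X p, symmetric]] 3 Fq by (simp del: FAr_qF)
      then show
          "Cmp B.Q (FOb F Z0) (FOb B.Sig (FOb F X0)) (FOb B.Sig (FOb F X)) (FAr B.Sig (FOb F X0)
          (FOb F X) (FAr qF X0 X p))
         (B.cls (FOb F Z0) (B.SS (FOb F X0)) (Cmp D (FOb F Z0) (FOb F (A.SS X0)) (B.SS (FOb F X0))
             (th X0) (FAr F Z0 (A.SS X0) w0)))
        = Cmp B.Q (FOb F Z0) (FOb F Z) (FOb B.Sig (FOb F X))
            (Cmp B.Q (FOb F Z) (FOb F (A.SS X)) (B.SS (FOb F X)) (\<theta> X) (FAr qF Z (A.SS X) w))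
            (FAr qF Z0 Z r)"
        by (simp add: B.FOb_Sig \<theta>_def)
    qed
    then show ?thesis
      by (rule B.distinguishedI[OF _ ct', rotated])
          (use Fq in \<open>simp add: B.Q.triangles_iff B.FOb_Sig\<close>)
  qed
  have "natural_iso A.T B.T (comp_fctr qF (Susp A.T)) (comp_fctr (Susp B.T) qF) \<theta>"
    using iso nat by (simp add: natural_iso_def comp_fctr_def A.FOb_Sig B.FOb_Sig)
  moreover have "additive_functor A.T B.T qF"
    using qF_additive by (simp add: additive_functor_def is_functor_def)
  ultimately show ?thesis
    unfolding triangle_functor_def using dist
        by (intro conjI exI[of _ \<theta>]) (simp_all add: A.FOb_Sig B.FOb_Sig)
qed

end

lemma quotient_adjoint:
  assumes F: "exact_functor C E I D E' I' F" and G: "exact_functor D E' I' C E I G"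
    and u_in: "\<And>X. X \<in> Obj C \<Longrightarrow> u X \<in> Hom C X (FOb G (FOb F X))"
    and e_in: "\<And>Y. Y \<in> Obj D \<Longrightarrow> e Y \<in> Hom D (FOb F (FOb G Y)) Y"
    and u_nat: "\<And>X X' f. \<lbrakk>X \<in> Obj C; X' \<in> Obj C; f \<in> Hom C X X'\<rbrakk> \<Longrightarrow>
      Cmp C X X' (FOb G (FOb F X')) (u X') f
        = Cmp C X (FOb G (FOb F X)) (FOb G (FOb F X')) (FAr G (FOb F X) (FOb F X') (FAr F X X' f))
            (u X)"
    and e_nat: "\<And>Y Y' g. \<lbrakk>Y \<in> Obj D; Y' \<in> Obj D; g \<in> Hom D Y Y'\<rbrakk> \<Longrightarrow>
      Cmp D (FOb F (FOb G Y)) (FOb F (FOb G Y')) Y' (e Y')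
          (FAr F (FOb G Y) (FOb G Y') (FAr G Y Y' g))
        = Cmp D (FOb F (FOb G Y)) Y Y' g (e Y)"
    and t1: "\<And>X. X \<in> Obj C \<Longrightarrow>
      Cmp D (FOb F X) (FOb F (FOb G (FOb F X))) (FOb F X) (e (FOb F X))
          (FAr F X (FOb G (FOb F X)) (u X))
        = Idm D (FOb F X)"
    and t2: "\<And>Y. Y \<in> Obj D \<Longrightarrow>
      Cmp C (FOb G Y) (FOb G (FOb F (FOb G Y))) (FOb G Y) (FAr G (FOb F (FOb G Y)) Y (e Y))
          (u (FOb G Y))
        = Idm C (FOb G Y)"
  shows "adjoint_pair (stable_tcat C E I) (stable_tcat D E' I') (quot_fctr D I' F)
      (quot_fctr C I G)"
proof -
  interpret F: exact_functor C E I D E' I' F by fact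
  interpret G: exact_functor D E' I' C E I G by fact
  note [simp] = u_in e_in
  have "adjoint_pair F.A.Q F.B.Q F.qF G.qF"
  proof (rule adjoint_pairI[where u = "\<lambda>X. F.A.cls X (FOb G (FOb F X)) (u X)" and e = "\<lambda>Y. F.B.cls
      (FOb F (FOb G Y)) Y (e Y)"])
    show "preadditive_category F.A.Q" "preadditive_category F.B.Q" by unfold_locales
  qed (auto intro: F.qF_functor G.qF_functor elim!: F.A.cls_cases F.B.cls_cases simp: u_nat e_nat t1
      t2)
  then show ?thesis unfolding adjoint_pair_def is_functor_def by simp
qed

text \<open>\<open>G\<close> inverts \<open>F\<close> on the Hom-sets between objects in the image
  of \<open>F\<close>. Both functors preserve null maps, so the bijection survives in the
  quotient.\<close>

lemma quotient_fully_faithful: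
  assumes F: "exact_functor C E I D E' I' F" and G: "exact_functor D E' I' C E I G"
    and GF: "\<And>X. X \<in> Obj C \<Longrightarrow> FOb G (FOb F X) = X"
    and GFf: "\<And>X Y f. \<lbrakk>X \<in> Obj C; Y \<in> Obj C; f \<in> Hom C X Y\<rbrakk>
        \<Longrightarrow> FAr G (FOb F X) (FOb F Y) (FAr F X Y f) = f"
    and FGh: "\<And>X Y h. \<lbrakk>X \<in> Obj C; Y \<in> Obj C; h \<in> Hom D (FOb F X) (FOb F Y)\<rbrakk>
        \<Longrightarrow> FAr F X Y (FAr G (FOb F X) (FOb F Y) h) = h"
  shows "fully_faithful (stable_tcat C E I) (stable_tcat D E' I') (quot_fctr D I' F)"
proof -
  interpret F: exact_functor C E I D E' I' F by fact
  interpret G: exact_functor D E' I' C E I G by fact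
  have "bij_betw (FAr F.qF X Y) (Hom F.A.Q X Y) (Hom F.B.Q (FOb F X) (FOb F Y))"
    if [simp]: "X \<in> Obj C" "Y \<in> Obj C" for X Y
  proof (rule bij_betwI[where g = "FAr G.qF (FOb F X) (FOb F Y)"])
    show "FAr F.qF X Y \<in> Hom F.A.Q X Y \<rightarrow> Hom F.B.Q (FOb F X) (FOb F Y)"
      using is_functorD(2)[OF F.qF_functor] by auto
    show "FAr G.qF (FOb F X) (FOb F Y) \<in> Hom F.B.Q (FOb F X) (FOb F Y) \<rightarrow> Hom F.A.Q X Y"
      using is_functorD(2)[OF G.qF_functor, of "FOb F X" "FOb F Y"] by (auto simp: GF)
    show "FAr G.qF (FOb F X) (FOb F Y) (FAr F.qF X Y f) = f" if "f \<in> Hom F.A.Q X Y" for f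
      using that by (auto elim!: F.A.cls_cases simp: GF GFf)
    have "FAr G (FOb F X) (FOb F Y) h \<in> Hom C X Y" if "h \<in> Hom D (FOb F X) (FOb F Y)" for h
      using G.F_simps(2)[of "FOb F X" "FOb F Y" h] that by (simp add: GF)
    then show "FAr F.qF X Y (FAr G.qF (FOb F X) (FOb F Y) h) = h"
        if "h \<in> Hom F.B.Q (FOb F X) (FOb F Y)" for h
      using that by (auto elim!: F.B.cls_cases simp: GF FGh)
  qed
  then show ?thesis by (simp add: fully_faithful_def)
qed


section \<open>Complexes and null-homotopies\<close>

text \<open>\<open>dmap C X i j\<close> is the composite of differentials \<open>X\<^sup>i \<rightarrow> X\<^sup>j\<close>, so that a complex is treated as
    a
  functor on the ordered set of integers.\<close>

definition dmap :: "('o, 'm, 'z) cat_scheme \<Rightarrow> ('o, 'm) cpx \<Rightarrow> int \<Rightarrow> int \<Rightarrow> 'm" where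
  "dmap C X i j = dpath C X i (nat (j - i))"

text \<open>The part of \<open>is_cpx\<close> that does not involve \<open>N\<close>. It is what
  makes \<open>dmap\<close> a functor, independently of the order of nilpotency.\<close>

definition is_seq :: "('o, 'm, 'z) cat_scheme \<Rightarrow> ('o, 'm) cpx \<Rightarrow> bool" where
  "is_seq C X \<longleftrightarrow> (\<forall>i. Ob X i \<in> Obj C \<and> Df X i \<in> Hom C (Ob X i) (Ob X (i + 1)))"

lemma cpx_eqI: "\<lbrakk>\<And>i. Ob X i = Ob Y i; \<And>i. Df X i = Df Y i\<rbrakk> \<Longrightarrow> X = (Y :: ('o, 'm) cpx)"
  by (cases X; cases Y) (auto intro: ext)

context preadditive_category
begin

lemma is_seqD:
  assumes "is_seq C X"
  shows "Ob X i \<in> Obj C" "Df X i \<in> Hom C (Ob X i) (Ob X (i + 1))"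
  using assms by (auto simp: is_seq_def)

lemma dmap_refl [simp]: "dmap C X i i = Idm C (Ob X i)"
  by (simp add: dmap_def)

lemma dmap_Suc:
  assumes "i \<le> j"
  shows "dmap C X i (j + 1) = Cmp C (Ob X i) (Ob X j) (Ob X (j + 1)) (Df X j) (dmap C X i j)"
proof -
  have "nat (j + 1 - i) = Suc (nat (j - i))" "i + int (nat (j - i)) = j" using assms by auto
  then show ?thesis by (simp add: dmap_def)
qed

lemma dmap_in [simp, intro]:
  assumes "is_seq C X" "i \<le> j"
  shows "dmap C X i j \<in> Hom C (Ob X i) (Ob X j)"
  using assms(2)
proof (induction j rule: int_ge_induct)
  case (step j)
  then show ?case using is_seqD[OF assms(1)] by (simp add: dmap_Suc)
qed (use is_seqD[OF assms(1)] in simp)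

lemma dmap_cmp [simp]:
  assumes "is_seq C X" "i \<le> j" "j \<le> k"
  shows "Cmp C (Ob X i) (Ob X j) (Ob X k) (dmap C X j k) (dmap C X i j) = (dmap C X i k)"
  using assms(3)
proof (induction k rule: int_ge_induct)
  case base
  show ?case using assms is_seqD[OF assms(1)] by simp
next
  case (step k)
  note [simp] = is_seqD[OF assms(1)] dmap_in[OF assms(1)]
  have "Cmp C (Ob X i) (Ob X k) (Ob X (k + 1)) (Df X k) (Cmp C (Ob X i) (Ob X j) (Ob X k)
      (dmap C X j k) (dmap C X i j)) = Cmp C (Ob X i) (Ob X k) (Ob X (k + 1)) (Df X k) (dmap C X i
      k)" using step by simp
  then show ?case using step assms by (simp add: dmap_Suc)
qed

lemma dmap_step: "is_seq C X \<Longrightarrow> dmap C X i (i + 1) = Df X i"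
  using dmap_Suc[of i i X] is_seqD[of X] by simp

lemma is_cpx_iff:
    "is_cpx C N X \<longleftrightarrow> is_seq C X \<and> (\<forall>i. dmap C X i (i + int N) = Zero C (Ob X i) (Ob X (i + int N)))"
  by (auto simp: is_cpx_def is_seq_def dmap_def)

lemma dmap_zero:
  assumes "is_cpx C N X" "i + int N \<le> j"
  shows "dmap C X i j = Zero C (Ob X i) (Ob X j)"
proof -
  have s: "is_seq C X" using assms is_cpx_iff by blast
  have "dmap C X i j
      = Cmp C (Ob X i) (Ob X (i + int N)) (Ob X j) (dmap C X (i + int N) j)
      (dmap C X i (i + int N))" using assms s by (simp add: dmap_cmp)
  also have "\<dots> = Zero C (Ob X i) (Ob X j)"
    using assms is_cpx_iff[of N X] is_seqD[OF s] dmap_in[OF s] by simp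
  finally show ?thesis .
qed

lemma cpx_mapsI:
  assumes "\<And>i. f i \<in> Hom C (Ob X i) (Ob Y i)"
    and "\<And>i. Cmp C (Ob X i) (Ob X (i + 1)) (Ob Y (i + 1)) (f (i + 1)) (Df X i)
        = Cmp C (Ob X i) (Ob Y i) (Ob Y (i + 1)) (Df Y i) (f i)"
  shows "f \<in> cpx_maps C X Y"
  using assms by (simp add: cpx_maps_def)

lemma cpx_mapsD:
  assumes "f \<in> cpx_maps C X Y"
  shows "f i \<in> Hom C (Ob X i) (Ob Y i)"
    and "Cmp C (Ob X i) (Ob X (i + 1)) (Ob Y (i + 1)) (f (i + 1)) (Df X i)
        = Cmp C (Ob X i) (Ob Y i) (Ob Y (i + 1)) (Df Y i) (f i)"
  using assms by (auto simp: cpx_maps_def)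

lemma cpx_maps_dmap:
  assumes f: "f \<in> cpx_maps C X Y" and X: "is_seq C X" and Y: "is_seq C Y" and ij: "i \<le> j"
  shows "Cmp C (Ob X i) (Ob X j) (Ob Y j) (f j) (dmap C X i j)
      = Cmp C (Ob X i) (Ob Y i) (Ob Y j) (dmap C Y i j) (f i)"
  using ij
proof (induction j rule: int_ge_induct)
  case base
  show ?case using is_seqD[OF X] is_seqD[OF Y] cpx_mapsD[OF f] by simp
next
  case (step j)
  note [simp] = is_seqD[OF X] is_seqD[OF Y] cpx_mapsD(1)[OF f]
  show ?case using step cmp_eq_assoc[OF cpx_mapsD(2)[OF f, of j], of "Ob X i" "dmap C X i j"] X Y
    by (simp add: dmap_Suc)
qed

end

locale complexes = additive_category C
  for C :: "('o, 'm, 'z) cat_scheme" +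
  fixes N :: nat
  assumes N_pos: "1 \<le> N"
begin

abbreviation KK where "KK \<equiv> CN C N"
abbreviation EE where "EE \<equiv> conflations C N"
abbreviation Nul where "Nul \<equiv> null_homotopic C N"

lemma CN_sel [simp]:
  "Obj KK = {X. is_cpx C N X}" "Hom KK X Y = cpx_maps C X Y"
  "Cmp KK X Y Z g f = (\<lambda>i. Cmp C (Ob X i) (Ob Y i) (Ob Z i) (g i) (f i))"
  "Idm KK X = (\<lambda>i. Idm C (Ob X i))"
  "Zero KK X Y = (\<lambda>i. Zero C (Ob X i) (Ob Y i))"
  "Add KK X Y p q = (\<lambda>i. Add C (Ob X i) (Ob Y i) (p i) (q i))"
  by (simp_all add: CN_def)

lemma cpx_seq: "is_cpx C N X \<Longrightarrow> is_seq C X"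
  by (simp add: is_cpx_iff)

lemma cpx_simps:
  assumes "is_cpx C N X"
  shows "Ob X i \<in> Obj C" "Df X i \<in> Hom C (Ob X i) (Ob X (i + 1))"
      "i \<le> j \<Longrightarrow> dmap C X i j \<in> Hom C (Ob X i) (Ob X j)"
    "is_seq C X"
  using is_seqD[OF cpx_seq[OF assms]] cpx_seq[OF assms] dmap_in by auto

lemma hom_group_CN:
  assumes X: "is_cpx C N X" and Y: "is_cpx C N Y"
  shows "comm_group (HomG KK X Y)"
proof (rule comm_groupI)
  note [simp] = cpx_simps[OF X] cpx_simps[OF Y]
  fix f g h assume f: "f \<in> Hom KK X Y" and g: "g \<in> Hom KK X Y" and h: "h \<in> Hom KK X Y"
  note [simp] = f[simplified, THEN cpx_mapsD(1)] g[simplified, THEN cpx_mapsD(1)]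
      h[simplified, THEN cpx_mapsD(1)]
    f[simplified, THEN cpx_mapsD(2)] g[simplified, THEN cpx_mapsD(2)]
  show "Add KK X Y f g \<in> Hom KK X Y" by (auto intro!: cpx_mapsI)
  show "Add KK X Y (Add KK X Y f g) h = Add KK X Y f (Add KK X Y g h)" by (simp add: add_assoc)
  show "Add KK X Y f g = Add KK X Y g f" by (simp add: add_commute)
  show "Add KK X Y (Zero KK X Y) f = f" by simp
  show "\<exists>g\<in>Hom KK X Y. Add KK X Y g f = Zero KK X Y"
    by (intro bexI[of _ "\<lambda>i. Neg C (Ob X i) (Ob Y i) (f i)"]) (auto intro!: cpx_mapsI)
next
  note [simp] = cpx_simps[OF X] cpx_simps[OF Y]
  show "Zero KK X Y \<in> Hom KK X Y" by (auto intro!: cpx_mapsI)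
qed

lemma preadditive_CN: "preadditive_category KK"
proof (intro preadditive_category.intro)
  show "comm_group (HomG KK X Y)" if "X \<in> Obj KK" "Y \<in> Obj KK" for X Y
    using that hom_group_CN by simp
  show "(\<lambda>g. Cmp KK X Y Z g f) \<in> hom (HomG KK Y Z) (HomG KK X Z)"
    if "X \<in> Obj KK" "Y \<in> Obj KK" "Z \<in> Obj KK" "f \<in> Hom KK X Y" for X Y Z f
    using that
    by (auto simp: hom_def cpx_simps cpx_mapsD cmp_eq_assoc[OF cpx_mapsD(2)] intro!: cpx_mapsI)
  show "(\<lambda>f. Cmp KK X Y Z g f) \<in> hom (HomG KK X Y) (HomG KK X Z)"
    if "X \<in> Obj KK" "Y \<in> Obj KK" "Z \<in> Obj KK" "g \<in> Hom KK Y Z" for X Y Z g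
    using that
    by (auto simp: hom_def cpx_simps cpx_mapsD cmp_eq_assoc[OF cpx_mapsD(2)] intro!: cpx_mapsI)
qed (auto simp: cpx_simps cpx_mapsD intro!: cpx_mapsI)

sublocale K: preadditive_category KK by (rule preadditive_CN)

lemma cmp_cpx_maps:
  "\<lbrakk>is_cpx C N X; is_cpx C N Y; is_cpx C N Z; f \<in> cpx_maps C X Y; g \<in> cpx_maps C Y Z\<rbrakk>
    \<Longrightarrow> (\<lambda>i. (Cmp C (Ob X i) (Ob Y i) (Ob Z i) (g i) (f i))) \<in> cpx_maps C X Z"
  using K.cmp_in[of X Y Z f g] by simp

lemma id_cpx_maps: "is_cpx C N X \<Longrightarrow> (\<lambda>i. Idm C (Ob X i)) \<in> cpx_maps C X X"
  using K.id_in[of X] by simp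

text \<open>Compatibility of \<open>g\<close> with the differentials can be tested after composition
  with a degreewise split epimorphism; the sections \<open>t\<close> are not chain maps in
  general.\<close>

lemma chain_cancel_epi:
  assumes X: "is_cpx C N X" and Y: "is_cpx C N Y" and Z: "is_cpx C N Z"
    and f: "f \<in> cpx_maps C X Y" and t: "\<And>i. t i \<in> Hom C (Ob Y i) (Ob X i)"
        "\<And>i. Cmp C (Ob Y i) (Ob X i) (Ob Y i) (f i) (t i) = Idm C (Ob Y i)"
    and g: "\<And>i. g i \<in> Hom C (Ob Y i) (Ob Z i)"
        and gf: "(\<lambda>i. (Cmp C (Ob X i) (Ob Y i) (Ob Z i) (g i) (f i))) \<in> cpx_maps C X Z"
  shows "g \<in> cpx_maps C Y Z"
proof (rule cpx_mapsI[OF g])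
  fix i
  note [simp] = cpx_simps[OF X] cpx_simps[OF Y] cpx_simps[OF Z] cpx_mapsD(1)[OF f] g t
  have "Cmp C (Ob Y i) (Ob Y (i + 1)) (Ob Z (i + 1)) (g (i + 1)) (Df Y i)
      = Cmp C (Ob Y i) (Ob Y (i + 1)) (Ob Z (i + 1)) (g (i + 1))
      (Cmp C (Ob Y i) (Ob Y i) (Ob Y (i + 1)) (Df Y i)
      (Cmp C (Ob Y i) (Ob X i) (Ob Y i) (f i) (t i)))" by simp
  also have
      "\<dots> = Cmp C (Ob Y i) (Ob X (i + 1)) (Ob Z (i + 1)) (Cmp C (Ob X (i + 1)) (Ob Y (i + 1))
      (Ob Z (i + 1)) (g (i + 1)) (f (i + 1))) (Cmp C (Ob Y i) (Ob X i) (Ob X (i + 1)) (Df X i)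
      (t i))"
    using cmp_eq_assoc[OF cpx_mapsD(2)[OF f, of i]] by simp
  also have
      "\<dots> = Cmp C (Ob Y i) (Ob X i) (Ob Z (i + 1)) (Cmp C (Ob X i) (Ob Z i) (Ob Z (i + 1)) (Df Z i)
      (Cmp C (Ob X i) (Ob Y i) (Ob Z i) (g i) (f i))) (t i)"
    using cmp_eq_assoc[OF cpx_mapsD(2)[OF gf, of i]] by simp
  also have "\<dots> = Cmp C (Ob Y i) (Ob Z i) (Ob Z (i + 1)) (Df Z i) (g i)" by simp
  finally show "Cmp C (Ob Y i) (Ob Y (i + 1)) (Ob Z (i + 1)) (g (i + 1)) (Df Y i)
      = Cmp C (Ob Y i) (Ob Z i) (Ob Z (i + 1)) (Df Z i) (g i)" .
qed

lemma chain_cancel_mono: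
  assumes X: "is_cpx C N X" and Y: "is_cpx C N Y" and Z: "is_cpx C N Z"
    and g: "g \<in> cpx_maps C Y Z" and q: "\<And>i. q i \<in> Hom C (Ob Z i) (Ob Y i)"
        "\<And>i. Cmp C (Ob Y i) (Ob Z i) (Ob Y i) (q i) (g i) = Idm C (Ob Y i)"
    and f: "\<And>i. f i \<in> Hom C (Ob X i) (Ob Y i)"
        and gf: "(\<lambda>i. (Cmp C (Ob X i) (Ob Y i) (Ob Z i) (g i) (f i))) \<in> cpx_maps C X Z"
  shows "f \<in> cpx_maps C X Y"
proof (rule cpx_mapsI[OF f])
  fix i
  note [simp] = cpx_simps[OF X] cpx_simps[OF Y] cpx_simps[OF Z] cpx_mapsD(1)[OF g] f q
  have "Cmp C (Ob X i) (Ob X (i + 1)) (Ob Y (i + 1)) (f (i + 1)) (Df X i)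
      = Cmp C (Ob X i) (Ob Z (i + 1)) (Ob Y (i + 1)) (q (i + 1))
      (Cmp C (Ob X i) (Ob X (i + 1)) (Ob Z (i + 1))
      (Cmp C (Ob X (i + 1)) (Ob Y (i + 1)) (Ob Z (i + 1)) (g (i + 1)) (f (i + 1)))
      (Df X i))"
    using cmp_eq_assoc[OF q(2)] by simp
  also have
      "\<dots> = Cmp C (Ob X i) (Ob Z (i + 1)) (Ob Y (i + 1)) (q (i + 1)) (Cmp C (Ob X i) (Ob Y i)
      (Ob Z (i + 1)) (Cmp C (Ob Y i) (Ob Z i) (Ob Z (i + 1)) (Df Z i) (g i)) (f i))"
    using cpx_mapsD(2)[OF gf, of i] by simp
  also have
      "\<dots> = Cmp C (Ob X i) (Ob Z (i + 1)) (Ob Y (i + 1)) (q (i + 1)) (Cmp C (Ob X i) (Ob Y i)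
      (Ob Z (i + 1)) (Cmp C (Ob Y i) (Ob Y (i + 1)) (Ob Z (i + 1)) (g (i + 1)) (Df Y i)) (f i))"
    using cpx_mapsD(2)[OF g, of i] by simp
  also have "\<dots> = Cmp C (Ob X i) (Ob Y i) (Ob Y (i + 1)) (Df Y i) (f i)" using cmp_eq_assoc[OF q(2)]
      by simp
  finally show "Cmp C (Ob X i) (Ob X (i + 1)) (Ob Y (i + 1)) (f (i + 1)) (Df X i)
      = Cmp C (Ob X i) (Ob Y i) (Ob Y (i + 1)) (Df Y i) (f i)" .
qed

subsection \<open>Null-homotopies\<close>

text \<open>The sum in \<open>null_homotopic\<close> written with m = i + j - 1, the degree where
  \<open>s\<close> is applied. The summands are then indexed by the window of length
  \<open>N\<close> starting at \<open>i\<close>, which a monotone map can cut into pieces.\<close>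

definition nullh :: "('o, 'm) cpx \<Rightarrow> ('o, 'm) cpx \<Rightarrow> (int \<Rightarrow> 'm) \<Rightarrow> int \<Rightarrow> 'm" where
  "nullh X Y s i = finprod (HomG C (Ob X i) (Ob Y i))
     (\<lambda>m. (Cmp C (Ob X i) (Ob Y (m - int N + 1)) (Ob Y i) (dmap C Y (m - int N + 1) i)
         (Cmp C (Ob X i) (Ob X m) (Ob Y (m - int N + 1)) (s m) (dmap C X i m)))) {i..<i + int N}"

definition homot :: "('o, 'm) cpx \<Rightarrow> ('o, 'm) cpx \<Rightarrow> (int \<Rightarrow> 'm) set" where
  "homot X Y = {s. \<forall>i. s i \<in> Hom C (Ob X i) (Ob Y (i - int N + 1))}"

lemma homotD: "s \<in> homot X Y \<Longrightarrow> s i \<in> Hom C (Ob X i) (Ob Y (i - int N + 1))"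
  by (simp add: homot_def)

lemma nullh_term_in:
  assumes X: "is_cpx C N X" and Y: "is_cpx C N Y" and s: "s \<in> homot X Y"
      and m: "i \<le> m" "m < i + int N"
  shows "Cmp C (Ob X i) (Ob Y (m - int N + 1)) (Ob Y i) (dmap C Y (m - int N + 1) i)
      (Cmp C (Ob X i) (Ob X m) (Ob Y (m - int N + 1)) (s m) (dmap C X i m)) \<in> Hom C (Ob X i)
      (Ob Y i)"
proof -
  note [simp] = cpx_simps[OF X] cpx_simps[OF Y] homotD[OF s]
  show ?thesis using m by (intro cmp_in) auto
qed

lemma nullh_in:
  assumes X: "is_cpx C N X" and Y: "is_cpx C N Y" and s: "s \<in> homot X Y"
  shows "nullh X Y s i \<in> Hom C (Ob X i) (Ob Y i)"
proof -
  interpret G: comm_group "HomG C (Ob X i) (Ob Y i)" using hom_group cpx_simps[OF X] cpx_simps[OF Y]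
      by simp
  show ?thesis unfolding nullh_def using nullh_term_in[OF X Y s] by (intro G.finprod_closed) auto
qed

lemma null_homotopic_iff:
  assumes X: "is_cpx C N X" and Y: "is_cpx C N Y"
  shows "f \<in> Nul X Y \<longleftrightarrow> f \<in> cpx_maps C X Y \<and> (\<exists>s\<in>homot X Y. f = nullh X Y s)"
proof -
  have eq: "finprod (HomG C (Ob X i) (Ob Y i))
          (\<lambda>j. Cmp C (Ob X i) (Ob Y (i - int N + int j)) (Ob Y i)
                 (dpath C Y (i - int N + int j) (N - j))
                 (Cmp C (Ob X i) (Ob X (i + int j - 1)) (Ob Y (i - int N + int j))
                   (s (i + int j - 1))
                   (dpath C X i (j - 1)))) {1..N} = nullh X Y s i" if s: "s \<in> homot X Y" for s i
  proof -
    interpret G: comm_group "HomG C (Ob X i) (Ob Y i)"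
        using hom_group cpx_simps[OF X] cpx_simps[OF Y] by simp
    have img: "(\<lambda>j. i + int j - 1) ` {1..N} = {i..<i + int N}"
    proof
      show "{i..<i + int N} \<subseteq> (\<lambda>j. i + int j - 1) ` {1..N}"
      proof
        fix m assume "m \<in> {i..<i + int N}"
        then show "m \<in> (\<lambda>j. i + int j - 1) ` {1..N}"
          by (intro image_eqI[of _ _ "nat (m - i + 1)"]) auto
      qed
    qed auto
    have "nullh X Y s i = finprod (HomG C (Ob X i) (Ob Y i))
     (\<lambda>m. (Cmp C (Ob X i) (Ob Y (m - int N + 1)) (Ob Y i) (dmap C Y (m - int N + 1) i)
         (Cmp C (Ob X i) (Ob X m) (Ob Y (m - int N + 1)) (s m) (dmap C X i m))))
         ((\<lambda>j. i + int j - 1) ` {1..N})"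
      unfolding nullh_def img ..
    also have "\<dots> = finprod (HomG C (Ob X i) (Ob Y i))
     (\<lambda>j. (Cmp C (Ob X i) (Ob Y ((i + int j - 1) - int N + 1)) (Ob Y i)
         (dmap C Y (i + int j - 1 - int N + 1) i)
         (Cmp C (Ob X i) (Ob X (i + int j - 1)) (Ob Y ((i + int j - 1) - int N + 1))
         (s (i + int j - 1)) (dmap C X i (i + int j - 1))))) {1..N}"
    proof (rule G.finprod_reindex)
      show "(\<lambda>m. (Cmp C (Ob X i) (Ob Y (m - int N + 1)) (Ob Y i) (dmap C Y (m - int N + 1) i)
          (Cmp C (Ob X i) (Ob X m) (Ob Y (m - int N + 1)) (s m) (dmap C X i m)))) \<in>
          (\<lambda>j. i + int j - 1) ` {1..N} \<rightarrow> Hom C (Ob X i) (Ob Y i)"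
        unfolding img using nullh_term_in[OF X Y s] by auto
      show "inj_on (\<lambda>j. i + int j - 1) {1..N}" by (auto intro: inj_onI)
    qed
    also have "\<dots> = finprod (HomG C (Ob X i) (Ob Y i))
          (\<lambda>j. Cmp C (Ob X i) (Ob Y (i - int N + int j)) (Ob Y i)
                 (dpath C Y (i - int N + int j) (N - j))
                 (Cmp C (Ob X i) (Ob X (i + int j - 1)) (Ob Y (i - int N + int j))
                   (s (i + int j - 1))
                   (dpath C X i (j - 1)))) {1..N}"
    proof (rule G.finprod_cong')
      fix j assume j: "j \<in> {1..N}"
      have e: "i + int j - 1 - int N + 1 = i - int N + int j" by simp
      have n: "nat (i - (i - int N + int j)) = N - j" "nat (i + int j - 1 - i) = j - 1" using j
          by auto
      show "Cmp C (Ob X i) (Ob Y ((i + int j - 1) - int N + 1)) (Ob Y i)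
          (dmap C Y (i + int j - 1 - int N + 1) i)
          (Cmp C (Ob X i) (Ob X (i + int j - 1)) (Ob Y ((i + int j - 1) - int N + 1))
          (s (i + int j - 1)) (dmap C X i (i + int j - 1))) =
        Cmp C (Ob X i) (Ob Y (i - int N + int j)) (Ob Y i)
                 (dpath C Y (i - int N + int j) (N - j))
                 (Cmp C (Ob X i) (Ob X (i + int j - 1)) (Ob Y (i - int N + int j))
                   (s (i + int j - 1))
                   (dpath C X i (j - 1)))"
        unfolding e dmap_def n ..
    next
      show "(\<lambda>j. Cmp C (Ob X i) (Ob Y (i - int N + int j)) (Ob Y i)
                 (dpath C Y (i - int N + int j) (N - j))
                 (Cmp C (Ob X i) (Ob X (i + int j - 1)) (Ob Y (i - int N + int j))
                   (s (i + int j - 1))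
                   (dpath C X i (j - 1)))) \<in> {1..N} \<rightarrow> Hom C (Ob X i) (Ob Y i)"
      proof
        fix j assume j: "j \<in> {1..N}"
        have e: "i + int j - 1 - int N + 1 = i - int N + int j" by simp
        have n: "nat (i - (i - int N + int j)) = N - j" "nat (i + int j - 1 - i) = j - 1" using j
            by auto
        show "Cmp C (Ob X i) (Ob Y (i - int N + int j)) (Ob Y i)
                 (dpath C Y (i - int N + int j) (N - j))
                 (Cmp C (Ob X i) (Ob X (i + int j - 1)) (Ob Y (i - int N + int j))
                   (s (i + int j - 1))
                   (dpath C X i (j - 1))) \<in> Hom C (Ob X i) (Ob Y i)"
          using nullh_term_in[OF X Y s, of i "i + int j - 1"] j unfolding e dmap_def n by simp
      qed
    qed simp
    finally show ?thesis by simp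
  qed
  show ?thesis unfolding null_homotopic_def homot_def
    using eq[unfolded homot_def] by (auto simp: fun_eq_iff)
qed

text \<open>Composing with the differential on either side gives the same terms over two overlapping
  windows. The one term of each window outside the overlap contains \<open>N\<close> consecutive
  differentials: of \<open>X\<close> for m = i + N, of \<open>Y\<close> for m = i.\<close>

lemma nullh_chain:
  assumes X: "is_cpx C N X" and Y: "is_cpx C N Y" and s: "s \<in> homot X Y"
  shows "nullh X Y s \<in> cpx_maps C X Y"
proof (rule cpx_mapsI)
  note [simp] = cpx_simps[OF X] cpx_simps[OF Y] homotD[OF s]
  show "nullh X Y s i \<in> Hom C (Ob X i) (Ob Y i)" for i by (rule nullh_in[OF X Y s])
  fix i
  interpret G: comm_group "HomG C (Ob X i) (Ob Y (i + 1))" using hom_group by simp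
  define T where
      "T = (\<lambda>m. (Cmp C (Ob X i) (Ob Y (m - int N + 1)) (Ob Y (i + 1)) (dmap C Y (m - int N + 1)
      (i + 1)) (Cmp C (Ob X i) (Ob X m) (Ob Y (m - int N + 1)) (s m) (dmap C X i m))))"
  have Tin: "T m \<in> Hom C (Ob X i) (Ob Y (i + 1))" if "i \<le> m" "m \<le> i + int N" for m
    using that unfolding T_def by (intro cmp_in) auto
  have "Cmp C (Ob X i) (Ob X (i + 1)) (Ob Y (i + 1)) (nullh X Y s (i + 1)) (Df X i)
      = finprod (HomG C (Ob X i) (Ob Y (i + 1)))
          (\<lambda>m. (Cmp C (Ob X i) (Ob X (i + 1)) (Ob Y (i + 1))
          (Cmp C (Ob X (i + 1)) (Ob Y (m - int N + 1)) (Ob Y (i + 1))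
          (dmap C Y (m - int N + 1) (i + 1))
          (Cmp C (Ob X (i + 1)) (Ob X m) (Ob Y (m - int N + 1)) (s m)
          (dmap C X (i + 1) m))) (Df X i))) {i + 1..<i + 1 + int N}"
    unfolding nullh_def
    by (rule cmp_finprod_left) (use nullh_term_in[OF X Y s, of "i + 1"] in auto)
  also have "\<dots> = finprod (HomG C (Ob X i) (Ob Y (i + 1))) T {i + 1..<i + 1 + int N}"
  proof (rule G.finprod_cong')
    fix m assume m: "m \<in> {i + 1..<i + 1 + int N}"
    then have "Cmp C (Ob X i) (Ob X (i + 1)) (Ob X m) (dmap C X (i + 1) m) (Df X i) = dmap C X i m"
        by (simp flip: dmap_step)
    then show
        "Cmp C (Ob X i) (Ob X (i + 1)) (Ob Y (i + 1)) (Cmp C (Ob X (i + 1)) (Ob Y (m - int N + 1))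
        (Ob Y (i + 1)) (dmap C Y (m - int N + 1) (i + 1))
        (Cmp C (Ob X (i + 1)) (Ob X m) (Ob Y (m - int N + 1)) (s m) (dmap C X (i + 1) m)))
        (Df X i) = T m"
      using m by (simp add: T_def)
  qed (use Tin in auto)
  also have "{i + 1..<i + 1 + int N} = insert (i + int N) {i + 1..<i + int N}" using N_pos by auto
  also have "finprod (HomG C (Ob X i) (Ob Y (i + 1))) T (insert (i + int N) {i + 1..<i + int N})
      = finprod (HomG C (Ob X i) (Ob Y (i + 1))) T {i + 1..<i + int N}"
  proof -
    have "T (i + int N) = Zero C (Ob X i) (Ob Y (i + 1))"
      using dmap_zero[OF X, of i "i + int N"] homotD[OF s, of "i + int N"] unfolding T_def by simp
    moreover have "T \<in> {i + 1..<i + int N} \<rightarrow> Hom C (Ob X i) (Ob Y (i + 1))" using Tin by auto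
    ultimately show ?thesis by (subst G.finprod_insert) auto
  qed
  finally have 1: "Cmp C (Ob X i) (Ob X (i + 1)) (Ob Y (i + 1)) (nullh X Y s (i + 1)) (Df X i)
      = finprod (HomG C (Ob X i) (Ob Y (i + 1))) T {i + 1..<i + int N}" .
  have "Cmp C (Ob X i) (Ob Y i) (Ob Y (i + 1)) (Df Y i) (nullh X Y s i)
      = finprod (HomG C (Ob X i) (Ob Y (i + 1)))
          (\<lambda>m. (Cmp C (Ob X i) (Ob Y i) (Ob Y (i + 1)) (Df Y i)
          (Cmp C (Ob X i) (Ob Y (m - int N + 1)) (Ob Y i) (dmap C Y (m - int N + 1) i)
          (Cmp C (Ob X i) (Ob X m) (Ob Y (m - int N + 1)) (s m) (dmap C X i m))))) {i..<i +
          int N}"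
    unfolding nullh_def
    by (rule cmp_finprod_right) (use nullh_term_in[OF X Y s, of i] in auto)
  also have "\<dots> = finprod (HomG C (Ob X i) (Ob Y (i + 1))) T {i..<i + int N}"
  proof (rule G.finprod_cong')
    fix m assume m: "m \<in> {i..<i + int N}"
    then have e:
        "Cmp C (Ob Y (m - int N + 1)) (Ob Y i) (Ob Y (i + 1)) (Df Y i) (dmap C Y (m - int N + 1) i)
        = dmap C Y (m - int N + 1) (i + 1)" by (simp flip: dmap_step)
    show "Cmp C (Ob X i) (Ob Y i) (Ob Y (i + 1)) (Df Y i) (Cmp C (Ob X i) (Ob Y (m - int N + 1))
        (Ob Y i) (dmap C Y (m - int N + 1) i)
        (Cmp C (Ob X i) (Ob X m) (Ob Y (m - int N + 1)) (s m) (dmap C X i m))) = T m"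
      using m by (simp add: T_def cmp_eq_assoc[OF e])
  qed (use Tin in auto)
  also have "{i..<i + int N} = insert i {i + 1..<i + int N}" using N_pos by auto
  also have "finprod (HomG C (Ob X i) (Ob Y (i + 1))) T (insert i {i + 1..<i + int N})
      = finprod (HomG C (Ob X i) (Ob Y (i + 1))) T {i + 1..<i + int N}"
  proof -
    have "T i = Zero C (Ob X i) (Ob Y (i + 1))"
      using dmap_zero[OF Y, of "i - int N + 1" "i + 1"] unfolding T_def by simp
    moreover have "T \<in> {i + 1..<i + int N} \<rightarrow> Hom C (Ob X i) (Ob Y (i + 1))" using Tin by auto
    ultimately show ?thesis using Tin[of i] by (subst G.finprod_insert) auto
  qed
  finally show "Cmp C (Ob X i) (Ob X (i + 1)) (Ob Y (i + 1)) (nullh X Y s (i + 1)) (Df X i)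
      = Cmp C (Ob X i) (Ob Y i) (Ob Y (i + 1)) (Df Y i) (nullh X Y s i)" using 1 by simp
qed

lemma nullh_left:
  assumes X: "is_cpx C N X" and Y: "is_cpx C N Y" and Z: "is_cpx C N Z" and s: "s \<in> homot X Y"
      and g: "g \<in> cpx_maps C Y Z"
  shows "(\<lambda>i. Cmp C (Ob X i) (Ob Y i) (Ob Z i) (g i) (nullh X Y s i))
      = nullh X Z
      (\<lambda>m. (Cmp C (Ob X m) (Ob Y (m - int N + 1)) (Ob Z (m - int N + 1)) (g (m - int N + 1))
      (s m)))"
    "(\<lambda>m. (Cmp C (Ob X m) (Ob Y (m - int N + 1)) (Ob Z (m - int N + 1)) (g (m - int N + 1))
        (s m))) \<in> homot X Z"
proof -
  note [simp] = cpx_simps[OF X] cpx_simps[OF Y] cpx_simps[OF Z] homotD[OF s] cpx_mapsD(1)[OF g]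
  show s': "(\<lambda>m. (Cmp C (Ob X m) (Ob Y (m - int N + 1)) (Ob Z (m - int N + 1)) (g (m - int N + 1))
      (s m))) \<in> homot X Z" by (simp add: homot_def)
  show "(\<lambda>i. Cmp C (Ob X i) (Ob Y i) (Ob Z i) (g i) (nullh X Y s i))
      = nullh X Z
      (\<lambda>m. (Cmp C (Ob X m) (Ob Y (m - int N + 1)) (Ob Z (m - int N + 1)) (g (m - int N + 1))
      (s m)))"
  proof
    fix i
    interpret G: comm_group "HomG C (Ob X i) (Ob Z i)" using hom_group by simp
    have "Cmp C (Ob X i) (Ob Y i) (Ob Z i) (g i) (nullh X Y s i)
      = finprod (HomG C (Ob X i) (Ob Z i))
          (\<lambda>m.
          (Cmp C (Ob X i) (Ob Y i) (Ob Z i) (g i)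
          (Cmp C (Ob X i) (Ob Y (m - int N + 1)) (Ob Y i) (dmap C Y (m - int N + 1) i)
          (Cmp C (Ob X i) (Ob X m) (Ob Y (m - int N + 1)) (s m) (dmap C X i m)))))
          {i..<i + int N}"
      unfolding nullh_def
      by (rule cmp_finprod_right) (use nullh_term_in[OF X Y s, of i] in auto)
    also have
        "\<dots> = nullh X Z (\<lambda>m. (Cmp C (Ob X m) (Ob Y (m - int N + 1)) (Ob Z (m - int N + 1))
        (g (m - int N + 1)) (s m))) i"
      unfolding nullh_def
    proof (rule G.finprod_cong')
      fix m assume m: "m \<in> {i..<i + int N}"
      have e: "Cmp C (Ob Y (m - int N + 1)) (Ob Y i) (Ob Z i) (g i) (dmap C Y (m - int N + 1) i)
          = Cmp C (Ob Y (m - int N + 1)) (Ob Z (m - int N + 1)) (Ob Z i)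
          (dmap C Z (m - int N + 1) i) (g (m - int N + 1))"
        by (rule cpx_maps_dmap[OF g]) (use m in auto)
      show "Cmp C (Ob X i) (Ob Y i) (Ob Z i) (g i) (Cmp C (Ob X i) (Ob Y (m - int N + 1)) (Ob Y i)
          (dmap C Y (m - int N + 1) i)
          (Cmp C (Ob X i) (Ob X m) (Ob Y (m - int N + 1)) (s m) (dmap C X i m))) = Cmp C (Ob X
          i) (Ob Z (m - int N + 1)) (Ob Z i) (dmap C Z (m - int N + 1) i) (Cmp C (Ob X i)
          (Ob X m) (Ob Z (m - int N + 1))
          (Cmp C (Ob X m) (Ob Y (m - int N + 1)) (Ob Z (m - int N + 1))
          (g (m - int N + 1)) (s m)) (dmap C X i m))"
        using m by (simp add: cmp_eq_assoc[OF e])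
    qed (use nullh_term_in[OF X Z s'] in auto)
    finally show
        "Cmp C (Ob X i) (Ob Y i) (Ob Z i) (g i) (nullh X Y s i)
        = nullh X Z
        (\<lambda>m. (Cmp C (Ob X m) (Ob Y (m - int N + 1)) (Ob Z (m - int N + 1))
        (g (m - int N + 1)) (s m))) i" .
  qed
qed

lemma nullh_right:
  assumes W: "is_cpx C N W" and X: "is_cpx C N X" and Y: "is_cpx C N Y" and s: "s \<in> homot X Y"
      and f: "f \<in> cpx_maps C W X"
  shows "(\<lambda>i. Cmp C (Ob W i) (Ob X i) (Ob Y i) (nullh X Y s i) (f i))
      = nullh W Y (\<lambda>m. (Cmp C (Ob W m) (Ob X m) (Ob Y (m - int N + 1)) (s m) (f m)))"
    "(\<lambda>m. (Cmp C (Ob W m) (Ob X m) (Ob Y (m - int N + 1)) (s m) (f m))) \<in> homot W Y"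
proof -
  note [simp] = cpx_simps[OF W] cpx_simps[OF X] cpx_simps[OF Y] homotD[OF s] cpx_mapsD(1)[OF f]
  show s': "(\<lambda>m. (Cmp C (Ob W m) (Ob X m) (Ob Y (m - int N + 1)) (s m) (f m))) \<in> homot W Y"
      by (simp add: homot_def)
  show "(\<lambda>i. Cmp C (Ob W i) (Ob X i) (Ob Y i) (nullh X Y s i) (f i))
      = nullh W Y (\<lambda>m. (Cmp C (Ob W m) (Ob X m) (Ob Y (m - int N + 1)) (s m) (f m)))"
  proof
    fix i
    interpret G: comm_group "HomG C (Ob W i) (Ob Y i)" using hom_group by simp
    have "Cmp C (Ob W i) (Ob X i) (Ob Y i) (nullh X Y s i) (f i)
      = finprod (HomG C (Ob W i) (Ob Y i))
          (\<lambda>m. (Cmp C (Ob W i) (Ob X i) (Ob Y i) (Cmp C (Ob X i) (Ob Y (m - int N + 1)) (Ob Y i)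
          (dmap C Y (m - int N + 1) i)
          (Cmp C (Ob X i) (Ob X m) (Ob Y (m - int N + 1)) (s m) (dmap C X i m))) (f i)))
          {i..<i + int N}"
      unfolding nullh_def
      by (rule cmp_finprod_left) (use nullh_term_in[OF X Y s, of i] in auto)
    also have "\<dots> = nullh W Y (\<lambda>m. (Cmp C (Ob W m) (Ob X m) (Ob Y (m - int N + 1)) (s m) (f m))) i"
      unfolding nullh_def
    proof (rule G.finprod_cong')
      fix m assume m: "m \<in> {i..<i + int N}"
      have "Cmp C (Ob W i) (Ob W m) (Ob X m) (f m) (dmap C W i m)
          = Cmp C (Ob W i) (Ob X i) (Ob X m) (dmap C X i m) (f i)"
        by (rule cpx_maps_dmap[OF f]) (use m in auto)
      then show
          "Cmp C (Ob W i) (Ob X i) (Ob Y i) (Cmp C (Ob X i) (Ob Y (m - int N + 1)) (Ob Y i)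
          (dmap C Y (m - int N + 1) i)
          (Cmp C (Ob X i) (Ob X m) (Ob Y (m - int N + 1)) (s m) (dmap C X i m))) (f i) = Cmp
          C (Ob W i) (Ob Y (m - int N + 1)) (Ob Y i) (dmap C Y (m - int N + 1) i)
          (Cmp C (Ob W i) (Ob W m) (Ob Y (m - int N + 1))
          (Cmp C (Ob W m) (Ob X m) (Ob Y (m - int N + 1)) (s m) (f m))
          (dmap C W i m))"
        using m by simp
    qed (use nullh_term_in[OF W Y s'] in auto)
    finally show
        "Cmp C (Ob W i) (Ob X i) (Ob Y i) (nullh X Y s i) (f i)
        = nullh W Y (\<lambda>m. (Cmp C (Ob W m) (Ob X m) (Ob Y (m - int N + 1)) (s m) (f m))) i" .
  qed
qed

section \<open>Null-homotopic maps, contractible complexes and conflations\<close>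

lemma null_in: "f \<in> Nul X Y \<Longrightarrow> f \<in> cpx_maps C X Y"
  by (simp add: null_homotopic_def)

lemma null_left:
  assumes "is_cpx C N X" "is_cpx C N Y" "is_cpx C N Z" "f \<in> Nul X Y" "g \<in> cpx_maps C Y Z"
  shows "Cmp KK X Y Z g f \<in> Nul X Z"
proof -
  obtain t where t: "t \<in> homot X Y" "f = nullh X Y t" using assms null_homotopic_iff by blast
  have "Cmp KK X Y Z g f
      = nullh X Z
      (\<lambda>m. (Cmp C (Ob X m) (Ob Y (m - int N + 1)) (Ob Z (m - int N + 1)) (g (m - int N + 1))
      (t m)))"
    using nullh_left(1)[OF assms(1-3) t(1) assms(5)] t(2) by simp
  then show ?thesis
    using null_homotopic_iff[OF assms(1,3)] nullh_left(2)[OF assms(1-3) t(1) assms(5)]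
        K.cmp_in[of X Y Z f g] assms null_in
    by auto
qed

lemma null_right:
  assumes "is_cpx C N W" "is_cpx C N X" "is_cpx C N Y" "f \<in> cpx_maps C W X" "g \<in> Nul X Y"
  shows "Cmp KK W X Y g f \<in> Nul W Y"
proof -
  obtain t where t: "t \<in> homot X Y" "g = nullh X Y t" using assms null_homotopic_iff by blast
  have "Cmp KK W X Y g f
      = nullh W Y (\<lambda>m. (Cmp C (Ob W m) (Ob X m) (Ob Y (m - int N + 1)) (t m) (f m)))"
    using nullh_right(1)[OF assms(1-3) t(1) assms(4)] t(2) by simp
  then show ?thesis
    using null_homotopic_iff[OF assms(1,3)] nullh_right(2)[OF assms(1-3) t(1) assms(4)]
        K.cmp_in[of W X Y f g] assms null_in
    by auto
qed

definition contractible :: "('o, 'm) cpx \<Rightarrow> bool" where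
  "contractible X \<longleftrightarrow> is_cpx C N X \<and> Idm KK X \<in> Nul X X"

lemma null_if_contractible:
  assumes "is_cpx C N X" "is_cpx C N Y" "f \<in> cpx_maps C X Y" "contractible X \<or> contractible Y"
  shows "f \<in> Nul X Y"
  using assms null_left[of X X Y "Idm KK X" f] null_right[of X Y Y f "Idm KK Y"] K.id_left[of X Y f]
      K.id_right[of X Y f]
  unfolding contractible_def by auto

lemma conflationD:
  assumes "(X, Y, Z, u, v) \<in> EE"
  shows "is_cpx C N X" "is_cpx C N Y" "is_cpx C N Z" "u \<in> cpx_maps C X Y" "v \<in> cpx_maps C Y Z"
    "\<exists>q t. \<forall>i. biproduct C (Ob X i) (Ob Z i) (Ob Y i) (u i) (t i) (q i) (v i)"
  using assms unfolding conflations_def split_exact_def by (simp_all add: choice_iff)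

lemma conflationI:
  assumes "is_cpx C N X" "is_cpx C N Y" "is_cpx C N Z" "u \<in> cpx_maps C X Y" "v \<in> cpx_maps C Y Z"
    "\<And>i. biproduct C (Ob X i) (Ob Z i) (Ob Y i) (u i) (t i) (q i) (v i)"
  shows "(X, Y, Z, u, v) \<in> EE"
  using assms unfolding conflations_def split_exact_def by auto

text \<open>A homotopy is a family of maps subject to no compatibility, so it can be composed with
  the degreewise retractions \<open>q\<close>, which in general are not chain maps.\<close>

lemma null_extends:
  assumes e: "(X, Y, Z, u, v) \<in> EE" and W: "is_cpx C N W" and f: "f \<in> Nul X W"
  shows "\<exists>g\<in>Nul Y W. Cmp KK X Y W g u = f"
proof -
  note X = conflationD(1)[OF e] and Y = conflationD(2)[OF e] and u = conflationD(4)[OF e]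
  obtain q t where "\<forall>i. biproduct C (Ob X i) (Ob Z i) (Ob Y i) (u i) (t i) (q i) (v i)"
      using conflationD(6)[OF e] by auto
  then have bp: "biproduct C (Ob X i) (Ob Z i) (Ob Y i) (u i) (t i) (q i) (v i)" for i by blast
  obtain s where s: "s \<in> homot X W" "f = nullh X W s" using f null_homotopic_iff[OF X W] by blast
  note [simp] = cpx_simps[OF X] cpx_simps[OF Y] cpx_simps[OF W] homotD[OF s(1)] biproductD[OF bp]
  have sq: "(\<lambda>m. (Cmp C (Ob Y m) (Ob X m) (Ob W (m - int N + 1)) (s m) (q m))) \<in> homot Y W"
      by (simp add: homot_def)
  have "(\<lambda>m. (Cmp C (Ob X m) (Ob Y m) (Ob W (m - int N + 1)) (Cmp C (Ob Y m) (Ob X m)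
      (Ob W (m - int N + 1)) (s m) (q m)) (u m))) = s" by (simp add: fun_eq_iff)
  then have
      "Cmp KK X Y W (nullh Y W (\<lambda>m. (Cmp C (Ob Y m) (Ob X m) (Ob W (m - int N + 1)) (s m) (q m)))) u
      = f"
    using nullh_right(1)[OF X Y W sq u] s(2) by simp
  moreover have
      "nullh Y W (\<lambda>m. (Cmp C (Ob Y m) (Ob X m) (Ob W (m - int N + 1)) (s m) (q m))) \<in> Nul Y W"
    using nullh_chain[OF Y W sq] sq null_homotopic_iff[OF Y W] by blast
  ultimately show ?thesis by blast
qed

text \<open>Dually, the homotopy is composed with the degreewise sections \<open>t\<close>, taken in
  the degree m - N + 1 where it lands.\<close>

lemma null_lifts:
  assumes e: "(X, Y, Z, u, v) \<in> EE" and W: "is_cpx C N W" and f: "f \<in> Nul W Z"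
  shows "\<exists>g\<in>Nul W Y. Cmp KK W Y Z v g = f"
proof -
  note Y = conflationD(2)[OF e] and Z = conflationD(3)[OF e] and v = conflationD(5)[OF e]
  obtain q t where "\<forall>i. biproduct C (Ob X i) (Ob Z i) (Ob Y i) (u i) (t i) (q i) (v i)"
      using conflationD(6)[OF e] by auto
  then have bp: "biproduct C (Ob X i) (Ob Z i) (Ob Y i) (u i) (t i) (q i) (v i)" for i by blast
  obtain s' where s: "s' \<in> homot W Z" "f = nullh W Z s'" using f null_homotopic_iff[OF W Z] by blast
  note [simp] = cpx_simps[OF Y] cpx_simps[OF Z] cpx_simps[OF W] homotD[OF s(1)] biproductD[OF bp]
  have ts: "(\<lambda>m. (Cmp C (Ob W m) (Ob Z (m - int N + 1)) (Ob Y (m - int N + 1)) (t (m - int N + 1))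
      (s' m))) \<in> homot W Y" by (simp add: homot_def)
  have "(\<lambda>m. (Cmp C (Ob W m) (Ob Y (m - int N + 1)) (Ob Z (m - int N + 1)) (v (m - int N + 1))
      (Cmp C (Ob W m) (Ob Z (m - int N + 1)) (Ob Y (m - int N + 1)) (t (m - int N + 1)) (s' m)))) =
      s'"
    using cmp_eq_assoc[OF biproductD(7)[OF bp]] by (simp add: fun_eq_iff)
  then have
      "Cmp KK W Y Z v (nullh W Y (\<lambda>m. (Cmp C (Ob W m) (Ob Z (m - int N + 1)) (Ob Y (m - int N + 1))
      (t (m - int N + 1)) (s' m)))) = f"
    using nullh_left(1)[OF W Y Z ts v] s(2) by simp
  moreover have
      "nullh W Y (\<lambda>m. (Cmp C (Ob W m) (Ob Z (m - int N + 1)) (Ob Y (m - int N + 1))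
      (t (m - int N + 1)) (s' m))) \<in> Nul W Y"
    using nullh_chain[OF W Y ts] ts null_homotopic_iff[OF W Y] by blast
  ultimately show ?thesis by blast
qed

text \<open>Every map into a contractible complex is null-homotopic, and such maps extend along
  conflations.\<close>

lemma contractible_injective:
  assumes "contractible K"
  shows "injective_object KK EE K"
  unfolding injective_object_def
proof (intro conjI allI impI ballI)
  show "K \<in> Obj KK" using assms by (simp add: contractible_def)
  fix X Y Z u v f assume e: "(X, Y, Z, u, v) \<in> EE" and f: "f \<in> Hom KK X K"
  have K: "is_cpx C N K" using assms by (simp add: contractible_def)
  have "f \<in> Nul X K" using null_if_contractible[OF conflationD(1)[OF e] K] f assms by simp
  then obtain g where "g \<in> Nul Y K" "Cmp KK X Y K g u = f" using null_extends[OF e K] by blast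
  then show "\<exists>g\<in>Hom KK Y K. Cmp KK X Y K g u = f" using null_in by auto
qed

lemma contractible_projective:
  assumes K: "contractible K" and e: "(X, Y, Z, u, v) \<in> EE" and f: "f \<in> Hom KK K Z"
  shows "\<exists>g\<in>Hom KK K Y. Cmp KK K Y Z v g = f"
proof -
  have K': "is_cpx C N K" using assms by (simp add: contractible_def)
  have "f \<in> Nul K Z" using null_if_contractible[OF K' conflationD(3)[OF e]] f K by simp
  then obtain g where "g \<in> Nul K Y" "Cmp KK K Y Z v g = f" using null_lifts[OF e K'] by blast
  then show ?thesis using null_in by auto
qed

lemma contractible_retract:
  assumes K: "contractible K" and X: "is_cpx C N X" and i: "i \<in> cpx_maps C X K"
      and p: "p \<in> cpx_maps C K X"
    and pi: "Cmp KK X K X p i = Idm KK X"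
  shows "contractible X"
proof -
  have K': "is_cpx C N K" using assms by (simp add: contractible_def)
  have "Cmp KK X K X p i \<in> Nul X X"
    by (rule null_left[OF X K' X null_if_contractible[OF X K' i] p]) (use K in simp)
  then show ?thesis using X unfolding contractible_def pi by simp
qed

end


section \<open>Finite biproducts\<close>

definition nbiproduct ::
    "('o, 'm, 'z) cat_scheme \<Rightarrow> 'k set \<Rightarrow> ('k \<Rightarrow> 'o) \<Rightarrow> 'o \<Rightarrow> ('k \<Rightarrow> 'm) \<Rightarrow> ('k \<Rightarrow> 'm) \<Rightarrow> bool" where
  "nbiproduct C K A P i p \<longleftrightarrow> P \<in> Obj C \<and> (\<forall>k\<in>K. i k \<in> Hom C (A k) P \<and> p k \<in> Hom C P (A k)) \<and>
    (\<forall>k\<in>K. \<forall>l\<in>K. Cmp C (A l) P (A k) (p k) (i l) = (if k = l then Idm C (A k) else Zero C (A l)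
        (A k))) \<and>
    finprod (HomG C P P) (\<lambda>k. (Cmp C P (A k) P (i k) (p k))) K = Idm C P"

lemma nbiproductD:
  assumes "nbiproduct C K A P i p"
  shows "P \<in> Obj C" "k \<in> K \<Longrightarrow> i k \<in> Hom C (A k) P" "k \<in> K \<Longrightarrow> p k \<in> Hom C P (A k)"
    "\<lbrakk>k \<in> K; l \<in> K\<rbrakk>
        \<Longrightarrow> Cmp C (A l) P (A k) (p k) (i l) = (if k = l then Idm C (A k) else Zero C (A l) (A k))"
    "finprod (HomG C P P) (\<lambda>k. (Cmp C P (A k) P (i k) (p k))) K = Idm C P"
  using assms unfolding nbiproduct_def by auto

context additive_category
begin

lemma nbiproduct_exists:
  "\<lbrakk>finite K; \<And>k. k \<in> K \<Longrightarrow> A k \<in> Obj C\<rbrakk> \<Longrightarrow> \<exists>P i p. nbiproduct C K A P i p"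
proof (induction K rule: finite_induct)
  case empty
  obtain Z where "zero_object C Z" using ex_zero_object by auto
  then have Z: "Z \<in> Obj C" "Idm C Z = Zero C Z Z" using zero_object_iff
      by (auto simp: zero_object_def)
  interpret G: comm_group "HomG C Z Z" by (rule hom_group) (use Z in auto)
  show ?case using Z unfolding nbiproduct_def by (intro exI[of _ Z]) simp
next
  case (insert x K)
  then obtain P0 i0 p0 where n: "nbiproduct C K A P0 i0 p0" by auto
  note [simp] = nbiproductD(1-3)[OF n]
  have [simp]: "A x \<in> Obj C" "\<And>k. k \<in> K \<Longrightarrow> A k \<in> Obj C" using insert by auto
  obtain P i1 i2 p1 p2 where bp: "biproduct C (A x) P0 P i1 i2 p1 p2"
      using ex_biproduct[of "A x" P0] by auto
  note [simp] = biproductD[OF bp]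
  note bps = cmp_eq_assoc[OF biproductD(7)[OF bp]] cmp_eq_assoc[OF biproductD(8)[OF bp]]
      cmp_eq_assoc[OF biproductD(9)[OF bp]]
  define i where "i k = (if k = x then i1 else (Cmp C (A k) P0 P i2 (i0 k)))" for k
  define p where "p k = (if k = x then p1 else (Cmp C P P0 (A k) (p0 k) p2))" for k
  interpret G: comm_group "HomG C P P" by (rule hom_group) simp_all
  have "nbiproduct C (insert x K) A P i p"
    unfolding nbiproduct_def
  proof (intro conjI ballI)
    show "i k \<in> Hom C (A k) P" "p k \<in> Hom C P (A k)" if "k \<in> insert x K" for k
      using that by (auto simp: i_def p_def)
    show "Cmp C (A l) P (A k) (p k) (i l) = (if k = l then Idm C (A k) else Zero C (A l) (A k))"
      if "k \<in> insert x K" "l \<in> insert x K" for k l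
      using that insert(2) nbiproductD(4)[OF n] by (auto simp: i_def p_def bps)
    have "finprod (HomG C P P) (\<lambda>k. (Cmp C P (A k) P (i k) (p k))) (insert x K)
        = Add C P P (Cmp C P (A x) P (i x) (p x))
            (finprod (HomG C P P) (\<lambda>k. (Cmp C P (A k) P (i k) (p k))) K)"
      by (rule G.finprod_insert) (use insert in \<open>auto simp: i_def p_def\<close>)
    also have
        "finprod (HomG C P P) (\<lambda>k. (Cmp C P (A k) P (i k) (p k))) K
        = finprod (HomG C P P)
        (\<lambda>k. (Cmp C P P0 P i2 (Cmp C P P0 P0 (Cmp C P0 (A k) P0 (i0 k) (p0 k)) p2))) K"
      by (rule G.finprod_cong') (use insert(2) in \<open>auto simp: i_def p_def\<close>)
    also have
        "\<dots> = Cmp C P P0 P i2 (finprod (HomG C P P0)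
        (\<lambda>k. (Cmp C P P0 P0 (Cmp C P0 (A k) P0 (i0 k) (p0 k)) p2)) K)"
      by (rule cmp_finprod_right[symmetric]) auto
    also have "finprod (HomG C P P0) (\<lambda>k. (Cmp C P P0 P0 (Cmp C P0 (A k) P0 (i0 k) (p0 k)) p2)) K
        = Cmp C P P0 P0 (finprod (HomG C P0 P0) (\<lambda>k. (Cmp C P0 (A k) P0 (i0 k) (p0 k))) K) p2"
      by (rule cmp_finprod_left[symmetric]) auto
    also have "\<dots> = p2" by (simp add: nbiproductD(5)[OF n])
    finally show "finprod (HomG C P P) (\<lambda>k. (Cmp C P (A k) P (i k) (p k))) (insert x K) = Idm C P"
      by (simp add: i_def p_def)
  qed simp
  then show ?case by blast
qed

lemma nbiproduct_joint_mono:
  assumes n: "nbiproduct C K A P i p" and A [simp]: "\<And>k. k \<in> K \<Longrightarrow> A k \<in> Obj C"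
      and [simp]: "W \<in> Obj C" "g \<in> Hom C W P" "g' \<in> Hom C W P"
    and eq: "\<And>k. k \<in> K \<Longrightarrow> Cmp C W P (A k) (p k) g = Cmp C W P (A k) (p k) g'"
  shows "g = g'"
proof -
  note [simp] = nbiproductD(1-3)[OF n]
  have e: "g = finprod (HomG C W P) (\<lambda>k. (Cmp C W (A k) P (i k) (Cmp C W P (A k) (p k) g))) K"
      if [simp]: "g \<in> Hom C W P" for g
  proof -
    interpret G: comm_group "HomG C W P" by (rule hom_group) simp_all
    have "g = Cmp C W P P (finprod (HomG C P P) (\<lambda>k. (Cmp C P (A k) P (i k) (p k))) K) g"
        by (simp add: nbiproductD(5)[OF n])
    also have "\<dots> = finprod (HomG C W P) (\<lambda>k. (Cmp C W P P (Cmp C P (A k) P (i k) (p k)) g)) K"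
        by (rule cmp_finprod_left) auto
    also have "\<dots> = finprod (HomG C W P) (\<lambda>k. (Cmp C W (A k) P (i k) (Cmp C W P (A k) (p k) g))) K"
        by (rule G.finprod_cong') auto
    finally show ?thesis .
  qed
  interpret G: comm_group "HomG C W P" by (rule hom_group) simp_all
  have "finprod (HomG C W P) (\<lambda>k. (Cmp C W (A k) P (i k) (Cmp C W P (A k) (p k) g))) K
      = finprod (HomG C W P) (\<lambda>k. (Cmp C W (A k) P (i k) (Cmp C W P (A k) (p k) g'))) K"
    by (rule G.finprod_cong') (auto simp: eq)
  then show ?thesis using e[of g] e[of g'] by simp
qed

lemma nbiproduct_joint_epi:
  assumes n: "nbiproduct C K A P i p" and A [simp]: "\<And>k. k \<in> K \<Longrightarrow> A k \<in> Obj C"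
      and [simp]: "W \<in> Obj C" "e \<in> Hom C P W" "e' \<in> Hom C P W"
    and eq: "\<And>k. k \<in> K \<Longrightarrow> Cmp C (A k) P W e (i k) = Cmp C (A k) P W e' (i k)"
  shows "e = e'"
proof -
  note [simp] = nbiproductD(1-3)[OF n]
  have e: "g = finprod (HomG C P W) (\<lambda>k. Cmp C P (A k) W (Cmp C (A k) P W g (i k)) (p k)) K"
      if [simp]: "g \<in> Hom C P W" for g
  proof -
    interpret G: comm_group "HomG C P W" by (rule hom_group) simp_all
    have "g = Cmp C P P W g (finprod (HomG C P P) (\<lambda>k. (Cmp C P (A k) P (i k) (p k))) K)"
        by (simp add: nbiproductD(5)[OF n])
    also have "\<dots> = finprod (HomG C P W) (\<lambda>k. Cmp C P P W g (Cmp C P (A k) P (i k) (p k))) K"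
        by (rule cmp_finprod_right) auto
    also have "\<dots> = finprod (HomG C P W) (\<lambda>k. Cmp C P (A k) W (Cmp C (A k) P W g (i k)) (p k)) K"
        by (rule G.finprod_cong') auto
    finally show ?thesis .
  qed
  interpret G: comm_group "HomG C P W" by (rule hom_group) simp_all
  have "finprod (HomG C P W) (\<lambda>k. Cmp C P (A k) W (Cmp C (A k) P W e (i k)) (p k)) K
     = finprod (HomG C P W) (\<lambda>k. Cmp C P (A k) W (Cmp C (A k) P W e' (i k)) (p k)) K"
    by (rule G.finprod_cong') (auto simp: eq simp del: cmp_assoc)
  then show ?thesis using e[of e] e[of e'] by simp
qed

lemma nbiproduct_tuple:
  assumes n: "nbiproduct C K A P i p" and fin: "finite K" and A [simp]: "\<And>k. k \<in> K \<Longrightarrow> A k \<in> Obj C"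
      and [simp]: "W \<in> Obj C"
    and f [simp]: "\<And>k. k \<in> K \<Longrightarrow> f k \<in> Hom C W (A k)"
  shows "\<exists>g\<in>Hom C W P. \<forall>k\<in>K. Cmp C W P (A k) (p k) g = f k"
proof (intro bexI[of _ "finprod (HomG C W P) (\<lambda>k. (Cmp C W (A k) P (i k) (f k))) K"] ballI)
  note [simp] = nbiproductD(1-3)[OF n]
  interpret G: comm_group "HomG C W P" by (rule hom_group) simp_all
  show "finprod (HomG C W P) (\<lambda>k. (Cmp C W (A k) P (i k) (f k))) K \<in> Hom C W P"
      by (rule G.finprod_closed) auto
  fix l assume l [simp]: "l \<in> K"
  interpret H: comm_group "HomG C W (A l)" by (rule hom_group) simp_all
  have "Cmp C W P (A l) (p l) (finprod (HomG C W P) (\<lambda>k. (Cmp C W (A k) P (i k) (f k))) K)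
      = finprod (HomG C W (A l)) (\<lambda>k. (Cmp C W P (A l) (p l) (Cmp C W (A k) P (i k) (f k))))
          K" by (rule cmp_finprod_right) auto
  also have "\<dots> = finprod (HomG C W (A l)) (\<lambda>k. if l = k then f l else Zero C W (A l)) K"
    by (rule H.finprod_cong') (auto simp: cmp_eq_assoc[OF nbiproductD(4)[OF n]])
  also have "\<dots> = f l" by (rule H.finprod_singleton) (use fin in auto)
  finally show "Cmp C W P (A l) (p l) (finprod (HomG C W P) (\<lambda>k. (Cmp C W (A k) P (i k) (f k))) K)
      = f l" .
qed

lemma nbiproduct_cotuple:
  assumes n: "nbiproduct C K A P i p" and fin: "finite K" and A [simp]: "\<And>k. k \<in> K \<Longrightarrow> A k \<in> Obj C"
      and [simp]: "W \<in> Obj C"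
    and h [simp]: "\<And>k. k \<in> K \<Longrightarrow> h k \<in> Hom C (A k) W"
  shows "\<exists>e\<in>Hom C P W. \<forall>k\<in>K. Cmp C (A k) P W e (i k) = h k"
proof (intro bexI[of _ "finprod (HomG C P W) (\<lambda>k. (Cmp C P (A k) W (h k) (p k))) K"] ballI)
  note [simp] = nbiproductD(1-3)[OF n]
  interpret G: comm_group "HomG C P W" by (rule hom_group) simp_all
  show "finprod (HomG C P W) (\<lambda>k. (Cmp C P (A k) W (h k) (p k))) K \<in> Hom C P W"
      by (rule G.finprod_closed) auto
  fix l assume l [simp]: "l \<in> K"
  interpret H: comm_group "HomG C (A l) W" by (rule hom_group) simp_all
  have "Cmp C (A l) P W (finprod (HomG C P W) (\<lambda>k. (Cmp C P (A k) W (h k) (p k))) K) (i l)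
      = finprod (HomG C (A l) W) (\<lambda>k. (Cmp C (A l) P W (Cmp C P (A k) W (h k) (p k)) (i l)))
          K" by (rule cmp_finprod_left) auto
  also have "\<dots> = finprod (HomG C (A l) W) (\<lambda>k. if l = k then h l else Zero C (A l) W) K"
    by (rule H.finprod_cong') (auto simp: nbiproductD(4)[OF n])
  also have "\<dots> = h l" by (rule H.finprod_singleton) (use fin in auto)
  finally show "Cmp C (A l) P W (finprod (HomG C P W) (\<lambda>k. (Cmp C P (A k) W (h k) (p k))) K) (i l)
      = h l" .
qed

text \<open>The sum of the other summands is a complement. This provides the degreewise splittings
  of the hulls.\<close>

lemma nbiproduct_complement:
  assumes n: "nbiproduct C K A P i p" and fin: "finite K" and A [simp]: "\<And>k. k \<in> K \<Longrightarrow> A k \<in> Obj C"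
      and x [simp]: "x \<in> K"
  shows "\<exists>S t q. S \<in> Obj C \<and> biproduct C (A x) S P (i x) t (p x) q"
proof -
  note [simp] = nbiproductD(1-3)[OF n]
  obtain S i' p' where n': "nbiproduct C (K - {x}) A S i' p'"
      using nbiproduct_exists[of "K - {x}" A] fin by auto
  note [simp] = nbiproductD(1-3)[OF n']
  have "\<exists>t\<in>Hom C S P. \<forall>k\<in>K. Cmp C S P (A k) (p k) t = (if k = x then Zero C S (A k) else p' k)"
    by (rule nbiproduct_tuple[OF n fin]) auto
  then obtain t where t [simp]: "t \<in> Hom C S P"
      and pt: "\<And>k. k \<in> K \<Longrightarrow> Cmp C S P (A k) (p k) t = (if k = x then Zero C S (A k) else p' k)"
    by auto
  have "\<exists>q\<in>Hom C P S. \<forall>k\<in>K - {x}. Cmp C P S (A k) (p' k) q = p k"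
    by (rule nbiproduct_tuple[OF n']) (use fin in auto)
  then obtain q where q [simp]: "q \<in> Hom C P S"
      and pq: "\<And>k. k \<in> K \<Longrightarrow> k \<noteq> x \<Longrightarrow> Cmp C P S (A k) (p' k) q = p k" by auto
  have 1: "Cmp C S P S q t = Idm C S"
    by (rule nbiproduct_joint_mono[OF n']) (auto simp: cmp_eq_assoc[OF pq] pt)
  have 2: "Cmp C (A x) P S q (i x) = Zero C (A x) S"
    by (rule nbiproduct_joint_mono[OF n']) (auto simp: cmp_eq_assoc[OF pq] nbiproductD(4)[OF n])
  have 3: "Add C P P (Cmp C P (A x) P (i x) (p x)) (Cmp C P S P t q) = Idm C P"
    by (rule nbiproduct_joint_mono[OF n])
      (auto simp: cmp_eq_assoc[OF pt] cmp_eq_assoc[OF nbiproductD(4)[OF n]] pq)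
  have "biproduct C (A x) S P (i x) t (p x) q"
    unfolding biproduct_def using 1 2 3 nbiproductD(4)[OF n, of x x] pt[of x] by simp
  then show ?thesis using nbiproductD(1)[OF n'] by blast
qed

text \<open>The cancellation behind the later checks that a sheared decomposition still sums to the
  identity.\<close>

lemma add_add_neg:
  assumes [simp]: "X \<in> Obj C" "P \<in> Obj C" "x \<in> Hom C X P" "y \<in> Hom C X P" "z \<in> Hom C X P"
  shows "Add C X P (Add C X P x y) (Add C X P z (Neg C X P y)) = Add C X P x z"
      "Add C X P (Add C X P z (Neg C X P y)) (Add C X P x y) = Add C X P x z"
proof -
  show "Add C X P (Add C X P x y) (Add C X P z (Neg C X P y)) = Add C X P x z"
    by (subst add_commute[of X P z]) (simp_all add: add_assoc)
  then show "Add C X P (Add C X P z (Neg C X P y)) (Add C X P x y) = Add C X P x z"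
      by (subst add_commute) simp_all
qed

text \<open>A shear of the decomposition: the complement \<open>i2\<close> stays in place, and the
  correction p2 u p1 makes the second projection vanish on the new first summand.\<close>

lemma biproduct_twist:
  assumes bp: "biproduct C X S P i1 i2 p1 p2" and [simp]: "X \<in> Obj C" "S \<in> Obj C" "u \<in> Hom C X P"
      and pu: "Cmp C X P X p1 u = Idm C X"
  shows "biproduct C X S P u i2 p1 (Add C P S p2 (Neg C P S (Cmp C P P S p2 (Cmp C P X P u p1))))"
proof -
  note [simp] = biproductD(1-5)[OF bp]
  note bps = biproductD(6-9)[OF bp]
  have "Cmp C X P P (Add C P P (Cmp C P X P i1 p1) (Cmp C P S P i2 p2)) u = u"
      unfolding biproductD(10)[OF bp] by simp
  then have "Add C X P i1 (Cmp C X S P i2 (Cmp C X P S p2 u)) = u" by (simp add: pu)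
  then have "Cmp C P X P (Add C X P i1 (Cmp C X S P i2 (Cmp C X P S p2 u))) p1 = Cmp C P X P u p1"
      by simp
  then have e:
      "Cmp C P X P u p1
      = Add C P P (Cmp C P X P i1 p1)
      (Cmp C P S P i2 (Cmp C P P S p2 (Cmp C P X P u p1)))" by simp
  have "Add C P P (Cmp C P X P u p1)
      (Cmp C P S P i2 (Add C P S p2 (Neg C P S (Cmp C P P S p2 (Cmp C P X P u p1))))) = Idm C P"
  proof -
    have "Add C P P (Cmp C P X P u p1)
        (Cmp C P S P i2 (Add C P S p2 (Neg C P S (Cmp C P P S p2 (Cmp C P X P u p1))))) = Add C P P
        (Add C P P (Cmp C P X P i1 p1) (Cmp C P S P i2 (Cmp C P P S p2 (Cmp C P X P u p1))))
        (Add C P P (Cmp C P S P i2 p2)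
        (Neg C P P (Cmp C P S P i2 (Cmp C P P S p2 (Cmp C P X P u p1)))))" by
        (simp flip: e)
    also have "\<dots> = Add C P P (Cmp C P X P i1 p1) (Cmp C P S P i2 p2)" by (rule add_add_neg) simp_all
    finally show ?thesis unfolding biproductD(10)[OF bp] .
  qed
  then show ?thesis unfolding biproduct_def using bps
    by (simp add: pu)
qed

text \<open>The dual shear, in which the inclusion of the complement is moved into the kernel of
  \<open>v\<close>.\<close>

lemma biproduct_twist':
  assumes bp: "biproduct C X S P i1 i2 p1 p2" and [simp]: "X \<in> Obj C" "S \<in> Obj C" "v \<in> Hom C P X"
      and vi: "Cmp C X P X v i1 = Idm C X"
  shows "biproduct C S X P (Add C S P i2 (Neg C S P (Cmp C S X P i1 (Cmp C S P X v i2)))) i1 p2 v"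
proof -
  note [simp] = biproductD(1-5)[OF bp]
  note bps = biproductD(6-9)[OF bp]
  have "Cmp C P P X v (Add C P P (Cmp C P X P i1 p1) (Cmp C P S P i2 p2)) = v"
      unfolding biproductD(10)[OF bp] by simp
  then have "Add C P X p1 (Cmp C P P X v (Cmp C P S P i2 p2)) = v"
      by (simp add: cmp_eq_assoc[OF vi])
  then have "Cmp C P X P i1 (Add C P X p1 (Cmp C P P X v (Cmp C P S P i2 p2))) = Cmp C P X P i1 v"
      by simp
  then have e:
      "Cmp C P X P i1 v
      = Add C P P (Cmp C P X P i1 p1)
      (Cmp C P X P i1 (Cmp C P P X v (Cmp C P S P i2 p2)))" by simp
  have "Add C P P (Cmp C P S P (Add C S P i2 (Neg C S P (Cmp C S X P i1 (Cmp C S P X v i2)))) p2)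
      (Cmp C P X P i1 v) = Idm C P"
  proof -
    have "Add C P P (Cmp C P S P (Add C S P i2 (Neg C S P (Cmp C S X P i1 (Cmp C S P X v i2)))) p2)
        (Cmp C P X P i1 v) = Add C P P
        (Add C P P (Cmp C P S P i2 p2)
        (Neg C P P (Cmp C P X P i1 (Cmp C P P X v (Cmp C P S P i2 p2))))) (Add C P P
        (Cmp C P X P i1 p1) (Cmp C P X P i1 (Cmp C P P X v (Cmp C P S P i2 p2))))" by
        (simp add: e)
    also have "\<dots> = Add C P P (Cmp C P X P i1 p1) (Cmp C P S P i2 p2)" by (rule add_add_neg) simp_all
    finally show ?thesis unfolding biproductD(10)[OF bp] .
  qed
  then show ?thesis unfolding biproduct_def using bps
    by (simp add: cmp_eq_assoc[OF vi] cmp_eq_assoc[OF biproductD(9)[OF bp]] vi)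
qed

end


section \<open>The Frobenius category of complexes\<close>

context complexes
begin

text \<open>The differential is carried to the complements as p d t. Since \<open>u\<close> is a
  chain map and p u = 0, \<open>p\<close> becomes a chain map; being a split epimorphism in each
  degree, it passes on the vanishing of \<open>N\<close>-fold composites.\<close>

lemma coker_complex:
  assumes X: "is_cpx C N X" and Y: "is_cpx C N Y" and u: "u \<in> cpx_maps C X Y"
      and S [simp]: "\<And>i. S i \<in> Obj C"
    and bp: "\<And>i. biproduct C (Ob X i) (S i) (Ob Y i) (u i) (t i) (q i) (p i)"
  shows "\<exists>Z. Ob Z = S \<and> (X, Y, Z, u, p) \<in> EE"
proof -
  define Z where
      "Z = \<lparr>Ob = S, Df
      = (\<lambda>i. (Cmp C (S i) (Ob Y (i + 1)) (S (i + 1)) (p (i + 1))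
      (Cmp C (S i) (Ob Y i) (Ob Y (i + 1)) (Df Y i) (t i))))\<rparr>"
  have Zs [simp]: "Ob Z = S"
      "Df Z i = Cmp C (S i) (Ob Y (i + 1)) (S (i + 1)) (p (i + 1)) (Cmp C (S i) (Ob Y i)
      (Ob Y (i + 1)) (Df Y i) (t i))" for i by (simp_all add: Z_def)
  note [simp] = cpx_simps[OF X] cpx_simps[OF Y] cpx_mapsD(1)[OF u] biproductD[OF bp]
  have seq: "is_seq C Z" by (simp add: is_seq_def)
  have pc: "Cmp C (Ob Y i) (Ob Y (i + 1)) (S (i + 1)) (p (i + 1)) (Df Y i)
      = Cmp C (Ob Y i) (S i) (S (i + 1))
      (Cmp C (S i) (Ob Y (i + 1)) (S (i + 1)) (p (i + 1))
      (Cmp C (S i) (Ob Y i) (Ob Y (i + 1)) (Df Y i) (t i))) (p i)" for i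
  proof -
    have "Cmp C (Ob Y i) (Ob Y (i + 1)) (S (i + 1)) (p (i + 1)) (Df Y i)
        = Cmp C (Ob Y i) (Ob Y (i + 1)) (S (i + 1)) (p (i + 1))
        (Cmp C (Ob Y i) (Ob Y i) (Ob Y (i + 1)) (Df Y i)
        (Add C (Ob Y i) (Ob Y i) (Cmp C (Ob Y i) (Ob X i) (Ob Y i) (u i) (q i))
        (Cmp C (Ob Y i) (S i) (Ob Y i) (t i) (p i))))" by simp
    also have
        "\<dots> = Add C (Ob Y i) (S (i + 1)) (Cmp C (Ob Y i) (Ob Y (i + 1)) (S (i + 1)) (p (i + 1))
        (Cmp C (Ob Y i) (Ob X i) (Ob Y (i + 1)) (Cmp C (Ob X i) (Ob Y i) (Ob Y (i + 1)) (Df Y i)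
        (u i)) (q i))) (Cmp C (Ob Y i) (Ob Y (i + 1)) (S (i + 1)) (p (i + 1))
        (Cmp C (Ob Y i) (Ob Y i) (Ob Y (i + 1)) (Df Y i)
        (Cmp C (Ob Y i) (S i) (Ob Y i) (t i) (p i))))"
      by (simp del: biproductD(10)[OF bp])
    also have
        "Cmp C (Ob Y i) (Ob Y (i + 1)) (S (i + 1)) (p (i + 1)) (Cmp C (Ob Y i) (Ob X i)
        (Ob Y (i + 1)) (Cmp C (Ob X i) (Ob Y i) (Ob Y (i + 1)) (Df Y i) (u i)) (q i)) = Zero C
        (Ob Y i) (S (i + 1))"
      unfolding cpx_mapsD(2)[OF u, of i, symmetric]
      by (simp add: cmp_eq_assoc[OF biproductD(9)[OF bp]])
    finally show ?thesis by simp
  qed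
  have pd: "Cmp C (Ob Y i) (S i) (S j) (dmap C Z i j) (p i)
      = Cmp C (Ob Y i) (Ob Y j) (S j) (p j) (dmap C Y i j)" if "i \<le> j" for i j
    using cpx_maps_dmap[of p Y Z i j] that seq pc by (simp add: cpx_maps_def)
  have Z: "is_cpx C N Z"
    unfolding is_cpx_iff
  proof (intro conjI allI seq)
    fix i
    have "(dmap C Z i (i + int N))
        = Cmp C (S i) (Ob Y i) (S (i + int N))
        (Cmp C (Ob Y i) (S i) (S (i + int N)) (dmap C Z i (i + int N)) (p i)) (t i)"
      using dmap_in[OF seq, of i "i + int N"] by simp
    also have "\<dots> = Zero C (S i) (S (i + int N))"
      unfolding pd[of i "i + int N", simplified] using dmap_zero[OF Y, of i "i + int N"] by simp
    finally show "dmap C Z i (i + int N) = Zero C (Ob Z i) (Ob Z (i + int N))" by simp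
  qed
  have "p \<in> cpx_maps C Y Z" using pc by (simp add: cpx_maps_def)
  then have "(X, Y, Z, u, p) \<in> EE" by (intro conflationI[OF X Y Z u]) (use bp in auto)
  then show ?thesis by (intro exI[of _ Z]) simp
qed

lemma ker_complex:
  assumes Y: "is_cpx C N Y" and Z: "is_cpx C N Z" and v: "v \<in> cpx_maps C Y Z"
      and S [simp]: "\<And>i. S i \<in> Obj C"
    and bp: "\<And>i. biproduct C (S i) (Ob Z i) (Ob Y i) (u i) (t i) (q i) (v i)"
  shows "\<exists>K. Ob K = S \<and> (K, Y, Z, u, v) \<in> EE"
proof -
  define K where
      "K = \<lparr>Ob = S, Df
      = (\<lambda>i. (Cmp C (S i) (Ob Y (i + 1)) (S (i + 1)) (q (i + 1))
      (Cmp C (S i) (Ob Y i) (Ob Y (i + 1)) (Df Y i) (u i))))\<rparr>"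
  have Ks [simp]: "Ob K = S"
      "Df K i = Cmp C (S i) (Ob Y (i + 1)) (S (i + 1)) (q (i + 1)) (Cmp C (S i) (Ob Y i)
      (Ob Y (i + 1)) (Df Y i) (u i))" for i by (simp_all add: K_def)
  note [simp] = cpx_simps[OF Y] cpx_simps[OF Z] cpx_mapsD(1)[OF v] biproductD[OF bp]
  have seq: "is_seq C K" by (simp add: is_seq_def)
  have uc: "Cmp C (S i) (Ob Y i) (Ob Y (i + 1)) (Df Y i) (u i)
      = Cmp C (S i) (S (i + 1)) (Ob Y (i + 1)) (u (i + 1))
      (Cmp C (S i) (Ob Y (i + 1)) (S (i + 1)) (q (i + 1))
      (Cmp C (S i) (Ob Y i) (Ob Y (i + 1)) (Df Y i) (u i)))" for i
  proof -
    have "Cmp C (S i) (Ob Y i) (Ob Y (i + 1)) (Df Y i) (u i)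
        = Cmp C (S i) (Ob Y (i + 1)) (Ob Y (i + 1))
        (Add C (Ob Y (i + 1)) (Ob Y (i + 1)) (Cmp C (Ob Y (i + 1)) (S (i + 1)) (Ob Y (i + 1))
        (u (i + 1)) (q (i + 1))) (Cmp C (Ob Y (i + 1)) (Ob Z (i + 1)) (Ob Y (i + 1))
        (t (i + 1)) (v (i + 1)))) (Cmp C (S i) (Ob Y i) (Ob Y (i + 1)) (Df Y i) (u
        i))" by simp
    also have
        "\<dots> = Add C (S i) (Ob Y (i + 1)) (Cmp C (S i) (S (i + 1)) (Ob Y (i + 1)) (u (i + 1))
        (Cmp C (S i) (Ob Y (i + 1)) (S (i + 1)) (q (i + 1))
        (Cmp C (S i) (Ob Y i) (Ob Y (i + 1)) (Df Y i) (u i))))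
        (Cmp C (S i) (Ob Z (i + 1)) (Ob Y (i + 1)) (t (i + 1))
        (Cmp C (S i) (Ob Y i) (Ob Z (i + 1))
        (Cmp C (Ob Y i) (Ob Y (i + 1)) (Ob Z (i + 1)) (v (i + 1)) (Df Y i)) (u i)))"
      by (simp del: biproductD(10)[OF bp])
    also have
        "Cmp C (S i) (Ob Z (i + 1)) (Ob Y (i + 1)) (t (i + 1)) (Cmp C (S i) (Ob Y i) (Ob Z (i + 1))
        (Cmp C (Ob Y i) (Ob Y (i + 1)) (Ob Z (i + 1)) (v (i + 1)) (Df Y i)) (u i)) = Zero C (S
        i) (Ob Y (i + 1))"
      unfolding cpx_mapsD(2)[OF v, of i] by simp
    finally show ?thesis by simp
  qed
  have ud: "Cmp C (S i) (S j) (Ob Y j) (u j) (dmap C K i j)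
      = Cmp C (S i) (Ob Y i) (Ob Y j) (dmap C Y i j) (u i)" if "i \<le> j" for i j
    using cpx_maps_dmap[of u K Y i j] that seq uc by (simp add: cpx_maps_def)
  have K: "is_cpx C N K"
    unfolding is_cpx_iff
  proof (intro conjI allI seq)
    fix i
    have "(dmap C K i (i + int N))
        = Cmp C (S i) (Ob Y (i + int N)) (S (i + int N)) (q (i + int N))
        (Cmp C (S i) (S (i + int N)) (Ob Y (i + int N)) (u (i + int N))
        (dmap C K i (i + int N)))"
      using dmap_in[OF seq, of i "i + int N"] by (simp add: cmp_eq_assoc[OF biproductD(6)[OF bp]])
    also have "\<dots> = Zero C (S i) (S (i + int N))"
      unfolding ud[of i "i + int N", simplified] using dmap_zero[OF Y, of i "i + int N"] by simp
    finally show "dmap C K i (i + int N) = Zero C (Ob K i) (Ob K (i + int N))" by simp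
  qed
  have "u \<in> cpx_maps C K Y" using uc by (simp add: cpx_maps_def)
  then have "(K, Y, Z, u, v) \<in> EE" by (intro conflationI[OF K Y Z _ v]) (use bp in auto)
  then show ?thesis by (intro exI[of _ K]) simp
qed

end

section \<open>Contractible complexes as enough injectives and projectives\<close>

context complexes
begin

text \<open>The contractible complex with \<open>\<Oplus>\<^sub>m A m\<close>, \<open>i \<le> m < i + N\<close>, in degree \<open>i\<close>: a map into it
  amounts to a family of maps into the \<open>A m\<close>, a map out of it to a family of maps out of them.\<close>

definition free_cpx :: "(int \<Rightarrow> 'o) \<Rightarrow> ('o, 'm) cpx \<Rightarrow> (int \<Rightarrow> int \<Rightarrow> 'm) \<Rightarrow> (int \<Rightarrow> int \<Rightarrow> 'm) \<Rightarrow> bool"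
    where
  "free_cpx A Z e r \<longleftrightarrow> contractible Z \<and> (\<forall>i. nbiproduct C {i..<i + int N} A (Ob Z i) (e i) (r i)) \<and>
    (\<forall>i m. i + 1 \<le> m \<longrightarrow> m < i + 1 + int N \<longrightarrow>
      Cmp C (Ob Z i) (Ob Z (i + 1)) (A m) (r (i + 1) m) (Df Z i) =
          (if m < i + int N then r i m else Zero C (Ob Z i) (A m)))"

text \<open>Each A m occupies the degrees from m - N + 1 to m, connected by identities. From degree
  i to i + 1 the differential therefore drops A i and has zero component in the new summand A (i +
  N).\<close>

lemma free_cpx_exists:
  assumes A [simp]: "\<And>m. A m \<in> Obj C"
  shows "\<exists>Z e r. free_cpx A Z e r"
proof -
  have "\<exists>P i p. nbiproduct C {k..<k + int N} A P i p" for k by (rule nbiproduct_exists) auto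
  then obtain P e r where n: "\<And>i. nbiproduct C {i..<i + int N} A (P i) (e i) (r i)" by metis
  note [simp] = nbiproductD(1)[OF n]
  have ein [simp]: "e i m \<in> Hom C (A m) (P i)" "r i m \<in> Hom C (P i) (A m)"
      if "i \<le> m" "m < i + int N" for i m
    using nbiproductD(2,3)[OF n, of m i] that by auto
  have re: "Cmp C (A l) (P i) (A k) (r i k) (e i l)
      = (if k = l then Idm C (A k) else Zero C (A l) (A k))"
    if "i \<le> k" "k < i + int N" "i \<le> l" "l < i + int N" for i k l
    using nbiproductD(4)[OF n, of k i l] that by auto
  have "\<exists>g\<in>Hom C (P i) (P (i + 1)). \<forall>m\<in>{i + 1..<i + 1 + int N}.
      Cmp C (P i) (P (i + 1)) (A m) (r (i + 1) m) g =
          (if m < i + int N then r i m else Zero C (P i) (A m))" for i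
    by (rule nbiproduct_tuple[OF n]) auto
  then obtain del where del [simp]: "\<And>i. del i \<in> Hom C (P i) (P (i + 1))"
    and rdel: "\<And>i m. \<lbrakk>i + 1 \<le> m; m < i + 1 + int N\<rbrakk>
        \<Longrightarrow> Cmp C (P i) (P (i + 1)) (A m) (r (i + 1) m) (del i) =
        (if m < i + int N then r i m else Zero C (P i) (A m))"
    by (metis atLeastLessThan_iff)
  define Z where "Z = \<lparr>Ob = P, Df = del\<rparr>"
  have Zs [simp]: "Ob Z = P" "Df Z = del" by (simp_all add: Z_def)
  have seq: "is_seq C Z" by (simp add: is_seq_def)
  have din [simp]: "dmap C Z i j \<in> Hom C (P i) (P j)" if "i \<le> j" for i j using dmap_in[OF seq that]
      by simp
  have rD: "Cmp C (P i) (P j) (A m) (r j m) (dmap C Z i j)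
      = (if m < i + int N then r i m else Zero C (P i) (A m))"
    if "i \<le> j" "j \<le> m" "m < j + int N" for i j m
    using that
  proof (induction j arbitrary: m rule: int_ge_induct)
    case base
    then show ?case by simp
  next
    case (step j)
    have "Cmp C (P i) (P (j + 1)) (A m) (r (j + 1) m) (dmap C Z i (j + 1))
      = Cmp C (P i) (P j) (A m) (Cmp C (P j) (P (j + 1)) (A m) (r (j + 1) m) (del j))
          (dmap C Z i j)"
      using step by (simp add: dmap_Suc)
    also have "\<dots> = (if m < i + int N then r i m else Zero C (P i) (A m))"
      using step by (subst rdel) auto
    finally show ?case .
  qed
  have cpx: "is_cpx C N Z"
    unfolding is_cpx_iff
  proof (intro conjI allI seq)
    fix i show "dmap C Z i (i + int N) = Zero C (Ob Z i) (Ob Z (i + int N))"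
      by (rule nbiproduct_joint_mono[OF n[of "i + int N"]]) (auto simp: rD)
  qed
  have De: "Cmp C (A k) (P i) (P j) (dmap C Z i j) (e i k)
      = (if j \<le> k then e j k else Zero C (A k) (P j))"
    if "i \<le> j" "i \<le> k" "k < i + int N" for i j k
  proof (rule nbiproduct_joint_mono[OF n[of j]])
    fix m assume m: "m \<in> {j..<j + int N}"
    have "Cmp C (A k) (P j) (A m) (r j m) (Cmp C (A k) (P i) (P j) (dmap C Z i j) (e i k))
      = Cmp C (A k) (P i) (A m) (Cmp C (P i) (P j) (A m) (r j m) (dmap C Z i j)) (e i k)"
      using that m by simp
    also have "\<dots> = (if m = k then Idm C (A k) else Zero C (A k) (A m))"
      using that m by (subst rD) (auto simp: re)
    also have "\<dots> = Cmp C (A k) (P j) (A m) (r j m) (if j \<le> k then e j k else Zero C (A k) (P j))"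
      using that m by (auto simp: re)
    finally show "Cmp C (A k) (P j) (A m) (r j m) (Cmp C (A k) (P i) (P j) (dmap C Z i j) (e i k))
      = Cmp C (A k) (P j) (A m) (r j m) (if j \<le> k then e j k else Zero C (A k) (P j))" .
  qed (use that in auto)
  \<comment> \<open>The contraction carries A m from its last degree m straight back to its first
    degree m - N + 1. In the homotopy sum in degree i the term at m is then the projector e r onto A
    m, and these projectors add up to the identity.\<close>
  define h where "h m = Cmp C (P m) (A m) (P (m - int N + 1)) (e (m - int N + 1) m) (r m m)" for m
  have hh: "h \<in> homot Z Z" using N_pos by (auto simp: homot_def h_def)
  have "nullh Z Z h i = Idm C (P i)" for i
  proof -
    interpret G: comm_group "HomG C (P i) (P i)" by (rule hom_group) simp_all
    have "nullh Z Z h i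
        = finprod (HomG C (P i) (P i)) (\<lambda>m. Cmp C (P i) (A m) (P i) (e i m) (r i m)) {i..<i + int
        N}"
      unfolding nullh_def Zs
    proof (rule G.finprod_cong')
      fix m assume m: "m \<in> {i..<i + int N}"
      have 1: "Cmp C (A m) (P (m - int N + 1)) (P i) (dmap C Z (m - int N + 1) i)
          (e (m - int N + 1) m) = e i m"
        using m N_pos by (subst De) auto
      have 2: "Cmp C (P i) (P m) (A m) (r m m) (dmap C Z i m) = r i m"
        using m N_pos by (subst rD) auto
      have "e (m - int N + 1) m \<in> Hom C (A m) (P (m - int N + 1))" using N_pos by (intro ein) auto
      then show "Cmp C (P i) (P (m - int N + 1)) (P i) (dmap C Z (m - int N + 1) i)
          (Cmp C (P i) (P m) (P (m - int N + 1)) (h m) (dmap C Z i m)) = Cmp C (P i) (A m) (P i)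
              (e i m) (r i m)"
        using m N_pos cmp_eq_assoc[OF 1, of "P i" "r i m"] by (simp add: h_def 2)
    qed auto
    then show ?thesis using nbiproductD(5)[OF n] by simp
  qed
  then have "Idm KK Z = nullh Z Z h" by (simp add: fun_eq_iff)
  then have "contractible Z"
    unfolding contractible_def null_homotopic_iff[OF cpx cpx] using cpx hh id_cpx_maps[OF cpx]
        by auto
  then have "free_cpx A Z e r"
    unfolding free_cpx_def using n rdel by auto
  then show ?thesis by blast
qed

lemma free_cpxD:
  assumes "free_cpx A Z e r"
  shows "contractible Z" "is_cpx C N Z" "nbiproduct C {i..<i + int N} A (Ob Z i) (e i) (r i)"
    "\<lbrakk>i + 1 \<le> m; m < i + 1 + int N\<rbrakk> \<Longrightarrow>
      Cmp C (Ob Z i) (Ob Z (i + 1)) (A m) (r (i + 1) m) (Df Z i) =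
          (if m < i + int N then r i m else Zero C (Ob Z i) (A m))"
    "\<lbrakk>i \<le> m; m < i + int N\<rbrakk> \<Longrightarrow> e i m \<in> Hom C (A m) (Ob Z i)" "\<lbrakk>i \<le> m; m < i + int N\<rbrakk>
        \<Longrightarrow> r i m \<in> Hom C (Ob Z i) (A m)"
  using assms unfolding free_cpx_def contractible_def nbiproduct_def by auto

lemma free_cpx_De:
  assumes fr: "free_cpx A Z e r" and A [simp]: "\<And>m. A m \<in> Obj C" and m: "i \<le> m" "m < i + int N"
  shows "Cmp C (A m) (Ob Z i) (Ob Z (i + 1)) (Df Z i) (e i m)
      = (if i + 1 \<le> m then e (i + 1) m else Zero C (A m) (Ob Z (i + 1)))"
proof (rule nbiproduct_joint_mono[OF free_cpxD(3)[OF fr, of "i + 1"]])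
  note [simp] = cpx_simps[OF free_cpxD(2)[OF fr]] free_cpxD(5,6)[OF fr]
  note re = nbiproductD(4)[OF free_cpxD(3)[OF fr]]
  fix k assume k: "k \<in> {i + 1..<i + 1 + int N}"
  have "Cmp C (A m) (Ob Z (i + 1)) (A k) (r (i + 1) k) (Cmp C (A m) (Ob Z i) (Ob Z (i + 1)) (Df Z i)
      (e i m))
    = Cmp C (A m) (Ob Z i) (A k) (if k < i + int N then r i k else Zero C (Ob Z i) (A k)) (e i m)"
    using k m by (simp add: cmp_eq_assoc[OF free_cpxD(4)[OF fr, of i k]])
  also have
      "\<dots> = Cmp C (A m) (Ob Z (i + 1)) (A k) (r (i + 1) k) (if i + 1 \<le> m then e (i + 1) m else Zero C
      (A m) (Ob Z (i + 1)))"
    using re[of k i m] re[of k "i + 1" m] k m by auto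
  finally show
      "Cmp C (A m) (Ob Z (i + 1)) (A k) (r (i + 1) k) (Cmp C (A m) (Ob Z i) (Ob Z (i + 1)) (Df Z i)
      (e i m))
    = Cmp C (A m) (Ob Z (i + 1)) (A k) (r (i + 1) k)
        (if i + 1 \<le> m then e (i + 1) m else Zero C (A m) (Ob Z (i + 1)))" .
qed (use cpx_simps[OF free_cpxD(2)[OF fr]] free_cpxD(5)[OF fr] m in auto)

text \<open>The component at m of the embedding is the composite of differentials from degree i to
  m. At m = i it is the identity, which splits the embedding degreewise.\<close>

lemma hull_exists:
  assumes X: "is_cpx C N X"
  shows "\<exists>Z S u p. (X, Z, S, u, p) \<in> EE \<and> contractible Z"
proof -
  note [simp] = cpx_simps[OF X]
  obtain Z e r where fr: "free_cpx (Ob X) Z e r" using free_cpx_exists[of "Ob X"] by auto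
  note Z = free_cpxD(2)[OF fr]
  note [simp] = cpx_simps[OF Z]
  note rin = free_cpxD(6)[OF fr]
  have "\<exists>g\<in>Hom C (Ob X i) (Ob Z i). \<forall>m\<in>{i..<i + int N}. Cmp C (Ob X i) (Ob Z i) (Ob X m) (r i m) g
      = dmap C X i m" for i
    by (rule nbiproduct_tuple[OF free_cpxD(3)[OF fr]]) auto
  then obtain u where u [simp]: "\<And>i. u i \<in> Hom C (Ob X i) (Ob Z i)"
    and ru: "\<And>i m. \<lbrakk>i \<le> m; m < i + int N\<rbrakk> \<Longrightarrow> Cmp C (Ob X i) (Ob Z i) (Ob X m) (r i m) (u i)
        = dmap C X i m"
    by (metis atLeastLessThan_iff)
  have uc: "u \<in> cpx_maps C X Z"
  proof (rule cpx_mapsI)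
    fix i
    show "Cmp C (Ob X i) (Ob X (i + 1)) (Ob Z (i + 1)) (u (i + 1)) (Df X i)
        = Cmp C (Ob X i) (Ob Z i) (Ob Z (i + 1)) (Df Z i) (u i)"
    proof (rule nbiproduct_joint_mono[OF free_cpxD(3)[OF fr, of "i + 1"]])
      fix m assume m: "m \<in> {i + 1..<i + 1 + int N}"
      have "Cmp C (Ob X i) (Ob Z (i + 1)) (Ob X m) (r (i + 1) m) (Cmp C (Ob X i) (Ob X (i + 1))
          (Ob Z (i + 1)) (u (i + 1)) (Df X i))
        = dmap C X i m"
        using m rin[of "i + 1" m] cmp_eq_assoc[OF ru[of "i + 1" m]] by (simp flip: dmap_step)
      moreover have
          "Cmp C (Ob X i) (Ob Z (i + 1)) (Ob X m) (r (i + 1) m) (Cmp C (Ob X i) (Ob Z i)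
          (Ob Z (i + 1)) (Df Z i) (u i)) = dmap C X i m"
        using m rin[of "i + 1" m] cmp_eq_assoc[OF free_cpxD(4)[OF fr, of i m]] ru[of i m]
            dmap_zero[OF X, of i m] by simp
      ultimately show
          "Cmp C (Ob X i) (Ob Z (i + 1)) (Ob X m) (r (i + 1) m) (Cmp C (Ob X i) (Ob X (i + 1))
          (Ob Z (i + 1)) (u (i + 1)) (Df X i))
        = Cmp C (Ob X i) (Ob Z (i + 1)) (Ob X m) (r (i + 1) m)
            (Cmp C (Ob X i) (Ob Z i) (Ob Z (i + 1)) (Df Z i) (u i))" by simp
    qed simp_all
  qed simp
  have "\<exists>S t q. S \<in> Obj C \<and> biproduct C (Ob X i) S (Ob Z i) (e i i) t (r i i) q" for i
    by (rule nbiproduct_complement[OF free_cpxD(3)[OF fr]]) (use N_pos in auto)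
  then obtain S t q where S [simp]: "\<And>i. S i \<in> Obj C"
      and bp: "\<And>i. biproduct C (Ob X i) (S i) (Ob Z i) (e i i) (t i) (r i i) (q i)"
    by metis
  have "biproduct C (Ob X i) (S i) (Ob Z i) (u i) (t i) (r i i)
     (Add C (Ob Z i) (S i) (q i)
         (Neg C (Ob Z i) (S i)
         (Cmp C (Ob Z i) (Ob Z i) (S i) (q i)
         (Cmp C (Ob Z i) (Ob X i) (Ob Z i) (u i) (r i i)))))" for i
    by (rule biproduct_twist[OF bp]) (use ru[of i i] N_pos in simp_all)
  from coker_complex[OF X Z uc S this] show ?thesis using free_cpxD(1)[OF fr] by blast
qed

text \<open>Here the splitting comes from the summand with the last index i + N - 1 in degree i.
  That it should be \<open>X\<close> in degree i dictates that A m is \<open>X\<close> in degree m -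
  N + 1.\<close>

lemma projective_exists:
  assumes X: "is_cpx C N X"
  shows "\<exists>K Z u p. (K, Z, X, u, p) \<in> EE \<and> contractible Z"
proof -
  note [simp] = cpx_simps[OF X]
  define A where "A m = Ob X (m - int N + 1)" for m
  have A [simp]: "A m \<in> Obj C" for m by (simp add: A_def)
  have AX: "A (i + int N - 1) = Ob X i" for i by (simp add: A_def)
  obtain Z e r where fr: "free_cpx A Z e r" using free_cpx_exists[of A] by auto
  note Z = free_cpxD(2)[OF fr]
  note [simp] = cpx_simps[OF Z]
  note ein = free_cpxD(5)[OF fr]
  have Din: "dmap C X (m - int N + 1) i \<in> Hom C (A m) (Ob X i)" if "m < i + int N" for m i
    using that by (simp add: A_def)
  have "\<exists>g\<in>Hom C (Ob Z i) (Ob X i). \<forall>m\<in>{i..<i + int N}. Cmp C (A m) (Ob Z i) (Ob X i) g (e i m)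
      = dmap C X (m - int N + 1) i" for i
    by (rule nbiproduct_cotuple[OF free_cpxD(3)[OF fr]]) (auto simp: Din)
  then obtain v where v [simp]: "\<And>i. v i \<in> Hom C (Ob Z i) (Ob X i)"
    and ve: "\<And>i m. \<lbrakk>i \<le> m; m < i + int N\<rbrakk> \<Longrightarrow> Cmp C (A m) (Ob Z i) (Ob X i) (v i) (e i m)
        = dmap C X (m - int N + 1) i"
    by (metis atLeastLessThan_iff)
  have vc: "v \<in> cpx_maps C Z X"
  proof (rule cpx_mapsI)
    fix i
    show "Cmp C (Ob Z i) (Ob Z (i + 1)) (Ob X (i + 1)) (v (i + 1)) (Df Z i)
        = Cmp C (Ob Z i) (Ob X i) (Ob X (i + 1)) (Df X i) (v i)"
    proof (rule nbiproduct_joint_epi[OF free_cpxD(3)[OF fr, of i]])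
      fix m assume m: "m \<in> {i..<i + int N}"
      have [simp]: "e i m \<in> Hom C (A m) (Ob Z i)" using ein m by simp
      then have [simp]: "e i m \<in> Hom C (Ob X (m - int N + 1)) (Ob Z i)" by (simp add: A_def)
      have "Cmp C (A m) (Ob Z i) (Ob X (i + 1)) (Cmp C (Ob Z i) (Ob Z (i + 1)) (Ob X (i + 1))
          (v (i + 1)) (Df Z i)) (e i m)
        = dmap C X (m - int N + 1) (i + 1)"
        using m free_cpx_De[OF fr A, of i m] ve[of "i + 1" m]
            dmap_zero[OF X, of "m - int N + 1" "i + 1"] AX[of "i - int N + 1"] by (auto simp: A_def)
      moreover have
          "Cmp C (A m) (Ob Z i) (Ob X (i + 1)) (Cmp C (Ob Z i) (Ob X i) (Ob X (i + 1)) (Df X i)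
          (v i)) (e i m)
        = dmap C X (m - int N + 1) (i + 1)"
      proof -
        have "Cmp C (Ob X (m - int N + 1)) (Ob X i) (Ob X (i + 1)) (dmap C X i (i + 1))
            (dmap C X (m - int N + 1) i) = dmap C X (m - int N + 1) (i + 1)"
          by (rule dmap_cmp) (use m in auto)
        then show ?thesis using m ve[of i m] by (simp add: A_def dmap_step)
      qed
      ultimately show
          "Cmp C (A m) (Ob Z i) (Ob X (i + 1)) (Cmp C (Ob Z i) (Ob Z (i + 1)) (Ob X (i + 1))
          (v (i + 1)) (Df Z i)) (e i m)
        = Cmp C (A m) (Ob Z i) (Ob X (i + 1))
            (Cmp C (Ob Z i) (Ob X i) (Ob X (i + 1)) (Df X i) (v i)) (e i m)" by simp
    qed simp_all
  qed simp
  have "\<exists>S t q. S \<in> Obj C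
      \<and> biproduct C (A (i + int N - 1)) S (Ob Z i) (e i (i + int N - 1)) t (r i (i + int N - 1))
      q" for i
    by (rule nbiproduct_complement[OF free_cpxD(3)[OF fr]]) (use N_pos in auto)
  then obtain S t q where S [simp]: "\<And>i. S i \<in> Obj C"
    and bp: "\<And>i. biproduct C (A (i + int N - 1)) (S i) (Ob Z i) (e i (i + int N - 1)) (t i)
        (r i (i + int N - 1)) (q i)"
    by metis
  note bp = bp[unfolded AX]
  have "biproduct C (S i) (Ob X i) (Ob Z i)
     (Add C (S i) (Ob Z i) (t i)
         (Neg C (S i) (Ob Z i) (Cmp C (S i) (Ob X i) (Ob Z i) (e i (i + int N - 1))
         (Cmp C (S i) (Ob Z i) (Ob X i) (v i) (t i)))))
     (e i (i + int N - 1)) (q i) (v i)" for i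
    by (rule biproduct_twist'[OF bp]) (use ve[of i "i + int N - 1"] N_pos in \<open>simp_all add: AX\<close>)
  from ker_complex[OF Z X vc S this] show ?thesis using free_cpxD(1)[OF fr] by blast
qed

subsection \<open>Direct sums and the zero complex\<close>

lemma sum_complex:
  assumes X: "is_cpx C N X" and Y: "is_cpx C N Y"
    and bp: "\<And>i. biproduct C (Ob X i) (Ob Y i) (P i) (i1 i) (i2 i) (p1 i) (p2 i)"
  shows "\<exists>Z. Ob Z = P \<and> biproduct KK X Y Z i1 i2 p1 p2"
proof -
  define Z where
      "Z = \<lparr>Ob = P, Df
      = (\<lambda>i.
      (Add C (P i) (P (i + 1)) (Cmp C (P i) (Ob X (i + 1)) (P (i + 1)) (i1 (i + 1))
      (Cmp C (P i) (Ob X i) (Ob X (i + 1)) (Df X i) (p1 i))) (Cmp C (P i) (Ob Y (i + 1))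
      (P (i + 1)) (i2 (i + 1))
      (Cmp C (P i) (Ob Y i) (Ob Y (i + 1)) (Df Y i) (p2 i)))))\<rparr>"
  have Zs [simp]: "Ob Z = P"
      "Df Z i = Add C (P i) (P (i + 1)) (Cmp C (P i) (Ob X (i + 1)) (P (i + 1)) (i1 (i + 1))
      (Cmp C (P i) (Ob X i) (Ob X (i + 1)) (Df X i) (p1 i))) (Cmp C (P i) (Ob Y (i + 1))
      (P (i + 1)) (i2 (i + 1))
      (Cmp C (P i) (Ob Y i) (Ob Y (i + 1)) (Df Y i) (p2 i)))" for i by
      (simp_all add: Z_def)
  note [simp] = cpx_simps[OF X] cpx_simps[OF Y] biproductD[OF bp]
  note bps = cmp_eq_assoc[OF biproductD(6)[OF bp]] cmp_eq_assoc[OF biproductD(7)[OF bp]]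
     cmp_eq_assoc[OF biproductD(8)[OF bp]] cmp_eq_assoc[OF biproductD(9)[OF bp]]
  have seq: "is_seq C Z" by (simp add: is_seq_def)
  have ch: "i1 \<in> cpx_maps C X Z" "i2 \<in> cpx_maps C Y Z" "p1 \<in> cpx_maps C Z X" "p2 \<in> cpx_maps C Z Y"
    by (auto intro!: cpx_mapsI simp: bps)
  have Z: "is_cpx C N Z"
    unfolding is_cpx_iff
  proof (intro conjI allI seq)
    fix i
    let ?j = "i + int N"
    have [simp]: "dmap C Z i ?j \<in> Hom C (P i) (P ?j)" using dmap_in[OF seq, of i ?j] by simp
    have "(dmap C Z i (i + int N))
        = Cmp C (P i) (P (i + int N)) (P (i + int N))
        (Add C (P (i + int N)) (P (i + int N)) (Cmp C (P (i + int N)) (Ob X (i + int N))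
        (P (i + int N)) (i1 (i + int N)) (p1 (i + int N))) (Cmp C (P (i + int N))
        (Ob Y (i + int N)) (P (i + int N)) (i2 (i + int N)) (p2 (i + int N))))
        (dmap C Z i (i + int N))" by simp
    also have
        "\<dots> = Add C (P i) (P (i + int N)) (Cmp C (P i) (Ob X (i + int N)) (P (i + int N))
        (i1 (i + int N))
        (Cmp C (P i) (P (i + int N)) (Ob X (i + int N)) (p1 (i + int N))
        (dmap C Z i (i + int N)))) (Cmp C (P i) (Ob Y (i + int N)) (P (i + int N)) (i2
        (i + int N)) (Cmp C (P i) (P (i + int N)) (Ob Y (i + int N))
        (p2 (i + int N)) (dmap C Z i (i + int N))))"
      by (simp del: biproductD(10)[OF bp])
    also have
        "Cmp C (P i) (P (i + int N)) (Ob X (i + int N)) (p1 (i + int N)) (dmap C Z i (i + int N))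
        = Zero C (P i) (Ob X (i + int N))"
      using cpx_maps_dmap[OF ch(3) seq, of i ?j] dmap_zero[OF X, of i ?j] by simp
    also have
        "Cmp C (P i) (P (i + int N)) (Ob Y (i + int N)) (p2 (i + int N)) (dmap C Z i (i + int N))
        = Zero C (P i) (Ob Y (i + int N))"
      using cpx_maps_dmap[OF ch(4) seq, of i ?j] dmap_zero[OF Y, of i ?j] by simp
    finally show "dmap C Z i (i + int N) = Zero C (Ob Z i) (Ob Z (i + int N))" by simp
  qed
  have "biproduct KK X Y Z i1 i2 p1 p2"
    unfolding biproduct_def using ch Z by simp
  then show ?thesis by (intro exI[of _ Z]) simp
qed

lemma biproduct_CN:
  assumes "is_cpx C N X" "is_cpx C N Y" "biproduct KK X Y Z i1 i2 p1 p2"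
  shows "biproduct C (Ob X i) (Ob Y i) (Ob Z i) (i1 i) (i2 i) (p1 i) (p2 i)"
  using assms unfolding biproduct_def by (auto simp: cpx_simps cpx_mapsD fun_eq_iff)

lemma additive_CN: "additive_category KK"
proof (intro additive_category.intro additive_category_axioms.intro preadditive_CN)
  obtain z where z: "zero_object C z" using ex_zero_object by auto
  then have [simp]: "z \<in> Obj C" and "Idm C z = Zero C z z" using zero_object_iff
      by (auto simp: zero_object_def)
  define Z :: "('o, 'm) cpx" where "Z = \<lparr>Ob = (\<lambda>_. z), Df = (\<lambda>_. Zero C z z)\<rparr>"
  have [simp]: "Ob Z i = z" "Df Z i = Zero C z z" for i by (simp_all add: Z_def)
  have seq: "is_seq C Z" by (simp add: is_seq_def)
  have "f = Zero C z z" if "f \<in> Hom C z z" for f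
    using z that unfolding zero_object_def by (metis zero_in)
  then have "dmap C Z i (i + int N) = Zero C z z" for i using dmap_in[OF seq, of i "i + int N"]
      by simp
  then have "is_cpx C N Z" unfolding is_cpx_iff using seq by simp
  then have "zero_object KK Z" using K.zero_object_iff[of Z] \<open>Idm C z = Zero C z z\<close> by simp
  then show "\<exists>Z. zero_object KK Z" by blast
  show "\<exists>P i1 i2 p1 p2. biproduct KK X Y P i1 i2 p1 p2" if "X \<in> Obj KK" "Y \<in> Obj KK" for X Y
  proof -
    have XY: "is_cpx C N X" "is_cpx C N Y" using that by simp_all
    have "\<exists>P i1 i2 p1 p2. biproduct C (Ob X i) (Ob Y i) P i1 i2 p1 p2" for i
      using ex_biproduct cpx_simps(1) XY by blast
    then obtain P i1 i2 p1 p2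
        where "\<And>i. biproduct C (Ob X i) (Ob Y i) (P i) (i1 i) (i2 i) (p1 i) (p2 i)" by metis
    from sum_complex[OF XY this] show ?thesis by blast
  qed
qed

section \<open>The Frobenius axioms for complexes\<close>

lemma injective_contractible:
  assumes "injective_object KK EE K"
  shows "contractible K"
proof -
  have K: "is_cpx C N K" using assms by (simp add: injective_object_def)
  obtain Z S u p where e: "(K, Z, S, u, p) \<in> EE" and Z: "contractible Z" using hull_exists[OF K]
      by auto
  have "Idm KK K \<in> Hom KK K K" using K.id_in[of K] K by simp
  then obtain g where "g \<in> Hom KK Z K" "Cmp KK K Z K g u = Idm KK K"
    using assms e unfolding injective_object_def by blast
  then show ?thesis by (intro contractible_retract[OF Z K conflationD(4)[OF e]]) auto
qed

lemma injective_iff_contractible: "injective_object KK EE K \<longleftrightarrow> contractible K"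
  using injective_contractible contractible_injective by blast

text \<open>A null-homotopic map extends over the contractible hull of its source. This is what
  identifies the homotopy category with the stable category.\<close>

lemma null_iff_factor:
  assumes X: "is_cpx C N X" and Y: "is_cpx C N Y"
  shows "f \<in> Nul X Y
      \<longleftrightarrow> (\<exists>K. contractible K \<and> (\<exists>a\<in>cpx_maps C X K. \<exists>b\<in>cpx_maps C K Y. f = Cmp KK X K Y b a))"
proof
  assume f: "f \<in> Nul X Y"
  obtain Z S u p where e: "(X, Z, S, u, p) \<in> EE" and Z: "contractible Z" using hull_exists[OF X]
      by auto
  obtain g where "g \<in> Nul Z Y" "Cmp KK X Z Y g u = f" using null_extends[OF e Y f] by blast
  then show "\<exists>K. contractible K \<and> (\<exists>a\<in>cpx_maps C X K. \<exists>b\<in>cpx_maps C K Y. f = Cmp KK X K Y b a)"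
    using Z conflationD(4)[OF e] null_in by blast
next
  assume "\<exists>K. contractible K \<and> (\<exists>a\<in>cpx_maps C X K. \<exists>b\<in>cpx_maps C K Y. f = Cmp KK X K Y b a)"
  then obtain K a b where K: "contractible K" and a: "a \<in> cpx_maps C X K"
      and b: "b \<in> cpx_maps C K Y" and f: "f = Cmp KK X K Y b a"
    by blast
  have "is_cpx C N K" using K by (simp add: contractible_def)
  then show "f \<in> Nul X Y" unfolding f
    using null_left[OF X _ Y null_if_contractible[OF X _ a] b] K by blast
qed

text \<open>Degreewise the cokernel of i1 u + i2 f is S + Y. \<open>coker_complex\<close> puts a
  differential on it, and the projection to S is a chain map because it is one after composition
  with the split epimorphism \<open>v\<close>.\<close>

lemma conflation_pushout:
  assumes e: "(X, J, S, u, p) \<in> EE" and Y: "is_cpx C N Y" and f: "f \<in> cpx_maps C X Y"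
      and bp: "biproduct KK J Y B i1 i2 p1 p2"
  shows "\<exists>P v h. (X, B, P, Add KK X B (Cmp KK X J B i1 u) (Cmp KK X Y B i2 f), v) \<in> EE \<and>
    (Y, P, S, Cmp KK Y B P v i2, h) \<in> EE \<and> Cmp KK B P S h v = Neg KK B S (Cmp KK B J S p p1)"
proof -
  note X = conflationD(1)[OF e] and J = conflationD(2)[OF e] and S = conflationD(3)[OF e]
    and u = conflationD(4)[OF e] and p = conflationD(5)[OF e]
  obtain q t where sp: "\<And>i. biproduct C (Ob X i) (Ob S i) (Ob J i) (u i) (t i) (q i) (p i)"
    using conflationD(6)[OF e] by blast
  note bpi = biproduct_CN[OF J Y bp]
  have B: "is_cpx C N B" and ic: "i1 \<in> cpx_maps C J B" "i2 \<in> cpx_maps C Y B" "p1 \<in> cpx_maps C B J"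
      "p2 \<in> cpx_maps C B Y"
    using bp by (simp_all add: biproduct_def)
  have "\<exists>P i1 i2 p1 p2. biproduct C (Ob S i) (Ob Y i) P i1 i2 p1 p2" for i
    using ex_biproduct cpx_simps(1) S Y by blast
  then obtain P jS jY rS rY
      where bP: "\<And>i. biproduct C (Ob S i) (Ob Y i) (P i) (jS i) (jY i) (rS i) (rY i)" by metis
  note [simp] = cpx_simps[OF X] cpx_simps[OF Y] cpx_simps[OF J] cpx_simps[OF S] cpx_simps[OF B]
    biproductD[OF sp] biproductD[OF bpi] biproductD[OF bP] cpx_mapsD(1)[OF f]
  note bps = cmp_eq_assoc[OF biproductD(6)[OF sp]] cmp_eq_assoc[OF biproductD(7)[OF sp]]
     cmp_eq_assoc[OF biproductD(8)[OF sp]] cmp_eq_assoc[OF biproductD(9)[OF sp]]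
     cmp_eq_assoc[OF biproductD(6)[OF bpi]] cmp_eq_assoc[OF biproductD(7)[OF bpi]]
     cmp_eq_assoc[OF biproductD(8)[OF bpi]] cmp_eq_assoc[OF biproductD(9)[OF bpi]]
     cmp_eq_assoc[OF biproductD(6)[OF bP]] cmp_eq_assoc[OF biproductD(7)[OF bP]]
     cmp_eq_assoc[OF biproductD(8)[OF bP]] cmp_eq_assoc[OF biproductD(9)[OF bP]]
  define ee where "ee = Add KK X B (Cmp KK X J B i1 u) (Cmp KK X Y B i2 f)"
  have ee: "ee \<in> cpx_maps C X B"
    using K.add_in[of X B "Cmp KK X J B i1 u" "Cmp KK X Y B i2 f"] K.cmp_in[of X J B u i1]
        K.cmp_in[of X Y B f i2] X J Y B u f ic
    unfolding ee_def by (simp del: CN_sel(3-6))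
  have eei:
      "ee i = Add C (Ob X i) (Ob B i) (Cmp C (Ob X i) (Ob J i) (Ob B i) (i1 i) (u i))
      (Cmp C (Ob X i) (Ob Y i) (Ob B i) (i2 i) (f i))" for i by (simp add: ee_def)
  \<comment> \<open>The term - f q p1 corrects the projection to \<open>Y\<close> so that
    \<open>v\<close> vanishes on the embedded \<open>X\<close>. The sign of the \<open>S\<close>
    component produces the minus sign in the last identity of the statement.\<close>
  define v where
      "v i = Add C (Ob B i) (P i) (Neg C (Ob B i) (P i) (Cmp C (Ob B i) (Ob S i) (P i) (jS i)
      (Cmp C (Ob B i) (Ob J i) (Ob S i) (p i) (p1 i))))
      (Cmp C (Ob B i) (Ob Y i) (P i) (jY i)
      (Add C (Ob B i) (Ob Y i) (p2 i)
      (Neg C (Ob B i) (Ob Y i)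
      (Cmp C (Ob B i) (Ob X i) (Ob Y i) (f i)
      (Cmp C (Ob B i) (Ob J i) (Ob X i) (q i) (p1 i))))))" for i
  define w where
      "w i = Add C (P i) (Ob B i) (Neg C (P i) (Ob B i) (Cmp C (P i) (Ob J i) (Ob B i) (i1 i)
      (Cmp C (P i) (Ob S i) (Ob J i) (t i) (rS i)))) (Cmp C (P i) (Ob Y i) (Ob B i) (i2 i) (rY
      i))" for i
  have sum:
      "Add C (Ob B i) (Ob B i) (Cmp C (Ob B i) (Ob X i) (Ob B i) (Add C (Ob X i) (Ob B i)
      (Cmp C (Ob X i) (Ob J i) (Ob B i) (i1 i) (u i))
      (Cmp C (Ob X i) (Ob Y i) (Ob B i) (i2 i) (f i))) (Cmp C (Ob B i) (Ob J i) (Ob X i)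
      (q i) (p1 i))) (Cmp C (Ob B i) (P i) (Ob B i) (w i) (v i)) = Idm C (Ob B i)" for i
  proof -
    have wv: "Cmp C (Ob B i) (P i) (Ob B i) (w i) (v i)
        = Add C (Ob B i) (Ob B i)
        (Add C (Ob B i) (Ob B i) (Cmp C (Ob B i) (Ob J i) (Ob B i) (i1 i)
        (Cmp C (Ob B i) (Ob S i) (Ob J i) (t i)
        (Cmp C (Ob B i) (Ob J i) (Ob S i) (p i) (p1 i))))
        (Cmp C (Ob B i) (Ob Y i) (Ob B i) (i2 i) (p2 i))) (Neg C (Ob B i) (Ob B i)
        (Cmp C (Ob B i) (Ob Y i) (Ob B i) (i2 i)
        (Cmp C (Ob B i) (Ob X i) (Ob Y i) (f i)
        (Cmp C (Ob B i) (Ob J i) (Ob X i) (q i) (p1 i)))))"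
      by (simp add: w_def v_def bps add_assoc)
    have "(Add C (Ob B i) (Ob B i) (Cmp C (Ob B i) (Ob X i) (Ob B i) (Add C (Ob X i) (Ob B i)
        (Cmp C (Ob X i) (Ob J i) (Ob B i) (i1 i) (u i))
        (Cmp C (Ob X i) (Ob Y i) (Ob B i) (i2 i) (f i))) (Cmp C (Ob B i) (Ob J i) (Ob X i) (q i)
        (p1 i))) (Cmp C (Ob B i) (P i) (Ob B i) (w i) (v i)))
       = Add C (Ob B i) (Ob B i)
           (Add C (Ob B i) (Ob B i) (Cmp C (Ob B i) (Ob J i) (Ob B i) (i1 i)
           (Cmp C (Ob B i) (Ob X i) (Ob J i) (u i)
           (Cmp C (Ob B i) (Ob J i) (Ob X i) (q i) (p1 i))))
           (Cmp C (Ob B i) (Ob Y i) (Ob B i) (i2 i)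
           (Cmp C (Ob B i) (Ob X i) (Ob Y i) (f i)
           (Cmp C (Ob B i) (Ob J i) (Ob X i) (q i) (p1 i)))))
           (Add C (Ob B i) (Ob B i)
           (Add C (Ob B i) (Ob B i) (Cmp C (Ob B i) (Ob J i) (Ob B i) (i1 i)
           (Cmp C (Ob B i) (Ob S i) (Ob J i) (t i)
           (Cmp C (Ob B i) (Ob J i) (Ob S i) (p i) (p1 i))))
           (Cmp C (Ob B i) (Ob Y i) (Ob B i) (i2 i) (p2 i))) (Neg C (Ob B i) (Ob B i)
           (Cmp C (Ob B i) (Ob Y i) (Ob B i) (i2 i)
           (Cmp C (Ob B i) (Ob X i) (Ob Y i) (f i)
           (Cmp C (Ob B i) (Ob J i) (Ob X i) (q i) (p1 i))))))"
      unfolding wv by (simp del: biproductD(10)[OF bpi] biproductD(10)[OF sp])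
    also have
        "\<dots> = Add C (Ob B i) (Ob B i) (Cmp C (Ob B i) (Ob J i) (Ob B i) (i1 i)
        (Cmp C (Ob B i) (Ob X i) (Ob J i) (u i)
        (Cmp C (Ob B i) (Ob J i) (Ob X i) (q i) (p1 i))))
        (Add C (Ob B i) (Ob B i) (Cmp C (Ob B i) (Ob J i) (Ob B i) (i1 i)
        (Cmp C (Ob B i) (Ob S i) (Ob J i) (t i)
        (Cmp C (Ob B i) (Ob J i) (Ob S i) (p i) (p1 i))))
        (Cmp C (Ob B i) (Ob Y i) (Ob B i) (i2 i) (p2 i)))"
      by (rule add_add_neg) simp_all
    also have
        "\<dots> = Add C (Ob B i) (Ob B i) (Cmp C (Ob B i) (Ob J i) (Ob B i) (i1 i)
        (Cmp C (Ob B i) (Ob J i) (Ob J i)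
        (Add C (Ob J i) (Ob J i) (Cmp C (Ob J i) (Ob X i) (Ob J i) (u i) (q i))
        (Cmp C (Ob J i) (Ob S i) (Ob J i) (t i) (p i))) (p1 i)))
        (Cmp C (Ob B i) (Ob Y i) (Ob B i) (i2 i) (p2 i))"
      by (simp add: add_assoc del: biproductD(10)[OF bpi] biproductD(10)[OF sp])
    finally show ?thesis by simp
  qed
  have bpv:
      "biproduct C (Ob X i) (P i) (Ob B i) (ee i) (w i) (Cmp C (Ob B i) (Ob J i) (Ob X i) (q i)
      (p1 i)) (v i)" for i
    unfolding biproduct_def eei using sum[of i]
    by (simp add: v_def w_def bps del: biproductD(10)[OF bpi] biproductD(10)[OF sp])
  obtain Z where ZP: "Ob Z = P" and e1: "(X, B, Z, ee, v) \<in> EE"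
    using coker_complex[OF X B ee _ bpv] by auto
  note Z = conflationD(3)[OF e1] and vc = conflationD(5)[OF e1]
  have vi2: "Cmp KK Y B Z v i2 = jY"
    by (simp add: ZP fun_eq_iff v_def bps)
  have jYc: "jY \<in> cpx_maps C Y Z" using cmp_cpx_maps[OF Y B Z ic(2) vc] vi2 by simp
  have hv: "Cmp KK B Z S rS v
      = (\<lambda>i. (Neg C (Ob B i) (Ob S i) (Cmp C (Ob B i) (Ob J i) (Ob S i) (p i) (p1 i))))"
    by (simp add: ZP fun_eq_iff v_def bps)
  have ppc: "Cmp KK B J S p p1 \<in> cpx_maps C B S" using cmp_cpx_maps[OF B J S ic(3) p] by simp
  have ngc: "Neg KK B S (Cmp KK B J S p p1) \<in> cpx_maps C B S"
      using K.neg_in[of B S "Cmp KK B J S p p1"] ppc B S by simp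
  have ng: "(\<lambda>i. (Neg C (Ob B i) (Ob S i) (Cmp C (Ob B i) (Ob J i) (Ob S i) (p i) (p1 i))))
      = Neg KK B S (Cmp KK B J S p p1)"
  proof (rule K.neg_unique)
    show "(\<lambda>i. (Neg C (Ob B i) (Ob S i) (Cmp C (Ob B i) (Ob J i) (Ob S i) (p i) (p1 i)))) \<in> Hom KK B
        S"
      using cpx_mapsD[OF ppc] by (auto intro!: cpx_mapsI)
    show "Cmp KK B J S p p1 \<in> Hom KK B S" using ppc by simp
    show "Add KK B S (Cmp KK B J S p p1)
        (\<lambda>i. (Neg C (Ob B i) (Ob S i) (Cmp C (Ob B i) (Ob J i) (Ob S i) (p i) (p1 i)))) = Zero KK B
        S" by simp
  qed (use B S in simp_all)
  have rSc: "rS \<in> cpx_maps C Z S"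
  proof (rule chain_cancel_epi[OF B Z S vc])
    show "w i \<in> Hom C (Ob Z i) (Ob B i)" for i by (simp add: ZP w_def)
    show "Cmp C (Ob Z i) (Ob B i) (Ob Z i) (v i) (w i) = Idm C (Ob Z i)" for i
      using biproductD(7)[OF bpv[of i]] by (simp add: ZP)
    show "rS i \<in> Hom C (Ob Z i) (Ob S i)" for i by (simp add: ZP)
    show "(\<lambda>i. Cmp C (Ob B i) (Ob Z i) (Ob S i) (rS i) (v i)) \<in> cpx_maps C B S"
      using hv ng ngc by simp
  qed
  have "biproduct C (Ob Y i) (Ob S i) (Ob Z i) (jY i) (jS i) (rY i) (rS i)" for i
    using bP[of i] add_commute[of "P i" "P i" "Cmp C (P i) (Ob S i) (P i) (jS i) (rS i)" "Cmp C
        (P i) (Ob Y i) (P i) (jY i) (rY i)"] by (simp add: ZP biproduct_def)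
  then have e2: "(Y, Z, S, jY, rS) \<in> EE" by (rule conflationI[OF Y Z S jYc rSc])
  have "Cmp KK B Z S rS v = Neg KK B S (Cmp KK B J S p p1)" using hv ng by simp
  then show ?thesis using e1 e2 vi2 unfolding ee_def
      by (intro exI[of _ Z] exI[of _ v] exI[of _ rS]) (simp del: CN_sel(3-6))
qed

text \<open>Degreewise the cokernel of b a is A + B, by composing the two splittings. That the maps
  to and from it are chain maps is tested on the split epimorphisms \<open>i\<close> and
  \<open>c\<close>.\<close>

lemma conflation_cmp:
  assumes e1: "(X, Y, A, a, i) \<in> EE" and e2: "(Y, Z, B, b, j) \<in> EE"
  shows "\<exists>D k m n. (X, Z, D, Cmp KK X Y Z b a, k) \<in> EE \<and> (A, D, B, m, n) \<in> EE \<and>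
    Cmp KK Y A D m i = Cmp KK Y Z D k b \<and> Cmp KK Z D B n k = j"
proof -
  note X = conflationD(1)[OF e1] and Y = conflationD(2)[OF e1] and A = conflationD(3)[OF e1]
    and a = conflationD(4)[OF e1] and i = conflationD(5)[OF e1]
  note Z = conflationD(2)[OF e2] and B = conflationD(3)[OF e2]
    and b = conflationD(4)[OF e2] and j = conflationD(5)[OF e2]
  obtain qa ta where spa: "\<And>k. biproduct C (Ob X k) (Ob A k) (Ob Y k) (a k) (ta k) (qa k) (i k)"
    using conflationD(6)[OF e1] by blast
  obtain qb tb where spb: "\<And>k. biproduct C (Ob Y k) (Ob B k) (Ob Z k) (b k) (tb k) (qb k) (j k)"
    using conflationD(6)[OF e2] by blast
  have "\<exists>P i1 i2 p1 p2. biproduct C (Ob A k) (Ob B k) P i1 i2 p1 p2" for k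
    using ex_biproduct cpx_simps(1) A B by blast
  then obtain P jA jB rA rB
      where bP: "\<And>k. biproduct C (Ob A k) (Ob B k) (P k) (jA k) (jB k) (rA k) (rB k)" by metis
  note [simp] = cpx_simps[OF X] cpx_simps[OF Y] cpx_simps[OF Z] cpx_simps[OF A] cpx_simps[OF B]
    biproductD[OF spa] biproductD[OF spb] biproductD[OF bP]
  note bps = cmp_eq_assoc[OF biproductD(6)[OF spa]] cmp_eq_assoc[OF biproductD(7)[OF spa]]
     cmp_eq_assoc[OF biproductD(8)[OF spa]] cmp_eq_assoc[OF biproductD(9)[OF spa]]
     cmp_eq_assoc[OF biproductD(6)[OF spb]] cmp_eq_assoc[OF biproductD(7)[OF spb]]
     cmp_eq_assoc[OF biproductD(8)[OF spb]] cmp_eq_assoc[OF biproductD(9)[OF spb]]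
     cmp_eq_assoc[OF biproductD(6)[OF bP]] cmp_eq_assoc[OF biproductD(7)[OF bP]]
     cmp_eq_assoc[OF biproductD(8)[OF bP]] cmp_eq_assoc[OF biproductD(9)[OF bP]]
  define c where
      "c k = Add C (Ob Z k) (P k) (Cmp C (Ob Z k) (Ob A k) (P k) (jA k) (Cmp C (Ob Z k) (Ob Y k)
      (Ob A k) (i k) (qb k))) (Cmp C (Ob Z k) (Ob B k) (P k) (jB k) (j k))" for k
  define w where
      "w k = Add C (P k) (Ob Z k) (Cmp C (P k) (Ob Y k) (Ob Z k) (b k) (Cmp C (P k) (Ob A k)
      (Ob Y k) (ta k) (rA k))) (Cmp C (P k) (Ob B k) (Ob Z k) (tb k) (rB k))" for k
  have sum:
      "Add C (Ob Z k) (Ob Z k) (Cmp C (Ob Z k) (Ob Y k) (Ob Z k) (b k) (Cmp C (Ob Z k) (Ob X k)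
      (Ob Y k) (a k) (Cmp C (Ob Z k) (Ob Y k) (Ob X k) (qa k) (qb k))))
      (Cmp C (Ob Z k) (P k) (Ob Z k) (w k) (c k)) = Idm C (Ob Z k)" for k
  proof -
    have "Add C (Ob Z k) (Ob Z k) (Cmp C (Ob Z k) (Ob Y k) (Ob Z k) (b k) (Cmp C (Ob Z k) (Ob X k)
        (Ob Y k) (a k) (Cmp C (Ob Z k) (Ob Y k) (Ob X k) (qa k) (qb k))))
        (Cmp C (Ob Z k) (P k) (Ob Z k) (w k) (c k)) = Add C (Ob Z k) (Ob Z k)
        (Cmp C (Ob Z k) (Ob Y k) (Ob Z k) (b k)
        (Cmp C (Ob Z k) (Ob Y k) (Ob Y k)
        (Add C (Ob Y k) (Ob Y k) (Cmp C (Ob Y k) (Ob X k) (Ob Y k) (a k) (qa k))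
        (Cmp C (Ob Y k) (Ob A k) (Ob Y k) (ta k) (i k))) (qb k)))
        (Cmp C (Ob Z k) (Ob B k) (Ob Z k) (tb k) (j k))"
      by (simp add: w_def c_def bps add_assoc del: biproductD(10)[OF spa] biproductD(10)[OF spb])
    then show ?thesis by simp
  qed
  define ba where "ba = Cmp KK X Y Z b a"
  have bai: "ba k = Cmp C (Ob X k) (Ob Y k) (Ob Z k) (b k) (a k)" for k by (simp add: ba_def)
  have bac: "ba \<in> cpx_maps C X Z" unfolding ba_def using cmp_cpx_maps[OF X Y Z a b] by simp
  have bpc:
      "biproduct C (Ob X k) (P k) (Ob Z k) (ba k) (w k) (Cmp C (Ob Z k) (Ob Y k) (Ob X k) (qa k)
      (qb k)) (c k)" for k
    unfolding biproduct_def bai using sum[of k]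
    by (simp add: c_def w_def bps del: biproductD(10)[OF spa] biproductD(10)[OF spb])
  obtain D where DP: "Ob D = P" and e3: "(X, Z, D, ba, c) \<in> EE"
    using coker_complex[OF X Z bac _ bpc] by auto
  note D = conflationD(3)[OF e3] and cc = conflationD(5)[OF e3]
  have jAi: "Cmp KK Y A D jA i = Cmp KK Y Z D c b" by (simp add: DP fun_eq_iff c_def bps)
  have rBc: "Cmp KK Z D B rB c = j" by (simp add: DP fun_eq_iff c_def bps)
  have jA: "jA \<in> cpx_maps C A D"
  proof (rule chain_cancel_epi[OF Y A D i])
    show "ta k \<in> Hom C (Ob A k) (Ob Y k)"
        "Cmp C (Ob A k) (Ob Y k) (Ob A k) (i k) (ta k) = Idm C (Ob A k)" for k by simp_all
    show "jA k \<in> Hom C (Ob A k) (Ob D k)" for k by (simp add: DP)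
    show "(\<lambda>k. Cmp C (Ob Y k) (Ob A k) (Ob D k) (jA k) (i k)) \<in> cpx_maps C Y D"
      using jAi cmp_cpx_maps[OF Y Z D b cc] by simp
  qed
  have rB: "rB \<in> cpx_maps C D B"
  proof (rule chain_cancel_epi[OF Z D B cc])
    show "w k \<in> Hom C (Ob D k) (Ob Z k)" for k by (simp add: DP w_def)
    show "Cmp C (Ob D k) (Ob Z k) (Ob D k) (c k) (w k) = Idm C (Ob D k)" for k
      using biproductD(7)[OF bpc[of k]] by (simp add: DP)
    show "rB k \<in> Hom C (Ob D k) (Ob B k)" for k by (simp add: DP)
    show "(\<lambda>k. Cmp C (Ob Z k) (Ob D k) (Ob B k) (rB k) (c k)) \<in> cpx_maps C Z B" using rBc j by simp
  qed
  have "(A, D, B, jA, rB) \<in> EE" by (rule conflationI[OF A D B jA rB]) (use bP in \<open>simp add: DP\<close>)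
  then show ?thesis using e3 jAi rBc unfolding ba_def by blast
qed

theorem frobenius_CN: "frobenius_category KK EE Nul"
proof (intro frobenius_category.intro frobenius_category_axioms.intro additive_CN)
  fix X Y Z a b assume e: "(X, Y, Z, a, b) \<in> EE"
  note X = conflationD(1)[OF e] and Y = conflationD(2)[OF e] and Z = conflationD(3)[OF e]
    and a = conflationD(4)[OF e] and b = conflationD(5)[OF e]
  obtain q t where sp: "\<And>k. biproduct C (Ob X k) (Ob Z k) (Ob Y k) (a k) (t k) (q k) (b k)"
    using conflationD(6)[OF e] by blast
  note [simp] = cpx_simps[OF X] cpx_simps[OF Y] cpx_simps[OF Z] biproductD[OF sp]
  note bps = cmp_eq_assoc[OF biproductD(6)[OF sp]] cmp_eq_assoc[OF biproductD(7)[OF sp]]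
     cmp_eq_assoc[OF biproductD(8)[OF sp]] cmp_eq_assoc[OF biproductD(9)[OF sp]]
  show "X \<in> Obj KK \<and> Y \<in> Obj KK \<and> Z \<in> Obj KK" using X Y Z by simp
  show "a \<in> Hom KK X Y \<and> b \<in> Hom KK Y Z" using a b by simp
  show "Cmp KK X Y Z b a = Zero KK X Z" by simp
  fix W assume "W \<in> Obj KK"
  then have W: "is_cpx C N W" by simp
  note [simp] = cpx_simps[OF W]
  show "f = Zero KK W X" if f: "f \<in> Hom KK W X" and 0: "Cmp KK W X Y a f = Zero KK W Y" for f
  proof -
    have [simp]: "f k \<in> Hom C (Ob W k) (Ob X k)" for k using f cpx_mapsD by auto
    have "Cmp C (Ob W k) (Ob X k) (Ob Y k) (a k) (f k) = Zero C (Ob W k) (Ob Y k)" for k using 0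
        by (simp add: fun_eq_iff)
    then have "Cmp C (Ob W k) (Ob Y k) (Ob X k) (q k) (Cmp C (Ob W k) (Ob X k) (Ob Y k) (a k) (f k))
        = Zero C (Ob W k) (Ob X k)" for k by simp
    then show ?thesis by (simp add: bps fun_eq_iff)
  qed
  show "g = Zero KK Z W" if g: "g \<in> Hom KK Z W" and 0: "Cmp KK Y Z W g b = Zero KK Y W" for g
  proof -
    have [simp]: "g k \<in> Hom C (Ob Z k) (Ob W k)" for k using g cpx_mapsD by auto
    have "Cmp C (Ob Y k) (Ob Z k) (Ob W k) (g k) (b k) = Zero C (Ob Y k) (Ob W k)" for k using 0
        by (simp add: fun_eq_iff)
    then have "Cmp C (Ob Z k) (Ob Y k) (Ob W k) (Cmp C (Ob Y k) (Ob Z k) (Ob W k) (g k) (b k)) (t k)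
        = Zero C (Ob Z k) (Ob W k)" for k by simp
    then show ?thesis by (simp add: fun_eq_iff)
  qed
  show "\<exists>f\<in>Hom KK W X. Cmp KK W X Y a f = h" if h: "h \<in> Hom KK W Y"
      and 0: "Cmp KK W Y Z b h = Zero KK W Z" for h
  proof -
    have [simp]: "h k \<in> Hom C (Ob W k) (Ob Y k)" for k using h cpx_mapsD by auto
    have bh: "Cmp C (Ob W k) (Ob Y k) (Ob Z k) (b k) (h k) = Zero C (Ob W k) (Ob Z k)" for k using 0
        by (simp add: fun_eq_iff)
    have eq: "Cmp C (Ob W k) (Ob X k) (Ob Y k) (a k) (Cmp C (Ob W k) (Ob Y k) (Ob X k) (q k) (h k))
        = h k" for k
    proof -
      have "h k
          = Cmp C (Ob W k) (Ob Y k) (Ob Y k)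
          (Add C (Ob Y k) (Ob Y k) (Cmp C (Ob Y k) (Ob X k) (Ob Y k) (a k) (q k))
          (Cmp C (Ob Y k) (Ob Z k) (Ob Y k) (t k) (b k))) (h k)" by simp
      also have
          "\<dots> = Add C (Ob W k) (Ob Y k) (Cmp C (Ob W k) (Ob X k) (Ob Y k) (a k)
          (Cmp C (Ob W k) (Ob Y k) (Ob X k) (q k) (h k))) (Cmp C (Ob W k) (Ob Z k) (Ob Y k)
          (t k) (Cmp C (Ob W k) (Ob Y k) (Ob Z k) (b k) (h k)))" by
          (simp del: biproductD(10)[OF sp])
      finally show ?thesis by (simp add: bh)
    qed
    \<comment> \<open>Although \<open>q\<close> is only a degreewise retraction, q h is a chain map,
      because a q h = h is one and \<open>a\<close> is split injective in each degree.\<close>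
    have "(\<lambda>k. (Cmp C (Ob W k) (Ob Y k) (Ob X k) (q k) (h k))) \<in> cpx_maps C W X"
      by (rule chain_cancel_mono[OF W X Y a, where q = q]) (use h in \<open>simp_all add: eq\<close>)
    then show ?thesis using eq
        by (intro bexI[of _ "\<lambda>k. Cmp C (Ob W k) (Ob Y k) (Ob X k) (q k) (h k)"]) simp_all
  qed
  show "\<exists>g\<in>Hom KK Z W. Cmp KK Y Z W g b = l" if l: "l \<in> Hom KK Y W"
      and 0: "Cmp KK X Y W l a = Zero KK X W" for l
  proof -
    have [simp]: "l k \<in> Hom C (Ob Y k) (Ob W k)" for k using l cpx_mapsD by auto
    have la: "Cmp C (Ob X k) (Ob Y k) (Ob W k) (l k) (a k) = Zero C (Ob X k) (Ob W k)" for k using 0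
        by (simp add: fun_eq_iff)
    have eq: "Cmp C (Ob Y k) (Ob Y k) (Ob W k) (l k) (Cmp C (Ob Y k) (Ob Z k) (Ob Y k) (t k) (b k))
        = l k" for k
    proof -
      have "l k
          = Cmp C (Ob Y k) (Ob Y k) (Ob W k) (l k)
          (Add C (Ob Y k) (Ob Y k) (Cmp C (Ob Y k) (Ob X k) (Ob Y k) (a k) (q k))
          (Cmp C (Ob Y k) (Ob Z k) (Ob Y k) (t k) (b k)))" by simp
      also have
          "\<dots> = Add C (Ob Y k) (Ob W k) (Cmp C (Ob Y k) (Ob X k) (Ob W k) (Cmp C (Ob X k) (Ob Y k)
          (Ob W k) (l k) (a k)) (q k)) (Cmp C (Ob Y k) (Ob Y k) (Ob W k) (l k) (Cmp C (Ob Y k)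
          (Ob Z k) (Ob Y k) (t k) (b k)))" by (simp del: biproductD(10)[OF sp])
      finally show ?thesis by (simp add: la)
    qed
    have "(\<lambda>k. (Cmp C (Ob Z k) (Ob Y k) (Ob W k) (l k) (t k))) \<in> cpx_maps C Z W"
      by (rule chain_cancel_epi[OF Y Z W b, where t = t]) (use l in \<open>simp_all add: eq\<close>)
    then show ?thesis using eq
        by (intro bexI[of _ "\<lambda>k. Cmp C (Ob Z k) (Ob Y k) (Ob W k) (l k) (t k)"]) simp_all
  qed
next
  fix X Z assume "X \<in> Obj KK" and z: "zero_object KK Z"
  then have X: "is_cpx C N X" and Z: "is_cpx C N Z" by (simp_all add: zero_object_def)
  note [simp] = cpx_simps[OF X] cpx_simps[OF Z]
  have "Idm KK Z = Zero KK Z Z" using K.zero_object_iff[of Z] z Z by simp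
  then have z0: "Idm C (Ob Z k) = Zero C (Ob Z k) (Ob Z k)" for k by (simp add: fun_eq_iff)
  show "(X, X, Z, Idm KK X, Zero KK X Z) \<in> EE"
    by (rule conflationI[OF X X Z, where t = "\<lambda>k. Zero C (Ob Z k) (Ob X k)" and q = "\<lambda>k. Idm C
        (Ob X k)"])
      (auto simp: biproduct_def z0 intro!: cpx_mapsI)
next
  show "\<exists>P v h. (X, B, P, Add KK X B (Cmp KK X J B i1 u) (Cmp KK X Y B i2 f), v) \<in> EE \<and>
    (Y, P, S, Cmp KK Y B P v i2, h) \<in> EE \<and> Cmp KK B P S h v = Neg KK B S (Cmp KK B J S p p1)"
    if "(X, J, S, u, p) \<in> EE" "Y \<in> Obj KK" "f \<in> Hom KK X Y"
        "biproduct KK J Y B i1 i2 p1 p2" for X J S u p Y f B i1 i2 p1 p2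
    using conflation_pushout[of X J S u p Y f B i1 i2 p1 p2] that by (simp del: CN_sel(3-6))
  show "\<exists>Y' k m n. (X, Z, Y', Cmp KK X Y Z c a, k) \<in> EE \<and> (Z', Y', X', m, n) \<in> EE \<and>
            Cmp KK Y Z' Y' m q = Cmp KK Y Z Y' k c \<and> Cmp KK Z Y' X' n k = d"
    if "(X, Y, Z', a, q) \<in> EE" "(Y, Z, X', c, d) \<in> EE" for X Y Z' a q Z X' c d
    by (rule conflation_cmp[OF that])
  show "\<exists>g\<in>Hom KK K Y. Cmp KK K Y Z b g = f"
    if "injective_object KK EE K" "(X, Y, Z, a, b) \<in> EE" "f \<in> Hom KK K Z" for K X Y Z a b f
    by (rule contractible_projective[OF injective_contractible[OF that(1)] that(2,3)])
  show "\<exists>J S u p. (X, J, S, u, p) \<in> EE \<and> injective_object KK EE J" if "X \<in> Obj KK" for X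
    unfolding injective_iff_contractible using hull_exists that by simp
  show "\<exists>K P u p. (K, P, Z, u, p) \<in> EE \<and> injective_object KK EE P" if "Z \<in> Obj KK" for Z
    unfolding injective_iff_contractible using projective_exists that by simp
  show "f \<in> Nul X Y
      \<longleftrightarrow> (\<exists>K. injective_object KK EE K \<and> (\<exists>a\<in>Hom KK X K. \<exists>b\<in>Hom KK K Y. f = Cmp KK X K Y b a))"
    if "X \<in> Obj KK" "Y \<in> Obj KK" for X Y f
    unfolding injective_iff_contractible using null_iff_factor[of X Y f] that
        by (simp del: CN_sel(3-6))
qed

end


section \<open>Reindexing functors\<close>

text \<open>A complex, viewed as a functor on the ordered set of integers, is pulled back along a monotone
    map.
  If \<open>\<phi> (i + N) = \<phi> i + M\<close>, this takes \<open>M\<close>-complexes to \<open>N\<close>-complexes.\<close>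

definition reix ::
    "('o, 'm, 'z) cat_scheme \<Rightarrow> (int \<Rightarrow> int) \<Rightarrow> (('o, 'm) cpx, int \<Rightarrow> 'm, ('o, 'm) cpx, int \<Rightarrow> 'm) fctr"
    where
  "reix C \<phi> = \<lparr>FOb = (\<lambda>X. \<lparr>Ob = (\<lambda>i. Ob X (\<phi> i)), Df = (\<lambda>i. dmap C X (\<phi> i) (\<phi> (i + 1)))\<rparr>),
     FAr = (\<lambda>X Y f i. f (\<phi> i))\<rparr>"

lemma reix_sel [simp]:
  "Ob (FOb (reix C \<phi>) X) i = Ob X (\<phi> i)" "Df (FOb (reix C \<phi>) X) i = dmap C X (\<phi> i) (\<phi> (i + 1))"
  "FAr (reix C \<phi>) X Y f i = f (\<phi> i)"
  by (simp_all add: reix_def)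

definition periodic :: "nat \<Rightarrow> nat \<Rightarrow> (int \<Rightarrow> int) \<Rightarrow> bool" where
  "periodic M N \<phi> \<longleftrightarrow> mono \<phi> \<and> (\<forall>i. \<phi> (i + int N) = \<phi> i + int M)"

lemma periodicD:
  assumes "periodic M N \<phi>"
  shows "i \<le> j \<Longrightarrow> \<phi> i \<le> \<phi> j" "\<phi> (i + int N) = \<phi> i + int M" "mono \<phi>"
  using assms unfolding periodic_def mono_def by auto

lemma periodic_comp: "\<lbrakk>periodic L M \<phi>; periodic M N \<psi>\<rbrakk> \<Longrightarrow> periodic L N (\<phi> \<circ> \<psi>)"
  unfolding periodic_def mono_def by simp

lemma periodic_id: "periodic N N (\<lambda>i. i)"
  unfolding periodic_def mono_def by simp

text \<open>The half-open blocks between consecutive values of \<phi> tile the interval; where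
  \<phi> is constant the block is empty.\<close>

lemma (in comm_monoid) finprod_concat:
  fixes \<phi> :: "int \<Rightarrow> int"
  assumes \<phi>: "mono \<phi>" and ij: "i \<le> j" and T: "T \<in> {\<phi> i..<\<phi> j} \<rightarrow> carrier G"
  shows "finprod G (\<lambda>n. finprod G T {\<phi> n..<\<phi> (n + 1)}) {i..<j} = finprod G T {\<phi> i..<\<phi> j}"
  using ij T
proof (induction j rule: int_ge_induct)
  case base
  then show ?case by simp
next
  case (step j)
  have le: "\<phi> i \<le> \<phi> j" "\<phi> j \<le> \<phi> (j + 1)" "\<And>n. i \<le> n \<Longrightarrow> \<phi> i \<le> \<phi> n" "\<And>n. n < j \<Longrightarrow> \<phi> (n + 1) \<le> \<phi> j"
    using \<phi> step(1) by (auto intro: monoD)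
  have T: "T \<in> {\<phi> i..<\<phi> j} \<rightarrow> carrier G" "T \<in> {\<phi> j..<\<phi> (j + 1)} \<rightarrow> carrier G"
    using step(3) le by auto
  have "finprod G T {\<phi> n..<\<phi> (n + 1)} \<in> carrier G" if "n \<in> {i..<j}" for n
    using that step(3) le(2) le(3)[of n] le(4)[of n] by (intro finprod_closed) fastforce
  then have "finprod G (\<lambda>n. finprod G T {\<phi> n..<\<phi> (n + 1)}) (insert j {i..<j})
    = finprod G T {\<phi> j..<\<phi> (j + 1)} \<otimes> finprod G (\<lambda>n. finprod G T {\<phi> n..<\<phi> (n + 1)}) {i..<j}"
    using T(2) by (intro finprod_insert) auto
  also have "\<dots> = finprod G T {\<phi> i..<\<phi> j} \<otimes> finprod G T {\<phi> j..<\<phi> (j + 1)}"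
    using step(2)[OF T(1)] T by (simp add: m_comm)
  also have "\<dots> = finprod G T ({\<phi> i..<\<phi> j} \<union> {\<phi> j..<\<phi> (j + 1)})"
    by (rule finprod_Un_disjoint[symmetric]) (use T in auto)
  also have "{\<phi> i..<\<phi> j} \<union> {\<phi> j..<\<phi> (j + 1)} = {\<phi> i..<\<phi> (j + 1)}" using le by auto
  also have "insert j {i..<j} = {i..<j + 1}" using step(1) by auto
  finally show ?case .
qed

context preadditive_category
begin

lemma reix_seq:
  assumes "is_seq C X" "mono \<phi>"
  shows "is_seq C (FOb (reix C \<phi>) X)"
  using is_seqD[OF assms(1)] dmap_in[OF assms(1)] monoD[OF assms(2)] by (simp add: is_seq_def)

lemma dmap_reix:
  assumes X: "is_seq C X" and \<phi>: "mono \<phi>" and "i \<le> j"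
  shows "dmap C (FOb (reix C \<phi>) X) i j = dmap C X (\<phi> i) (\<phi> j)"
  using assms(3)
proof (induction j rule: int_ge_induct)
  case (step j)
  then show ?case using X monoD[OF \<phi>] by (simp add: dmap_Suc)
qed simp

lemma reix_comp:
  assumes "is_seq C X" "mono \<phi>" "mono \<psi>"
  shows "FOb (reix C \<psi>) (FOb (reix C \<phi>) X) = FOb (reix C (\<phi> \<circ> \<psi>)) X"
  using assms dmap_reix[OF assms(1,2)] by (intro cpx_eqI) (simp_all add: monoD)

lemma reix_id: "is_seq C X \<Longrightarrow> FOb (reix C (\<lambda>i. i)) X = X"
  by (intro cpx_eqI) (simp_all add: dmap_step)

lemma reix_cpx:
  assumes X: "is_cpx C M X" and \<phi>: "periodic M N \<phi>"
  shows "is_cpx C N (FOb (reix C \<phi>) X)"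
proof -
  have seq: "is_seq C X" using X is_cpx_iff by blast
  show ?thesis
    unfolding is_cpx_iff
    using reix_seq[OF seq periodicD(3)[OF \<phi>]] dmap_reix[OF seq periodicD(3)[OF \<phi>]]
        periodicD(2)[OF \<phi>] dmap_zero[OF X]
    by simp
qed

lemma reix_maps:
  assumes X: "is_seq C X" and Y: "is_seq C Y" and \<phi>: "mono \<phi>" and f: "f \<in> cpx_maps C X Y"
  shows "FAr (reix C \<phi>) X Y f \<in> cpx_maps C (FOb (reix C \<phi>) X) (FOb (reix C \<phi>) Y)"
  by (rule cpx_mapsI) (use cpx_mapsD(1)[OF f] cpx_maps_dmap[OF f X Y] monoD[OF \<phi>] in simp_all)

lemma reix_transform:
  assumes X: "is_seq C X" and \<phi>: "mono \<phi>" and \<psi>: "mono \<psi>" and le: "\<And>i. \<phi> i \<le> \<psi> i"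
  shows "(\<lambda>i. dmap C X (\<phi> i) (\<psi> i)) \<in> cpx_maps C (FOb (reix C \<phi>) X) (FOb (reix C \<psi>) X)"
  by (rule cpx_mapsI) (use monoD[OF \<phi>] monoD[OF \<psi>] le X in simp_all)

end

locale reindexing = additive_category C
  for C :: "('o, 'm, 'z) cat_scheme" +
  fixes M N :: nat and \<phi> :: "int \<Rightarrow> int"
  assumes MN: "1 \<le> M" "1 \<le> N" and per: "periodic M N \<phi>"
begin

sublocale A: complexes C M by unfold_locales (rule MN)
sublocale B: complexes C N by unfold_locales (rule MN)

abbreviation R where "R \<equiv> reix C \<phi>"

lemma le: "i \<le> j \<Longrightarrow> \<phi> i \<le> \<phi> j"
  by (rule periodicD(1)[OF per])

lemma shift: "\<phi> (i + int N) = \<phi> i + int M"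
  by (rule periodicD(2)[OF per])

text \<open>The new homotopy in degree n collects the terms of the old one for all m from \<phi> n
  up to, but excluding, \<phi> (n + 1), carried to the two ends by differentials. By periodicity
  \<open>N\<close> consecutive blocks fill one window of length \<open>M\<close>, so the homotopy
  sums agree.\<close>

lemma reix_nullh:
  assumes X: "is_cpx C M X" and Y: "is_cpx C M Y" and s: "s \<in> A.homot X Y"
  shows "\<exists>h\<in>B.homot (FOb R X) (FOb R Y). FAr R X Y (A.nullh X Y s) = B.nullh (FOb R X) (FOb R Y) h"
proof -
  note [simp] = A.cpx_simps[OF X] A.cpx_simps[OF Y] A.homotD[OF s]
  have sX: "is_seq C X" and sY: "is_seq C Y" by simp_all
  have RX: "is_cpx C N (FOb R X)" and RY: "is_cpx C N (FOb R Y)" using reix_cpx[OF _ per] X Y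
      by auto
  note Dm = dmap_reix[OF sX periodicD(3)[OF per]] dmap_reix[OF sY periodicD(3)[OF per]]
  \<comment> \<open>The target degree n - N + 1 of a homotopy lies one period below n + 1.\<close>
  have sh: "\<phi> (n - int N + 1) = \<phi> (n + 1) - int M" for n
    using shift[of "n - int N + 1"] by (simp add: algebra_simps)
  define tm
      where "tm n m
      = Cmp C (Ob X (\<phi> n)) (Ob Y (m - int M + 1)) (Ob Y (\<phi> (n + 1) - int M))
      (dmap C Y (m - int M + 1) (\<phi> (n + 1) - int M))
      (Cmp C (Ob X (\<phi> n)) (Ob X m) (Ob Y (m - int M + 1)) (s m)
      (dmap C X (\<phi> n) m))" for n m
  have tm_in: "tm n m \<in> Hom C (Ob X (\<phi> n)) (Ob Y (\<phi> (n + 1) - int M))"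
      if "m \<in> {\<phi> n..<\<phi> (n + 1)}" for n m
    unfolding tm_def using that by (intro cmp_in) auto
  define h where
      "h n = finprod (HomG C (Ob X (\<phi> n)) (Ob Y (\<phi> (n + 1) - int M))) (tm n) {\<phi> n..<\<phi> (n + 1)}" for
      n
  have h_in: "h n \<in> Hom C (Ob X (\<phi> n)) (Ob Y (\<phi> (n + 1) - int M))" for n
  proof -
    interpret G: comm_group "HomG C (Ob X (\<phi> n)) (Ob Y (\<phi> (n + 1) - int M))"
        by (rule hom_group) simp_all
    show ?thesis unfolding h_def using tm_in by (intro G.finprod_closed) auto
  qed
  then have hh: "h \<in> B.homot (FOb R X) (FOb R Y)" by (simp add: B.homot_def sh)
  have "A.nullh X Y s (\<phi> i) = B.nullh (FOb R X) (FOb R Y) h i" for i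
  proof -
    interpret G: comm_group "HomG C (Ob X (\<phi> i)) (Ob Y (\<phi> i))" by (rule hom_group) simp_all
    define T where
        "T m = Cmp C (Ob X (\<phi> i)) (Ob Y (m - int M + 1)) (Ob Y (\<phi> i)) (dmap C Y (m - int M + 1)
        (\<phi> i)) (Cmp C (Ob X (\<phi> i)) (Ob X m) (Ob Y (m - int M + 1)) (s m)
        (dmap C X (\<phi> i) m))" for m
    have Tin: "T m \<in> Hom C (Ob X (\<phi> i)) (Ob Y (\<phi> i))" if "\<phi> i \<le> m" "m < \<phi> i + int M" for m
      unfolding T_def by (rule A.nullh_term_in[OF X Y s that])
    have "B.nullh (FOb R X) (FOb R Y) h i = finprod (HomG C (Ob X (\<phi> i)) (Ob Y (\<phi> i)))
        (\<lambda>n. finprod (HomG C (Ob X (\<phi> i)) (Ob Y (\<phi> i))) T {\<phi> n..<\<phi> (n + 1)}) {i..<i + int N}"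
      unfolding B.nullh_def reix_sel
    proof (rule G.finprod_cong')
      fix n assume n: "n \<in> {i..<i + int N}"
      have n1: "\<phi> i \<le> \<phi> n" "\<phi> (n + 1) - int M \<le> \<phi> i"
          using le[of i n] le[of "n + 1" "i + int N"] shift[of i] n by auto
      have d: "dmap C (FOb R Y) (n - int N + 1) i = dmap C Y (\<phi> (n + 1) - int M) (\<phi> i)"
          "dmap C (FOb R X) i n = dmap C X (\<phi> i) (\<phi> n)"
        using n Dm by (simp_all add: sh)
      have dY [simp]:
          "dmap C Y (\<phi> (n + 1) - int M) (\<phi> i) \<in> Hom C (Ob Y (\<phi> (n + 1) - int M)) (Ob Y (\<phi> i))"
        and dX [simp]: "dmap C X (\<phi> i) (\<phi> n) \<in> Hom C (Ob X (\<phi> i)) (Ob X (\<phi> n))" using n1 by simp_all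
      have "Cmp C (Ob X (\<phi> i)) (Ob Y (\<phi> (n + 1) - int M)) (Ob Y (\<phi> i)) (dmap C Y (\<phi> (n + 1) - int M)
          (\<phi> i))
          (Cmp C (Ob X (\<phi> i)) (Ob X (\<phi> n)) (Ob Y (\<phi> (n + 1) - int M)) (h n) (dmap C X (\<phi> i) (\<phi> n)))
        = Cmp C (Ob X (\<phi> i)) (Ob Y (\<phi> (n + 1) - int M)) (Ob Y (\<phi> i))
            (dmap C Y (\<phi> (n + 1) - int M) (\<phi> i))
          (finprod (HomG C (Ob X (\<phi> i)) (Ob Y (\<phi> (n + 1) - int M)))
              (\<lambda>m. Cmp C (Ob X (\<phi> i)) (Ob X (\<phi> n)) (Ob Y (\<phi> (n + 1) - int M)) (tm n m)
              (dmap C X (\<phi> i) (\<phi> n))) {\<phi> n..<\<phi> (n + 1)})"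
        unfolding h_def by (subst cmp_finprod_left) (use tm_in in auto)
      also have
          "\<dots> = finprod (HomG C (Ob X (\<phi> i)) (Ob Y (\<phi> i))) (\<lambda>m. Cmp C (Ob X (\<phi> i))
          (Ob Y (\<phi> (n + 1) - int M)) (Ob Y (\<phi> i)) (dmap C Y (\<phi> (n + 1) - int M) (\<phi> i))
          (Cmp C (Ob X (\<phi> i)) (Ob X (\<phi> n)) (Ob Y (\<phi> (n + 1) - int M)) (tm n m)
              (dmap C X (\<phi> i) (\<phi> n)))) {\<phi> n..<\<phi> (n + 1)}"
        by (rule cmp_finprod_right) (use tm_in in auto)
      also have "\<dots> = finprod (HomG C (Ob X (\<phi> i)) (Ob Y (\<phi> i))) T {\<phi> n..<\<phi> (n + 1)}"
      proof (rule G.finprod_cong')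
        fix m assume m: "m \<in> {\<phi> n..<\<phi> (n + 1)}"
        then show
            "Cmp C (Ob X (\<phi> i)) (Ob Y (\<phi> (n + 1) - int M)) (Ob Y (\<phi> i))
            (dmap C Y (\<phi> (n + 1) - int M) (\<phi> i))
          (Cmp C (Ob X (\<phi> i)) (Ob X (\<phi> n)) (Ob Y (\<phi> (n + 1) - int M)) (tm n m)
              (dmap C X (\<phi> i) (\<phi> n))) = T m"
          using n1 cmp_eq_assoc[OF dmap_cmp[OF sY, of "m - int M + 1" "\<phi> (n + 1) - int M" "\<phi> i"]]
          by (simp add: tm_def T_def)
      next
        show "T \<in> {\<phi> n..<\<phi> (n + 1)} \<rightarrow> Hom C (Ob X (\<phi> i)) (Ob Y (\<phi> i))" using n1 Tin by auto
      qed simp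
      finally show
          "Cmp C (Ob X (\<phi> i)) (Ob Y (\<phi> (n - int N + 1))) (Ob Y (\<phi> i))
          (dmap C (FOb R Y) (n - int N + 1) i)
          (Cmp C (Ob X (\<phi> i)) (Ob X (\<phi> n)) (Ob Y (\<phi> (n - int N + 1))) (h n) (dmap C (FOb R X) i n))
        = finprod (HomG C (Ob X (\<phi> i)) (Ob Y (\<phi> i))) T {\<phi> n..<\<phi> (n + 1)}"
        unfolding d sh .
    next
      show "(\<lambda>n. finprod (HomG C (Ob X (\<phi> i)) (Ob Y (\<phi> i))) T {\<phi> n..<\<phi>
          (n + 1)}) \<in> {i..<i + int N} \<rightarrow> Hom C (Ob X (\<phi> i)) (Ob Y (\<phi> i))"
      proof
        fix n assume n: "n \<in> {i..<i + int N}"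
        then have "\<phi> i \<le> \<phi> n" "\<phi> (n + 1) \<le> \<phi> i + int M"
            using le[of i n] le[of "n + 1" "i + int N"] shift[of i] by auto
        then show
            "finprod (HomG C (Ob X (\<phi> i)) (Ob Y (\<phi> i))) T {\<phi> n..<\<phi> (n + 1)} \<in> Hom C (Ob X (\<phi> i))
            (Ob Y (\<phi> i))"
          using Tin by (intro G.finprod_closed) auto
      qed
    qed simp
    also have "\<dots> = finprod (HomG C (Ob X (\<phi> i)) (Ob Y (\<phi> i))) T {\<phi> i..<\<phi> (i + int N)}"
      by (rule G.finprod_concat[OF periodicD(3)[OF per]]) (use Tin shift[of i] in auto)
    also have "\<dots> = A.nullh X Y s (\<phi> i)" unfolding A.nullh_def T_def shift ..
    finally show ?thesis by simp
  qed
  then show ?thesis using hh by (intro bexI[of _ h]) (simp_all add: fun_eq_iff)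
qed

lemma reix_contractible:
  assumes "A.contractible X"
  shows "B.contractible (FOb R X)"
proof -
  have X: "is_cpx C M X" using assms by (simp add: A.contractible_def)
  note RX = reix_cpx[OF X per]
  obtain s where s: "s \<in> A.homot X X" "Idm (CN C M) X = A.nullh X X s"
    using assms A.null_homotopic_iff[OF X X] unfolding A.contractible_def by blast
  obtain h where "h \<in> B.homot (FOb R X) (FOb R X)"
      "FAr R X X (A.nullh X X s) = B.nullh (FOb R X) (FOb R X) h"
    using reix_nullh[OF X X s(1)] by blast
  moreover have "FAr R X X (Idm (CN C M) X) = Idm (CN C N) (FOb R X)" by (simp add: fun_eq_iff)
  ultimately show ?thesis
    unfolding B.contractible_def B.null_homotopic_iff[OF RX RX] using RX s(2) B.id_cpx_maps[OF RX]
    by (auto intro!: bexI[of _ h])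
qed

lemma reix_functor: "is_functor (CN C M) (CN C N) R"
  by (rule is_functorI)
      (auto simp: fun_eq_iff intro: reix_cpx[OF _ per]
      reix_maps[OF A.cpx_seq A.cpx_seq periodicD(3)[OF per]])

lemma reix_exact:
  "exact_functor (CN C M) (conflations C M) (null_homotopic C M) (CN C N) (conflations C N)
      (null_homotopic C N) R"
proof (intro exact_functor.intro exact_functor_axioms.intro A.frobenius_CN B.frobenius_CN)
  show "additive_functor (CN C M) (CN C N) R"
    unfolding additive_functor_def using is_functorD(2)[OF reix_functor]
    by (intro conjI reix_functor) (auto simp: hom_def fun_eq_iff)
  show "(FOb R X, FOb R Y, FOb R Z, FAr R X Y a, FAr R Y Z b) \<in> conflations C N"
    if e: "(X, Y, Z, a, b) \<in> conflations C M" for X Y Z a b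
  proof -
    obtain q t where "\<And>k. biproduct C (Ob X k) (Ob Z k) (Ob Y k) (a k) (t k) (q k) (b k)"
      using A.conflationD(6)[OF e] by blast
    then show ?thesis
      using A.conflationD[OF e]
      by (intro B.conflationI[where t = "\<lambda>i. t (\<phi> i)" and q = "\<lambda>i. q (\<phi> i)"])
        (auto intro: reix_cpx[OF _ per] reix_maps[OF A.cpx_seq A.cpx_seq periodicD(3)[OF per]])
  qed
  show "injective_object (CN C N) (conflations C N) (FOb R K)"
    if "injective_object (CN C M) (conflations C M) K" for K
    using that reix_contractible A.injective_iff_contractible B.injective_iff_contractible by blast
qed

abbreviation qR where "qR \<equiv> quot_fctr (CN C N) (null_homotopic C N) R"

lemma reix_triangle_functor: "triangle_functor (KN C M) (KN C N) qR"
  unfolding KN_def by (rule exact_functor.qF_triangle[OF reix_exact])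

end

text \<open>The lower Galois adjoint \<open>b\<close> gives the right adjoint functor. Unit and
  counit are the transition maps along the two inequalities; the triangle identities hold because a
  b a = a and b a b = b.\<close>

lemma (in additive_category) reix_adjoint:
  assumes MN: "1 \<le> M" "1 \<le> N" and a: "periodic M N a" and b: "periodic N M b"
    and ab: "\<And>i. i \<le> a (b i)" and ba: "\<And>j. b (a j) \<le> j"
  shows "adjoint_pair (KN C M) (KN C N) (quot_fctr (CN C N) (null_homotopic C N) (reix C a))
    (quot_fctr (CN C M) (null_homotopic C M) (reix C b))"
proof -
  interpret a: reindexing C M N a by unfold_locales (use MN a in auto)
  interpret b: reindexing C N M b by unfold_locales (use MN b in auto)
  have seqM: "is_seq C X" if "X \<in> Obj (CN C M)" for X using that a.A.cpx_seq by simp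
  have seqN: "is_seq C X" if "X \<in> Obj (CN C N)" for X using that a.B.cpx_seq by simp
  have GF: "FOb (reix C b) (FOb (reix C a) X) = FOb (reix C (a \<circ> b)) X" if "is_seq C X" for X
    by (rule reix_comp[OF that periodicD(3)[OF a] periodicD(3)[OF b]])
  have FG: "FOb (reix C a) (FOb (reix C b) X) = FOb (reix C (b \<circ> a)) X" if "is_seq C X" for X
    by (rule reix_comp[OF that periodicD(3)[OF b] periodicD(3)[OF a]])
  have mono: "mono (a \<circ> b)" "mono (b \<circ> a)" "mono (\<lambda>i. i)"
    using periodicD(3)[OF a] periodicD(3)[OF b] by (simp_all add: mono_def)
  show ?thesis
    unfolding KN_def
  proof (rule quotient_adjoint[OF a.reix_exact b.reix_exact,
        where u = "\<lambda>X i. dmap C X i (a (b i))" and e = "\<lambda>Y j. dmap C Y (b (a j)) j"])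
    show "(\<lambda>i. dmap C X i (a (b i))) \<in> Hom (CN C M) X (FOb (reix C b) (FOb (reix C a) X))"
      if "X \<in> Obj (CN C M)" for X
      using reix_transform[OF seqM[OF that] mono(3,1)] ab by (simp add: GF seqM[OF that] reix_id)
    show "(\<lambda>j. dmap C Y (b (a j)) j) \<in> Hom (CN C N) (FOb (reix C a) (FOb (reix C b) Y)) Y"
      if "Y \<in> Obj (CN C N)" for Y
      using reix_transform[OF seqN[OF that] mono(2,3)] ba by (simp add: FG seqN[OF that] reix_id)
    show "Cmp (CN C M) X X' (FOb (reix C b) (FOb (reix C a) X')) (\<lambda>i. dmap C X' i (a (b i))) f
      = Cmp (CN C M) X (FOb (reix C b) (FOb (reix C a) X)) (FOb (reix C b) (FOb (reix C a) X'))
         (FAr (reix C b) (FOb (reix C a) X) (FOb (reix C a) X') (FAr (reix C a) X X' f))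
             (\<lambda>i. dmap C X i (a (b i)))"
      if "X \<in> Obj (CN C M)" "X' \<in> Obj (CN C M)" "f \<in> Hom (CN C M) X X'" for X X' f
      using cpx_maps_dmap[OF _ seqM seqM] that ab by (simp add: fun_eq_iff)
    show "Cmp (CN C N) (FOb (reix C a) (FOb (reix C b) Y)) (FOb (reix C a) (FOb (reix C b) Y')) Y'
        (\<lambda>j. dmap C Y' (b (a j)) j)
        (FAr (reix C a) (FOb (reix C b) Y) (FOb (reix C b) Y') (FAr (reix C b) Y Y' g))
      = Cmp (CN C N) (FOb (reix C a) (FOb (reix C b) Y)) Y Y' g (\<lambda>j. dmap C Y (b (a j)) j)"
      if "Y \<in> Obj (CN C N)" "Y' \<in> Obj (CN C N)" "g \<in> Hom (CN C N) Y Y'" for Y Y' g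
      using cpx_maps_dmap[OF _ seqN seqN] that ba by (simp add: fun_eq_iff)
    show "Cmp (CN C N) (FOb (reix C a) X) (FOb (reix C a) (FOb (reix C b) (FOb (reix C a) X)))
        (FOb (reix C a) X)
        (\<lambda>j. dmap C (FOb (reix C a) X) (b (a j)) j)
        (FAr (reix C a) X (FOb (reix C b) (FOb (reix C a) X)) (\<lambda>i. dmap C X i (a (b i)))) = Idm
            (CN C N) (FOb (reix C a) X)"
      if "X \<in> Obj (CN C M)" for X
      using dmap_reix[OF seqM[OF that] periodicD(3)[OF a]] ab ba periodicD(1)[OF a] seqM[OF that]
      by (simp add: fun_eq_iff)
    show "Cmp (CN C M) (FOb (reix C b) Y) (FOb (reix C b) (FOb (reix C a) (FOb (reix C b) Y)))
        (FOb (reix C b) Y)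
        (FAr (reix C b) (FOb (reix C a) (FOb (reix C b) Y)) Y (\<lambda>j. dmap C Y (b (a j)) j))
        (\<lambda>i. dmap C (FOb (reix C b) Y) i (a (b i))) = Idm (CN C M) (FOb (reix C b) Y)"
      if "Y \<in> Obj (CN C N)" for Y
      using dmap_reix[OF seqN[OF that] periodicD(3)[OF b]] ab ba periodicD(1)[OF b] seqN[OF that]
      by (simp add: fun_eq_iff)
  qed
qed

text \<open>A map \<open>h\<close> between restrictions along \<open>a\<close> is determined by its
  values at the indices b (a j): the transition from b (a j) to j is the identity on both complexes
  since a (b (a j)) = a j, and \<open>h\<close> commutes with it.\<close>

lemma (in additive_category) reix_fully_faithful:
  assumes MN: "1 \<le> M" "1 \<le> N" and a: "periodic M N a" and b: "periodic N M b"
    and ab: "\<And>i. a (b i) = i" and ba: "\<And>j. b (a j) \<le> j"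
  shows "fully_faithful (KN C M) (KN C N) (quot_fctr (CN C N) (null_homotopic C N) (reix C a))"
proof -
  interpret a: reindexing C M N a by unfold_locales (use MN a in auto)
  interpret b: reindexing C N M b by unfold_locales (use MN b in auto)
  have id: "a \<circ> b = (\<lambda>i. i)" using ab by (simp add: fun_eq_iff)
  show ?thesis
    unfolding KN_def
  proof (rule quotient_fully_faithful[OF a.reix_exact b.reix_exact])
    show "FOb (reix C b) (FOb (reix C a) X) = X" if "X \<in> Obj (CN C M)" for X
      using reix_comp[OF _ periodicD(3)[OF a] periodicD(3)[OF b]] reix_id a.A.cpx_seq that id
          by simp
    show "FAr (reix C b) (FOb (reix C a) X) (FOb (reix C a) Y) (FAr (reix C a) X Y f) = f" for X Y f
      by (simp add: fun_eq_iff ab)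
    show "FAr (reix C a) X Y (FAr (reix C b) (FOb (reix C a) X) (FOb (reix C a) Y) h) = h"
      if X: "X \<in> Obj (CN C M)" and Y: "Y \<in> Obj (CN C M)"
          and h: "h \<in> Hom (CN C N) (FOb (reix C a) X) (FOb (reix C a) Y)" for X Y h
    proof
      fix j
      have cX: "is_cpx C M X" and cY: "is_cpx C M Y" using X Y by simp_all
      note sX = a.A.cpx_seq[OF cX] and sY = a.A.cpx_seq[OF cY]
      note [simp] = is_seqD[OF sX] is_seqD[OF sY]
      have hc: "h \<in> cpx_maps C (FOb (reix C a) X) (FOb (reix C a) Y)" using h by simp
      note hh = cpx_mapsD(1)[OF hc, simplified]
      have "h (b (a j)) \<in> Hom C (Ob X (a j)) (Ob Y (a j))" "h j \<in> Hom C (Ob X (a j)) (Ob Y (a j))"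
        using hh[of "b (a j)"] hh[of j] by (simp_all add: ab)
      moreover have
          "Cmp C (Ob X (a (b (a j)))) (Ob X (a j)) (Ob Y (a j)) (h j) (dmap C (FOb (reix C a) X)
          (b (a j)) j)
        = Cmp C (Ob X (a (b (a j)))) (Ob Y (a (b (a j)))) (Ob Y (a j))
            (dmap C (FOb (reix C a) Y) (b (a j)) j) (h (b (a j)))"
        using cpx_maps_dmap[OF hc reix_seq[OF sX periodicD(3)[OF a]]
            reix_seq[OF sY periodicD(3)[OF a]] ba[of j]] by simp
      ultimately show "FAr (reix C a) X Y (FAr (reix C b) (FOb (reix C a) X) (FOb (reix C a) Y) h) j
          = h j"
        using dmap_reix[OF sX periodicD(3)[OF a] ba[of j]]
            dmap_reix[OF sY periodicD(3)[OF a] ba[of j]]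
        by (simp add: ab)
    qed
  qed
qed

text \<open>Every map \<open>s\<close> of \<open>1\<close>-complexes is the null-homotopy of itself.\<close>

lemma (in complexes) contractible_one:
  assumes N: "N = 1" and X: "is_cpx C N X"
  shows "contractible X"
proof -
  note [simp] = cpx_simps[OF X]
  have "(\<lambda>i. Idm C (Ob X i)) \<in> homot X X" unfolding homot_def by (simp add: N)
  moreover have "(\<lambda>i. Idm C (Ob X i)) = nullh X X (\<lambda>i. Idm C (Ob X i))"
  proof
    fix i
    interpret G: comm_group "HomG C (Ob X i) (Ob X i)" by (rule hom_group) simp_all
    have "{i..<i + int N} = {i}" using N by auto
    then show "Idm C (Ob X i) = nullh X X (\<lambda>i. Idm C (Ob X i)) i"
      unfolding nullh_def by (simp add: N)
  qed
  ultimately show ?thesis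
    using id_cpx_maps[OF X] X unfolding contractible_def null_homotopic_iff[OF X X] CN_sel(4)
        by blast
qed

lemma (in additive_category) reix_factor_contractible:
  assumes MN: "1 \<le> M" "1 \<le> N" and a: "periodic M 1 a" and b: "periodic 1 N b" and X: "is_cpx C M X"
  shows "complexes.contractible C N (FOb (reix C (a \<circ> b)) X)"
proof -
  interpret a: reindexing C M 1 a by unfold_locales (use MN a in auto)
  interpret b: reindexing C 1 N b by unfold_locales (use MN b in auto)
  have "a.B.contractible (FOb (reix C a) X)"
    by (rule a.B.contractible_one[OF refl reix_cpx[OF X a]])
  from b.reix_contractible[OF this] show ?thesis
    using reix_comp[OF a.A.cpx_seq[OF X] periodicD(3)[OF a] periodicD(3)[OF b]] by simp
qed

context complexes
begin

lemma KN_iso_sym: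
  assumes "is_iso (KN C N) X Y f" "X \<in> Obj (KN C N)" "Y \<in> Obj (KN C N)"
  shows "\<exists>g. is_iso (KN C N) Y X g"
  using assms unfolding is_iso_def by blast

lemma zero_object_KN:
  assumes "is_cpx C N X"
  shows "zero_object (KN C N) X \<longleftrightarrow> contractible X"
proof -
  interpret frobenius_category KK EE Nul by (rule frobenius_CN)
  show ?thesis unfolding KN_def using zero_object_Q_iff[of X] assms injective_iff_contractible
      by simp
qed

text \<open>In each degree two opposite sides of the commutative square \<open>\<lambda> \<le> id \<le> \<mu>\<close>, \<open>\<lambda> \<le> \<pi> \<le> \<mu>\<close> are
  identities, so that it induces a degreewise split Mayer--Vietoris sequence.\<close>

lemma mayer_vietoris:
  assumes X: "is_cpx C N X" and la: "periodic N N la" and mu: "periodic N N mu"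
      and pi: "periodic N N pi"
    and le: "\<And>i. la i \<le> i" "\<And>i. i \<le> mu i" "\<And>i. la i \<le> pi i" "\<And>i. pi i \<le> mu i"
    and alt: "\<And>i. la i = i \<and> pi i = mu i \<or> la i = pi i \<and> mu i = i"
  shows "\<exists>Z u v i1 i2 p1 p2. (FOb (reix C la) X, Z, FOb (reix C mu) X, u, v) \<in> EE \<and>
    biproduct KK X (FOb (reix C pi) X) Z i1 i2 p1 p2"
proof -
  interpret KA: additive_category KK by (rule additive_CN)
  note sX = cpx_seq[OF X]
  note [simp] = cpx_simps[OF X]
  have L: "is_cpx C N (FOb (reix C la) X)" and M: "is_cpx C N (FOb (reix C mu) X)"
      and P: "is_cpx C N (FOb (reix C pi) X)"
    using reix_cpx[OF X] la mu pi by auto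
  obtain Z i1 i2 p1 p2 where bp: "biproduct KK X (FOb (reix C pi) X) Z i1 i2 p1 p2"
    using KA.ex_biproduct[of X "FOb (reix C pi) X"] X P by auto
  have Z: "is_cpx C N Z" and ic: "i1 \<in> cpx_maps C X Z" "i2 \<in> cpx_maps C (FOb (reix C pi) X) Z"
     "p1 \<in> cpx_maps C Z X" "p2 \<in> cpx_maps C Z (FOb (reix C pi) X)"
    using bp by (simp_all add: biproduct_def)
  note bpi = biproduct_CN[OF X P bp, simplified]
  note [simp] = cpx_simps[OF Z] biproductD[OF bpi] le
  note bps = cmp_eq_assoc[OF biproductD(6)[OF bpi]] cmp_eq_assoc[OF biproductD(7)[OF bpi]]
     cmp_eq_assoc[OF biproductD(8)[OF bpi]] cmp_eq_assoc[OF biproductD(9)[OF bpi]]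
  note m = periodicD(3)[OF la] periodicD(3)[OF mu] periodicD(3)[OF pi]
      periodicD(3)[OF periodic_id[of N]]
  have tr: "(\<lambda>i. dmap C X (la i) i) \<in> cpx_maps C (FOb (reix C la) X) X"
    "(\<lambda>i. dmap C X (la i) (pi i)) \<in> cpx_maps C (FOb (reix C la) X) (FOb (reix C pi) X)"
    "(\<lambda>i. dmap C X i (mu i)) \<in> cpx_maps C X (FOb (reix C mu) X)"
    "(\<lambda>i. dmap C X (pi i) (mu i)) \<in> cpx_maps C (FOb (reix C pi) X) (FOb (reix C mu) X)"
    using reix_transform[OF sX m(1) m(4)] reix_transform[OF sX m(1) m(3)]
        reix_transform[OF sX m(4) m(2)]
      reix_transform[OF sX m(3) m(2)] by (simp_all add: reix_id[OF sX])
  define u where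
      "u = (\<lambda>i. (Add C (Ob X (la i)) (Ob Z i) (Cmp C (Ob X (la i)) (Ob X i) (Ob Z i) (i1 i)
      (dmap C X (la i) i)) (Cmp C (Ob X (la i)) (Ob X (pi i)) (Ob Z i) (i2 i)
      (dmap C X (la i) (pi i)))))"
  \<comment> \<open>With a sum in \<open>u\<close> and a difference in \<open>v\<close> the
    composite vanishes, both ways around the square being the transition from \<lambda> to
    \<mu>.\<close>
  define v where
      "v = (\<lambda>i. (Add C (Ob Z i) (Ob X (mu i)) (Cmp C (Ob Z i) (Ob X i) (Ob X (mu i))
      (dmap C X i (mu i)) (p1 i)) (Neg C (Ob Z i) (Ob X (mu i))
      (Cmp C (Ob Z i) (Ob X (pi i)) (Ob X (mu i)) (dmap C X (pi i) (mu i)) (p2 i)))))"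
  have uc: "u \<in> cpx_maps C (FOb (reix C la) X) Z"
    using K.add_in[of "FOb (reix C la) X" Z "Cmp KK (FOb (reix C la) X) X Z i1
        (\<lambda>i. dmap C X (la i) i)"
        "Cmp KK (FOb (reix C la) X) (FOb (reix C pi) X) Z i2 (\<lambda>i. dmap C X (la i) (pi i))"]
      cmp_cpx_maps[OF L X Z tr(1) ic(1)] cmp_cpx_maps[OF L P Z tr(2) ic(2)] L Z by (simp add: u_def)
  have 1: "(\<lambda>i. (Cmp C (Ob Z i) (Ob X i) (Ob X (mu i)) (dmap C X i (mu i)) (p1 i))) \<in> cpx_maps C Z
      (FOb (reix C mu) X)"
    and 2: "(\<lambda>i. (Cmp C (Ob Z i) (Ob X (pi i)) (Ob X (mu i)) (dmap C X (pi i) (mu i))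
        (p2 i))) \<in> cpx_maps C Z (FOb (reix C mu) X)"
    using cmp_cpx_maps[OF Z X M ic(3) tr(3)] cmp_cpx_maps[OF Z P M ic(4) tr(4)] by simp_all
  have neg: "(\<lambda>i. Neg C (Ob Z i) (Ob X (mu i)) (f i)) \<in> cpx_maps C Z (FOb (reix C mu) X)"
      if f: "f \<in> cpx_maps C Z (FOb (reix C mu) X)" for f
    using cpx_mapsD[OF f] cpx_simps[OF M] by (intro cpx_mapsI) simp_all
  have vc: "v \<in> cpx_maps C Z (FOb (reix C mu) X)"
    using K.add_in[of Z "FOb (reix C mu) X" "\<lambda>i. Cmp C (Ob Z i) (Ob X i) (Ob X (mu i))
        (dmap C X i (mu i)) (p1 i)" "\<lambda>i. Neg C (Ob Z i) (Ob X (mu i))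
        (Cmp C (Ob Z i) (Ob X (pi i)) (Ob X (mu i)) (dmap C X (pi i) (mu i))
        (p2 i))"] 1 neg[OF 2] Z M
    by (simp add: v_def)
  have bq: "\<exists>t q. biproduct C (Ob X (la i)) (Ob X (mu i)) (Ob Z i) (u i) t q (v i)" for i
    using alt[of i]
  proof
    \<comment> \<open>Here the component of \<open>u\<close> in \<open>X\<close> is an identity, so
      \<open>p1\<close> is a retraction of \<open>u\<close>, while minus \<open>i2\<close> is a
      section of \<open>v\<close>.\<close>
    assume a: "la i = i \<and> pi i = mu i"
    then have a1: "la i = i" and a2: "mu i = pi i" by simp_all
    have le': "i \<le> pi i" using le(2)[of i] a2 by simp
    have ui: "u i
        = Add C (Ob X i) (Ob Z i) (i1 i)
        (Cmp C (Ob X i) (Ob X (pi i)) (Ob Z i) (i2 i) (dmap C X i (pi i)))" by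
        (simp add: u_def a1 le')
    have vi: "v i
        = Add C (Ob Z i) (Ob X (pi i))
        (Cmp C (Ob Z i) (Ob X i) (Ob X (pi i)) (dmap C X i (pi i)) (p1 i))
        (Neg C (Ob Z i) (Ob X (pi i)) (p2 i))" by (simp add: v_def a2)
    have bi: "Idm C (Ob Z i)
        = Add C (Ob Z i) (Ob Z i) (Cmp C (Ob Z i) (Ob X i) (Ob Z i) (i1 i) (p1 i))
        (Cmp C (Ob Z i) (Ob X (pi i)) (Ob Z i) (i2 i) (p2 i))" by simp
    have "(Add C (Ob Z i) (Ob Z i) (Cmp C (Ob Z i) (Ob X i) (Ob Z i) (Add C (Ob X i) (Ob Z i) (i1 i)
        (Cmp C (Ob X i) (Ob X (pi i)) (Ob Z i) (i2 i) (dmap C X i (pi i)))) (p1 i))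
        (Cmp C (Ob Z i) (Ob X (pi i)) (Ob Z i) (Neg C (Ob X (pi i)) (Ob Z i) (i2 i))
        (Add C (Ob Z i) (Ob X (pi i))
        (Cmp C (Ob Z i) (Ob X i) (Ob X (pi i)) (dmap C X i (pi i)) (p1 i))
        (Neg C (Ob Z i) (Ob X (pi i)) (p2 i)))))
       = Add C (Ob Z i) (Ob Z i)
           (Add C (Ob Z i) (Ob Z i) (Cmp C (Ob Z i) (Ob X i) (Ob Z i) (i1 i) (p1 i))
           (Cmp C (Ob Z i) (Ob X (pi i)) (Ob Z i) (i2 i)
           (Cmp C (Ob Z i) (Ob X i) (Ob X (pi i)) (dmap C X i (pi i)) (p1 i))))
           (Add C (Ob Z i) (Ob Z i) (Cmp C (Ob Z i) (Ob X (pi i)) (Ob Z i) (i2 i)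
           (p2 i)) (Neg C (Ob Z i) (Ob Z i)
           (Cmp C (Ob Z i) (Ob X (pi i)) (Ob Z i) (i2 i)
           (Cmp C (Ob Z i) (Ob X i) (Ob X (pi i)) (dmap C X i (pi i)) (p1 i)))))"
      using le'
          add_commute[of "Ob Z i" "Ob Z i" "Neg C (Ob Z i) (Ob Z i) (Cmp C (Ob Z i) (Ob X (pi i))
          (Ob Z i) (i2 i)
          (Cmp C (Ob Z i) (Ob X i) (Ob X (pi i)) (dmap C X i (pi i)) (p1 i)))" "Cmp C (Ob Z
          i) (Ob X (pi i)) (Ob Z i) (i2 i) (p2 i)"]
      by (simp del: biproductD(10)[OF bpi])
    also have "\<dots> = Idm C (Ob Z i)" unfolding bi by (rule add_add_neg) (use le' in simp_all)
    finally have sum: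
        "Add C (Ob Z i) (Ob Z i) (Cmp C (Ob Z i) (Ob X i) (Ob Z i) (Add C (Ob X i) (Ob Z i) (i1 i)
        (Cmp C (Ob X i) (Ob X (pi i)) (Ob Z i) (i2 i) (dmap C X i (pi i)))) (p1 i))
        (Cmp C (Ob Z i) (Ob X (pi i)) (Ob Z i) (Neg C (Ob X (pi i)) (Ob Z i) (i2 i))
        (Add C (Ob Z i) (Ob X (pi i))
        (Cmp C (Ob Z i) (Ob X i) (Ob X (pi i)) (dmap C X i (pi i)) (p1 i))
        (Neg C (Ob Z i) (Ob X (pi i)) (p2 i)))) = Idm C (Ob Z i)" .
    show ?thesis
      unfolding ui vi a1 a2 using sum le'
      by (intro exI[of _ "Neg C (Ob X (pi i)) (Ob Z i) (i2 i)"] exI[of _ "p1 i"])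
          (simp add: biproduct_def bps del: biproductD(10)[OF bpi])
  next
    \<comment> \<open>Here the identities sit on the other two sides of the square, so
      \<open>p2\<close> retracts \<open>u\<close> and \<open>i1\<close> is a section of
      \<open>v\<close>.\<close>
    assume a: "la i = pi i \<and> mu i = i"
    then have a1: "la i = pi i" and a2: "mu i = i" by simp_all
    have le': "pi i \<le> i" using le(1)[of i] a1 by simp
    have ui: "u i
        = Add C (Ob X (pi i)) (Ob Z i)
        (Cmp C (Ob X (pi i)) (Ob X i) (Ob Z i) (i1 i) (dmap C X (pi i) i))
        (i2 i)" by (simp add: u_def a1 le')
    have vi: "v i
        = Add C (Ob Z i) (Ob X i) (p1 i)
        (Neg C (Ob Z i) (Ob X i) (Cmp C (Ob Z i) (Ob X (pi i)) (Ob X i) (dmap C X (pi i) i)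
        (p2 i)))" by (simp add: v_def a2)
    have bi: "Idm C (Ob Z i)
        = Add C (Ob Z i) (Ob Z i) (Cmp C (Ob Z i) (Ob X (pi i)) (Ob Z i) (i2 i) (p2 i))
        (Cmp C (Ob Z i) (Ob X i) (Ob Z i) (i1 i) (p1 i))"
      using add_commute[of "Ob Z i" "Ob Z i" "Cmp C (Ob Z i) (Ob X i) (Ob Z i) (i1 i) (p1 i)" "Cmp C
          (Ob Z i) (Ob X (pi i)) (Ob Z i) (i2 i) (p2 i)"] by simp
    have "(Add C (Ob Z i) (Ob Z i) (Cmp C (Ob Z i) (Ob X (pi i)) (Ob Z i) (Add C (Ob X (pi i))
        (Ob Z i) (Cmp C (Ob X (pi i)) (Ob X i) (Ob Z i) (i1 i) (dmap C X (pi i) i)) (i2 i)) (p2 i))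
        (Cmp C (Ob Z i) (Ob X i) (Ob Z i) (i1 i)
        (Add C (Ob Z i) (Ob X i) (p1 i)
        (Neg C (Ob Z i) (Ob X i)
        (Cmp C (Ob Z i) (Ob X (pi i)) (Ob X i) (dmap C X (pi i) i) (p2 i))))))
       = Add C (Ob Z i) (Ob Z i)
           (Add C (Ob Z i) (Ob Z i) (Cmp C (Ob Z i) (Ob X (pi i)) (Ob Z i) (i2 i) (p2 i))
           (Cmp C (Ob Z i) (Ob X i) (Ob Z i) (i1 i)
           (Cmp C (Ob Z i) (Ob X (pi i)) (Ob X i) (dmap C X (pi i) i) (p2 i))))
           (Add C (Ob Z i) (Ob Z i) (Cmp C (Ob Z i) (Ob X i) (Ob Z i) (i1 i) (p1 i))
           (Neg C (Ob Z i) (Ob Z i) (Cmp C (Ob Z i) (Ob X i) (Ob Z i) (i1 i)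
           (Cmp C (Ob Z i) (Ob X (pi i)) (Ob X i) (dmap C X (pi i) i) (p2 i)))))"
      using le' add_commute[of "Ob Z i" "Ob Z i" "Cmp C (Ob Z i) (Ob X i) (Ob Z i) (i1 i)
          (Cmp C (Ob Z i) (Ob X (pi i)) (Ob X i) (dmap C X (pi i) i) (p2 i))" "Cmp C (Ob Z i)
          (Ob X (pi i)) (Ob Z i) (i2 i) (p2 i)"]
      by (simp del: biproductD(10)[OF bpi])
    also have "\<dots> = Idm C (Ob Z i)" unfolding bi by (rule add_add_neg) (use le' in simp_all)
    finally have sum:
        "Add C (Ob Z i) (Ob Z i) (Cmp C (Ob Z i) (Ob X (pi i)) (Ob Z i) (Add C (Ob X (pi i))
        (Ob Z i) (Cmp C (Ob X (pi i)) (Ob X i) (Ob Z i) (i1 i) (dmap C X (pi i) i)) (i2 i)) (p2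
        i)) (Cmp C (Ob Z i) (Ob X i) (Ob Z i) (i1 i) (Add C (Ob Z i) (Ob X i) (p1 i)
        (Neg C (Ob Z i) (Ob X i)
        (Cmp C (Ob Z i) (Ob X (pi i)) (Ob X i) (dmap C X (pi i) i) (p2 i))))) = Idm
        C (Ob Z i)" .
    show ?thesis
      unfolding ui vi a1 a2 using sum le'
      by (intro exI[of _ "i1 i"] exI[of _ "p2 i"])
          (simp add: biproduct_def bps del: biproductD(10)[OF bpi])
  qed
  then obtain t q
      where "\<And>i. biproduct C (Ob X (la i)) (Ob X (mu i)) (Ob Z i) (u i) (t i) (q i) (v i)" by metis
  then have "(FOb (reix C la) X, Z, FOb (reix C mu) X, u, v) \<in> EE"
    by (intro conflationI[OF L Z M uc vc, where t = t and q = q]) simp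
  then show ?thesis using bp by blast
qed

end


section \<open>The index maps\<close>

text \<open>\<open>rep_map M k s\<close> repeats the index \<open>s\<close> (and its translates by \<open>M\<close>) \<open>k\<close> additional times;
  \<open>omit_map M k s\<close> omits the \<open>k\<close> indices following \<open>s\<close> (and their translates by \<open>M + k\<close>).\<close>

definition rep_map :: "nat \<Rightarrow> nat \<Rightarrow> int \<Rightarrow> int \<Rightarrow> int" where
  "rep_map M k s n = s + (n - s) div int (M + k) * int M + max 0 ((n - s) mod int (M + k) - int k)"

definition omit_map :: "nat \<Rightarrow> nat \<Rightarrow> int \<Rightarrow> int \<Rightarrow> int" where
  "omit_map M k s n = s + (n - s) div int M * int (M + k) +
     (if (n - s) mod int M = 0 then 0 else (n - s) mod int M + int k)"

lemma int_residue:
  fixes s n P :: int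
  assumes "0 < P"
  obtains q j where "n = s + q * P + j" "0 \<le> j" "j < P"
  using assms by (intro that[of "(n - s) div P" "(n - s) mod P"]) auto

lemma divmod_residue:
  fixes s q P j :: int
  assumes "0 \<le> j" "j < P"
  shows "(s + q * P + j - s) div P = q" "(s + q * P + j - s) mod P = j"
  using assms by (simp_all add: algebra_simps)

lemma rep_map_eval:
  assumes "0 \<le> j" "j < int (M + k)"
  shows "rep_map M k s (s + q * int (M + k) + j) = s + q * int M + max 0 (j - int k)"
  unfolding rep_map_def divmod_residue[OF assms] ..

lemma omit_map_eval:
  assumes "0 \<le> j" "j < int M"
  shows "omit_map M k s (s + q * int M + j) = s + q * int (M + k) + (if j
      = 0 then 0 else j + int k)"
  unfolding omit_map_def divmod_residue[OF assms] ..

text \<open>The run omitted after s - 1 is s, ..., s + k - 1, so relative to \<open>s\<close> the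
  map is a translation by \<open>k\<close> in each period. The exceptional residue of
  \<open>omit_map\<close>, which is now M - 1, fits the same formula.\<close>

lemma omit_map_eval_pred:
  assumes "0 \<le> j" "j < int M"
  shows "omit_map M k (s - 1) (s + q * int M + j) = s + q * int (M + k) + j + int k"
proof (cases "j + 1 < int M")
  case True
  have e: "s + q * int M + j = (s - 1) + q * int M + (j + 1)" by simp
  have "omit_map M k (s - 1) (s + q * int M + j) = s - 1 + q * int (M + k) + (if j + 1
      = 0 then 0 else j + 1 + int k)"
    unfolding e by (rule omit_map_eval) (use True assms in auto)
  then show ?thesis using assms by simp
next
  case False
  then have j: "j = int M - 1" using assms by simp
  have e: "s + q * int M + j = (s - 1) + (q + 1) * int M + 0" using j by (simp add: algebra_simps)
  have "omit_map M k (s - 1) (s + q * int M + j) = s - 1 + (q + 1) * int (M + k) + (if (0 :: int)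
      = 0 then 0 else 0 + int k)"
    unfolding e by (rule omit_map_eval) (use j assms in auto)
  moreover have "s - 1 + (q + 1) * int (M + k) + (if (0 :: int) = 0 then 0 else 0 + int k)
      = s + q * int (M + k) + j + int k"
    using j by (simp add: algebra_simps)
  ultimately show ?thesis by (rule trans)
qed

lemma mono_int_stepI:
  fixes f :: "int \<Rightarrow> int"
  assumes "\<And>n. f n \<le> f (n + 1)"
  shows "mono f"
proof
  fix i j :: int assume "i \<le> j"
  then show "f i \<le> f j"
  proof (induction j rule: int_ge_induct)
    case (step j)
    then show ?case using assms[of j] by simp
  qed simp
qed

text \<open>It suffices to know a map on the residues \<open>s, \<dots>, s + N - 1\<close>.\<close>

lemma periodicI:
  fixes f :: "int \<Rightarrow> int"
  assumes N: "1 \<le> N" and f: "\<And>q j. \<lbrakk>0 \<le> j; j < int N\<rbrakk> \<Longrightarrow> f (s + q * int N + j) = g j + q * int M"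
    and g: "\<And>j. \<lbrakk>0 \<le> j; j + 1 < int N\<rbrakk> \<Longrightarrow> g j \<le> g (j + 1)" "g (int N - 1) \<le> g 0 + int M"
  shows "periodic M N f"
  unfolding periodic_def
proof (intro conjI allI mono_int_stepI)
  fix n
  obtain q j where n: "n = s + q * int N + j" and j: "0 \<le> j" "j < int N"
      using int_residue[of "int N" n s] N by auto
  have fn: "f n = g j + q * int M" unfolding n by (rule f[OF j])
  have e: "n + int N = s + (q + 1) * int N + j" using n by (simp add: algebra_simps)
  have "f (n + int N) = g j + (q + 1) * int M" unfolding e by (rule f[OF j])
  then show "f (n + int N) = f n + int M" using fn by (simp add: algebra_simps)
  show "f n \<le> f (n + 1)"
  proof (cases "j + 1 < int N")
    case True
    have e: "n + 1 = s + q * int N + (j + 1)" using n by simp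
    have "f (n + 1) = g (j + 1) + q * int M" unfolding e by (rule f) (use True j in auto)
    then show ?thesis using fn g(1)[of j] True j by simp
  next
    case False
    then have jN: "j = int N - 1" using j by simp
    have e: "n + 1 = s + (q + 1) * int N + 0" using n jN by (simp add: algebra_simps)
    have "f (n + 1) = g 0 + (q + 1) * int M" unfolding e by (rule f) (use N in auto)
    then show ?thesis using fn g(2) jN by (simp add: algebra_simps)
  qed
qed

lemma periodic_rep_map: "1 \<le> M \<Longrightarrow> periodic M (M + k) (rep_map M k s)"
  by (rule periodicI[where s = s and g = "\<lambda>j. s + max 0 (j - int k)"])
    (auto simp: rep_map_eval simp del: of_nat_add)

lemma periodic_omit_map: "1 \<le> M \<Longrightarrow> periodic (M + k) M (omit_map M k s)"
  by (rule periodicI[where s = s and g = "\<lambda>j. s + (if j = 0 then 0 else j + int k)"])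
    (auto simp: omit_map_eval)

text \<open>The value \<open>s\<close> is taken by \<open>rep_map\<close> on the run s, ..., s + k.
  Omission after \<open>s\<close> selects the first element of the run, omission after s - 1 the
  last. These are the least and the greatest section, hence the lower and the upper adjoint.\<close>

lemma rep_omit: "1 \<le> M \<Longrightarrow> rep_map M k s (omit_map M k s n) = n"
  by (rule int_residue[of "int M" n s])
      (auto simp: omit_map_eval rep_map_eval rep_map_eval[of 0 M k, simplified] simp del:
      of_nat_add)

lemma rep_omit_pred: "1 \<le> M \<Longrightarrow> rep_map M k s (omit_map M k (s - 1) n) = n"
  by (rule int_residue[of "int M" n s])
    (auto simp: omit_map_eval_pred add.assoc[of _ _ "int k"] rep_map_eval simp del: of_nat_add)

text \<open>This composite moves a run down to its first element, while the one with base s - 1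
  moves it up to its last. They will serve as \<lambda> and \<mu>.\<close>

lemma omit_rep_eval:
  assumes "1 \<le> M" "0 \<le> j" "j < int (M + k)"
  shows "omit_map M k s (rep_map M k s (s + q * int (M + k) + j))
      = s + q * int (M + k) + (if j \<le> int k then 0 else j)"
  using assms omit_map_eval[of "max 0 (j - int k)" M k s q]
      by (auto simp: rep_map_eval simp del: of_nat_add)

lemma omit_pred_rep_eval:
  assumes "1 \<le> M" "0 \<le> j" "j < int (M + k)"
  shows "omit_map M k (s - 1) (rep_map M k s (s + q * int (M + k) + j))
      = s + q * int (M + k) + max (int k) j"
  using assms omit_map_eval_pred[of "max 0 (j - int k)" M k s q]
      by (auto simp: rep_map_eval simp del: of_nat_add)

lemma omit_rep_le: "1 \<le> M \<Longrightarrow> omit_map M k s (rep_map M k s n) \<le> n"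
  by (rule int_residue[of "int (M + k)" n s]) (auto simp: omit_rep_eval simp del: of_nat_add)

lemma omit_pred_rep_ge: "1 \<le> M \<Longrightarrow> n \<le> omit_map M k (s - 1) (rep_map M k s n)"
  by (rule int_residue[of "int (M + k)" n s]) (auto simp: omit_pred_rep_eval simp del: of_nat_add)

lemma iota_eq: "iota M s = rep_map M 1 s"
proof
  fix n
  define i where "i = (n - s) mod (int M + 1)"
  have "0 \<le> i" by (simp add: i_def)
  then show "iota M s n = rep_map M 1 s n"
    unfolding iota_def rep_map_def Let_def of_nat_add of_nat_1 i_def[symmetric] by auto
qed

lemma rho_eq: "1 \<le> M \<Longrightarrow> rho (M + 1) s = omit_map M 1 s"
  unfolding rho_def omit_map_def Let_def by (auto simp: fun_eq_iff)

text \<open>Restriction is contravariant, so the functor applied last in the iteration is the inner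
  map here. It lengthens the run of copies of \<open>s\<close> by one.\<close>

lemma rep_map_Suc: "1 \<le> M \<Longrightarrow> rep_map M k s \<circ> rep_map (M + k) 1 s = rep_map M (Suc k) s"
proof
  fix n assume M: "1 \<le> M"
  obtain q j where n: "n = s + q * int (M + k + 1) + j" and j: "0 \<le> j" "j < int (M + k + 1)"
    using int_residue[of "int (M + k + 1)" n s] by auto
  have "rep_map (M + k) 1 s n = s + q * int (M + k) + max 0 (j - 1)"
    unfolding n using rep_map_eval[of j "M + k" 1 s q] j by simp
  moreover have
      "rep_map M k s (s + q * int (M + k) + max 0 (j - 1))
      = s + q * int M + max 0 (max 0 (j - 1) - int k)"
    by (rule rep_map_eval) (use j M in auto)
  moreover have "rep_map M (Suc k) s n = s + q * int M + max 0 (j - int (Suc k))"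
    unfolding n using rep_map_eval[of j M "Suc k" s q] j by simp
  ultimately show "(rep_map M k s \<circ> rep_map (M + k) 1 s) n = rep_map M (Suc k) s n" by simp
qed

lemma omit_map_Suc: "1 \<le> M \<Longrightarrow> omit_map (M + k) 1 s \<circ> omit_map M k s = omit_map M (Suc k) s"
proof
  fix n assume M: "1 \<le> M"
  obtain q j where n: "n = s + q * int M + j" and j: "0 \<le> j" "j < int M"
    using int_residue[of "int M" n s] M by auto
  let ?j = "if j = 0 then 0 else j + int k"
  have "omit_map M k s n = s + q * int (M + k) + ?j" unfolding n by (rule omit_map_eval[OF j])
  moreover have "omit_map (M + k) 1 s (s + q * int (M + k) + ?j) = s + q * int (M + k + 1) + (if ?j
      = 0 then 0 else ?j + int 1)"
    by (rule omit_map_eval) (use j M in auto)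
  moreover have
      "omit_map M (Suc k) s n = s + q * int (M + Suc k) + (if j = 0 then 0 else j + int (Suc k))"
    unfolding n by (rule omit_map_eval[OF j])
  ultimately show "(omit_map (M + k) 1 s \<circ> omit_map M k s) n = omit_map M (Suc k) s n" using j
      by simp
qed

lemma rep_map_0: "1 \<le> M \<Longrightarrow> rep_map M 0 s = (\<lambda>n. n)"
proof
  fix n assume "1 \<le> M"
  then show "rep_map M 0 s n = n"
    using div_mult_mod_eq[of "n - s" "int M"] pos_mod_sign[of "int M" "n - s"]
        by (simp add: rep_map_def)
qed

lemma omit_map_0: "1 \<le> M \<Longrightarrow> omit_map M 0 s = (\<lambda>n. n)"
proof
  fix n assume "1 \<le> M"
  then show "omit_map M 0 s n = n"
    using div_mult_mod_eq[of "n - s" "int M"] by (auto simp: omit_map_def)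
qed


section \<open>Functors agreeing on objects and morphisms\<close>

text \<open>The iterated functors and the restrictions are compared only on objects and morphisms of
  the category, since elsewhere their values may differ. Adjunctions, full faithfulness and
  exactness of triangles see no more than this.\<close>

definition agree ::
    "('o1, 'm1, 'z) cat_scheme \<Rightarrow> ('o1, 'm1, 'o2, 'm2) fctr \<Rightarrow> ('o1, 'm1, 'o2, 'm2) fctr \<Rightarrow> bool" where
  "agree C F G
      \<longleftrightarrow> (\<forall>X\<in>Obj C. FOb F X = FOb G X \<and> (\<forall>Y\<in>Obj C. \<forall>f\<in>Hom C X Y. FAr F X Y f = FAr G X Y f))"

lemma agreeD:
  assumes "agree C F G"
  shows "X \<in> Obj C \<Longrightarrow> FOb F X = FOb G X" "\<lbrakk>X \<in> Obj C; Y \<in> Obj C; f \<in> Hom C X Y\<rbrakk>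
      \<Longrightarrow> FAr F X Y f = FAr G X Y f"
  using assms by (auto simp: agree_def)

lemma agree_is_functor:
  assumes C: "preadditive_category C" and a: "agree C F G" and G: "is_functor C D G"
  shows "is_functor C D F"
proof -
  interpret preadditive_category C by fact
  show ?thesis by (rule is_functorI) (simp_all add: agreeD[OF a] is_functorD[OF G])
qed

lemma agree_additive:
  assumes C: "preadditive_category C" and a: "agree C F G" and G: "additive_functor C D G"
  shows "additive_functor C D F"
proof -
  interpret preadditive_category C by fact
  have "FAr F X Y \<in> hom (HomG C X Y) (HomG D (FOb F X) (FOb F Y))"
      if XY: "X \<in> Obj C" "Y \<in> Obj C" for X Y
  proof -
    have "FAr G X Y \<in> hom (HomG C X Y) (HomG D (FOb G X) (FOb G Y))"
      using G XY unfolding additive_functor_def by blast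
    then show ?thesis using XY unfolding hom_def by (auto simp: agreeD[OF a] Pi_iff)
  qed
  then show ?thesis using agree_is_functor[OF C a] G unfolding additive_functor_def by blast
qed

lemma agree_fully_faithful:
  assumes a: "agree C F G" and G: "fully_faithful C D G"
  shows "fully_faithful C D F"
  unfolding fully_faithful_def
proof (intro ballI)
  fix X Y assume XY: "X \<in> Obj C" "Y \<in> Obj C"
  have "bij_betw (FAr G X Y) (Hom C X Y) (Hom D (FOb G X) (FOb G Y))"
    using G XY by (auto simp: fully_faithful_def)
  then show "bij_betw (FAr F X Y) (Hom C X Y) (Hom D (FOb F X) (FOb F Y))"
    using agreeD[OF a] XY bij_betw_cong[of "Hom C X Y" "FAr F X Y" "FAr G X Y"] by simp
qed

lemma agree_adjoint:
  assumes C: "preadditive_category C" and D: "preadditive_category D"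
    and F: "agree C F F'" and G: "agree D G G'" and adj: "adjoint_pair C D F' G'"
  shows "adjoint_pair C D F G"
proof -
  from adj obtain \<phi> where F': "is_functor C D F'" and G': "is_functor D C G'"
    and 1: "\<forall>X\<in>Obj C. \<forall>Y\<in>Obj D. bij_betw (\<phi> X Y) (Hom D (FOb F' X) Y) (Hom C X (FOb G' Y))"
    and 2: "\<forall>X\<in>Obj C. \<forall>X'\<in>Obj C. \<forall>Y\<in>Obj D. \<forall>f\<in>Hom C X' X. \<forall>h\<in>Hom D (FOb F' X) Y.
           \<phi> X' Y (Cmp D (FOb F' X') (FOb F' X) Y h (FAr F' X' X f))
             = Cmp C X' X (FOb G' Y) (\<phi> X Y h) f"
    and 3: "\<forall>X\<in>Obj C. \<forall>Y\<in>Obj D. \<forall>Y'\<in>Obj D. \<forall>g\<in>Hom D Y Y'. \<forall>h\<in>Hom D (FOb F' X) Y.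
           \<phi> X Y' (Cmp D (FOb F' X) Y Y' g h)
             = Cmp C X (FOb G' Y) (FOb G' Y') (FAr G' Y Y' g) (\<phi> X Y h)"
    unfolding adjoint_pair_def by blast
  show ?thesis
    unfolding adjoint_pair_def
    using agree_is_functor[OF C F F'] agree_is_functor[OF D G G'] 1 2 3
    by (intro conjI exI[of _ \<phi>]) (simp_all add: agreeD[OF F] agreeD[OF G])
qed

lemma agree_triangle:
  assumes T: "triangulated_category T" and T': "triangulated_category T'" and a: "agree T F G"
      and G: "triangle_functor T T' G"
  shows "triangle_functor T T' F"
proof -
  interpret T: triangulated_category T by fact
  have S: "is_functor T T (Susp T)" using T.susp_additive by (simp add: additive_functor_def)
  from G obtain \<theta> where G': "additive_functor T T' G"
      and nat: "natural_iso T T' (comp_fctr G (Susp T)) (comp_fctr (Susp T') G) \<theta>"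
    and d: "\<And>X Y Z u v w. (X, Y, Z, u, v, w) \<in> Dist T \<Longrightarrow>
           (FOb G X, FOb G Y, FOb G Z, FAr G X Y u, FAr G Y Z v,
              Cmp T' (FOb G Z) (FOb G (FOb (Susp T) X)) (FOb (Susp T') (FOb G X))
                (\<theta> X) (FAr G Z (FOb (Susp T) X) w)) \<in> Dist T'"
    unfolding triangle_functor_def by blast
  have "natural_iso T T' (comp_fctr F (Susp T)) (comp_fctr (Susp T') F) \<theta>"
    using nat unfolding natural_iso_def comp_fctr_def by (simp add: agreeD[OF a] is_functorD[OF S])
  moreover have "(FOb F X, FOb F Y, FOb F Z, FAr F X Y u, FAr F Y Z v,
              Cmp T' (FOb F Z) (FOb F (FOb (Susp T) X)) (FOb (Susp T') (FOb F X))
                (\<theta> X) (FAr F Z (FOb (Susp T) X) w)) \<in> Dist T'" if t: "(X, Y, Z, u, v, w) \<in> Dist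
                    T" for X Y Z u v w
  proof -
    have "(X, Y, Z, u, v, w) \<in> triangles T (Susp T)" using t T.dist_triangles by blast
    then show ?thesis using d[OF t] by (simp add: triangles_def agreeD[OF a] is_functorD[OF S])
  qed
  ultimately show ?thesis
    unfolding triangle_functor_def using agree_additive[OF T.preadditive_category_axioms a G']
        by blast
qed


section \<open>The functors between homotopy categories\<close>

definition reixK ::
    "('o, 'm, 'z) cat_scheme \<Rightarrow> nat \<Rightarrow> (int \<Rightarrow> int) \<Rightarrow> (('o, 'm) cpx, (int \<Rightarrow> 'm) set, ('o, 'm) cpx,
    (int \<Rightarrow> 'm) set) fctr" where
  "reixK C N \<phi> = quot_fctr (CN C N) (null_homotopic C N) (reix C \<phi>)"

lemma FOb_reixK [simp]: "FOb (reixK C N \<phi>) = FOb (reix C \<phi>)"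
  by (simp add: reixK_def quot_fctr_def)

context additive_category
begin

lemma Obj_KN [simp]: "Obj (KN C N) = {X. is_cpx C N X}"
  by (simp add: KN_def stable_tcat_def quot_cat_def cat.defs CN_def)

lemma KN_triangulated: "1 \<le> N \<Longrightarrow> triangulated_category (KN C N)"
proof -
  assume "1 \<le> N"
  then interpret complexes C N by unfold_locales
  interpret frobenius_category KK EE Nul by (rule frobenius_CN)
  show ?thesis unfolding KN_def by (rule stable_triangulated)
qed

lemma KN_preadditive: "1 \<le> N \<Longrightarrow> preadditive_category (KN C N)"
  using KN_triangulated by (simp add: triangulated_category_def additive_category_def)

lemma KN_hom_cases:
  assumes "F \<in> Hom (KN C N) X Y" "1 \<le> N"
  obtains f where "f \<in> cpx_maps C X Y" "F = mor_class (CN C N) (null_homotopic C N) X Y f"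
proof -
  interpret complexes C N by unfold_locales (rule assms)
  interpret frobenius_category KK EE Nul by (rule frobenius_CN)
  from assms(1) have "F \<in> Hom Q X Y" unfolding KN_def by simp
  then obtain f where "f \<in> Hom KK X Y" "F = cls X Y f" by (rule cls_cases)
  then show thesis using that by simp
qed

lemma reixK_class:
  assumes MN: "1 \<le> M" "1 \<le> N" and \<phi>: "periodic M N \<phi>" and X: "is_cpx C M X" and Y: "is_cpx C M Y"
      and f: "f \<in> cpx_maps C X Y"
  shows "FAr (reixK C N \<phi>) X Y (mor_class (CN C M) (null_homotopic C M) X Y f)
    = mor_class (CN C N) (null_homotopic C N) (FOb (reix C \<phi>) X) (FOb (reix C \<phi>) Y) (\<lambda>i. f (\<phi> i))"
proof -
  interpret reindexing C M N \<phi> by unfold_locales (use MN \<phi> in auto)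
  interpret exact_functor "CN C M" "conflations C M" "null_homotopic C M" "CN C N" "conflations C N"
      "null_homotopic C N" R
    by (rule reix_exact)
  have "FAr R X Y f = (\<lambda>i. f (\<phi> i))" by (simp add: fun_eq_iff)
  then show ?thesis unfolding reixK_def using FAr_qF[of X Y f] X Y f by simp
qed

lemma agree_comp_reixK:
  assumes L: "1 \<le> L" "1 \<le> M" "1 \<le> N" and \<phi>: "periodic L M \<phi>" and \<psi>: "periodic M N \<psi>"
    and F: "agree (KN C L) F (reixK C M \<phi>)" and G: "agree (KN C M) G (reixK C N \<psi>)"
  shows "agree (KN C L) (comp_fctr G F) (reixK C N (\<phi> \<circ> \<psi>))"
  unfolding agree_def
proof (intro ballI conjI)
  fix X assume X: "X \<in> Obj (KN C L)"
  have sX: "is_seq C X" if "is_cpx C L X" for X using that is_cpx_iff by blast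
  have rX: "is_cpx C M (FOb (reix C \<phi>) X)" if "is_cpx C L X" for X using reix_cpx[OF that \<phi>] .
  have rc: "FOb (reix C \<psi>) (FOb (reix C \<phi>) X) = FOb (reix C (\<phi> \<circ> \<psi>)) X" if "is_cpx C L X" for X
    by (rule reix_comp[OF sX[OF that] periodicD(3)[OF \<phi>] periodicD(3)[OF \<psi>]])
  show "FOb (comp_fctr G F) X = FOb (reixK C N (\<phi> \<circ> \<psi>)) X"
    using X by (simp add: comp_fctr_def agreeD(1)[OF F] agreeD(1)[OF G] rX rc)
  fix Y f assume Y: "Y \<in> Obj (KN C L)" and f: "f \<in> Hom (KN C L) X Y"
  obtain g where g: "g \<in> cpx_maps C X Y" "f = mor_class (CN C L) (null_homotopic C L) X Y g"
    by (rule KN_hom_cases[OF f L(1)])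
  have XY: "is_cpx C L X" "is_cpx C L Y" using X Y by simp_all
  interpret reindexing C L M \<phi> by unfold_locales (use L \<phi> in auto)
  interpret Fb: frobenius_category "CN C M" "conflations C M" "null_homotopic C M"
      by (rule B.frobenius_CN)
  have gm: "(\<lambda>i. g (\<phi> i)) \<in> cpx_maps C (FOb (reix C \<phi>) X) (FOb (reix C \<phi>) Y)"
    using reix_maps[OF sX[OF XY(1)] sX[OF XY(2)] periodicD(3)[OF \<phi>] g(1)] by (simp add: reix_def)
  have h: "mor_class (CN C M) (null_homotopic C M) (FOb (reix C \<phi>) X) (FOb (reix C \<phi>) Y)
      (\<lambda>i. g (\<phi> i))
     \<in> Hom (KN C M) (FOb (reix C \<phi>) X) (FOb (reix C \<phi>) Y)"
    unfolding KN_def using Fb.cls_in gm rX XY by simp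
  have "FAr (comp_fctr G F) X Y f = FAr (reixK C N \<psi>) (FOb (reix C \<phi>) X) (FOb (reix C \<phi>) Y)
      (mor_class (CN C M) (null_homotopic C M) (FOb (reix C \<phi>) X) (FOb (reix C \<phi>) Y) (\<lambda>i. g (\<phi> i)))"
    using X Y f h g
        by (simp add: comp_fctr_def agreeD[OF F] agreeD(2)[OF G] rX reixK_class[OF L(1,2) \<phi>])
  also have "\<dots> = FAr (reixK C N (\<phi> \<circ> \<psi>)) X Y f"
    using reixK_class[OF L(2,3) \<psi> rX rX gm] reixK_class[OF L(1,3) periodic_comp[OF \<phi> \<psi>] XY g(1)] XY
        g(2) by (simp add: rc)
  finally show "FAr (comp_fctr G F) X Y f = FAr (reixK C N (\<phi> \<circ> \<psi>)) X Y f" .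
qed

lemma agree_id_reixK:
  assumes M: "1 \<le> M"
  shows "agree (KN C M) id_fctr (reixK C M (\<lambda>i. i))"
  unfolding agree_def
proof (intro ballI conjI)
  have sX: "is_seq C X" if "is_cpx C M X" for X using that is_cpx_iff by blast
  fix X assume X: "X \<in> Obj (KN C M)"
  then show "FOb id_fctr X = FOb (reixK C M (\<lambda>i. i)) X" by (simp add: id_fctr_def reix_id sX)
  fix Y f assume Y: "Y \<in> Obj (KN C M)" and f: "f \<in> Hom (KN C M) X Y"
  obtain g where g: "g \<in> cpx_maps C X Y" "f = mor_class (CN C M) (null_homotopic C M) X Y g"
    by (rule KN_hom_cases[OF f M])
  then show "FAr id_fctr X Y f = FAr (reixK C M (\<lambda>i. i)) X Y f"
    using X Y reixK_class[OF M M periodic_id _ _ g(1)] by (simp add: id_fctr_def reix_id sX)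
qed

lemma agree_quot:
  assumes "\<And>X. is_cpx C M X \<Longrightarrow> FOb F X = FOb (reix C \<phi>) X"
      "\<And>X Y f. FAr F X Y f = FAr (reix C \<phi>) X Y f"
  shows "agree (KN C M) (quot_fctr (CN C N) (null_homotopic C N) F) (reixK C N \<phi>)"
  using assms by (simp add: agree_def reixK_def quot_fctr_def)

text \<open>\<open>I_fctr\<close> uses single differentials and identities, the restriction uses
  composites of differentials. They agree because the index map grows by at most one at each
  step.\<close>

lemma agree_I_K:
  assumes "1 \<le> M"
  shows "agree (KN C M) (I_K C M s) (reixK C (M + 1) (rep_map M 1 s))"
  unfolding I_K_def
proof (rule agree_quot)
  fix X assume X: "is_cpx C M X"
  then have sX: "is_seq C X" using is_cpx_iff by blast
  have le: "rep_map M 1 s i \<le> rep_map M 1 s (i + 1)" for i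
    using periodicD(1)[OF periodic_rep_map[OF assms]] by simp
  have le1: "rep_map M 1 s (i + 1) \<le> rep_map M 1 s i + 1" for i
  proof -
    obtain q j where n: "i = s + q * int (M + 1) + j" and j: "0 \<le> j" "j < int (M + 1)"
      using int_residue[of "int (M + 1)" i s] by auto
    have v: "rep_map M 1 s i = s + q * int M + max 0 (j - int 1)" unfolding n
        by (rule rep_map_eval[OF j])
    show ?thesis
    proof (cases "j + 1 < int (M + 1)")
      case True
      have e: "i + 1 = s + q * int (M + 1) + (j + 1)" using n by simp
      have "rep_map M 1 s (i + 1) = s + q * int M + max 0 (j + 1 - int 1)"
        unfolding e by (rule rep_map_eval) (use True j in auto)
      then show ?thesis using v by auto
    next
      case False
      have e: "i + 1 = s + (q + 1) * int (M + 1) + 0" using n j False by (simp add: algebra_simps)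
      have "rep_map M 1 s (i + 1) = s + (q + 1) * int M + max 0 (0 - int 1)"
        unfolding e by (rule rep_map_eval) (use j in auto)
      then show ?thesis using v False j by (auto simp: algebra_simps)
    qed
  qed
  have "Df (FOb (I_fctr C M s) X) i = Df (FOb (reix C (rep_map M 1 s)) X) i" for i
  proof (cases "rep_map M 1 s i < rep_map M 1 s (i + 1)")
    case True
    then have "rep_map M 1 s (i + 1) = rep_map M 1 s i + 1" using le1[of i] by simp
    then show ?thesis using dmap_step[OF sX] by (simp add: I_fctr_def iota_eq)
  next
    case False
    then have "rep_map M 1 s (i + 1) = rep_map M 1 s i" using le[of i] by simp
    then show ?thesis by (simp add: I_fctr_def iota_eq)
  qed
  then show "FOb (I_fctr C M s) X = FOb (reix C (rep_map M 1 s)) X"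
    by (intro cpx_eqI) (simp_all add: I_fctr_def iota_eq)
qed (simp add: I_fctr_def reix_def iota_eq)

lemma agree_J_K:
  assumes "1 \<le> M"
  shows "agree (KN C (M + 1)) (J_K C (M + 1) s) (reixK C M (omit_map M 1 s))"
  unfolding J_K_def diff_add_inverse2
  by (rule agree_quot) (simp_all add: J_fctr_def reix_def rho_eq[OF assms, simplified] dmap_def)

lemma agree_I_iter:
  assumes M: "1 \<le> M"
  shows "agree (KN C M) (I_iter C s M k) (reixK C (M + k) (rep_map M k s))"
proof (induction k)
  case 0
  show ?case using agree_id_reixK[OF M] by (simp add: rep_map_0[OF M])
next
  case (Suc k)
  have "agree (KN C M) (comp_fctr (I_K C (M + k) s) (I_iter C s M k)) (reixK C (M + k + 1)
      (rep_map M k s \<circ> rep_map (M + k) 1 s))"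
    by (rule agree_comp_reixK[OF _ _ _ periodic_rep_map periodic_rep_map Suc agree_I_K])
        (use M in simp_all)
  then show ?case using rep_map_Suc[OF M] by simp
qed

lemma agree_J_iter:
  assumes M: "1 \<le> M"
  shows "agree (KN C (M + k)) (J_iter C s M k) (reixK C M (omit_map M k s))"
proof (induction k)
  case 0
  show ?case using agree_id_reixK[OF M] by (simp add: omit_map_0[OF M])
next
  case (Suc k)
  have "agree (KN C (M + k + 1)) (comp_fctr (J_iter C s M k) (J_K C (M + k + 1) s))
      (reixK C M (omit_map (M + k) 1 s \<circ> omit_map M k s))"
    by (rule agree_comp_reixK[OF _ _ _ periodic_omit_map periodic_omit_map agree_J_K Suc])
        (use M in simp_all)
  then show ?case using omit_map_Suc[OF M] by simp
qed

end


section \<open>The recollement\<close>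

text \<open>A map compatible with the periods and constant on the blocks of \<open>N\<close> indices
  starting at c + q N factors through this one, and so its restriction passes through
  1-complexes.\<close>

lemma periodic_floor: "1 \<le> N \<Longrightarrow> periodic 1 N (\<lambda>n. (n - c) div int N)"
  by (rule periodicI[where s = c and g = "\<lambda>_. 0"]) (simp_all add: divmod_residue)

lemma periodic_scale: "periodic M 1 (\<lambda>q. d + q * int M)"
  by (rule periodicI[where s = 0 and g = "\<lambda>_. d"]) simp_all

context additive_category
begin

lemma reix_step_contractible:
  assumes M: "1 \<le> M" and N: "1 \<le> N" and X: "is_cpx C M X"
    and \<phi>: "\<And>q j. \<lbrakk>0 \<le> j; j < int N\<rbrakk> \<Longrightarrow> \<phi> (c + q * int N + j) = d + q * int M"
  shows "complexes.contractible C N (FOb (reix C \<phi>) X)"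
proof -
  have "\<phi> = (\<lambda>q. d + q * int M) \<circ> (\<lambda>n. (n - c) div int N)"
  proof
    fix n
    obtain q j where n: "n = c + q * int N + j" and j: "0 \<le> j" "j < int N"
        using int_residue[of "int N" n c] N by auto
    show "\<phi> n = ((\<lambda>q. d + q * int M) \<circ> (\<lambda>n. (n - c) div int N)) n"
      unfolding n by (simp only: \<phi>[OF j] divmod_residue[OF j] o_apply)
  qed
  then show ?thesis using reix_factor_contractible[OF M N periodic_scale periodic_floor[OF N] X]
      by metis
qed

text \<open>On the block of length \<open>N\<close> starting at c + q N, \<open>la\<close> and
  \<open>mu\<close> are the minimum and the maximum of n and the fixed index d + q N. The fourth
  corner of the square is thus constant on each block, and its restriction is contractible.\<close>

lemma reix_mayer_vietoris_iso:
  assumes N: "1 \<le> N" and X: "is_cpx C N X" and la: "periodic N N la" and mu: "periodic N N mu"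
    and alt: "\<And>n q j. \<lbrakk>n = c + q * int N + j; 0 \<le> j; j < int N\<rbrakk> \<Longrightarrow>
        n \<le> d + q * int N \<and> la n = n \<and> mu n = d + q * int N \<or>
        d + q * int N \<le> n \<and> la n = d + q * int N \<and> mu n = n"
  shows "complexes.contractible C N (FOb (reix C mu) X)
      \<Longrightarrow> \<exists>e. is_iso (KN C N) (FOb (reix C la) X) X e"
    and "complexes.contractible C N (FOb (reix C la) X)
        \<Longrightarrow> \<exists>e. is_iso (KN C N) (FOb (reix C mu) X) X e"
proof -
  interpret complexes C N using N by unfold_locales
  define pi where "pi n = d + (n - c) div int N * int N" for n
  have pi: "periodic N N pi"
    using periodic_comp[OF periodic_scale[of N d] periodic_floor[OF N, of c]]
    by (simp add: pi_def[abs_def] comp_def)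
  have alt': "n \<le> pi n \<and> la n = n \<and> mu n = pi n \<or> pi n \<le> n \<and> la n = pi n \<and> mu n = n" for n
  proof -
    obtain q j where n: "n = c + q * int N + j" and j: "0 \<le> j" "j < int N"
        using int_residue[of "int N" n c] N by auto
    have "pi n = d + q * int N" unfolding pi_def n by (simp only: divmod_residue[OF j])
    then show ?thesis using alt[OF n j] by simp
  qed
  have "la n \<le> n" "n \<le> mu n" "la n \<le> pi n" "pi n \<le> mu n"
      "la n = n \<and> pi n = mu n \<or> la n = pi n \<and> mu n = n" for n
    using alt'[of n] by auto
  then obtain Z u v i1 i2 p1 p2 where e: "(FOb (reix C la) X, Z, FOb (reix C mu) X, u, v) \<in> EE"
    and bp: "biproduct KK X (FOb (reix C pi) X) Z i1 i2 p1 p2"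
    using mayer_vietoris[OF X la mu pi] by metis
  have "contractible (FOb (reix C pi) X)"
    by (rule reix_step_contractible[OF N N X, where c = c and d = d])
        (simp only: pi_def divmod_residue)
  interpret frobenius_category KK EE Nul by (rule frobenius_CN)
  from \<open>contractible (FOb (reix C pi) X)\<close> have inj: "injective_object KK EE (FOb (reix C pi) X)"
      using injective_iff_contractible by blast
  have X' [simp]: "X \<in> Obj KK" using X by simp
  note Z = conf_obj[OF e]
  note iso = biproduct_stable_iso[OF bp inj X']
  show "\<exists>e. is_iso (KN C N) (FOb (reix C la) X) X e" if "contractible (FOb (reix C mu) X)"
  proof -
    have "is_iso Q (FOb (reix C la) X) Z (cls (FOb (reix C la) X) Z u)"
      using that by (intro conf_stable_iso_left[OF e]) (simp add: injective_iff_contractible)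
    from Q.is_iso_cmp[OF _ _ _ this iso(2)] Z X' show ?thesis by (auto simp: KN_def)
  qed
  show "\<exists>e. is_iso (KN C N) (FOb (reix C mu) X) X e" if "contractible (FOb (reix C la) X)"
  proof -
    have "is_iso Q Z (FOb (reix C mu) X) (cls Z (FOb (reix C mu) X) v)"
      using that by (intro conf_stable_iso_right[OF e]) (simp add: injective_iff_contractible)
    from Q.is_iso_cmp[OF _ _ _ iso(1) this] Z X' have "\<exists>e. is_iso (KN C N) X (FOb (reix C mu) X) e"
        by (auto simp: KN_def)
    then show ?thesis using KN_iso_sym[of X "FOb (reix C mu) X"] X reix_cpx[OF X mu] by auto
  qed
qed

text \<open>\<alpha> and \<beta> belong to the two functors, and \<open>step\<close> makes their
  composite vanish. \<gamma> and \<delta> lead back: for \<open>Y\<close> in the kernel the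
  restriction along \<beta> \<delta> is contractible, and then \<open>iso\<close> exhibits
  \<open>Y\<close>, up to isomorphism, as the image of its restriction along \<gamma>.\<close>

lemma Im_Ker_equivalence:
  assumes M1: "1 \<le> M1" and M2: "1 \<le> M2" and N: "1 \<le> N"
    and \<alpha>: "periodic M1 N \<alpha>" and \<gamma>: "periodic N M1 \<gamma>" and \<beta>: "periodic N M2 \<beta>"
        and \<delta>: "periodic M2 N \<delta>"
    and F: "agree (KN C M1) F (reixK C N \<alpha>)" and G: "agree (KN C N) G (reixK C M2 \<beta>)"
    and step: "\<And>q j. \<lbrakk>0 \<le> j; j < int M2\<rbrakk> \<Longrightarrow> \<alpha> (\<beta> (c + q * int M2 + j)) = d + q * int M1"
    and iso: "\<And>X. \<lbrakk>is_cpx C N X; complexes.contractible C N (FOb (reix C (\<lambda>n. \<beta> (\<delta> n))) X)\<rbrakk> \<Longrightarrow>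
        \<exists>e. is_iso (KN C N) (FOb (reix C (\<lambda>n. \<gamma> (\<alpha> n))) X) X e"
  shows "equivalence (Im_fctr (KN C M1) (KN C N) F) (Ker_fctr (KN C N) (KN C M2) G) id_fctr"
proof -
  interpret A: complexes C M2 using M2 by unfold_locales
  interpret R: reindexing C M2 N \<delta> by unfold_locales (use M2 N \<delta> in auto)
  note mono = periodicD(3)[OF \<alpha>] periodicD(3)[OF \<beta>] periodicD(3)[OF \<gamma>] periodicD(3)[OF \<delta>]
  have FX: "FOb F X = FOb (reix C \<alpha>) X" if "is_cpx C M1 X" for X using agreeD(1)[OF F] that by simp
  have GX: "FOb G X = FOb (reix C \<beta>) X" if "is_cpx C N X" for X using agreeD(1)[OF G] that by simp
  have Ker: "zero_object (KN C M2) (FOb G X) \<longleftrightarrow> A.contractible (FOb (reix C \<beta>) X)"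
      if "is_cpx C N X" for X
    using A.zero_object_KN reix_cpx[OF that \<beta>] GX[OF that] by simp
  have seq: "is_seq C X" if "is_cpx C K X" for K X using that is_cpx_iff by blast
  show ?thesis
    unfolding Im_fctr_def Ker_fctr_def
  proof (rule equivalence_subcat_inclusion[OF KN_preadditive[OF N]])
    show "FOb F ` Obj (KN C M1) \<subseteq> {X \<in> Obj (KN C N). zero_object (KN C M2) (FOb G X)}"
    proof clarsimp
      fix X assume X: "is_cpx C M1 X"
      have FN: "is_cpx C N (FOb F X)" using reix_cpx[OF X \<alpha>] FX[OF X] by simp
      have "A.contractible (FOb (reix C (\<alpha> \<circ> \<beta>)) X)"
        by (rule reix_step_contractible[OF M1 M2 X, where c = c and d = d]) (simp add: step)
      then have "A.contractible (FOb (reix C \<beta>) (FOb F X))"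
        using reix_comp[OF seq[OF X] mono(1,2)] FX[OF X] by simp
      then show "is_cpx C N (FOb F X) \<and> zero_object (KN C M2) (FOb G (FOb F X))" using Ker[OF FN] FN
          by blast
    qed
    show "{X \<in> Obj (KN C N). zero_object (KN C M2) (FOb G X)} \<subseteq> Obj (KN C N)" by blast
    fix Y assume "Y \<in> {X \<in> Obj (KN C N). zero_object (KN C M2) (FOb G X)}"
    then have Y: "is_cpx C N Y" and "A.contractible (FOb (reix C \<beta>) Y)" using Ker by auto
    then have "complexes.contractible C N (FOb (reix C \<delta>) (FOb (reix C \<beta>) Y))"
        by (intro R.reix_contractible)
    then have "complexes.contractible C N (FOb (reix C (\<lambda>n. \<beta> (\<delta> n))) Y)"
      using reix_comp[OF seq[OF Y] mono(2,4)] by (simp add: comp_def)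
    from iso[OF Y this] obtain e where e: "is_iso (KN C N) (FOb (reix C (\<lambda>n. \<gamma> (\<alpha> n))) Y) Y e"
        by blast
    have \<gamma>Y: "is_cpx C M1 (FOb (reix C \<gamma>) Y)" by (rule reix_cpx[OF Y \<gamma>])
    have "FOb F (FOb (reix C \<gamma>) Y) = FOb (reix C (\<lambda>n. \<gamma> (\<alpha> n))) Y"
      using reix_comp[OF seq[OF Y] mono(3,1)] FX[OF \<gamma>Y] by (simp add: comp_def)
    then show "\<exists>X\<in>FOb F ` Obj (KN C M1). \<exists>e. is_iso (KN C N) X Y e" using e \<gamma>Y
        by (metis Obj_KN imageI mem_Collect_eq)
  qed
qed

lemma reixK_triangle:
  assumes "1 \<le> M" "1 \<le> N" "periodic M N \<phi>" "agree (KN C M) F (reixK C N \<phi>)"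
  shows "triangle_functor (KN C M) (KN C N) F"
proof -
  interpret reindexing C M N \<phi> by unfold_locales (use assms in auto)
  show ?thesis
    using agree_triangle[OF KN_triangulated[OF assms(1)] KN_triangulated[OF assms(2)] assms(4)]
      reix_triangle_functor by (simp add: reixK_def)
qed

lemma reixK_adjoint:
  assumes M: "1 \<le> M" and N: "1 \<le> N" and a: "periodic M N a" and b: "periodic N M b"
    and F: "agree (KN C M) F (reixK C N a)" and G: "agree (KN C N) G (reixK C M b)"
    and "\<And>i. i \<le> a (b i)" "\<And>j. b (a j) \<le> j"
  shows "adjoint_pair (KN C M) (KN C N) F G"
  using agree_adjoint[OF KN_preadditive[OF M] KN_preadditive[OF N] F G]
    reix_adjoint[OF M N a b] assms(7,8) by (simp add: reixK_def)

end

theorem corollary5p10: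
  fixes B :: "('o, 'm) cat" and N r :: nat and s :: int
  assumes "additive_category B"
    and "3 \<le> N" and "1 \<le> r" and "r \<le> N - 2"
  shows "recollement (KN B (N - r)) (KN B N) (KN B (r + 1))
    (J_down B (s - 1) (N - r) N) (I_up B s (N - r) N) (J_down B s (N - r) N)
    (I_up B (int r + s) (r + 1) N) (J_down B (int r + s) (r + 1) N)
    (I_up B (int r + s + 1) (r + 1) N)"
proof -
  interpret additive_category B by fact
  \<comment> \<open>With N = K + 1 + r the outer categories become symmetric: one side has period K
    + 1 and \<open>r\<close> extra copies, the other period r + 1 and \<open>K\<close> extra
    copies.\<close>
  define K where "K = N - r - 1"
  define t where "t = int r + s"
  have K: "N - r = K + 1" "N = K + 1 + r" "N = r + 1 + K" "1 \<le> K"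
    using assms by (auto simp: K_def)
  have iN: "int N = int K + int r + 1" using K(2) by simp
  have ge [simp]: "1 \<le> N" "1 \<le> K + 1" "1 \<le> r + 1" using assms by auto
  have I: "agree (KN B (K + 1)) (I_up B s' (K + 1) N) (reixK B N (rep_map (K + 1) r s'))"
      "periodic (K + 1) N (rep_map (K + 1) r s')"
      "agree (KN B N) (J_down B s' (K + 1) N) (reixK B (K + 1) (omit_map (K + 1) r s'))"
      "periodic N (K + 1) (omit_map (K + 1) r s')" for s'
    using agree_I_iter[of "K + 1" s' r] agree_J_iter[of "K + 1" r s']
      periodic_rep_map[of "K + 1" r s'] periodic_omit_map[of "K + 1" r s']
    by (simp_all add: I_up_def J_down_def K(2))
  have J: "agree (KN B (r + 1)) (I_up B s' (r + 1) N) (reixK B N (rep_map (r + 1) K s'))"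
      "periodic (r + 1) N (rep_map (r + 1) K s')"
      "agree (KN B N) (J_down B s' (r + 1) N) (reixK B (r + 1) (omit_map (r + 1) K s'))"
      "periodic N (r + 1) (omit_map (r + 1) K s')" for s'
    using agree_I_iter[of "r + 1" s' K] agree_J_iter[of "r + 1" K s']
      periodic_rep_map[of "r + 1" K s'] periodic_omit_map[of "r + 1" K s']
    by (simp_all add: I_up_def J_down_def K(3))
  have la: "omit_map (K + 1) r s (rep_map (K + 1) r s (s + q * int N + j))
      = s + q * int N + (if j \<le> int r then 0 else j)"
    if "0 \<le> j" "j < int N" for q j
    unfolding K(2) by (rule omit_rep_eval) (use that K(2) in simp_all)
  have mu: "omit_map (r + 1) K t (rep_map (r + 1) K (t + 1) (t + 1 + q * int N + j))
      = t + 1 + q * int N + max (int K) j"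
    if "0 \<le> j" "j < int N" for q j
    using omit_pred_rep_eval[of "r + 1" j K "t + 1" q] that unfolding K(3) by simp
  have la': "omit_map (r + 1) K t (rep_map (r + 1) K t (t + q * int N + j))
      = t + q * int N + (if j \<le> int K then 0 else j)"
    if "0 \<le> j" "j < int N" for q j
    unfolding K(3) by (rule omit_rep_eval) (use that K(2) in simp_all)
  have mu': "omit_map (K + 1) r (s - 1) (rep_map (K + 1) r s (s + q * int N + j))
      = s + q * int N + max (int r) j"
    if "0 \<le> j" "j < int N" for q j
    unfolding K(2) by (rule omit_pred_rep_eval) (use that K(2) in simp_all)
  have per: "periodic N N (\<lambda>n. omit_map (K + 1) r s' (rep_map (K + 1) r s n))"
     "periodic N N (\<lambda>n. omit_map (r + 1) K s' (rep_map (r + 1) K s'' n))" for s' s''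
    using periodic_comp[OF I(4) I(2)] periodic_comp[OF J(4) J(2)] by (simp_all add: comp_def)
  \<comment> \<open>The block starting at t + 1 ends with the run s + N, ..., s + N + r. The K + 1
    side collapses this run to its first element s + N, and the r + 1 side raises the indices t + 1,
    ..., s + N - 1 before it to s + N.\<close>
  have mv1: "n \<le> s + int N + q * int N \<and> omit_map (K + 1) r s (rep_map (K + 1) r s n) = n \<and>
      omit_map (r + 1) K t (rep_map (r + 1) K (t + 1) n) = s + int N + q * int N \<or>
    s + int N + q * int N \<le> n \<and> omit_map (K + 1) r s (rep_map (K + 1) r s n) = s + int N + q * int N
        \<and>
      omit_map (r + 1) K t (rep_map (r + 1) K (t + 1) n) = n"
    if n: "n = t + 1 + q * int N + j" and j: "0 \<le> j" "j < int N" for n q j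
  proof (cases "j < int K")
    case True
    have e: "n = s + q * int N + (int r + 1 + j)" by (simp add: n t_def)
    have "omit_map (K + 1) r s (rep_map (K + 1) r s n) = n"
      using la[of "int r + 1 + j" q] j True iN unfolding e by simp
    moreover have "omit_map (r + 1) K t (rep_map (r + 1) K (t + 1) n) = s + int N + q * int N"
      using mu[OF j, of q] True iN unfolding n by (simp add: t_def)
    ultimately show ?thesis using True iN n t_def by simp
  next
    case False
    have e: "n = s + (q + 1) * int N + (j - int K)" by (simp add: n t_def iN algebra_simps)
    have "omit_map (K + 1) r s (rep_map (K + 1) r s n) = s + (q + 1) * int N"
      using la[of "j - int K" "q + 1"] j False iN unfolding e by simp
    then have "omit_map (K + 1) r s (rep_map (K + 1) r s n) = s + int N + q * int N"
        by (simp add: algebra_simps)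
    moreover have "omit_map (r + 1) K t (rep_map (r + 1) K (t + 1) n) = n"
      using mu[OF j, of q] False unfolding n by simp
    moreover have "s + int N + q * int N \<le> n" using False by (simp add: e algebra_simps)
    ultimately show ?thesis by blast
  qed
  \<comment> \<open>The block starting at \<open>s\<close> ends with the run t, ..., t + K. Now the
    r + 1 side collapses this run to \<open>t\<close>, and the K + 1 side raises s, ..., t - 1 to
    \<open>t\<close>.\<close>
  have mv2: "n \<le> t + q * int N \<and> omit_map (r + 1) K t (rep_map (r + 1) K t n) = n \<and>
      omit_map (K + 1) r (s - 1) (rep_map (K + 1) r s n) = t + q * int N \<or>
    t + q * int N \<le> n \<and> omit_map (r + 1) K t (rep_map (r + 1) K t n) = t + q * int N \<and>
      omit_map (K + 1) r (s - 1) (rep_map (K + 1) r s n) = n"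
    if n: "n = s + q * int N + j" and j: "0 \<le> j" "j < int N" for n q j
  proof (cases "j < int r")
    case True
    have e: "n = t + (q - 1) * int N + (j + int K + 1)" by (simp add: n t_def iN algebra_simps)
    have "omit_map (r + 1) K t (rep_map (r + 1) K t n) = n"
      using la'[of "j + int K + 1" "q - 1"] j True iN unfolding e by simp
    moreover have "omit_map (K + 1) r (s - 1) (rep_map (K + 1) r s n) = t + q * int N"
      using mu'[OF j, of q] True unfolding n by (simp add: t_def)
    ultimately show ?thesis using True n t_def by simp
  next
    case False
    have e: "n = t + q * int N + (j - int r)" by (simp add: n t_def)
    have "omit_map (r + 1) K t (rep_map (r + 1) K t n) = t + q * int N"
      using la'[of "j - int r" q] j False iN unfolding e by simp
    moreover have "omit_map (K + 1) r (s - 1) (rep_map (K + 1) r s n) = n"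
      using mu'[OF j, of q] False unfolding n by simp
    ultimately show ?thesis using False e by simp
  qed
  \<comment> \<open>Omitting s, ..., t - 1 leaves in each period exactly t, ..., t + K, the run on
    which the other map is constant. This matches the base point r + s.\<close>
  have step1: "rep_map (r + 1) K t (omit_map (K + 1) r (s - 1) (s + q * int (K + 1) + j))
      = t + q * int (r + 1)"
    if "0 \<le> j" "j < int (K + 1)" for q j
  proof -
    have e: "omit_map (K + 1) r (s - 1) (s + q * int (K + 1) + j) = t + q * int (r + 1 + K) + j"
      using omit_map_eval_pred[OF that, of r s q] by (simp add: t_def algebra_simps)
    show ?thesis unfolding e using rep_map_eval[of j "r + 1" K t q] that by simp
  qed
  \<comment> \<open>Omitting t + 1, ..., t + K leaves the indices from t + K + 1 = s + N to s + N +
    r, the run that repeats \<open>s\<close> one period later; hence the extra K + 1 in the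
    offset.\<close>
  have step2: "rep_map (K + 1) r s (omit_map (r + 1) K t (t + 1 + q * int (r + 1) + j))
      = s + int (K + 1) + q * int (K + 1)"
    if "0 \<le> j" "j < int (r + 1)" for q j
  proof -
    have e: "omit_map (r + 1) K t (t + 1 + q * int (r + 1) + j) = s + (q + 1) * int (K + 1 + r) + j"
      using omit_map_eval_pred[OF that, of K "t + 1" q] by (simp add: t_def algebra_simps)
    show ?thesis unfolding e using rep_map_eval[of j "K + 1" r s "q + 1"] that
        by (simp add: algebra_simps)
  qed
  \<comment> \<open>Omitting s + 1, ..., t moves the surviving run up by one, to t + 1, ..., t + 1 +
    K. This is why the right adjoint embedding has base point r + s + 1.\<close>
  have step3: "rep_map (r + 1) K (t + 1) (omit_map (K + 1) r s (s + 1 + q * int (K + 1) + j))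
      = t + 1 + q * int (r + 1)"
    if "0 \<le> j" "j < int (K + 1)" for q j
  proof -
    have e: "omit_map (K + 1) r s (s + 1 + q * int (K + 1) + j) = t + 1 + q * int (r + 1 + K) + j"
      using omit_map_eval_pred[OF that, of r "s + 1" q] by (simp add: t_def algebra_simps)
    show ?thesis unfolding e using rep_map_eval[of j "r + 1" K "t + 1" q] that by simp
  qed
  \<comment> \<open>The right adjoint keeps the first copy of the repeated index and omits the
    others, the left adjoint keeps the last copy; this is the shift of the base point by
    one.\<close>
  have adjI: "adjoint_pair (KN B (K + 1)) (KN B N) (I_up B s' (K + 1) N) (J_down B s' (K + 1) N)"
      "adjoint_pair (KN B N) (KN B (K + 1)) (J_down B (s' - 1) (K + 1) N) (I_up B s' (K + 1) N)" for
          s'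
    using reixK_adjoint[OF ge(2,1) I(2,4,1,3)[of s']]
        reixK_adjoint[OF ge(1,2) I(4)[of "s' - 1"] I(2)[of s'] I(3,1)]
    by (simp_all add: rep_omit omit_rep_le rep_omit_pred omit_pred_rep_ge)
  have adjJ: "adjoint_pair (KN B (r + 1)) (KN B N) (I_up B s' (r + 1) N) (J_down B s' (r + 1) N)"
      "adjoint_pair (KN B N) (KN B (r + 1)) (J_down B (s' - 1) (r + 1) N) (I_up B s' (r + 1) N)" for
          s'
    using reixK_adjoint[OF ge(3,1) J(2,4,1,3)[of s']]
        reixK_adjoint[OF ge(1,3) J(4)[of "s' - 1"] J(2)[of s'] J(3,1)]
    by (simp_all add: rep_omit omit_rep_le rep_omit_pred omit_pred_rep_ge)
  have ff: "fully_faithful (KN B (K + 1)) (KN B N) (I_up B s' (K + 1) N)"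
      "fully_faithful (KN B (r + 1)) (KN B N) (I_up B s' (r + 1) N)" for s'
    using agree_fully_faithful[OF I(1)] reix_fully_faithful[OF ge(2,1) I(2,4)[of s']]
      agree_fully_faithful[OF J(1)] reix_fully_faithful[OF ge(3,1) J(2,4)[of s']]
    by (simp_all add: reixK_def rep_omit omit_rep_le)
  have tri: "triangle_functor (KN B (K + 1)) (KN B N) (I_up B s' (K + 1) N)"
      "triangle_functor (KN B N) (KN B (K + 1)) (J_down B s' (K + 1) N)"
      "triangle_functor (KN B (r + 1)) (KN B N) (I_up B s' (r + 1) N)"
      "triangle_functor (KN B N) (KN B (r + 1)) (J_down B s' (r + 1) N)" for s'
    using reixK_triangle[OF ge(2,1) I(2,1)] reixK_triangle[OF ge(1,2) I(4,3)]
      reixK_triangle[OF ge(3,1) J(2,1)] reixK_triangle[OF ge(1,3) J(4,3)] by blast+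
  \<comment> \<open>The kernel condition makes the restriction along the larger map \<mu>
    contractible, so the one along \<lambda> recovers the object.\<close>
  have e1: "equivalence (Im_fctr (KN B (r + 1)) (KN B N) (I_up B t (r + 1) N))
      (Ker_fctr (KN B N) (KN B (K + 1)) (J_down B (s - 1) (K + 1) N)) id_fctr"
    by (rule Im_Ker_equivalence[OF ge(3,2,1) J(2) J(4) I(4) I(2) J(1) I(3) step1])
       (assumption | rule reix_mayer_vietoris_iso(1)[OF ge(1) _ per(2) per(1) mv2])+
  have e2: "equivalence (Im_fctr (KN B (K + 1)) (KN B N) (I_up B s (K + 1) N))
      (Ker_fctr (KN B N) (KN B (r + 1)) (J_down B t (r + 1) N)) id_fctr"
    by (rule Im_Ker_equivalence[OF ge(2,3,1) I(2) I(4) J(4) J(2) I(1) J(3) step2])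
       (assumption | rule reix_mayer_vietoris_iso(1)[OF ge(1) _ per(1) per(2) mv1])+
  \<comment> \<open>Here the kernel condition kills the restriction along \<lambda> instead, and the
    one along \<mu> recovers the object.\<close>
  have e3: "equivalence (Im_fctr (KN B (r + 1)) (KN B N) (I_up B (t + 1) (r + 1) N))
      (Ker_fctr (KN B N) (KN B (K + 1)) (J_down B s (K + 1) N)) id_fctr"
    by (rule Im_Ker_equivalence[OF ge(3,2,1) J(2) J(4) I(4) I(2) J(1) I(3) step3])
       (assumption | rule reix_mayer_vietoris_iso(2)[OF ge(1) _ per(1) per(2) mv1])+
  \<comment> \<open>The restriction with base point t has both an I at t as left adjoint and an I at
    t + 1 as right adjoint; the latter is the second adjunction read at t + 1.\<close>
  show ?thesis
    unfolding recollement_def K(1) t_def[symmetric]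
    using KN_triangulated ge tri ff adjI adjJ adjJ(2)[of "t + 1"] e1 e2 e3
        by (simp del: One_nat_def add: One_nat_def[symmetric])
qed

end
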